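(* Let $X$ be a complex manifold of even dimension $2n$, let $D\subset X$ be a reduced hypersurface and let $p\in D$ be a point such that $\Omega^1_X(\log D)_p$ is generated by logarithmic differentials. Suppose that $\omega_0,\omega_1\in\Omega^2_X(\log D)_p$ are two germs of log symplectic structures with the same local logarithmic cohomology classes $$[\omega_0]=[\omega_1]\in H^2_{dR,p}(X,\log D).$$ Then $\omega_0$ and $\omega_1$ are isotopic.
   Context: Let $h$ be a local reduced equation of $D$. $\Omega^k_X(\log D)$ is the sheaf of meromorphic $k$-forms $\omega$ with $h\omega$ and $h\,d\omega$ holomorphic. It forms a complex under $d$, and $H^\bullet_{dR,p}(X,\log D)$ (local logarithmic de Rham cohomology) denotes the cohomology of the complex of stalks $(\Omega^\bullet_X(\log D)_p,d)$. A germ $\omega\in\Omega^2_X(\log D)_p$ is log symplectic if $d\omega=0$ and $\omega^n$ generates $\Omega^{2n}_X(D)_p=h^{-1}\Omega^{2n}_{X,p}$. Let $f_1,\dots,f_k$ be equations for the irreducible components of the germ of $D$ at $p$; $\Omega^1_X(\log D)_p$ is generated by logarithmic differentials if it is generated as an $\mathcal O_{X,p}$-module by $f_1^{-1}df_1,\dots,f_k^{-1}df_k$ together with the holomorphic forms $\Omega^1_{X,p}$. Isotopic means: there is a smooth family $\phi_t$, $t\in[0,1]$, of germs of biholomorphic automorphisms of $(X,p)$ (fixing $p$ and preserving $D$) with $\phi_0=\mathrm{id}$ and $\phi_1^*\omega_1=\omega_0$. *)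

theory Defs
  imports "HOL-Analysis.Analysis"
begin

section \<open>Holomorphic functions of several variables and smooth maps\<close>

definition holo_on :: "(complex^'n \<Rightarrow> complex) \<Rightarrow> (complex^'n) set \<Rightarrow> bool" where
  "holo_on f S \<longleftrightarrow>
     (\<forall>z\<in>S. \<exists>f'. (f has_derivative f') (at z) \<and> (\<forall>a v. f' (a *s v) = a * f' v))"

text \<open>Derivatives are taken within \<open>S\<close>, so that \<open>smooth_on\<close> makes sense on sets such as
  \<open>[0,1] \<times> W\<close> with \<open>W\<close> open, using one-sided derivatives at the end points. On these sets
  derivatives are unique.\<close>

primrec C_times :: "nat \<Rightarrow> ('a::real_normed_vector \<Rightarrow> 'b::real_normed_vector) \<Rightarrow> 'a set \<Rightarrow> bool" where
  "C_times 0 f S \<longleftrightarrow> continuous_on S f"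
| "C_times (Suc k) f S \<longleftrightarrow>
     (\<exists>f'. (\<forall>x\<in>S. (f has_derivative f' x) (at x within S)) \<and> (\<forall>v. C_times k (\<lambda>x. f' x v) S))"

definition smooth_on :: "('a::real_normed_vector \<Rightarrow> 'b::real_normed_vector) \<Rightarrow> 'a set \<Rightarrow> bool" where
  "smooth_on f S \<longleftrightarrow> (\<forall>k. C_times k f S)"

section \<open>Complex manifolds\<close>

text \<open>The manifold \<open>X\<close> is the whole type \<open>'m\<close>, with a holomorphic atlas (not necessarily maximal)
  modelled on \<open>complex^'n\<close>; its complex dimension is \<open>CARD('n)\<close>.\<close>

type_synonym ('m, 'n) chart = "'m set \<times> ('m \<Rightarrow> complex^'n)"

definition chart_inv :: "('m, 'n) chart \<Rightarrow> complex^'n \<Rightarrow> 'm" where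
  "chart_inv c = inv_into (fst c) (snd c)"

definition complex_atlas ::
    "('m::{t2_space,second_countable_topology}, 'n::finite) chart set \<Rightarrow> bool" where
  "complex_atlas A \<longleftrightarrow>
     (\<forall>c\<in>A. open (fst c) \<and> open (snd c ` fst c) \<and>
             homeomorphism (fst c) (snd c ` fst c) (snd c) (chart_inv c)) \<and>
     (\<Union>c\<in>A. fst c) = UNIV \<and>
     (\<forall>c\<in>A. \<forall>c'\<in>A. \<forall>j.
        holo_on (\<lambda>z. snd c' (chart_inv c z) $ j) (snd c ` (fst c \<inter> fst c')))"

definition charts_at :: "('m, 'n) chart set \<Rightarrow> 'm \<Rightarrow> ('m, 'n) chart set" where
  "charts_at A x = {c \<in> A. x \<in> fst c}"

text \<open>The elements of the local ring \<open>\<O>\<^bsub>X,x\<^esub>\<close> are represented by functions on \<open>X\<close> that are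
  holomorphic near \<open>x\<close>; two representatives are equal as germs if they agree eventually
  in \<open>nhds x\<close>. The same convention is used for germs of maps, sets and forms.\<close>

definition hol_germ ::
    "('m::{t2_space,second_countable_topology}, 'n::finite) chart set \<Rightarrow> 'm \<Rightarrow> ('m \<Rightarrow> complex) set" where
  "hol_germ A x =
     {f. \<forall>c\<in>charts_at A x. \<exists>S. open S \<and> snd c x \<in> S \<and> holo_on (\<lambda>z. f (chart_inv c z)) S}"

definition hol_map_germ ::
    "('m::{t2_space,second_countable_topology}, 'n::finite) chart set \<Rightarrow> 'm \<Rightarrow> ('m \<Rightarrow> 'm) \<Rightarrow> bool" where
  "hol_map_germ A x F \<longleftrightarrow>
     (\<forall>c\<in>charts_at A x. \<forall>c'\<in>charts_at A (F x). \<exists>S. open S \<and> snd c x \<in> S \<and> S \<subseteq> snd c ` fst c \<and>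
        (\<forall>z\<in>S. F (chart_inv c z) \<in> fst c') \<and>
        (\<forall>j. holo_on (\<lambda>z. snd c' (F (chart_inv c z)) $ j) S))"

definition biholo_aut_germ ::
    "('m::{t2_space,second_countable_topology}, 'n::finite) chart set \<Rightarrow> 'm \<Rightarrow> ('m \<Rightarrow> 'm) \<Rightarrow> bool" where
  "biholo_aut_germ A p F \<longleftrightarrow> F p = p \<and> hol_map_germ A p F \<and>
     (\<exists>G. G p = p \<and> hol_map_germ A p G \<and>
          (\<forall>\<^sub>F x in nhds p. G (F x) = x) \<and> (\<forall>\<^sub>F x in nhds p. F (G x) = x))"

section \<open>Hypersurfaces and their local equations\<close>

text \<open>A reduced hypersurface is determined by its underlying set, so it is represented by that set.\<close>

definition hypersurface ::
    "('m::{t2_space,second_countable_topology}, 'n::finite) chart set \<Rightarrow> 'm set \<Rightarrow> bool" where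
  "hypersurface A D \<longleftrightarrow> closed D \<and>
     (\<forall>q\<in>D. \<exists>f\<in>hol_germ A q. \<not> (\<forall>\<^sub>F x in nhds q. f x = 0) \<and>
                              (\<forall>\<^sub>F x in nhds q. x \<in> D \<longleftrightarrow> f x = 0))"

definition vanishing_ideal ::
    "('m::{t2_space,second_countable_topology}, 'n::finite) chart set \<Rightarrow> 'm set \<Rightarrow> 'm \<Rightarrow> ('m \<Rightarrow> complex) set" where
  "vanishing_ideal A D p = {f \<in> hol_germ A p. \<forall>\<^sub>F x in nhds p. x \<in> D \<longrightarrow> f x = 0}"

definition reduced_equation ::
    "('m::{t2_space,second_countable_topology}, 'n::finite) chart set \<Rightarrow> 'm set \<Rightarrow> 'm \<Rightarrow> ('m \<Rightarrow> complex) \<Rightarrow> bool" where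
  "reduced_equation A D p h \<longleftrightarrow> h \<in> vanishing_ideal A D p \<and>
     (\<forall>f\<in>vanishing_ideal A D p. \<exists>g\<in>hol_germ A p. \<forall>\<^sub>F x in nhds p. f x = g x * h x)"

definition analytic_germ ::
    "('m::{t2_space,second_countable_topology}, 'n::finite) chart set \<Rightarrow> 'm \<Rightarrow> 'm set \<Rightarrow> bool" where
  "analytic_germ A p S \<longleftrightarrow>
     (\<exists>F. finite F \<and> F \<subseteq> hol_germ A p \<and> (\<forall>\<^sub>F x in nhds p. x \<in> S \<longleftrightarrow> (\<forall>f\<in>F. f x = 0)))"

definition irreducible_germ ::
    "('m::{t2_space,second_countable_topology}, 'n::finite) chart set \<Rightarrow> 'm \<Rightarrow> 'm set \<Rightarrow> bool" where
  "irreducible_germ A p S \<longleftrightarrow> analytic_germ A p S \<and> p \<in> S \<and>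
     (\<forall>S1 S2. analytic_germ A p S1 \<and> analytic_germ A p S2 \<and>
              (\<forall>\<^sub>F x in nhds p. x \<in> S \<longleftrightarrow> x \<in> S1 \<or> x \<in> S2) \<longrightarrow>
              (\<forall>\<^sub>F x in nhds p. x \<in> S \<longleftrightarrow> x \<in> S1) \<or> (\<forall>\<^sub>F x in nhds p. x \<in> S \<longleftrightarrow> x \<in> S2))"

definition irreducible_components ::
    "('m::{t2_space,second_countable_topology}, 'n::finite) chart set \<Rightarrow> 'm set \<Rightarrow> 'm \<Rightarrow> 'm set list \<Rightarrow> bool" where
  "irreducible_components A D p Cs \<longleftrightarrow>
     (\<forall>C\<in>set Cs. irreducible_germ A p C) \<and>
     (\<forall>\<^sub>F x in nhds p. x \<in> D \<longleftrightarrow> (\<exists>C\<in>set Cs. x \<in> C)) \<and>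
     (\<forall>i<length Cs. \<forall>j<length Cs. i \<noteq> j \<longrightarrow> \<not> (\<forall>\<^sub>F x in nhds p. x \<in> Cs ! i \<longrightarrow> x \<in> Cs ! j))"

definition component_equations ::
    "('m::{t2_space,second_countable_topology}, 'n::finite) chart set \<Rightarrow> 'm set \<Rightarrow> 'm \<Rightarrow> ('m \<Rightarrow> complex) list \<Rightarrow> bool" where
  "component_equations A D p fs \<longleftrightarrow>
     (\<exists>Cs. irreducible_components A D p Cs \<and> list_all2 (\<lambda>C f. reduced_equation A C p f) Cs fs)"

section \<open>Tangent vectors and differential forms\<close>

text \<open>A tangent vector at \<open>x\<close> is the derivation of \<open>\<O>\<^bsub>X,x\<^esub>\<close> given by a directional derivative in
  some chart. It is set to 0 outside \<open>\<O>\<^bsub>X,x\<^esub>\<close>, which makes it independent of the chart.\<close>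

type_synonym 'm tvec = "('m \<Rightarrow> complex) \<Rightarrow> complex"

definition tangent ::
    "('m::{t2_space,second_countable_topology}, 'n::finite) chart set \<Rightarrow> ('m, 'n) chart \<Rightarrow> 'm \<Rightarrow> complex^'n \<Rightarrow> 'm tvec" where
  "tangent A c x v = (\<lambda>f. if f \<in> hol_germ A x
     then frechet_derivative (\<lambda>z. f (chart_inv c z)) (at (snd c x)) v else 0)"

definition tspace ::
    "('m::{t2_space,second_countable_topology}, 'n::finite) chart set \<Rightarrow> 'm \<Rightarrow> 'm tvec set" where
  "tspace A x = {tangent A c x v | c v. c \<in> charts_at A x}"

text \<open>Inverse to \<open>tangent A c x\<close>: apply the derivation to the coordinate functions.\<close>

definition coords :: "('m, 'n::finite) chart \<Rightarrow> 'm tvec \<Rightarrow> complex^'n" where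
  "coords c t = (\<chi> j. t (\<lambda>y. snd c y $ j))"

definition pushforward ::
    "('m::{t2_space,second_countable_topology}, 'n::finite) chart set \<Rightarrow> ('m \<Rightarrow> 'm) \<Rightarrow> 'm \<Rightarrow> 'm tvec \<Rightarrow> 'm tvec" where
  "pushforward A F x t = (\<lambda>f. if f \<in> hol_germ A (F x) then t (\<lambda>y. f (F y)) else 0)"

text \<open>A \<open>k\<close>-form maps a point \<open>x\<close> and a list of \<open>k\<close> tangent vectors at \<open>x\<close> to a number. Its
  values on other lists are irrelevant.\<close>

type_synonym 'm dform = "'m \<Rightarrow> 'm tvec list \<Rightarrow> complex"

definition coord_form ::
    "('m::{t2_space,second_countable_topology}, 'n::finite) chart set \<Rightarrow> ('m, 'n) chart \<Rightarrow> 'm dform \<Rightarrow>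
     complex^'n \<Rightarrow> (complex^'n) list \<Rightarrow> complex" where
  "coord_form A c \<omega> z vs = \<omega> (chart_inv c z) (map (tangent A c (chart_inv c z)) vs)"

definition alternating_form :: "nat \<Rightarrow> ((complex^'n) list \<Rightarrow> complex) \<Rightarrow> bool" where
  "alternating_form k a \<longleftrightarrow>
     (\<forall>vs i b u w. length vs = k \<and> i < k \<longrightarrow>
        a (vs[i := b *s u + w]) = b * a (vs[i := u]) + a (vs[i := w])) \<and>
     (\<forall>vs i j. length vs = k \<and> i < j \<and> j < k \<and> vs ! i = vs ! j \<longrightarrow> a vs = 0)"

definition hol_form ::
    "('m::{t2_space,second_countable_topology}, 'n::finite) chart set \<Rightarrow> 'm \<Rightarrow> nat \<Rightarrow> 'm dform \<Rightarrow> bool" where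
  "hol_form A p k \<theta> \<longleftrightarrow>
     (\<forall>c\<in>charts_at A p. \<exists>S. open S \<and> snd c p \<in> S \<and>
        (\<forall>z\<in>S. alternating_form k (coord_form A c \<theta> z)) \<and>
        (\<forall>vs. length vs = k \<longrightarrow> holo_on (\<lambda>z. coord_form A c \<theta> z vs) S))"

text \<open>Meromorphic forms with poles on \<open>D\<close> are determined by their values off \<open>D\<close>; the values at
  points of \<open>D\<close> are ignored. This is equality of germs at \<open>p\<close> of such forms.\<close>

definition form_eq ::
    "('m::{t2_space,second_countable_topology}, 'n::finite) chart set \<Rightarrow> 'm set \<Rightarrow> 'm \<Rightarrow> nat \<Rightarrow>
     'm dform \<Rightarrow> 'm dform \<Rightarrow> bool" where
  "form_eq A D p k \<alpha> \<beta> \<longleftrightarrow>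
     (\<forall>\<^sub>F x in nhds p. x \<notin> D \<longrightarrow>
        (\<forall>ts. length ts = k \<and> set ts \<subseteq> tspace A x \<longrightarrow> \<alpha> x ts = \<beta> x ts))"

definition is_holomorphic ::
    "('m::{t2_space,second_countable_topology}, 'n::finite) chart set \<Rightarrow> 'm set \<Rightarrow> 'm \<Rightarrow> nat \<Rightarrow> 'm dform \<Rightarrow> bool" where
  "is_holomorphic A D p k \<alpha> \<longleftrightarrow> (\<exists>\<theta>. hol_form A p k \<theta> \<and> form_eq A D p k \<alpha> \<theta>)"

definition fmult :: "('m \<Rightarrow> complex) \<Rightarrow> 'm dform \<Rightarrow> 'm dform" where
  "fmult g \<omega> = (\<lambda>x ts. g x * \<omega> x ts)"

text \<open>\<open>d\<omega>(v\<^sub>0,\<dots>,v\<^sub>k) = \<Sum>\<^sub>i (-1)\<^sup>i \<partial>\<^bsub>v\<^sub>i\<^esub> (\<omega>(v\<^sub>0,\<dots>,v\<^sub>k without v\<^sub>i))\<close> for constant vector fields \<open>v\<^sub>i\<close>.\<close>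

definition coord_d ::
    "(complex^'n \<Rightarrow> (complex^'n) list \<Rightarrow> complex) \<Rightarrow> complex^'n \<Rightarrow> (complex^'n) list \<Rightarrow> complex" where
  "coord_d \<alpha> z vs = (\<Sum>i<length vs. (-1) ^ i *
     frechet_derivative (\<lambda>y. \<alpha> y (take i vs @ drop (Suc i) vs)) (at z) (vs ! i))"

text \<open>The exterior derivative computed in the chart \<open>c\<close>. It does not depend on \<open>c\<close> where \<open>\<omega>\<close> is
  holomorphic; below, conditions on it are required in all charts at \<open>p\<close>.\<close>

definition ext_d ::
    "('m::{t2_space,second_countable_topology}, 'n::finite) chart set \<Rightarrow> ('m, 'n) chart \<Rightarrow> 'm dform \<Rightarrow> 'm dform" where
  "ext_d A c \<omega> = (\<lambda>x ts. coord_d (coord_form A c \<omega>) (snd c x) (map (coords c) ts))"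

definition differential :: "('m \<Rightarrow> complex) \<Rightarrow> 'm dform" where
  "differential f = (\<lambda>x ts. hd ts f)"

definition dlog :: "('m \<Rightarrow> complex) \<Rightarrow> 'm dform" where
  "dlog f = fmult (\<lambda>x. inverse (f x)) (differential f)"

text \<open>The normalisation is the one for which \<open>(\<alpha> \<and> \<beta>)(v,w) = \<alpha>(v)\<beta>(w) - \<alpha>(w)\<beta>(v)\<close> for
  1-forms.\<close>

definition wedge :: "nat \<Rightarrow> nat \<Rightarrow> 'm dform \<Rightarrow> 'm dform \<Rightarrow> 'm dform" where
  "wedge k l \<alpha> \<beta> = (\<lambda>x ts. (\<Sum>\<sigma> | \<sigma> permutes {..<k + l}.
      of_int (sign \<sigma>) * \<alpha> x (map (\<lambda>i. ts ! \<sigma> i) [0..<k]) * \<beta> x (map (\<lambda>i. ts ! \<sigma> i) [k..<k + l]))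
      / (fact k * fact l))"

primrec wedge_power :: "'m dform \<Rightarrow> nat \<Rightarrow> 'm dform" where
  "wedge_power \<omega> 0 = (\<lambda>x ts. 1)"
| "wedge_power \<omega> (Suc m) = wedge 2 (2 * m) \<omega> (wedge_power \<omega> m)"

definition pullback ::
    "('m::{t2_space,second_countable_topology}, 'n::finite) chart set \<Rightarrow> ('m \<Rightarrow> 'm) \<Rightarrow> 'm dform \<Rightarrow> 'm dform" where
  "pullback A F \<omega> = (\<lambda>x ts. \<omega> (F x) (map (pushforward A F x) ts))"

section \<open>Logarithmic forms\<close>

text \<open>In this section \<open>h\<close> is meant to be a reduced equation of \<open>D\<close> at \<open>p\<close>. Meromorphy of \<open>\<omega>\<close> is
  not a separate condition, because \<open>h\<omega>\<close> is required to be holomorphic.\<close>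

definition pole_forms ::
    "('m::{t2_space,second_countable_topology}, 'n::finite) chart set \<Rightarrow> 'm set \<Rightarrow> ('m \<Rightarrow> complex) \<Rightarrow> 'm \<Rightarrow>
     nat \<Rightarrow> 'm dform set" where
  "pole_forms A D h p k = {\<omega>. is_holomorphic A D p k (fmult h \<omega>)}"

definition log_forms ::
    "('m::{t2_space,second_countable_topology}, 'n::finite) chart set \<Rightarrow> 'm set \<Rightarrow> ('m \<Rightarrow> complex) \<Rightarrow> 'm \<Rightarrow>
     nat \<Rightarrow> 'm dform set" where
  "log_forms A D h p k = {\<omega>. is_holomorphic A D p k (fmult h \<omega>) \<and>
     (\<forall>c\<in>charts_at A p. is_holomorphic A D p (Suc k) (fmult h (ext_d A c \<omega>)))}"

definition closed_log_forms ::
    "('m::{t2_space,second_countable_topology}, 'n::finite) chart set \<Rightarrow> 'm set \<Rightarrow> ('m \<Rightarrow> complex) \<Rightarrow> 'm \<Rightarrow>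
     nat \<Rightarrow> 'm dform set" where
  "closed_log_forms A D h p k = {\<omega> \<in> log_forms A D h p k.
     \<forall>c\<in>charts_at A p. form_eq A D p (Suc k) (ext_d A c \<omega>) (\<lambda>x ts. 0)}"

definition exact_log_forms ::
    "('m::{t2_space,second_countable_topology}, 'n::finite) chart set \<Rightarrow> 'm set \<Rightarrow> ('m \<Rightarrow> complex) \<Rightarrow> 'm \<Rightarrow>
     nat \<Rightarrow> 'm dform set" where
  "exact_log_forms A D h p k = (case k of
       0 \<Rightarrow> {\<omega>. form_eq A D p 0 \<omega> (\<lambda>x ts. 0)}
     | Suc j \<Rightarrow> {\<omega>. \<exists>\<eta>\<in>log_forms A D h p j. \<forall>c\<in>charts_at A p. form_eq A D p k \<omega> (ext_d A c \<eta>)})"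

definition log_cohomologous ::
    "('m::{t2_space,second_countable_topology}, 'n::finite) chart set \<Rightarrow> 'm set \<Rightarrow> ('m \<Rightarrow> complex) \<Rightarrow> 'm \<Rightarrow>
     nat \<Rightarrow> ('m dform \<times> 'm dform) set" where
  "log_cohomologous A D h p k = {(\<omega>, \<omega>').
     \<omega> \<in> closed_log_forms A D h p k \<and> \<omega>' \<in> closed_log_forms A D h p k \<and>
     (\<lambda>x ts. \<omega>' x ts - \<omega> x ts) \<in> exact_log_forms A D h p k}"

definition log_de_rham_class ::
    "('m::{t2_space,second_countable_topology}, 'n::finite) chart set \<Rightarrow> 'm set \<Rightarrow> ('m \<Rightarrow> complex) \<Rightarrow> 'm \<Rightarrow>
     nat \<Rightarrow> 'm dform \<Rightarrow> 'm dform set" where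
  "log_de_rham_class A D h p k \<omega> = log_cohomologous A D h p k `` {\<omega>}"

definition generated_by_log_differentials ::
    "('m::{t2_space,second_countable_topology}, 'n::finite) chart set \<Rightarrow> 'm set \<Rightarrow> ('m \<Rightarrow> complex) \<Rightarrow> 'm \<Rightarrow>
     ('m \<Rightarrow> complex) list \<Rightarrow> bool" where
  "generated_by_log_differentials A D h p fs \<longleftrightarrow>
     (\<forall>\<eta>\<in>log_forms A D h p 1. \<exists>g \<theta>. (\<forall>i<length fs. g i \<in> hol_germ A p) \<and> hol_form A p 1 \<theta> \<and>
        form_eq A D p 1 \<eta> (\<lambda>x ts. (\<Sum>i<length fs. fmult (g i) (dlog (fs ! i)) x ts) + \<theta> x ts))"

definition log_symplectic ::
    "('m::{t2_space,second_countable_topology}, 'n::finite) chart set \<Rightarrow> 'm set \<Rightarrow> ('m \<Rightarrow> complex) \<Rightarrow> 'm \<Rightarrow>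
     nat \<Rightarrow> 'm dform \<Rightarrow> bool" where
  "log_symplectic A D h p n \<omega> \<longleftrightarrow> \<omega> \<in> closed_log_forms A D h p 2 \<and>
     wedge_power \<omega> n \<in> pole_forms A D h p (2 * n) \<and>
     (\<forall>\<eta>\<in>pole_forms A D h p (2 * n). \<exists>g\<in>hol_germ A p.
        form_eq A D p (2 * n) \<eta> (fmult g (wedge_power \<omega> n)))"

section \<open>Isotopy\<close>

text \<open>Smoothness of the family means joint smoothness in \<open>t\<close> and the coordinates on
  \<open>[0,1] \<times> W\<close> for a neighbourhood \<open>W\<close> of \<open>p\<close>; as \<open>[0,1]\<close> is compact, one \<open>W\<close> serves all \<open>t\<close>.\<close>

definition smooth_family ::
    "('m::{t2_space,second_countable_topology}, 'n::finite) chart set \<Rightarrow> 'm \<Rightarrow> (real \<Rightarrow> 'm \<Rightarrow> 'm) \<Rightarrow> bool" where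
  "smooth_family A p \<Phi> \<longleftrightarrow>
     (\<forall>c\<in>charts_at A p. \<exists>W. open W \<and> snd c p \<in> W \<and> W \<subseteq> snd c ` fst c \<and>
        (\<forall>t\<in>{0..1}. \<forall>z\<in>W. \<Phi> t (chart_inv c z) \<in> fst c) \<and>
        smooth_on (\<lambda>(t, z). snd c (\<Phi> t (chart_inv c z))) ({0..1} \<times> W))"

definition isotopic ::
    "('m::{t2_space,second_countable_topology}, 'n::finite) chart set \<Rightarrow> 'm set \<Rightarrow> 'm \<Rightarrow>
     'm dform \<Rightarrow> 'm dform \<Rightarrow> bool" where
  "isotopic A D p \<omega>0 \<omega>1 \<longleftrightarrow>
     (\<exists>\<Phi>. smooth_family A p \<Phi> \<and>
        (\<forall>t\<in>{0..1}. biholo_aut_germ A p (\<Phi> t) \<and> (\<forall>\<^sub>F x in nhds p. \<Phi> t x \<in> D \<longleftrightarrow> x \<in> D)) \<and>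
        (\<forall>\<^sub>F x in nhds p. \<Phi> 0 x = x) \<and>
        form_eq A D p 2 (pullback A (\<Phi> 1) \<omega>1) \<omega>0)"

end

theory Submission
  imports Defs "HOL-Complex_Analysis.Complex_Analysis"
begin

no_notation fps_nth (infixl "$" 75)

text \<open>Moser's method in a chart at \<open>p\<close>. As the classes agree, \<open>\<omega>\<^sub>1 - \<omega>\<^sub>0 = d\<eta>\<close> with
  \<open>\<eta> = \<Sum>\<^sub>k g\<^sub>k dlog f\<^sub>k + \<theta>\<close>, and subtracting the closed form with the constant coefficients
  \<open>g\<^sub>k(p)\<close>, \<open>\<theta>(p)\<close> we may assume that the coefficients vanish at \<open>p\<close>. With \<open>h\<close> an equation of \<open>D\<close>
  and \<open>\<omega>\<^sub>s = \<omega>\<^sub>0 + s(\<omega>\<^sub>1 - \<omega>\<^sub>0)\<close>, the function \<open>Q(s, z) = h\<^sup>2 det \<omega>\<^sub>s\<close> is a holomorphic germ that is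
  polynomial in \<open>s\<close>, and it is a square of a Pfaffian up to a constant, so that \<open>Q(0, p)\<close> and \<open>Q(1, p)\<close>
  do not vanish. Hence some complex path from 0 to 1 avoids the roots of \<open>Q(\<cdot>, p)\<close>; along it
  \<open>\<omega>\<^sub>s\<close> contracts \<open>\<eta>\<close> to a logarithmic vector field that is holomorphic near \<open>p\<close> and zero at \<open>p\<close>.
  Its flow fixes \<open>p\<close>, exists up to time 1, preserves \<open>D\<close> because \<open>h\<close> satisfies a linear differential
  equation along it, and transports \<open>\<omega>\<^sub>1\<close> to \<open>\<omega>\<^sub>0\<close>.

  That \<open>Q\<close> and the vector field have no poles is checked at the generic point of each component
  of \<open>D\<close>, where some partial derivative of \<open>h\<close> is invertible and logarithmic vector fields have an
  explicit frame. Unique factorisation of \<open>h\<close> into the primes \<open>f\<^sub>k\<close> then replaces Hartogs' theorem.\<close>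

section \<open>Holomorphic functions of several variables\<close>

text \<open>Forms carry no information on \<open>D\<close>, so identities between them hold only
  where \<open>h\<close> is nonzero; the identity theorem extends those between holomorphic germs
  across \<open>D\<close>. Generation by the \<open>dlog f\<^sub>k\<close> is what lets the
  primitive be made zero at \<open>p\<close>: a logarithmic form has no value at \<open>p\<close>,
  but its coefficients have, and constants may be subtracted from them because the
  \<open>dlog f\<^sub>k\<close> are closed. A field that is zero at \<open>p\<close> has
  trajectories that stay near \<open>p\<close> up to time 1. The path must be able to leave the real
  line since \<open>Q\<close> may have roots between 0 and 1. That \<open>h\<close> times the
  Pfaffian is a unit is the condition that \<open>\<omega>^n\<close> generates the forms with simple
  pole. The field is given by Cramer's rule, with numerators whose poles have, a priori, an order
  growing with the dimension. In a logarithmic frame all entries become regular; the determinant of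
  the frame is \<open>h\<close> up to a unit at the generic point, and its square is the factor
  \<open>h\<^sup>2\<close>. Interpolation in \<open>s\<close> keeps all this uniform in the
  parameter.\<close>

abbreviation FD :: "('a::real_normed_vector \<Rightarrow> 'b::real_normed_vector) \<Rightarrow> 'a \<Rightarrow> 'a \<Rightarrow> 'b" where
  "FD f z \<equiv> frechet_derivative f (at z)"

lemma norm_smult_vec: "norm (a *s (v::complex^'n)) = cmod a * norm v"
  by (simp add: norm_vec_def L2_set_def norm_mult power_mult_distrib
      real_sqrt_mult flip: sum_distrib_left)

lemma bounded_linear_smult_vec: "bounded_linear (\<lambda>a. a *s (v::complex^'n))"
  by (rule bounded_linear_intro[where K="norm v"])
    (simp_all add: vec_eq_iff algebra_simps norm_smult_vec)

lemma scaleR_vec_smult: "r *\<^sub>R (v::complex^'n) = of_real r *s v"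
  by (simp add: vec_eq_iff scaleR_conv_of_real[of _ "_::complex"])

lemma holo_onI:
  assumes "\<And>z. z \<in> S \<Longrightarrow> (f has_derivative f' z) (at z)"
    and "\<And>z a v. z \<in> S \<Longrightarrow> f' z (a *s v) = a * f' z v"
  shows "holo_on f S"
  unfolding holo_on_def using assms by blast

lemma holo_onD:
  assumes "holo_on f S" "z \<in> S"
  shows "(f has_derivative FD f z) (at z)" "FD f z (a *s v) = a * FD f z v"
proof -
  obtain f' where f': "(f has_derivative f') (at z)" "\<forall>a v. f' (a *s v) = a * f' v"
    using assms holo_on_def by blast
  then have "f' = FD f z" by (simp add: frechet_derivative_at)
  with f' show "(f has_derivative FD f z) (at z)" "FD f z (a *s v) = a * FD f z v" by auto
qed

lemma FD_eq: "(f has_derivative f') (at z) \<Longrightarrow> FD f z v = f' v"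
  by (simp add: frechet_derivative_at[symmetric])

lemma FD_eqI:
  assumes "(f has_derivative f') (at z)" "f' v = w"
  shows "FD f z v = w"
  using FD_eq[OF assms(1)] assms(2) by simp

lemma FD_add:
  assumes "holo_on f S" "z \<in> S"
  shows "FD f z (u + v) = FD f z u + FD f z v"
  using holo_onD(1)[OF assms] by (simp add: has_derivative_linear linear_add)

lemma FD_0:
  assumes "holo_on f S" "z \<in> S"
  shows "FD f z 0 = 0"
  using holo_onD(1)[OF assms] by (simp add: has_derivative_linear linear_0)

lemma FD_sum:
  assumes "holo_on f S" "z \<in> S"
  shows "FD f z (\<Sum>i\<in>I. g i) = (\<Sum>i\<in>I. FD f z (g i))"
  using holo_onD(1)[OF assms] by (simp add: has_derivative_linear linear_sum)

lemma vec_axis_expand: "(v::complex^'n) = (\<Sum>i\<in>UNIV. (v $ i) *s axis i 1)"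
  by (simp add: vec_eq_iff axis_def if_distrib cong: if_cong)

lemma FD_expand:
  fixes f :: "complex^'n \<Rightarrow> complex"
  assumes "holo_on f S" "z \<in> S"
  shows "FD f z v = (\<Sum>i\<in>UNIV. v $ i * FD f z (axis i 1))"
proof -
  have "FD f z v = FD f z (\<Sum>i\<in>UNIV. (v $ i) *s axis i 1)"
    using vec_axis_expand[of v] by simp
  also have "\<dots> = (\<Sum>i\<in>UNIV. v $ i * FD f z (axis i 1))"
    using assms by (simp add: FD_sum holo_onD(2))
  finally show ?thesis .
qed

lemma holo_on_subset: "holo_on f S \<Longrightarrow> T \<subseteq> S \<Longrightarrow> holo_on f T"
  by (auto simp: holo_on_def)

lemma holo_on_continuous: "holo_on f S \<Longrightarrow> continuous_on S f"
  by (meson holo_onD(1) continuous_at_imp_continuous_on has_derivative_continuous)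

lemma holo_on_const: "holo_on (\<lambda>z. c) S"
  by (rule holo_onI[where f'="\<lambda>_ _. 0"]) auto

lemma holo_on_coord: "holo_on (\<lambda>z. z $ j) S"
  by (rule holo_onI[where f'="\<lambda>_ v. v $ j"])
    (auto intro: bounded_linear_imp_has_derivative bounded_linear_vec_nth)

lemma FD_coord: "FD (\<lambda>z. z $ j) z v = v $ j"
  by (rule FD_eq) (auto intro: bounded_linear_imp_has_derivative bounded_linear_vec_nth)

lemma holo_on_add: "holo_on f S \<Longrightarrow> holo_on g S \<Longrightarrow> holo_on (\<lambda>z. f z + g z) S"
  by (rule holo_onI[where f'="\<lambda>z v. FD f z v + FD g z v"])
    (auto intro!: derivative_eq_intros simp: holo_onD algebra_simps)

lemma holo_on_mult: "holo_on f S \<Longrightarrow> holo_on g S \<Longrightarrow> holo_on (\<lambda>z. f z * g z) S"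
  by (rule holo_onI[where f'="\<lambda>z v. f z * FD g z v + FD f z v * g z"])
    (rule has_derivative_mult, auto simp: holo_onD algebra_simps)

lemma holo_on_uminus: "holo_on f S \<Longrightarrow> holo_on (\<lambda>z. - f z) S"
  using holo_on_mult[OF holo_on_const[of "-1"]] by simp

lemma holo_on_diff: "holo_on f S \<Longrightarrow> holo_on g S \<Longrightarrow> holo_on (\<lambda>z. f z - g z) S"
  using holo_on_add[OF _ holo_on_uminus] by simp

lemma holo_on_sum: "(\<And>i. i \<in> I \<Longrightarrow> holo_on (f i) S) \<Longrightarrow> holo_on (\<lambda>z. \<Sum>i\<in>I. f i z) S"
  by (induction I rule: infinite_finite_induct) (auto intro: holo_on_const holo_on_add)

lemma holo_on_prod: "(\<And>i. i \<in> I \<Longrightarrow> holo_on (f i) S) \<Longrightarrow> holo_on (\<lambda>z. \<Prod>i\<in>I. f i z) S"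
  by (induction I rule: infinite_finite_induct) (auto intro: holo_on_const holo_on_mult)

lemma holo_on_power: "holo_on f S \<Longrightarrow> holo_on (\<lambda>z. f z ^ k) S"
  by (induction k) (auto intro: holo_on_const holo_on_mult)

lemma holo_on_inverse: "holo_on f S \<Longrightarrow> (\<And>z. z \<in> S \<Longrightarrow> f z \<noteq> 0) \<Longrightarrow> holo_on (\<lambda>z. inverse (f z)) S"
  by (rule holo_onI[where f'="\<lambda>z v. - (inverse (f z) * FD f z v * inverse (f z))"])
    (rule Deriv.has_derivative_inverse, auto simp: holo_onD algebra_simps)

lemma holo_on_divide:
  "holo_on f S \<Longrightarrow> holo_on g S \<Longrightarrow> (\<And>z. z \<in> S \<Longrightarrow> g z \<noteq> 0) \<Longrightarrow> holo_on (\<lambda>z. f z / g z) S"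
  unfolding divide_inverse by (intro holo_on_mult holo_on_inverse)

lemma holo_on_det:
  "(\<And>i j. holo_on (\<lambda>z. M z $ i $ j) S) \<Longrightarrow> holo_on (\<lambda>z. det (M z)) S"
  unfolding det_def by (intro holo_on_sum holo_on_mult holo_on_prod holo_on_const) auto

lemmas holo_intros = holo_on_const holo_on_coord holo_on_add holo_on_mult holo_on_uminus
  holo_on_diff holo_on_sum holo_on_prod holo_on_power holo_on_inverse holo_on_divide holo_on_det

lemma FD_cong:
  assumes "open T" "z \<in> T" "\<And>x. x \<in> T \<Longrightarrow> f x = g x"
  shows "FD f z = FD g z"
proof -
  have "(f has_derivative f') (at z) \<longleftrightarrow> (g has_derivative f') (at z)" for f'
    using has_derivative_transform_within_open[OF _ assms(1,2), of f f' UNIV g]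
      has_derivative_transform_within_open[OF _ assms(1,2), of g f' UNIV f] assms(3) by auto
  then show ?thesis unfolding frechet_derivative_def by simp
qed

lemma holo_on_cong:
  assumes "open S" "\<And>x. x \<in> S \<Longrightarrow> f x = g x" "holo_on f S"
  shows "holo_on g S"
proof -
  have "(g has_derivative FD f z) (at z)" if "z \<in> S" for z
    using has_derivative_transform_within_open[OF holo_onD(1)[OF assms(3) that] assms(1) that] assms(2)
    by auto
  then show ?thesis
    using holo_onD(2)[OF assms(3)] by (intro holo_onI) auto
qed

lemma holo_on_ballI: "(\<And>z. z \<in> S \<Longrightarrow> \<exists>T. z \<in> T \<and> holo_on f T) \<Longrightarrow> holo_on f S"
  unfolding holo_on_def by blast

section \<open>Holomorphic maps between complex vector spaces\<close>

definition hmap :: "(complex^'n \<Rightarrow> complex^'m) \<Rightarrow> (complex^'n) set \<Rightarrow> bool" where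
  "hmap f S \<longleftrightarrow> (\<forall>j. holo_on (\<lambda>z. f z $ j) S)"

lemma has_derivative_vecI:
  fixes f :: "'a::real_normed_vector \<Rightarrow> 'b::euclidean_space^'m"
  assumes "\<And>j. ((\<lambda>z. f z $ j) has_derivative (\<lambda>v. f' v $ j)) (at z within S)"
  shows "(f has_derivative f') (at z within S)"
proof (subst has_derivative_componentwise_within, rule ballI)
  fix i :: "'b^'m" assume "i \<in> Basis"
  then obtain j b where i: "i = axis j b" by (auto simp: Basis_vec_def)
  show "((\<lambda>x. f x \<bullet> i) has_derivative (\<lambda>x. f' x \<bullet> i)) (at z within S)"
    unfolding i inner_axis by (intro has_derivative_inner_left assms)
qed

lemma hmap_deriv:
  assumes "hmap f S" "z \<in> S"
  shows "(f has_derivative (\<lambda>v. \<chi> j. FD (\<lambda>z. f z $ j) z v)) (at z)"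
    and "FD f z v = (\<chi> j. FD (\<lambda>z. f z $ j) z v)"
    and "(f has_derivative FD f z) (at z)"
    and "FD f z (a *s v) = a *s FD f z v"
proof -
  show *: "(f has_derivative (\<lambda>v. \<chi> j. FD (\<lambda>z. f z $ j) z v)) (at z)"
    by (rule has_derivative_vecI) (use assms in \<open>auto simp: hmap_def intro: holo_onD\<close>)
  show **: "FD f z v = (\<chi> j. FD (\<lambda>z. f z $ j) z v)" for v by (rule FD_eq[OF *])
  show "(f has_derivative FD f z) (at z)" using * ** by (metis (no_types, lifting) ext)
  show "FD f z (a *s v) = a *s FD f z v"
    using assms by (auto simp: ** vec_eq_iff hmap_def holo_onD(2)[of _ S])
qed

lemma hmap_continuous: "hmap f S \<Longrightarrow> continuous_on S f"
  by (meson hmap_deriv(1) continuous_at_imp_continuous_on has_derivative_continuous)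

lemma hmap_subset: "hmap f S \<Longrightarrow> T \<subseteq> S \<Longrightarrow> hmap f T"
  by (auto simp: hmap_def intro: holo_on_subset)

lemma hmap_cong: "open S \<Longrightarrow> (\<And>x. x \<in> S \<Longrightarrow> f x = g x) \<Longrightarrow> hmap f S \<Longrightarrow> hmap g S"
  unfolding hmap_def by (metis (no_types, lifting) holo_on_cong)

lemma holo_on_compose:
  assumes f: "holo_on f T" and g: "hmap g S" and "g ` S \<subseteq> T"
  shows "holo_on (\<lambda>z. f (g z)) S"
    and "z \<in> S \<Longrightarrow> FD (\<lambda>z. f (g z)) z v = FD f (g z) (FD g z v)"
proof -
  have *: "((\<lambda>z. f (g z)) has_derivative (\<lambda>v. FD f (g z) (FD g z v))) (at z)" if "z \<in> S" for z
    using that assms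
    by (intro has_derivative_compose[of g _ _ _ f]) (auto intro: hmap_deriv(3) holo_onD)
  show "holo_on (\<lambda>z. f (g z)) S"
    by (rule holo_onI[OF *]) (use assms in \<open>auto simp: hmap_deriv(4) holo_onD\<close>)
  show "z \<in> S \<Longrightarrow> FD (\<lambda>z. f (g z)) z v = FD f (g z) (FD g z v)"
    using FD_eq[OF *] .
qed

lemma hmap_compose:
  assumes f: "hmap f T" and g: "hmap g S" and "g ` S \<subseteq> T"
  shows "hmap (\<lambda>z. f (g z)) S"
    and "z \<in> S \<Longrightarrow> FD (\<lambda>z. f (g z)) z v = FD f (g z) (FD g z v)"
proof -
  show h: "hmap (\<lambda>z. f (g z)) S"
    using assms by (auto simp: hmap_def intro: holo_on_compose(1)[OF _ assms(2,3)])
  assume z: "z \<in> S"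
  then show "FD (\<lambda>z. f (g z)) z v = FD f (g z) (FD g z v)"
    using assms(3)
    by (auto simp: hmap_deriv(2)[OF h] hmap_deriv(2)[OF f] vec_eq_iff
        intro!: holo_on_compose(2)[OF f[unfolded hmap_def, rule_format] g assms(3)])
qed

lemma hmap_translate: "hmap (\<lambda>z. z + a) S"
  unfolding hmap_def by (auto intro!: holo_intros)

section \<open>Cauchy estimates, limits and higher derivatives\<close>

lemma holo_slice:
  assumes "holo_on f S" "a + \<zeta> *s v \<in> S"
  shows "((\<lambda>\<zeta>. f (a + \<zeta> *s v)) has_field_derivative FD f (a + \<zeta> *s v) v) (at \<zeta>)"
proof -
  have "((\<lambda>\<zeta>. a + \<zeta> *s v) has_derivative (\<lambda>\<zeta>. \<zeta> *s v)) (at \<zeta>)"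
    using bounded_linear_imp_has_derivative[OF bounded_linear_smult_vec, of v]
    by (auto intro!: derivative_eq_intros)
  from has_derivative_compose[OF this holo_onD(1)[OF assms]] holo_onD(2)[OF assms]
  have "((\<lambda>\<zeta>. f (a + \<zeta> *s v)) has_derivative (\<lambda>x. x * FD f (a + \<zeta> *s v) v)) (at \<zeta>)"
    by simp
  then show ?thesis
    by (rule has_derivative_imp_has_field_derivative) simp
qed

lemma holo_slice_holomorphic:
  assumes "holo_on f S" "\<And>\<zeta>. \<zeta> \<in> T \<Longrightarrow> a + \<zeta> *s v \<in> S"
  shows "(\<lambda>\<zeta>. f (a + \<zeta> *s v)) holomorphic_on T"
  unfolding holomorphic_on_def field_differentiable_def
  using holo_slice[OF assms(1)] assms(2) has_field_derivative_at_within by blast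

text \<open>Reduces to one variable: on the complex line through \<open>z\<close> in direction
  \<open>v\<close> the derivative at 0 is \<open>FD f z v\<close>, and Cauchy's inequality bounds
  it.\<close>

lemma Cauchy_FD_bound:
  assumes f: "holo_on f (ball z r)" and "r > 0" and B: "\<And>w. w \<in> ball z r \<Longrightarrow> cmod (f w) \<le> B"
  shows "cmod (FD f z v) \<le> 2 * B * norm v / r"
proof (cases "v = 0")
  case True
  then show ?thesis using FD_0[OF f] \<open>r > 0\<close> by simp
next
  case False
  \<comment> \<open>Parameters in the disc of radius \<open>s\<close> stay within distance
    \<open>r / 2\<close> of \<open>z\<close>, hence inside the open ball; this halving is the factor
    2 of the bound.\<close>
  define s where "s = r / (2 * norm v)"
  have s: "s > 0" using False \<open>r > 0\<close> by (simp add: s_def)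
  have in_ball: "z + \<zeta> *s v \<in> ball z r" if "cmod \<zeta> \<le> s" for \<zeta>
  proof -
    have "cmod \<zeta> * norm v \<le> s * norm v" using that by (simp add: mult_right_mono)
    also have "\<dots> = r / 2" using False by (simp add: s_def)
    finally show ?thesis using \<open>r > 0\<close> by (simp add: dist_norm norm_smult_vec)
  qed
  have hol: "(\<lambda>\<zeta>. f (z + \<zeta> *s v)) holomorphic_on cball 0 s"
    by (rule holo_slice_holomorphic[OF f in_ball]) auto
  have "norm ((deriv ^^ 1) (\<lambda>\<zeta>. f (z + \<zeta> *s v)) 0) \<le> fact 1 * B / s ^ 1"
  proof (rule Cauchy_inequality)
    show "(\<lambda>\<zeta>. f (z + \<zeta> *s v)) holomorphic_on ball 0 s"
      using hol ball_subset_cball holomorphic_on_subset by blast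
    show "continuous_on (cball 0 s) (\<lambda>\<zeta>. f (z + \<zeta> *s v))"
      using hol holomorphic_on_imp_continuous_on by blast
    show "s > 0" by fact
    show "cmod (f (z + x *s v)) \<le> B" if "cmod (0 - x) = s" for x
      using that by (intro B in_ball) auto
  qed
  moreover have "deriv (\<lambda>\<zeta>. f (z + \<zeta> *s v)) 0 = FD f z v"
    using holo_slice[OF f, of z 0 v] \<open>r > 0\<close> by (auto intro!: DERIV_imp_deriv)
  ultimately show ?thesis using False by (simp add: s_def field_simps)
qed

text \<open>Weierstrass' theorem. Cauchy estimates on balls of half the radius turn uniform
  convergence of the functions into uniform convergence of their derivatives, and complex linearity
  passes to the limit.\<close>

lemma holo_uniform_limit:
  assumes r: "r > 0" and f: "\<And>k. holo_on (f k) (ball z r)"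
    and lim: "uniform_limit (ball z r) f g sequentially"
  shows "holo_on g (ball z (r/2))"
    and "\<And>w v. w \<in> ball z (r/2) \<Longrightarrow> (\<lambda>k. FD (f k) w v) \<longlonglongrightarrow> FD g w v"
proof -
  let ?B = "ball z (r/2)"
  have sub: "ball w (r/2) \<subseteq> ball z r" if "w \<in> ?B" for w
  proof
    fix x assume "x \<in> ball w (r/2)"
    then show "x \<in> ball z r" using that dist_triangle[of z x w] by auto
  qed
  have cau: "\<exists>N. \<forall>k\<ge>N. \<forall>l\<ge>N. \<forall>w\<in>?B. \<forall>v. cmod (FD (f k) w v - FD (f l) w v) \<le> e * norm v"
    if "e > 0" for e :: real
  proof -
    define d where "d = e * r / 8"
    have "d > 0" using that r by (simp add: d_def)
    then have "\<forall>\<^sub>F n in sequentially. \<forall>x\<in>ball z r. dist (f n x) (g x) < d"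
      using lim by (simp add: uniform_limit_iff)
    then obtain N where N: "\<And>n x. n \<ge> N \<Longrightarrow> x \<in> ball z r \<Longrightarrow> dist (f n x) (g x) < d"
      unfolding eventually_sequentially by blast
    have "cmod (FD (f k) w v - FD (f l) w v) \<le> e * norm v"
      if "k \<ge> N" "l \<ge> N" "w \<in> ?B" for k l w v
    proof -
      have h: "holo_on (\<lambda>x. f k x - f l x) (ball w (r/2))"
        using f sub[OF that(3)] by (intro holo_intros) (auto intro: holo_on_subset)
      have "cmod (FD (\<lambda>x. f k x - f l x) w v) \<le> 2 * (2*d) * norm v / (r/2)"
      proof (rule Cauchy_FD_bound[OF h])
        show "r/2 > 0" using r by simp
        fix x assume "x \<in> ball w (r/2)"
        then have x: "x \<in> ball z r" using sub that by blast
        show "cmod (f k x - f l x) \<le> 2*d"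
          using N[OF that(1) x] N[OF that(2) x] dist_triangle2[of "f k x" "f l x" "g x"]
          by (auto simp: dist_norm)
      qed
      moreover have "w \<in> ball z r" using that r by auto
      then have "FD (\<lambda>x. f k x - f l x) w v = FD (f k) w v - FD (f l) w v"
        by (intro FD_eqI[OF has_derivative_diff]) (auto intro: holo_onD(1)[OF f])
      ultimately show ?thesis using r by (simp add: d_def field_simps)
    qed
    then show ?thesis by blast
  qed
  have conv: "convergent (\<lambda>k. FD (f k) w v)" if "w \<in> ?B" for w v
  proof (rule Cauchy_convergent, rule metric_CauchyI)
    fix e :: real assume e: "e > 0"
    have pos: "e / (2 * (norm v + 1)) > 0"
      using e by (simp add: add_nonneg_pos)
    obtain N where N: "\<forall>k\<ge>N. \<forall>l\<ge>N. \<forall>w\<in>?B. \<forall>v'. cmod (FD (f k) w v' - FD (f l) w v') \<le> e / (2*(norm v + 1)) * norm v'"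
      using cau[OF pos] by blast
    have "e / (2*(norm v + 1)) * norm v < e"
    proof -
      have "norm v / (2*(norm v + 1)) < 1" by (simp add: add_nonneg_pos)
      then have "e * (norm v / (2*(norm v + 1))) < e * 1" using e mult_strict_left_mono by blast
      then show ?thesis by simp
    qed
    then show "\<exists>M. \<forall>m\<ge>M. \<forall>n\<ge>M. dist (FD (f m) w v) (FD (f n) w v) < e"
      unfolding dist_norm using N[rule_format, OF _ _ that, of _ _ v] by (blast intro: le_less_trans)
  qed
  define G where "G w v = lim (\<lambda>k. FD (f k) w v)" for w v
  have G: "(\<lambda>k. FD (f k) w v) \<longlonglongrightarrow> G w v" if "w \<in> ?B" for w v
    unfolding G_def using conv[OF that] convergent_LIMSEQ_iff by blast
  have glim: "(\<lambda>k. f k w) \<longlonglongrightarrow> g w" if "w \<in> ball z r" for w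
    using lim that by (rule tendsto_uniform_limitI)
  have "\<exists>h. \<forall>x\<in>?B. (\<lambda>n. f n x) \<longlonglongrightarrow> h x \<and> (h has_derivative G x) (at x within ?B)"
  proof (rule has_derivative_sequence)
    show "convex ?B" by simp
    show "(f n has_derivative FD (f n) x) (at x within ?B)" if "x \<in> ?B" for n x
      using holo_onD(1)[OF f, of x n] that r by (auto intro: has_derivative_at_withinI)
    show "z \<in> ?B" using r by simp
    show "(\<lambda>n. f n z) \<longlonglongrightarrow> g z" using glim r by simp
    show "\<forall>\<^sub>F n in sequentially. \<forall>x\<in>?B. \<forall>h. norm (FD (f n) x h - G x h) \<le> e * norm h"
      if "e > 0" for e
    proof -
      obtain N where N: "\<forall>k\<ge>N. \<forall>l\<ge>N. \<forall>w\<in>?B. \<forall>v. cmod (FD (f k) w v - FD (f l) w v) \<le> e * norm v"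
        using cau[OF \<open>e > 0\<close>] by blast
      have "norm (FD (f n) x h - G x h) \<le> e * norm h" if "n \<ge> N" "x \<in> ?B" for n x h
      proof (rule tendsto_upperbound)
        show "(\<lambda>l. norm (FD (f n) x h - FD (f l) x h)) \<longlonglongrightarrow> norm (FD (f n) x h - G x h)"
          by (intro tendsto_intros G that)
        show "\<forall>\<^sub>F l in sequentially. norm (FD (f n) x h - FD (f l) x h) \<le> e * norm h"
          unfolding eventually_sequentially using N that by blast
      qed auto
      then show ?thesis unfolding eventually_sequentially by blast
    qed
  qed
  then obtain h where h: "\<And>x. x \<in> ?B \<Longrightarrow> (\<lambda>n. f n x) \<longlonglongrightarrow> h x"
      "\<And>x. x \<in> ?B \<Longrightarrow> (h has_derivative G x) (at x within ?B)" by blast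
  have hg: "h x = g x" if "x \<in> ?B" for x
    using LIMSEQ_unique[OF h(1)[OF that] glim] that r by auto
  have gd: "(g has_derivative G x) (at x)" if "x \<in> ?B" for x
  proof -
    have "(h has_derivative G x) (at x)" using h(2)[OF that] unfolding at_within_open[OF that open_ball] .
    then show ?thesis
      by (rule has_derivative_transform_within_open[of _ _ _ _ ?B]) (use that hg in auto)
  qed
  show "holo_on g ?B"
  proof (rule holo_onI[OF gd])
    fix x a v assume x: "x \<in> ?B"
    have "(\<lambda>k. FD (f k) x (a *s v)) = (\<lambda>k. a * FD (f k) x v)"
      using holo_onD(2)[OF f, of x] x r by auto
    then show "G x (a *s v) = a * G x v"
      using LIMSEQ_unique[OF G[OF x, of "a *s v"]] tendsto_mult_left[OF G[OF x, of v], of a] by simp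
  qed auto
  show "(\<lambda>k. FD (f k) w v) \<longlonglongrightarrow> FD g w v" if "w \<in> ?B" for w v
    using G[OF that] FD_eq[OF gd[OF that]] by simp
qed

lemma uniformly_continuousE:
  assumes "uniformly_continuous_on S f" "e > 0"
  obtains d where "d > 0"
    "\<And>x x'. x \<in> S \<Longrightarrow> x' \<in> S \<Longrightarrow> dist x' x < d \<Longrightarrow> dist (f x') (f x) < e"
proof -
  have "\<exists>d>0. \<forall>x\<in>S. \<forall>x'\<in>S. dist x' x < d \<longrightarrow> dist (f x') (f x) < e"
    using assms unfolding uniformly_continuous_on_def by simp
  then obtain d where d: "d > 0" "\<forall>x\<in>S. \<forall>x'\<in>S. dist x' x < d \<longrightarrow> dist (f x') (f x) < e"
    by (elim exE conjE)
  show thesis by (rule that[of d]) (use d in auto)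
qed

text \<open>\<open>holo_on\<close> only asks for complex differentiability at each point, so
  continuity of the derivative has to come from Cauchy: translating \<open>f\<close> by
  \<open>w - z\<close> changes it little by uniform continuity, and the estimate applied to the
  difference compares the derivatives at \<open>w\<close> and \<open>z\<close>.\<close>

lemma holo_FD_continuous:
  assumes S: "open S" and f: "holo_on f S"
  shows "continuous_on S (\<lambda>z. FD f z v)"
proof (rule continuous_at_imp_continuous_on, rule ballI)
  fix z assume "z \<in> S"
  then obtain r0 where r0: "r0 > 0" "cball z r0 \<subseteq> S" using S open_contains_cball by blast
  define r where "r = r0/2"
  have r: "r > 0" "cball z (2*r) \<subseteq> S" using r0 by (auto simp: r_def)
  have uc: "uniformly_continuous_on (cball z (2*r)) f"
    by (rule compact_uniformly_continuous)
      (use holo_on_continuous[OF f] r continuous_on_subset in auto)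
  show "isCont (\<lambda>z. FD f z v) z"
    unfolding continuous_at_eps_delta
  proof (intro allI impI)
    fix e :: real assume e: "e > 0"
    define e' where "e' = e * r / (4 * (norm v + 1))"
    have e': "e' > 0" using e r by (simp add: e'_def add_nonneg_pos)
    obtain d where d: "d > 0" "\<And>x x'. x\<in>cball z (2*r) \<Longrightarrow> x'\<in>cball z (2*r) \<Longrightarrow> dist x' x < d \<Longrightarrow> dist (f x') (f x) < e'"
      by (rule uniformly_continuousE[OF uc e']) (rule that)
    have "dist (FD f w v) (FD f z v) < e" if w: "dist w z < min d r" for w
    proof -
      have m: "x + (w - z) \<in> cball z (2*r)" "x \<in> cball z (2*r)" if "x \<in> ball z r" for x
      proof -
        have "dist z (x + (w - z)) \<le> dist z x + dist w z"
          using norm_triangle_ineq4[of "z - x" "w - z"] by (simp add: dist_norm algebra_simps)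
        then show "x + (w - z) \<in> cball z (2*r)" using that w by auto
        show "x \<in> cball z (2*r)" using that r by auto
      qed
      have tr: "hmap (\<lambda>x. x + (w - z)) (ball z r)"
        unfolding hmap_def by (auto intro!: holo_intros)
      have tr': "(\<lambda>x. x + (w - z)) ` ball z r \<subseteq> S" using m r by blast
      have c: "holo_on (\<lambda>x. f (x + (w - z))) (ball z r)"
        by (rule holo_on_compose(1)[OF f tr tr'])
      have h: "holo_on (\<lambda>x. f (x + (w - z)) - f x) (ball z r)"
        by (intro holo_intros c holo_on_subset[OF f]) (use m r in blast)
      have "((\<lambda>x. x + (w - z)) has_derivative (\<lambda>v. v)) (at z)"
        by (auto intro!: derivative_eq_intros)
      then have "((\<lambda>x. f (x + (w - z))) has_derivative (\<lambda>v. FD f w v)) (at z)"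
        using has_derivative_compose[of "\<lambda>x. x + (w - z)" "\<lambda>v. v" z UNIV f "FD f w"]
          holo_onD(1)[OF f, of w] w r m[of z] by auto
      then have "FD (\<lambda>x. f (x + (w - z)) - f x) z v = FD f w v - FD f z v"
        by (intro FD_eqI[OF has_derivative_diff]) (auto intro: holo_onD(1)[OF f] \<open>z \<in> S\<close>)
      moreover have "cmod (FD (\<lambda>x. f (x + (w - z)) - f x) z v) \<le> 2 * e' * norm v / r"
      proof (rule Cauchy_FD_bound[OF h r(1)])
        fix x assume "x \<in> ball z r"
        from d(2)[OF m(2,1)[OF this]] w show "cmod (f (x + (w - z)) - f x) \<le> e'"
          by (auto simp: dist_norm)
      qed
      moreover have "2 * e' * norm v / r < e"
      proof -
        have "2 * (e * r / (4 * m)) * norm v / r = e * (norm v / (2 * m))" if "m > 0" for m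
          using r that by (simp add: field_simps)
        from this[of "norm v + 1"] have "2 * e' * norm v / r = e * (norm v / (2 * (norm v + 1)))"
          by (simp add: e'_def add_nonneg_pos)
        also have "\<dots> < e * 1"
          by (rule mult_strict_left_mono) (use e in \<open>auto simp: add_nonneg_pos\<close>)
        finally show ?thesis by simp
      qed
      ultimately show ?thesis by (simp add: dist_norm)
    qed
    then show "\<exists>d>0. \<forall>x'. dist x' z < d \<longrightarrow> dist (FD f x' v) (FD f z v) < e"
      using d(1) r(1) by (metis min_less_iff_conj)
  qed
qed

text \<open>Approximates \<open>FD f x v\<close> by functions that are visibly holomorphic in
  \<open>x\<close>. Continuity of the derivative and the mean value inequality make the convergence
  uniform near \<open>z\<close>.\<close>

lemma holo_difference_quotients:
  fixes f :: "complex^'n \<Rightarrow> complex"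
  assumes S: "open S" and f: "holo_on f S" and z: "z \<in> S"
  obtains r c where "r > 0" "ball z r \<subseteq> S" "\<And>k::nat. c k \<noteq> (0::complex)" "c \<longlonglongrightarrow> 0"
    "\<And>k x. x \<in> ball z r \<Longrightarrow> x + c k *s v \<in> S"
    "\<And>k. holo_on (\<lambda>x. (f (x + c k *s v) - f x) / c k) (ball z r)"
    "uniform_limit (ball z r) (\<lambda>k x. (f (x + c k *s v) - f x) / c k) (\<lambda>x. FD f x v) sequentially"
proof -
  obtain r0 where r0: "r0 > 0" "cball z r0 \<subseteq> S" using z S open_contains_cball by blast
  define r where "r = r0/2"
  have r: "r > 0" "cball z (2*r) \<subseteq> S" using r0 by (auto simp: r_def)
  \<comment> \<open>Chosen so that \<open>q k * norm v \<le> r / (k + 1)\<close>: the translates of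
    the ball stay in \<open>cball z (2*r)\<close>, and the steps tend to 0. The 1 added to
    \<open>norm v\<close> covers \<open>v = 0\<close>.\<close>
  define q where "q k = r / ((norm v + 1) * (real k + 1))" for k
  define c where "c k = complex_of_real (q k)" for k
  have q: "q k > 0" for k using r by (simp add: q_def add_nonneg_pos)
  have n1: "norm v + 1 > 0" by (simp add: add_nonneg_pos)
  have qv: "q k * norm v \<le> r / (real k + 1)" for k
  proof -
    have "q k * norm v = (r / (real k + 1)) * (norm v / (norm v + 1))" by (simp add: q_def)
    also have "\<dots> \<le> (r / (real k + 1)) * 1"
      by (rule mult_left_mono) (use r n1 in \<open>auto simp: field_simps\<close>)
    finally show ?thesis by simp
  qed
  have qv': "q k * norm v \<le> r" for k
  proof -
    have "r / (real k + 1) \<le> r / 1" by (rule divide_left_mono) (use r in auto)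
    then show ?thesis using qv[of k] by simp
  qed
  have near: "x + (t *\<^sub>R v) \<in> cball z (2*r)" if "x \<in> ball z r" "0 \<le> t" "t \<le> q k" for x t k
  proof -
    have "norm (t *\<^sub>R v) \<le> q k * norm v" using that by (simp add: mult_right_mono)
    also have "\<dots> \<le> r" by (rule qv')
    finally show ?thesis
      using that(1) norm_triangle_ineq4[of "z - x" "t *\<^sub>R v"] by (simp add: dist_norm algebra_simps)
  qed
  have cv: "c k *s v = q k *\<^sub>R v" for k by (simp add: c_def scaleR_vec_smult)
  have c0: "c \<longlonglongrightarrow> 0"
  proof -
    have "(\<lambda>k. r / (norm v + 1) * (1 / (real k + 1))) \<longlonglongrightarrow> r / (norm v + 1) * 0"
      using LIMSEQ_inverse_real_of_nat by (intro tendsto_intros) (simp add: inverse_eq_divide add.commute)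
    then have "q \<longlonglongrightarrow> 0" by (simp add: q_def[abs_def])
    then show ?thesis using tendsto_of_real[of q 0] by (simp add: c_def[abs_def])
  qed
  have holo: "holo_on (\<lambda>x. (f (x + c k *s v) - f x) / c k) (ball z r)" for k
  proof -
    have "holo_on (\<lambda>x. f (x + c k *s v)) (ball z r)"
      by (rule holo_on_compose(1)[OF f hmap_translate])
        (use near[of _ "q k" k] r q[of k] in \<open>auto simp: cv\<close>)
    moreover have "holo_on f (ball z r)"
      by (rule holo_on_subset[OF f]) (use r in auto)
    ultimately show ?thesis using q[of k] by (intro holo_intros) (auto simp: c_def)
  qed
  have ul: "uniform_limit (ball z r) (\<lambda>k x. (f (x + c k *s v) - f x) / c k) (\<lambda>x. FD f x v) sequentially"
    unfolding uniform_limit_iff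
  proof (intro allI impI)
    fix e :: real assume e: "e > 0"
    have uc: "uniformly_continuous_on (cball z (2*r)) (\<lambda>x. FD f x v)"
      by (intro compact_uniformly_continuous continuous_on_subset[OF holo_FD_continuous[OF S f] r(2)])
        simp
    obtain d where d: "d > 0" "\<And>x x'. x\<in>cball z (2*r) \<Longrightarrow> x'\<in>cball z (2*r) \<Longrightarrow> dist x' x < d
        \<Longrightarrow> dist (FD f x' v) (FD f x v) < e/2"
      by (rule uniformly_continuousE[OF uc half_gt_zero[OF e]]) (rule that)
    obtain N where N: "r / (real N + 1) < d"
    proof -
      obtain N where "r / d < real N" using reals_Archimedean2 by blast
      then have "r / (real N + 1) < d" using d(1) by (simp add: field_simps)
      then show ?thesis using that by blast
    qed
    have "dist ((f (x + c k *s v) - f x) / c k) (FD f x v) < e" if k: "k \<ge> N" and x: "x \<in> ball z r" for k x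
    proof -
      \<comment> \<open>Subtracting the linear part leaves a function of \<open>t\<close> whose
        derivative is at most \<open>e/2\<close>, so the mean value inequality bounds the error of
        the difference quotient.\<close>
      define G where "G t = f (x + t *\<^sub>R v) - of_real t * FD f x v" for t :: real
      have qd: "q k * norm v < d"
      proof -
        have "r / (real k + 1) \<le> r / (real N + 1)" using k r by (intro divide_left_mono) auto
        then show ?thesis using qv[of k] N by linarith
      qed
      have G: "(G has_vector_derivative (FD f (x + t *\<^sub>R v) v - FD f x v)) (at t within {0..q k})"
        if "t \<in> {0..q k}" for t
      proof -
        have "x + t *\<^sub>R v \<in> S" using near[OF x] that r by auto
        then have "(f has_derivative FD f (x + t *\<^sub>R v)) (at (x + t *\<^sub>R v))" by (rule holo_onD(1)[OF f])
        moreover have "((\<lambda>t. x + t *\<^sub>R v) has_derivative (\<lambda>s. s *\<^sub>R v)) (at t within {0..q k})"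
          by (auto intro!: derivative_eq_intros)
        ultimately have "((\<lambda>t. f (x + t *\<^sub>R v)) has_derivative (\<lambda>s. FD f (x + t *\<^sub>R v) (s *\<^sub>R v))) (at t within {0..q k})"
          by (rule has_derivative_compose[rotated])
        moreover have "FD f (x + t *\<^sub>R v) (s *\<^sub>R v) = s *\<^sub>R FD f (x + t *\<^sub>R v) v" for s
          using holo_onD(2)[OF f \<open>x + t *\<^sub>R v \<in> S\<close>] by (simp add: scaleR_vec_smult scaleR_conv_of_real)
        ultimately show ?thesis
          unfolding G_def has_vector_derivative_def
          by (auto intro!: derivative_eq_intros simp: algebra_simps scaleR_conv_of_real)
      qed
      have "norm (G (q k) - G 0) \<le> (e/2) * norm (q k - 0)"
      proof (rule differentiable_bound[where S="{0..q k}" and f'="\<lambda>t s. s *\<^sub>R (FD f (x + t *\<^sub>R v) v - FD f x v)"])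
        show "(G has_derivative (\<lambda>s. s *\<^sub>R (FD f (x + t *\<^sub>R v) v - FD f x v))) (at t within {0..q k})"
          if "t \<in> {0..q k}" for t using G[OF that] by (simp add: has_vector_derivative_def)
        show "onorm (\<lambda>s. s *\<^sub>R (FD f (x + t *\<^sub>R v) v - FD f x v)) \<le> e/2" if "t \<in> {0..q k}" for t
        proof -
          have "t * norm v \<le> q k * norm v" using that by (simp add: mult_right_mono)
          then have "dist (x + t *\<^sub>R v) x < d" using that qd by (simp add: dist_norm)
          then have le: "norm (FD f (x + t *\<^sub>R v) v - FD f x v) \<le> e/2"
            using d(2)[OF _ near[OF x, of t k], of x] that near[OF x, of 0 k] q[of k] by (simp add: dist_norm less_imp_le)
          have "norm (s *\<^sub>R (FD f (x + t *\<^sub>R v) v - FD f x v)) \<le> e/2 * norm s" for s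
            using mult_left_mono[OF le norm_ge_zero[of s]] by (simp add: mult.commute)
          then show ?thesis using e by (intro onorm_bound) auto
        qed
      qed (use q[of k] in auto)
      moreover have "G (q k) - G 0 = c k * ((f (x + c k *s v) - f x) / c k - FD f x v)"
      proof -
        have "c k \<noteq> 0" using q[of k] by (simp add: c_def)
        then have "c k * ((f (x + c k *s v) - f x) / c k - FD f x v) = f (x + c k *s v) - f x - c k * FD f x v"
          by (simp add: right_diff_distrib[of _ "_ / _"])
        then show ?thesis by (simp add: G_def cv) (simp add: c_def)
      qed
      ultimately have "q k * norm ((f (x + c k *s v) - f x) / c k - FD f x v) \<le> q k * (e/2)"
        using q[of k] by (simp add: norm_mult c_def mult.commute)
      then have "norm ((f (x + c k *s v) - f x) / c k - FD f x v) \<le> e/2"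
        using q[of k] mult_le_cancel_left_pos by blast
      then show ?thesis using e by (simp add: dist_norm)
    qed
    then show "\<forall>\<^sub>F k in sequentially. \<forall>x\<in>ball z r. dist ((f (x + c k *s v) - f x) / c k) (FD f x v) < e"
      unfolding eventually_sequentially by blast
  qed
  show thesis
  proof (rule that[of r c])
    show "ball z r \<subseteq> S" using r by auto
    show "x + c k *s v \<in> S" if "x \<in> ball z r" for x k
      using near[OF that, of "q k" k] q[of k] r by (auto simp: cv)
    show "c k \<noteq> 0" for k using q[of k] by (simp add: c_def)
  qed (use r c0 holo ul in auto)
qed

text \<open>Near each point the derivative is a uniform limit of holomorphic difference
  quotients.\<close>

lemma holo_on_FD:
  assumes S: "open S" and f: "holo_on f S"
  shows "holo_on (\<lambda>z. FD f z v) S"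
proof (rule holo_on_ballI)
  fix z assume "z \<in> S"
  obtain r c where r: "r > 0" "\<And>k::nat. holo_on (\<lambda>x. (f (x + c k *s v) - f x) / c k) (ball z r)"
    "uniform_limit (ball z r) (\<lambda>k x. (f (x + c k *s v) - f x) / c k) (\<lambda>x. FD f x v) sequentially"
    by (rule holo_difference_quotients[OF S f \<open>z \<in> S\<close>, of v]) (rule that)
  from holo_uniform_limit(1)[OF r] \<open>r > 0\<close>
  show "\<exists>T. z \<in> T \<and> holo_on (\<lambda>z. FD f z v) T" by (intro exI[of _ "ball z (r/2)"]) auto
qed

text \<open>Differentiating the difference quotients in direction \<open>v\<close> along
  \<open>u\<close> gives the difference quotients of \<open>FD f x u\<close> in direction
  \<open>v\<close>. Derivatives of a uniform limit are limits of the derivatives, so the two mixed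
  derivatives are limits of the same sequence.\<close>

lemma FD_symmetric:
  assumes S: "open S" and f: "holo_on f S" and z: "z \<in> S"
  shows "FD (\<lambda>x. FD f x v) z u = FD (\<lambda>x. FD f x u) z v"
proof -
  obtain r c where
    r: "r > 0" "ball z r \<subseteq> S" "\<And>k::nat. c k \<noteq> (0::complex)" "c \<longlonglongrightarrow> 0"
    "\<And>k x. x \<in> ball z r \<Longrightarrow> x + c k *s v \<in> S"
    "\<And>k. holo_on (\<lambda>x. (f (x + c k *s v) - f x) / c k) (ball z r)"
    "uniform_limit (ball z r) (\<lambda>k x. (f (x + c k *s v) - f x) / c k) (\<lambda>x. FD f x v) sequentially"
    by (rule holo_difference_quotients[OF S f z, of v]) (rule that)
  have zb: "z \<in> ball z (r/2)" "z \<in> ball z r" using r(1) by auto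
  have 1: "(\<lambda>k. FD (\<lambda>x. (f (x + c k *s v) - f x) / c k) z u) \<longlonglongrightarrow> FD (\<lambda>x. FD f x v) z u"
    by (rule holo_uniform_limit(2)[OF r(1,6,7) zb(1)])
  have 2: "FD (\<lambda>x. (f (x + c k *s v) - f x) / c k) z u = (FD f (z + c k *s v) u - FD f z u) / c k" for k
  proof -
    have "((\<lambda>x. x + c k *s v) has_derivative (\<lambda>v. v)) (at z)"
      by (auto intro!: derivative_eq_intros)
    then have "((\<lambda>x. f (x + c k *s v)) has_derivative (\<lambda>h. FD f (z + c k *s v) h)) (at z)"
      by (rule has_derivative_compose) (rule holo_onD(1)[OF f r(5)[OF zb(2)]])
    then have "((\<lambda>x. (f (x + c k *s v) - f x) / c k) has_derivative
        (\<lambda>h. (FD f (z + c k *s v) h - FD f z h) / c k)) (at z)"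
      unfolding divide_inverse
      by (intro has_derivative_mult_left has_derivative_diff holo_onD(1)[OF f z])
    then show ?thesis by (rule FD_eq)
  qed
  have h: "holo_on (\<lambda>x. FD f x u) S" by (rule holo_on_FD[OF S f])
  have "((\<lambda>\<zeta>. FD f (z + \<zeta> *s v) u) has_field_derivative FD (\<lambda>x. FD f x u) (z + 0 *s v) v) (at 0)"
    by (rule holo_slice[OF h]) (use z in simp)
  then have "((\<lambda>\<zeta>. (FD f (z + \<zeta> *s v) u - FD f z u) / \<zeta>) \<longlongrightarrow> FD (\<lambda>x. FD f x u) z v) (at 0)"
    by (simp add: DERIV_def)
  then have "(\<lambda>k. (FD f (z + c k *s v) u - FD f z u) / c k) \<longlonglongrightarrow> FD (\<lambda>x. FD f x u) z v"
    by (rule filterlim_compose) (use r in \<open>auto simp: filterlim_at\<close>)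
  with 1 2 show ?thesis by (auto intro: LIMSEQ_unique)
qed

lemma hmap_FD: "open S \<Longrightarrow> hmap f S \<Longrightarrow> hmap (\<lambda>z. FD f z v) S"
  by (rule hmap_cong[of S "\<lambda>z. \<chi> j. FD (\<lambda>z. f z $ j) z v"])
    (auto simp: hmap_deriv(2) hmap_def intro: holo_on_FD)

text \<open>A point \<open>a\<close> of \<open>V\<close> and \<open>w\<close> lie on a complex line;
  as the ball is convex, the line meets it in a convex, hence connected, set of parameters, where
  the one-variable identity theorem applies.\<close>

lemma holo_identity:
  assumes f: "holo_on f (ball z r)" and V: "open V" "V \<noteq> {}" "V \<subseteq> ball z r"
    and 0: "\<And>x. x \<in> V \<Longrightarrow> f x = 0" and w: "w \<in> ball z r"
  shows "f w = 0"
proof -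
  obtain a where a: "a \<in> V" using V by blast
  define v where "v = w - a"
  define g where "g \<zeta> = a + \<zeta> *s v" for \<zeta>
  define T where "T = g -` ball z r"
  have cont: "continuous_on X g" for X
    unfolding g_def by (intro continuous_intros bounded_linear.continuous_on[OF bounded_linear_smult_vec])
  have "open T" unfolding T_def using cont by (intro open_vimage) auto
  have "convex T"
    unfolding T_def g_def
  proof (intro convexI)
    fix x y :: complex and p q :: real
    assume xy: "x \<in> (\<lambda>\<zeta>. a + \<zeta> *s v) -` ball z r" "y \<in> (\<lambda>\<zeta>. a + \<zeta> *s v) -` ball z r"
      and pq: "0 \<le> p" "0 \<le> q" "p + q = 1"
    have "a + (p *\<^sub>R x + q *\<^sub>R y) *s v = p *\<^sub>R (a + x *s v) + q *\<^sub>R (a + y *s v)"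
      using pq(3) by (simp add: vec_eq_iff algebra_simps flip: scaleR_add_left)
    then show "p *\<^sub>R x + q *\<^sub>R y \<in> (\<lambda>\<zeta>. a + \<zeta> *s v) -` ball z r"
      using convexD[OF convex_ball, of "a + x *s v" z r "a + y *s v" p q] xy pq by simp
  qed
  define T0 where "T0 = g -` V"
  have "open T0" unfolding T0_def using cont V by (intro open_vimage) auto
  have "(\<lambda>\<zeta>. f (g \<zeta>)) 1 = (\<lambda>\<zeta>. 0) 1"
  proof (rule analytic_continuation_open[of T0 T "\<lambda>\<zeta>. f (g \<zeta>)" "\<lambda>_. 0" 1])
    have "0 \<in> T0" using a by (simp add: T0_def g_def)
    then show "T0 \<noteq> {}" by blast
    show "(\<lambda>\<zeta>. f (g \<zeta>)) holomorphic_on T"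
      unfolding g_def by (rule holo_slice_holomorphic[OF f]) (auto simp: T_def g_def)
    show "T0 \<subseteq> T" using V by (auto simp: T0_def T_def)
    show "1 \<in> T" using w by (simp add: T_def g_def v_def)
  qed (use \<open>open T\<close> \<open>open T0\<close> \<open>convex T\<close> 0 in \<open>auto simp: T0_def convex_connected\<close>)
  then show ?thesis by (simp add: g_def v_def)
qed

section \<open>Real smoothness and Gronwall's uniqueness argument\<close>

lemma C_times_cong: "(\<And>x. x \<in> S \<Longrightarrow> f x = g x) \<Longrightarrow> C_times k f S \<Longrightarrow> C_times k g S"
proof (induction k arbitrary: f g)
  case 0
  then show ?case by (auto cong: continuous_on_cong)
next
  case (Suc k)
  then obtain f' where f': "\<forall>x\<in>S. (f has_derivative f' x) (at x within S)" "\<forall>v. C_times k (\<lambda>x. f' x v) S"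
    by auto
  have "(g has_derivative f' x) (at x within S)" if "x \<in> S" for x
    using f'(1) that Suc.prems(1) by (intro has_derivative_transform[of x S g f]) auto
  then show ?case using f' by auto
qed

text \<open>Stated for \<open>f (L x)\<close> with \<open>L\<close> real linear because this shape
  is stable under differentiation: in a fixed direction the derivative is again a holomorphic map
  composed with \<open>L\<close>. The \<open>L\<close> used later embeds real time into complex
  time.\<close>

lemma C_times_hmap:
  assumes U: "open U" and L: "bounded_linear L"
  shows "hmap f U \<Longrightarrow> L ` S \<subseteq> U \<Longrightarrow> C_times k (\<lambda>x. f (L x)) S"
proof (induction k arbitrary: f)
  case 0
  then show ?case
    using continuous_on_compose2[OF hmap_continuous[OF 0(1)] linear_continuous_on[OF L] 0(2)] by simp
next
  case (Suc k)
  have "((\<lambda>x. f (L x)) has_derivative (\<lambda>v. FD f (L x) (L v))) (at x within S)" if "x \<in> S" for x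
    by (rule has_derivative_compose[OF bounded_linear_imp_has_derivative[OF L]])
      (use Suc.prems that in \<open>auto intro: hmap_deriv(3)\<close>)
  moreover have "C_times k (\<lambda>x. FD f (L x) (L v)) S" for v
    by (rule Suc.IH[OF hmap_FD[OF U Suc.prems(1)] Suc.prems(2)])
  ultimately show ?case
    unfolding C_times.simps by (intro exI[of _ "\<lambda>x v. FD f (L x) (L v)"]) blast
qed

lemma smooth_on_hmap:
  assumes "open U" "bounded_linear L" "hmap f U" "L ` S \<subseteq> U" "\<And>x. x \<in> S \<Longrightarrow> g x = f (L x)"
  shows "smooth_on g S"
  unfolding smooth_on_def
proof
  show "C_times k g S" for k
    by (rule C_times_cong[OF _ C_times_hmap[OF assms(1-4)]]) (simp add: assms(5))
qed

text \<open>Gronwall, in the form used for uniqueness, for invariance of zero sets and, with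
  \<open>L = 0\<close>, for conservation laws. The squared norm times a suitable exponential is
  monotone, in the direction that forces it to vanish on the side of \<open>t1\<close> in
  question.\<close>

lemma linear_ode_zero:
  fixes \<delta> :: "real \<Rightarrow> 'a::real_inner"
  assumes \<delta>: "\<And>t. t \<in> {a..b} \<Longrightarrow> (\<delta> has_vector_derivative \<delta>' t) (at t within {a..b})"
    and L: "\<And>t. t \<in> {a..b} \<Longrightarrow> norm (\<delta>' t) \<le> L * norm (\<delta> t)"
    and t1: "t1 \<in> {a..b}" "\<delta> t1 = 0" and t: "t \<in> {a..b}"
  shows "\<delta> t = 0"
proof -
  have main: "(norm (\<delta> t))\<^sup>2 \<le> 0"
  proof -
    \<comment> \<open>\<open>\<epsilon> = 1\<close> gives a nonincreasing function, for times after
      \<open>t1\<close>; \<open>\<epsilon> = -1\<close> gives a nondecreasing one, for times before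
      \<open>t1\<close>.\<close>
    define g where "g \<epsilon> s = exp (-2 * \<epsilon> * L * s) * (\<delta> s \<bullet> \<delta> s)" for \<epsilon> s :: real
    define g' where "g' \<epsilon> s = exp (-2 * \<epsilon> * L * s) * (2 * (\<delta> s \<bullet> \<delta>' s) - 2 * \<epsilon> * L * (\<delta> s \<bullet> \<delta> s))" for \<epsilon> s
    have der: "(g \<epsilon> has_derivative (\<lambda>h. h * g' \<epsilon> s)) (at s within {x..y})" if "{x..y} \<subseteq> {a..b}" "s \<in> {x..y}" for \<epsilon> s x y
    proof -
      have "s \<in> {a..b}" using that by blast
      from has_derivative_subset[OF \<delta>[OF this, unfolded has_vector_derivative_def] that(1)]
      have d: "(\<delta> has_derivative (\<lambda>h. h *\<^sub>R \<delta>' s)) (at s within {x..y})" .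
      show ?thesis
        unfolding g_def g'_def
        by (rule derivative_eq_intros d refl | simp)+ (simp add: algebra_simps inner_commute)
    qed
    have bd: "\<bar>\<delta> s \<bullet> \<delta>' s\<bar> \<le> L * (\<delta> s \<bullet> \<delta> s)" if "s \<in> {a..b}" for s
    proof -
      have "\<bar>\<delta> s \<bullet> \<delta>' s\<bar> \<le> norm (\<delta> s) * norm (\<delta>' s)" by (rule Cauchy_Schwarz_ineq2)
      also have "\<dots> \<le> norm (\<delta> s) * (L * norm (\<delta> s))" using L[OF that] by (intro mult_left_mono) auto
      finally show ?thesis by (simp add: dot_square_norm power2_eq_square algebra_simps)
    qed
    consider "t = t1" | "t1 < t" | "t < t1" by linarith
    then show ?thesis
    proof cases
      case 1 then show ?thesis using t1 by simp
    next
      case 2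
      have sub: "{t1..t} \<subseteq> {a..b}" using t t1 by auto
      obtain s where s: "s \<in> {t1<..<t}" "g 1 t - g 1 t1 = (t - t1) * g' 1 s"
        using mvt_simple[OF 2, of "g 1" "\<lambda>s h. h * g' 1 s"] der[OF sub] by auto
      have "s \<in> {a..b}" using s(1) sub by auto
      then have "g' 1 s \<le> 0" unfolding g'_def using bd[of s] by (intro mult_nonneg_nonpos) auto
      then have "(t - t1) * g' 1 s \<le> 0" using 2 by (intro mult_nonneg_nonpos) auto
      then have "g 1 t \<le> g 1 t1" using s(2) by linarith
      then have "exp (-2*1*L*t) * (\<delta> t \<bullet> \<delta> t) \<le> 0" using t1 by (simp add: g_def)
      then show ?thesis by (simp add: mult_le_0_iff dot_square_norm)
    next
      case 3
      have sub: "{t..t1} \<subseteq> {a..b}" using t t1 by auto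
      obtain s where s: "s \<in> {t<..<t1}" "g (-1) t1 - g (-1) t = (t1 - t) * g' (-1) s"
        using mvt_simple[OF 3, of "g (-1)" "\<lambda>s h. h * g' (-1) s"] der[OF sub] by auto
      have "s \<in> {a..b}" using s(1) sub by auto
      then have "g' (-1) s \<ge> 0" unfolding g'_def using bd[of s] by (intro mult_nonneg_nonneg) auto
      then have "(t1 - t) * g' (-1) s \<ge> 0" using 3 by (intro mult_nonneg_nonneg) auto
      then have "g (-1) t \<le> g (-1) t1" using s(2) by linarith
      then have "exp (-2*(-1)*L*t) * (\<delta> t \<bullet> \<delta> t) \<le> 0" using t1 by (simp add: g_def)
      then show ?thesis by (simp add: mult_le_0_iff dot_square_norm)
    qed
  qed
  then show ?thesis by simp
qed

section \<open>Germs of holomorphic functions and divisibility\<close>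

text \<open>Representatives of germs; equality of germs is eventual equality in
  \<open>nhds z0\<close>, and nothing is required of a representative far from
  \<open>z0\<close>.\<close>

definition Ogerm :: "complex^'n \<Rightarrow> (complex^'n \<Rightarrow> complex) set" where
  "Ogerm z0 = {f. \<exists>S. open S \<and> z0 \<in> S \<and> holo_on f S}"

lemma OgermI: "open S \<Longrightarrow> z0 \<in> S \<Longrightarrow> holo_on f S \<Longrightarrow> f \<in> Ogerm z0"
  by (auto simp: Ogerm_def)

lemma OgermE:
  assumes "f \<in> Ogerm z0"
  obtains S where "open S" "z0 \<in> S" "holo_on f S"
  using assms by (auto simp: Ogerm_def)

lemma Ogerm_ballE:
  assumes "f \<in> Ogerm z0" "eventually P (nhds z0)"
  obtains r where "r > 0" "holo_on f (ball z0 r)" "\<And>z. z \<in> ball z0 r \<Longrightarrow> P z"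
proof -
  obtain S where S: "open S" "z0 \<in> S" "holo_on f S" using assms(1) by (rule OgermE)
  obtain T where T: "open T" "z0 \<in> T" "\<forall>x\<in>T. P x" using assms(2) eventually_nhds by blast
  have "open (S \<inter> T)" "z0 \<in> S \<inter> T" using S T by auto
  then obtain r where "r > 0" "ball z0 r \<subseteq> S \<inter> T" using open_contains_ball by blast
  then show thesis
    by (intro that[of r]) (use S(3) T(3) in \<open>auto intro: holo_on_subset[OF S(3)]\<close>)
qed

lemma Ogerm_eventually_holo:
  assumes "f \<in> Ogerm z0"
  shows "\<forall>\<^sub>F z in nhds z0. \<exists>S. open S \<and> z \<in> S \<and> holo_on f S"
  using assms unfolding Ogerm_def eventually_nhds by blast

lemma Ogerm_const: "(\<lambda>z. c) \<in> Ogerm z0"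
  by (rule OgermI[of UNIV]) (auto intro: holo_intros)

lemma Ogerm_coord: "(\<lambda>z. z $ j) \<in> Ogerm z0"
  by (rule OgermI[of UNIV]) (auto intro: holo_intros)

lemma Ogerm_add: "f \<in> Ogerm z0 \<Longrightarrow> g \<in> Ogerm z0 \<Longrightarrow> (\<lambda>z. f z + g z) \<in> Ogerm z0"
proof (elim OgermE)
  fix S T assume *: "open S" "z0 \<in> S" "holo_on f S" "open T" "z0 \<in> T" "holo_on g T"
  have "holo_on (\<lambda>z. f z + g z) (S \<inter> T)"
    by (intro holo_intros holo_on_subset[OF *(3)] holo_on_subset[OF *(6)]) auto
  then show "(\<lambda>z. f z + g z) \<in> Ogerm z0" using * by (intro OgermI[of "S \<inter> T"]) auto
qed

lemma Ogerm_mult: "f \<in> Ogerm z0 \<Longrightarrow> g \<in> Ogerm z0 \<Longrightarrow> (\<lambda>z. f z * g z) \<in> Ogerm z0"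
proof (elim OgermE)
  fix S T assume *: "open S" "z0 \<in> S" "holo_on f S" "open T" "z0 \<in> T" "holo_on g T"
  have "holo_on (\<lambda>z. f z * g z) (S \<inter> T)"
    by (intro holo_intros holo_on_subset[OF *(3)] holo_on_subset[OF *(6)]) auto
  then show "(\<lambda>z. f z * g z) \<in> Ogerm z0" using * by (intro OgermI[of "S \<inter> T"]) auto
qed

lemma Ogerm_uminus: "f \<in> Ogerm z0 \<Longrightarrow> (\<lambda>z. - f z) \<in> Ogerm z0"
  using Ogerm_mult[OF Ogerm_const[of "-1"]] by simp

lemma Ogerm_diff: "f \<in> Ogerm z0 \<Longrightarrow> g \<in> Ogerm z0 \<Longrightarrow> (\<lambda>z. f z - g z) \<in> Ogerm z0"
  using Ogerm_add[OF _ Ogerm_uminus] by simp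

lemma Ogerm_sum: "(\<And>i. i \<in> I \<Longrightarrow> f i \<in> Ogerm z0) \<Longrightarrow> (\<lambda>z. \<Sum>i\<in>I. f i z) \<in> Ogerm z0"
  by (induction I rule: infinite_finite_induct) (auto intro: Ogerm_const Ogerm_add)

lemma Ogerm_prod: "(\<And>i. i \<in> I \<Longrightarrow> f i \<in> Ogerm z0) \<Longrightarrow> (\<lambda>z. \<Prod>i\<in>I. f i z) \<in> Ogerm z0"
  by (induction I rule: infinite_finite_induct) (auto intro: Ogerm_const Ogerm_mult)

lemma Ogerm_power: "f \<in> Ogerm z0 \<Longrightarrow> (\<lambda>z. f z ^ k) \<in> Ogerm z0"
  by (induction k) (auto intro: Ogerm_const Ogerm_mult)

lemma Ogerm_det: "(\<And>i j. (\<lambda>z. M z $ i $ j) \<in> Ogerm z0) \<Longrightarrow> (\<lambda>z. det (M z)) \<in> Ogerm z0"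
  unfolding det_def by (intro Ogerm_sum Ogerm_mult Ogerm_prod Ogerm_const) auto

lemma Ogerm_isCont: "f \<in> Ogerm z0 \<Longrightarrow> isCont f z0"
  by (elim OgermE) (meson holo_onD(1) has_derivative_continuous)

lemma Ogerm_nonzero_near: "f \<in> Ogerm z0 \<Longrightarrow> f z0 \<noteq> 0 \<Longrightarrow> \<forall>\<^sub>F z in nhds z0. f z \<noteq> 0"
  using tendsto_imp_eventually_ne[of f "f z0" "nhds z0" 0] Ogerm_isCont[of f z0]
  by (simp add: tendsto_at_iff_tendsto_nhds isCont_def)

lemma Ogerm_inverse:
  assumes "f \<in> Ogerm z0" "f z0 \<noteq> 0"
  shows "(\<lambda>z. inverse (f z)) \<in> Ogerm z0"
proof -
  obtain r where "r > 0" "holo_on f (ball z0 r)" "\<And>z. z \<in> ball z0 r \<Longrightarrow> f z \<noteq> 0"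
    by (rule Ogerm_ballE[OF assms(1) Ogerm_nonzero_near[OF assms]]) (rule that)
  then show ?thesis by (intro OgermI[of "ball z0 r"] holo_intros) auto
qed

lemma Ogerm_FD: "f \<in> Ogerm z0 \<Longrightarrow> (\<lambda>z. FD f z v) \<in> Ogerm z0"
  by (elim OgermE) (rule OgermI, auto intro: holo_on_FD)

lemma Ogerm_cong:
  assumes "f \<in> Ogerm z0" "\<forall>\<^sub>F z in nhds z0. f z = g z"
  shows "g \<in> Ogerm z0"
proof -
  obtain r where "r > 0" "holo_on f (ball z0 r)" "\<And>z. z \<in> ball z0 r \<Longrightarrow> f z = g z"
    by (rule Ogerm_ballE[OF assms]) (rule that)
  then show ?thesis using holo_on_cong[of "ball z0 r" f g] by (intro OgermI[of "ball z0 r"]) auto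
qed

lemmas Ogerm_intros = Ogerm_const Ogerm_coord Ogerm_add Ogerm_mult Ogerm_uminus Ogerm_diff
  Ogerm_sum Ogerm_prod Ogerm_power Ogerm_det

lemma eventually_FD_cong:
  assumes "\<forall>\<^sub>F z in nhds z0. f z = g z"
  shows "\<forall>\<^sub>F z in nhds z0. FD f z = FD g z"
proof -
  obtain T where "open T" "z0 \<in> T" "\<forall>x\<in>T. f x = g x"
    using assms by (auto simp: eventually_nhds)
  then show ?thesis
    unfolding eventually_nhds by (intro exI[of _ T]) (auto intro: FD_cong)
qed

definition nz :: "complex^'n \<Rightarrow> (complex^'n \<Rightarrow> complex) \<Rightarrow> bool" where
  "nz z0 f \<longleftrightarrow> \<not> (\<forall>\<^sub>F z in nhds z0. f z = 0)"

text \<open>The local ring is an integral domain: on the nonempty open set where \<open>f\<close> is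
  nonzero, \<open>g\<close> must vanish, and the identity theorem makes \<open>g\<close> zero on the
  whole ball.\<close>

lemma nz_mult:
  assumes f: "f \<in> Ogerm z0" "nz z0 f" and g: "g \<in> Ogerm z0" "nz z0 g"
  shows "nz z0 (\<lambda>z. f z * g z)"
  unfolding nz_def
proof
  assume "\<forall>\<^sub>F z in nhds z0. f z * g z = 0"
  then obtain r1 where r1: "r1 > 0" "holo_on f (ball z0 r1)" "\<And>z. z \<in> ball z0 r1 \<Longrightarrow> f z * g z = 0"
    by (rule Ogerm_ballE[OF f(1)]) (rule that)
  obtain r where r: "r > 0" "holo_on g (ball z0 r)" "\<And>z. z \<in> ball z0 r \<Longrightarrow> dist z z0 < r1"
    by (rule Ogerm_ballE[OF g(1), of "\<lambda>z. dist z z0 < r1"])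
      (use r1(1) in \<open>auto simp: eventually_nhds_metric\<close>)
  have hf: "holo_on f (ball z0 r)" by (rule holo_on_subset[OF r1(2)]) (use r(3) in \<open>auto simp: dist_commute\<close>)
  define V where "V = {x \<in> ball z0 r. f x \<noteq> 0}"
  have "V \<noteq> {}"
  proof
    assume "V = {}"
    then have "\<forall>\<^sub>F z in nhds z0. f z = 0"
      unfolding V_def eventually_nhds using r(1) by (intro exI[of _ "ball z0 r"]) auto
    then show False using f(2) by (simp add: nz_def)
  qed
  moreover have "open V"
  proof -
    have "V = ball z0 r \<inter> f -` (- {0})" by (auto simp: V_def)
    then show ?thesis using continuous_open_preimage[OF holo_on_continuous[OF hf] open_ball, of "- {0}"] by auto
  qed
  ultimately have "g w = 0" if "w \<in> ball z0 r" for w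
    using holo_identity[OF r(2), of V w] that r1(3) r(3) by (force simp: V_def dist_commute)
  then have "\<forall>\<^sub>F z in nhds z0. g z = 0"
    unfolding eventually_nhds using r(1) by (intro exI[of _ "ball z0 r"]) auto
  then show False using g(2) by (simp add: nz_def)
qed

lemma nz_const: "c \<noteq> 0 \<Longrightarrow> nz z0 (\<lambda>z. c)"
  by (simp add: nz_def eventually_False)

lemma nz_value: "f z0 \<noteq> 0 \<Longrightarrow> nz z0 f"
  unfolding nz_def using eventually_nhds_x_imp_x by blast

lemma nz_prod: "finite I \<Longrightarrow> (\<And>i. i \<in> I \<Longrightarrow> f i \<in> Ogerm z0 \<and> nz z0 (f i)) \<Longrightarrow> nz z0 (\<lambda>z. \<Prod>i\<in>I. f i z)"
  by (induction I rule: finite_induct) (auto intro!: nz_const nz_mult Ogerm_intros)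

lemma nz_cong: "\<forall>\<^sub>F z in nhds z0. f z = g z \<Longrightarrow> nz z0 f \<Longrightarrow> nz z0 g"
  unfolding nz_def by (smt (verit) eventually_elim2)

text \<open>The means by which identities known only off \<open>D\<close>, or off some other zero
  set, become identities of germs: the difference is annihilated by \<open>q\<close> in an integral
  domain.\<close>

lemma germ_eq_off_zeros:
  assumes "q \<in> Ogerm z0" "nz z0 q" "f \<in> Ogerm z0" "g \<in> Ogerm z0"
    and "\<forall>\<^sub>F z in nhds z0. q z \<noteq> 0 \<longrightarrow> f z = g z"
  shows "\<forall>\<^sub>F z in nhds z0. f z = g z"
proof -
  have "\<forall>\<^sub>F z in nhds z0. q z * (f z - g z) = 0" using assms(5) by eventually_elim auto
  then have "\<not> nz z0 (\<lambda>z. f z - g z)"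
    using nz_mult[OF assms(1,2) Ogerm_diff[OF assms(3,4)]] by (auto simp: nz_def)
  then show ?thesis by (simp add: nz_def)
qed

lemma germ_cancel:
  assumes "q \<in> Ogerm z0" "nz z0 q" "f \<in> Ogerm z0" "g \<in> Ogerm z0"
    and "\<forall>\<^sub>F z in nhds z0. q z * f z = q z * g z"
  shows "\<forall>\<^sub>F z in nhds z0. f z = g z"
  by (rule germ_eq_off_zeros[OF assms(1-4)]) (rule eventually_mono[OF assms(5)], metis mult_left_cancel)

section \<open>Divisibility and prime elements in the local ring\<close>

definition gdvd :: "complex^'n \<Rightarrow> (complex^'n \<Rightarrow> complex) \<Rightarrow> (complex^'n \<Rightarrow> complex) \<Rightarrow> bool" where
  "gdvd z0 f a \<longleftrightarrow> (\<exists>b\<in>Ogerm z0. \<forall>\<^sub>F z in nhds z0. a z = f z * b z)"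

lemma gdvdI: "b \<in> Ogerm z0 \<Longrightarrow> \<forall>\<^sub>F z in nhds z0. a z = f z * b z \<Longrightarrow> gdvd z0 f a"
  by (auto simp: gdvd_def)

lemma gdvdE:
  assumes "gdvd z0 f a"
  obtains b where "b \<in> Ogerm z0" "\<forall>\<^sub>F z in nhds z0. a z = f z * b z"
  using assms by (auto simp: gdvd_def)

lemma gdvd_cong: "\<forall>\<^sub>F z in nhds z0. a z = b z \<Longrightarrow> gdvd z0 f a \<Longrightarrow> gdvd z0 f b"
  by (elim gdvdE, rule gdvdI, assumption) (auto elim: eventually_elim2)

lemma gdvd_mult_right: "a \<in> Ogerm z0 \<Longrightarrow> gdvd z0 f (\<lambda>z. f z * a z)"
  by (rule gdvdI) auto

lemma gdvd_diff:
  assumes "gdvd z0 f a" "gdvd z0 f b" shows "gdvd z0 f (\<lambda>z. a z - b z)"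
proof -
  obtain a' where a': "a' \<in> Ogerm z0" "\<forall>\<^sub>F z in nhds z0. a z = f z * a' z" using assms(1) by (rule gdvdE)
  obtain b' where b': "b' \<in> Ogerm z0" "\<forall>\<^sub>F z in nhds z0. b z = f z * b' z" using assms(2) by (rule gdvdE)
  show ?thesis
    by (rule gdvdI[OF Ogerm_diff[OF a'(1) b'(1)]])
      (use a'(2) b'(2) in \<open>eventually_elim, simp add: algebra_simps\<close>)
qed

lemma not_gdvd_nz: "\<not> gdvd z0 f g \<Longrightarrow> nz z0 g"
  unfolding nz_def by (auto elim: notE intro!: gdvdI[OF Ogerm_const[of 0]])

text \<open>A prime element of the local ring; \<open>f z0 = 0\<close> says that it is not a
  unit.\<close>

definition prime_germ :: "complex^'n \<Rightarrow> (complex^'n \<Rightarrow> complex) \<Rightarrow> bool" where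
  "prime_germ z0 f \<longleftrightarrow> f \<in> Ogerm z0 \<and> nz z0 f \<and> f z0 = 0 \<and>
     (\<forall>a\<in>Ogerm z0. \<forall>b\<in>Ogerm z0. gdvd z0 f (\<lambda>z. a z * b z) \<longrightarrow> gdvd z0 f a \<or> gdvd z0 f b)"

lemma prime_germD:
  assumes "prime_germ z0 f"
  shows "f \<in> Ogerm z0" "nz z0 f" "f z0 = 0"
    and "a \<in> Ogerm z0 \<Longrightarrow> b \<in> Ogerm z0 \<Longrightarrow> gdvd z0 f (\<lambda>z. a z * b z) \<Longrightarrow> gdvd z0 f a \<or> gdvd z0 f b"
  using assms by (auto simp: prime_germ_def)

lemma not_gdvd_unit: "f z0 = 0 \<Longrightarrow> u z0 \<noteq> 0 \<Longrightarrow> \<not> gdvd z0 f u"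
  by (auto simp: gdvd_def dest: eventually_nhds_x_imp_x)

lemma prime_not_gdvd_mult:
  "prime_germ z0 f \<Longrightarrow> a \<in> Ogerm z0 \<Longrightarrow> b \<in> Ogerm z0 \<Longrightarrow> \<not> gdvd z0 f a \<Longrightarrow> \<not> gdvd z0 f b
     \<Longrightarrow> \<not> gdvd z0 f (\<lambda>z. a z * b z)"
  using prime_germD(4) by blast

lemma prime_not_gdvd_prod:
  assumes "prime_germ z0 f" "finite I" "\<And>i. i \<in> I \<Longrightarrow> a i \<in> Ogerm z0 \<and> \<not> gdvd z0 f (a i)"
  shows "\<not> gdvd z0 f (\<lambda>z. \<Prod>i\<in>I. a i z)"
  using assms(2,3)
proof (induction I rule: finite_induct)
  case empty
  then show ?case using not_gdvd_unit[of f z0 "\<lambda>_. 1"] prime_germD(3)[OF assms(1)] by simp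
next
  case (insert x F)
  have "\<not> gdvd z0 f (\<lambda>z. a x z * (\<Prod>i\<in>F. a i z))"
    by (intro prime_not_gdvd_mult[OF assms(1)] Ogerm_prod) (use insert in simp_all)
  then show ?case using insert by simp
qed

lemma prime_not_gdvd_power:
  assumes "prime_germ z0 f" "a \<in> Ogerm z0" "\<not> gdvd z0 f a"
  shows "\<not> gdvd z0 f (\<lambda>z. a z ^ k)"
  using prime_not_gdvd_prod[OF assms(1), of "{..<k}" "\<lambda>_. a"] assms by simp

text \<open>Each step uses primality to extract one factor \<open>f\<close> from \<open>v\<close>
  and cancels it from both sides, which is possible in an integral domain.\<close>

lemma prime_power_cancel:
  assumes p: "prime_germ z0 f" and g: "g \<in> Ogerm z0" "\<not> gdvd z0 f g"
  shows "v \<in> Ogerm z0 \<Longrightarrow> gdvd z0 (\<lambda>z. f z ^ M) (\<lambda>z. g z * v z) \<Longrightarrow> gdvd z0 (\<lambda>z. f z ^ M) v"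
proof (induction M arbitrary: v)
  case 0
  then show ?case by (intro gdvdI[of v]) auto
next
  case (Suc M)
  obtain w where w: "w \<in> Ogerm z0" "\<forall>\<^sub>F z in nhds z0. g z * v z = f z ^ Suc M * w z"
    using Suc.prems(2) by (rule gdvdE)
  note f = prime_germD[OF p]
  have "gdvd z0 f (\<lambda>z. g z * v z)"
    by (rule gdvdI[of "\<lambda>z. f z ^ M * w z"]) (use w f in \<open>auto intro!: Ogerm_intros simp: mult.assoc\<close>)
  then have "gdvd z0 f v" using f(4)[OF g(1) Suc.prems(1)] g(2) by blast
  then obtain v' where v': "v' \<in> Ogerm z0" "\<forall>\<^sub>F z in nhds z0. v z = f z * v' z" by (rule gdvdE)
  have "\<forall>\<^sub>F z in nhds z0. f z * (g z * v' z) = f z * (f z ^ M * w z)"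
    using w(2) v'(2) by eventually_elim (simp add: algebra_simps)
  then have "\<forall>\<^sub>F z in nhds z0. g z * v' z = f z ^ M * w z"
    by (rule germ_cancel[OF f(1,2) Ogerm_mult[OF g(1) v'(1)] Ogerm_mult[OF Ogerm_power[OF f(1)] w(1)]])
  then have "gdvd z0 (\<lambda>z. f z ^ M) (\<lambda>z. g z * v' z)" using w(1) by (intro gdvdI) auto
  from Suc.IH[OF v'(1) this] obtain w' where w': "w' \<in> Ogerm z0" "\<forall>\<^sub>F z in nhds z0. v' z = f z ^ M * w' z"
    by (rule gdvdE)
  show ?case by (rule gdvdI[OF w'(1)]) (use v'(2) w'(2) in \<open>eventually_elim, simp\<close>)
qed

text \<open>If every partial derivative is a multiple of \<open>f\<close>, then along each ray from
  \<open>z0\<close> the function \<open>f\<close> solves a homogeneous linear differential equation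
  with initial value 0. So a prime \<open>f\<close> has a partial derivative that it does not
  divide, which is the generic smoothness of its zero set.\<close>

lemma all_partials_divisible_imp_zero:
  fixes f :: "complex^'n \<Rightarrow> complex"
  assumes f: "f \<in> Ogerm z0" "f z0 = 0" and d: "\<And>i. gdvd z0 f (\<lambda>z. FD f z (axis i 1))"
  shows "\<not> nz z0 f"
proof -
  have "\<forall>i. \<exists>b. b \<in> Ogerm z0 \<and> (\<forall>\<^sub>F z in nhds z0. FD f z (axis i 1) = f z * b z)"
    using d unfolding gdvd_def by blast
  from choice[OF this] obtain b where b': "\<forall>i. b i \<in> Ogerm z0 \<and> (\<forall>\<^sub>F z in nhds z0. FD f z (axis i 1) = f z * b i z)"
    by (elim exE)
  have b: "b i \<in> Ogerm z0" "\<forall>\<^sub>F z in nhds z0. FD f z (axis i 1) = f z * b i z" for i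
    using b' by simp_all
  define B where "B i = cmod (b i z0) + 1" for i
  have bB: "\<forall>\<^sub>F z in nhds z0. cmod (b i z) < B i" for i
  proof -
    have "(b i \<longlongrightarrow> b i z0) (nhds z0)"
      using Ogerm_isCont[OF b(1)] by (simp add: tendsto_at_iff_tendsto_nhds isCont_def)
    then have "((\<lambda>z. cmod (b i z)) \<longlongrightarrow> cmod (b i z0)) (nhds z0)" by (rule tendsto_norm)
    then show ?thesis by (rule order_tendstoD) (simp add: B_def)
  qed
  have "\<forall>\<^sub>F z in nhds z0. \<forall>i. FD f z (axis i 1) = f z * b i z \<and> cmod (b i z) < B i"
    by (intro eventually_all_finite eventually_conj b bB)
  then obtain r where r: "r > 0" "holo_on f (ball z0 r)"
      "\<And>z. z \<in> ball z0 r \<Longrightarrow> \<forall>i. FD f z (axis i 1) = f z * b i z \<and> cmod (b i z) < B i"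
    by (rule Ogerm_ballE[OF f(1)]) (rule that)
  have "f x = 0" if x: "x \<in> ball z0 r" for x
  proof -
    define v where "v = x - z0"
    have inb: "z0 + t *\<^sub>R v \<in> ball z0 r" if "t \<in> {0..1}" for t
    proof -
      have "\<bar>t\<bar> * norm v \<le> 1 * norm v" using that by (intro mult_right_mono) auto
      then show ?thesis using x by (simp add: v_def dist_norm norm_minus_commute)
    qed
    have "f (z0 + 1 *\<^sub>R v) = 0"
    proof (rule linear_ode_zero[where \<delta>="\<lambda>t. f (z0 + t *\<^sub>R v)" and a=0 and b=1
          and \<delta>'="\<lambda>t. FD f (z0 + t *\<^sub>R v) v" and L="\<Sum>i\<in>UNIV. cmod (v $ i) * B i" and ?t1.0=0])
      fix t :: real assume t: "t \<in> {0..1}"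
      have hd: "(f has_derivative FD f (z0 + t *\<^sub>R v)) (at (z0 + t *\<^sub>R v))"
        by (rule holo_onD(1)[OF r(2) inb[OF t]])
      have "((\<lambda>t. z0 + t *\<^sub>R v) has_derivative (\<lambda>s. s *\<^sub>R v)) (at t within {0..1})"
        by (auto intro!: derivative_eq_intros)
      from has_derivative_compose[OF this hd]
      show "((\<lambda>t. f (z0 + t *\<^sub>R v)) has_vector_derivative FD f (z0 + t *\<^sub>R v) v) (at t within {0..1})"
        unfolding has_vector_derivative_def
        using linear_scale[OF has_derivative_linear[OF hd]] by simp
      have "FD f (z0 + t *\<^sub>R v) v = (\<Sum>i\<in>UNIV. v $ i * (f (z0 + t *\<^sub>R v) * b i (z0 + t *\<^sub>R v)))"
        using r(3)[OF inb[OF t]] by (simp add: FD_expand[OF r(2) inb[OF t], of v])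
      also have "cmod \<dots> \<le> (\<Sum>i\<in>UNIV. cmod (v $ i) * (cmod (f (z0 + t *\<^sub>R v)) * B i))"
        by (rule sum_norm_le) (use r(3)[OF inb[OF t]] in \<open>simp add: norm_mult mult_left_mono less_imp_le\<close>)
      finally show "cmod (FD f (z0 + t *\<^sub>R v) v) \<le> (\<Sum>i\<in>UNIV. cmod (v $ i) * B i) * cmod (f (z0 + t *\<^sub>R v))"
        by (simp add: sum_distrib_right sum_distrib_left algebra_simps)
    qed (use f in auto)
    then show ?thesis by (simp add: v_def)
  qed
  then show ?thesis
    unfolding nz_def eventually_nhds using r(1) by (auto intro!: exI[of _ "ball z0 r"])
qed

text \<open>The local situation with the manifold removed: a reduced equation factored into a unit
  and primes, none of which divides another. \<open>reduced_germ_chart\<close> produces it from the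
  components of \<open>D\<close>.\<close>

locale reduced_germ =
  fixes z0 :: "complex^'n" and fs :: "(complex^'n \<Rightarrow> complex) list"
    and u h :: "complex^'n \<Rightarrow> complex"
  assumes fs_prime: "k < length fs \<Longrightarrow> prime_germ z0 (fs ! k)"
    and fs_indep: "k < length fs \<Longrightarrow> j < length fs \<Longrightarrow> k \<noteq> j \<Longrightarrow> \<not> gdvd z0 (fs ! k) (fs ! j)"
    and u: "u \<in> Ogerm z0" "u z0 \<noteq> 0"
    and h_eq: "\<forall>\<^sub>F z in nhds z0. h z = u z * (\<Prod>k<length fs. (fs ! k) z)"
begin

lemma fsO: "k < length fs \<Longrightarrow> fs ! k \<in> Ogerm z0"
  using fs_prime prime_germD by blast

lemma fs_nz: "k < length fs \<Longrightarrow> nz z0 (fs ! k)"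
  using fs_prime prime_germD by blast

lemma prod_fsO: "(\<lambda>z. \<Prod>k<length fs. (fs ! k) z) \<in> Ogerm z0"
  by (intro Ogerm_prod fsO) simp

lemma h_eq': "\<forall>\<^sub>F z in nhds z0. u z * (\<Prod>k<length fs. (fs ! k) z) = h z"
  using h_eq by eventually_elim simp

lemma hO: "h \<in> Ogerm z0"
  by (rule Ogerm_cong[OF Ogerm_mult[OF u(1) prod_fsO] h_eq'])

lemma h_nz: "nz z0 h"
proof -
  have "nz z0 (\<lambda>z. \<Prod>k<length fs. (fs ! k) z)"
    by (rule nz_prod) (simp_all add: fsO fs_nz)
  from nz_cong[OF h_eq' nz_mult[OF u(1) nz_value[of u, OF u(2)] prod_fsO this]]
  show ?thesis .
qed

text \<open>The quotient of \<open>h\<close> by \<open>fs ! k\<close>, as a germ.\<close>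

definition cof :: "nat \<Rightarrow> complex^'n \<Rightarrow> complex" where
  "cof k z = u z * (\<Prod>j\<in>{..<length fs}-{k}. (fs ! j) z)"

lemma cofO: "cof k \<in> Ogerm z0"
  unfolding cof_def by (intro Ogerm_intros u fsO) auto

lemma h_cof:
  assumes "k < length fs" shows "\<forall>\<^sub>F z in nhds z0. h z = (fs ! k) z * cof k z"
  using h_eq by eventually_elim (use assms in \<open>simp add: cof_def prod.remove[of _ k]\<close>)

lemma not_gdvd_cof: "k < length fs \<Longrightarrow> \<not> gdvd z0 (fs ! k) (cof k)"
  unfolding cof_def
  by (intro prime_not_gdvd_mult prime_not_gdvd_prod fs_prime u not_gdvd_unit Ogerm_intros fsO conjI fs_indep
    prime_germD(3)[OF fs_prime]) auto

text \<open>Modulo \<open>fs ! k\<close>, a partial derivative of \<open>h = fs ! k * cof k\<close>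
  is \<open>cof k\<close> times that of \<open>fs ! k\<close>. The prime does not divide the
  cofactor, so divisibility of all partials of \<open>h\<close> would pass to those of
  \<open>fs ! k\<close>, which is impossible for a nonzero germ vanishing at
  \<open>z0\<close>.\<close>

lemma exists_partial_not_gdvd:
  assumes k: "k < length fs"
  shows "\<exists>i. \<not> gdvd z0 (fs ! k) (\<lambda>z. FD h z (axis i 1))"
proof (rule ccontr)
  let ?f = "fs ! k"
  assume "\<not> ?thesis"
  then have d: "gdvd z0 ?f (\<lambda>z. FD h z (axis i 1))" for i by blast
  have "gdvd z0 ?f (\<lambda>z. FD ?f z (axis i 1))" for i
  proof -
    have "\<forall>\<^sub>F z in nhds z0. FD h z (axis i 1) - ?f z * FD (cof k) z (axis i 1) = cof k z * FD ?f z (axis i 1)"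
      using eventually_FD_cong[OF h_cof[OF k]] Ogerm_eventually_holo[OF cofO[of k]]
        Ogerm_eventually_holo[OF fsO[OF k]]
    proof eventually_elim
      case (elim z)
      have "FD (\<lambda>z. ?f z * cof k z) z (axis i 1) = ?f z * FD (cof k) z (axis i 1) + FD ?f z (axis i 1) * cof k z"
        by (rule FD_eq[OF has_derivative_mult]) (use elim holo_onD(1) in blast)+
      then show ?case using elim by simp
    qed
    moreover have "gdvd z0 ?f (\<lambda>z. FD h z (axis i 1) - ?f z * FD (cof k) z (axis i 1))"
      by (intro gdvd_diff d gdvd_mult_right Ogerm_FD cofO)
    ultimately have "gdvd z0 ?f (\<lambda>z. cof k z * FD ?f z (axis i 1))" by (rule gdvd_cong)
    then show ?thesis
      using prime_germD(4)[OF fs_prime[OF k] cofO Ogerm_FD[OF fsO[OF k]]] not_gdvd_cof[OF k] by blast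
  qed
  then show False
    using all_partials_divisible_imp_zero[OF fsO[OF k] prime_germD(3)[OF fs_prime[OF k]]] fs_nz[OF k] by blast
qed

text \<open>\<open>reg k\<close> describes the local ring at the generic point of the \<open>k\<close>-th component, inside the
  functions that are only defined off a proper analytic subset.\<close>

definition reg :: "nat \<Rightarrow> (complex^'n \<Rightarrow> complex) \<Rightarrow> bool" where
  "reg k F \<longleftrightarrow> (\<exists>g\<in>Ogerm z0. \<exists>v\<in>Ogerm z0. \<exists>q\<in>Ogerm z0. nz z0 q \<and> \<not> gdvd z0 (fs ! k) g \<and>
     (\<forall>\<^sub>F z in nhds z0. q z \<noteq> 0 \<longrightarrow> g z * F z = v z))"

lemma regI:
  assumes "g \<in> Ogerm z0" "v \<in> Ogerm z0" "q \<in> Ogerm z0" "nz z0 q" "\<not> gdvd z0 (fs ! k) g"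
    "\<forall>\<^sub>F z in nhds z0. q z \<noteq> 0 \<longrightarrow> g z * F z = v z"
  shows "reg k F"
  unfolding reg_def using assms by blast

lemma regE:
  assumes "reg k F"
  obtains g v q where "g \<in> Ogerm z0" "v \<in> Ogerm z0" "q \<in> Ogerm z0" "nz z0 q" "\<not> gdvd z0 (fs ! k) g"
    "\<forall>\<^sub>F z in nhds z0. q z \<noteq> 0 \<longrightarrow> g z * F z = v z"
  using assms unfolding reg_def by blast

lemma reg_germ:
  assumes "k < length fs" "F \<in> Ogerm z0" shows "reg k F"
  by (rule regI[of "\<lambda>_. 1" F "\<lambda>_. 1"])
    (use assms prime_germD(3)[OF fs_prime] not_gdvd_unit[of "fs ! k" z0 "\<lambda>_. 1"] in \<open>auto intro!: Ogerm_intros nz_const\<close>)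

lemma reg_inverse:
  assumes "a \<in> Ogerm z0" "\<not> gdvd z0 (fs ! k) a"
  shows "reg k (\<lambda>z. inverse (a z))"
  by (rule regI[of a "\<lambda>_. 1" a]) (use assms not_gdvd_nz in \<open>auto intro!: Ogerm_intros\<close>)

lemma reg_mult:
  assumes k: "k < length fs" and F: "reg k F" and G: "reg k G"
  shows "reg k (\<lambda>z. F z * G z)"
proof -
  obtain g1 v1 q1 where 1: "g1 \<in> Ogerm z0" "v1 \<in> Ogerm z0" "q1 \<in> Ogerm z0" "nz z0 q1" "\<not> gdvd z0 (fs ! k) g1"
    "\<forall>\<^sub>F z in nhds z0. q1 z \<noteq> 0 \<longrightarrow> g1 z * F z = v1 z" using F by (rule regE)
  obtain g2 v2 q2 where 2: "g2 \<in> Ogerm z0" "v2 \<in> Ogerm z0" "q2 \<in> Ogerm z0" "nz z0 q2" "\<not> gdvd z0 (fs ! k) g2"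
    "\<forall>\<^sub>F z in nhds z0. q2 z \<noteq> 0 \<longrightarrow> g2 z * G z = v2 z" using G by (rule regE)
  show ?thesis
  proof (rule regI[of "\<lambda>z. g1 z * g2 z" "\<lambda>z. v1 z * v2 z" "\<lambda>z. q1 z * q2 z"])
    show "\<forall>\<^sub>F z in nhds z0. q1 z * q2 z \<noteq> 0 \<longrightarrow> g1 z * g2 z * (F z * G z) = v1 z * v2 z"
      using 1(6) 2(6) by eventually_elim (auto simp: algebra_simps)
    show "\<not> gdvd z0 (fs ! k) (\<lambda>z. g1 z * g2 z)" by (intro prime_not_gdvd_mult fs_prime 1 2 k)
  qed (use 1 2 k in \<open>auto intro!: Ogerm_intros nz_mult\<close>)
qed

lemma reg_add:
  assumes k: "k < length fs" and F: "reg k F" and G: "reg k G"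
  shows "reg k (\<lambda>z. F z + G z)"
proof -
  obtain g1 v1 q1 where 1: "g1 \<in> Ogerm z0" "v1 \<in> Ogerm z0" "q1 \<in> Ogerm z0" "nz z0 q1" "\<not> gdvd z0 (fs ! k) g1"
    "\<forall>\<^sub>F z in nhds z0. q1 z \<noteq> 0 \<longrightarrow> g1 z * F z = v1 z" using F by (rule regE)
  obtain g2 v2 q2 where 2: "g2 \<in> Ogerm z0" "v2 \<in> Ogerm z0" "q2 \<in> Ogerm z0" "nz z0 q2" "\<not> gdvd z0 (fs ! k) g2"
    "\<forall>\<^sub>F z in nhds z0. q2 z \<noteq> 0 \<longrightarrow> g2 z * G z = v2 z" using G by (rule regE)
  show ?thesis
  proof (rule regI[of "\<lambda>z. g1 z * g2 z" "\<lambda>z. g2 z * v1 z + g1 z * v2 z" "\<lambda>z. q1 z * q2 z"])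
    show "\<forall>\<^sub>F z in nhds z0. q1 z * q2 z \<noteq> 0 \<longrightarrow> g1 z * g2 z * (F z + G z) = g2 z * v1 z + g1 z * v2 z"
      using 1(6) 2(6) by eventually_elim (auto simp: algebra_simps)
    show "\<not> gdvd z0 (fs ! k) (\<lambda>z. g1 z * g2 z)" by (intro prime_not_gdvd_mult fs_prime 1 2 k)
  qed (use 1 2 k in \<open>auto intro!: Ogerm_intros nz_mult\<close>)
qed

lemma reg_sum: "k < length fs \<Longrightarrow> (\<And>i. i \<in> I \<Longrightarrow> reg k (F i)) \<Longrightarrow> reg k (\<lambda>z. \<Sum>i\<in>I. F i z)"
  by (induction I rule: infinite_finite_induct) (auto intro: reg_germ reg_add Ogerm_const)

lemma reg_prod: "k < length fs \<Longrightarrow> (\<And>i. i \<in> I \<Longrightarrow> reg k (F i)) \<Longrightarrow> reg k (\<lambda>z. \<Prod>i\<in>I. F i z)"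
  by (induction I rule: infinite_finite_induct) (auto intro: reg_germ reg_mult Ogerm_const)

lemma reg_uminus: "k < length fs \<Longrightarrow> reg k F \<Longrightarrow> reg k (\<lambda>z. - F z)"
  using reg_mult[OF _ reg_germ[OF _ Ogerm_const[of "-1"]]] by simp

lemma reg_diff: "k < length fs \<Longrightarrow> reg k F \<Longrightarrow> reg k G \<Longrightarrow> reg k (\<lambda>z. F z - G z)"
  using reg_add[OF _ _ reg_uminus] by simp

lemma reg_det:
  "k < length fs \<Longrightarrow> (\<And>i j. reg k (\<lambda>z. M z $ i $ j)) \<Longrightarrow> reg k (\<lambda>z. det (M z))"
  unfolding det_def by (intro reg_sum reg_mult reg_prod) (auto intro: reg_germ Ogerm_const)

lemma reg_cong:
  assumes F: "reg k F" and q: "q \<in> Ogerm z0" "nz z0 q" "\<forall>\<^sub>F z in nhds z0. q z \<noteq> 0 \<longrightarrow> F z = G z"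
  shows "reg k G"
proof -
  obtain g1 v1 q1 where 1: "g1 \<in> Ogerm z0" "v1 \<in> Ogerm z0" "q1 \<in> Ogerm z0" "nz z0 q1" "\<not> gdvd z0 (fs ! k) g1"
    "\<forall>\<^sub>F z in nhds z0. q1 z \<noteq> 0 \<longrightarrow> g1 z * F z = v1 z" using F by (rule regE)
  show ?thesis
  proof (rule regI[of g1 v1 "\<lambda>z. q1 z * q z"])
    show "\<forall>\<^sub>F z in nhds z0. q1 z * q z \<noteq> 0 \<longrightarrow> g1 z * G z = v1 z"
      using 1(6) q(3) by eventually_elim auto
  qed (use 1 q in \<open>auto intro!: Ogerm_intros nz_mult\<close>)
qed

text \<open>Poles of arbitrary order along \<open>D\<close>; as in \<open>reg\<close>, the function
  is only looked at off the zeros of some nonzero germ \<open>q\<close>.\<close>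

definition mero :: "(complex^'n \<Rightarrow> complex) \<Rightarrow> bool" where
  "mero F \<longleftrightarrow> (\<exists>M. \<exists>v\<in>Ogerm z0. \<exists>q\<in>Ogerm z0. nz z0 q \<and> (\<forall>\<^sub>F z in nhds z0. q z \<noteq> 0 \<longrightarrow> h z ^ M * F z = v z))"

lemma meroI: "v \<in> Ogerm z0 \<Longrightarrow> q \<in> Ogerm z0 \<Longrightarrow> nz z0 q \<Longrightarrow>
   \<forall>\<^sub>F z in nhds z0. q z \<noteq> 0 \<longrightarrow> h z ^ M * F z = v z \<Longrightarrow> mero F"
  unfolding mero_def by blast

text \<open>The prime \<open>fs ! K\<close> does not divide the product of the earlier powers, so
  its own power can be split off from the remaining quotient \<open>v'\<close>.\<close>

lemma gdvd_prod_powers: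
  assumes v: "v \<in> Ogerm z0" and d: "\<And>k. k < length fs \<Longrightarrow> gdvd z0 (\<lambda>z. (fs ! k) z ^ M) v"
  shows "K \<le> length fs \<Longrightarrow> gdvd z0 (\<lambda>z. \<Prod>k<K. (fs ! k) z ^ M) v"
proof (induction K)
  case 0
  then show ?case using v by (intro gdvdI[of v]) auto
next
  case (Suc K)
  then obtain v' where v': "v' \<in> Ogerm z0" "\<forall>\<^sub>F z in nhds z0. v z = (\<Prod>k<K. (fs ! k) z ^ M) * v' z"
    by (auto elim: gdvdE)
  have "gdvd z0 (\<lambda>z. (fs ! K) z ^ M) v'"
  proof (rule prime_power_cancel)
    show "prime_germ z0 (fs ! K)" using Suc by (intro fs_prime) simp
    show "(\<lambda>z. \<Prod>k<K. (fs ! k) z ^ M) \<in> Ogerm z0" using Suc by (intro Ogerm_intros fsO) auto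
    show "\<not> gdvd z0 (fs ! K) (\<lambda>z. \<Prod>k<K. (fs ! k) z ^ M)"
      by (intro prime_not_gdvd_prod prime_not_gdvd_power fs_prime fsO fs_indep Ogerm_intros conjI)
        (use Suc.prems in auto)
    show "gdvd z0 (\<lambda>z. (fs ! K) z ^ M) (\<lambda>z. (\<Prod>k<K. (fs ! k) z ^ M) * v' z)"
      using gdvd_cong[OF v'(2) d[of K]] Suc.prems by simp
  qed (rule v')
  then obtain w where w: "w \<in> Ogerm z0" "\<forall>\<^sub>F z in nhds z0. v' z = (fs ! K) z ^ M * w z" by (rule gdvdE)
  show ?case by (rule gdvdI[OF w(1)]) (use v'(2) w(2) in \<open>eventually_elim, simp\<close>)
qed

text \<open>Write \<open>F = v / h^M\<close>. At the \<open>k\<close>-th component \<open>F\<close>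
  also has a denominator \<open>g1\<close> that \<open>fs ! k\<close> does not divide; comparing the
  two shows that \<open>(fs ! k)^M\<close> divides \<open>g1 * v\<close>, hence \<open>v\<close>.
  Together the prime powers cancel \<open>h^M\<close> up to the unit \<open>u^M\<close>.\<close>

lemma reg_mero_holo:
  assumes F: "mero F" "\<And>k. k < length fs \<Longrightarrow> reg k F"
  shows "\<exists>v\<in>Ogerm z0. \<exists>q\<in>Ogerm z0. nz z0 q \<and> (\<forall>\<^sub>F z in nhds z0. q z \<noteq> 0 \<longrightarrow> F z = v z)"
proof -
  obtain M v q where v: "v \<in> Ogerm z0" "q \<in> Ogerm z0" "nz z0 q" "\<forall>\<^sub>F z in nhds z0. q z \<noteq> 0 \<longrightarrow> h z ^ M * F z = v z"
    using F(1) unfolding mero_def by blast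
  have "gdvd z0 (\<lambda>z. (fs ! k) z ^ M) v" if k: "k < length fs" for k
  proof -
    obtain g1 v1 q1 where 1: "g1 \<in> Ogerm z0" "v1 \<in> Ogerm z0" "q1 \<in> Ogerm z0" "nz z0 q1" "\<not> gdvd z0 (fs ! k) g1"
      "\<forall>\<^sub>F z in nhds z0. q1 z \<noteq> 0 \<longrightarrow> g1 z * F z = v1 z" using F(2)[OF k] by (rule regE)
    have "\<forall>\<^sub>F z in nhds z0. q z * q1 z \<noteq> 0 \<longrightarrow> g1 z * v z = (fs ! k) z ^ M * (cof k z ^ M * v1 z)"
      using 1(6) v(4) h_cof[OF k]
    proof eventually_elim
      case (elim z)
      show ?case
      proof
        assume "q z * q1 z \<noteq> 0"
        then have "g1 z * v z = h z ^ M * v1 z" using elim by (metis mult.left_commute mult_eq_0_iff)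
        then show "g1 z * v z = (fs ! k) z ^ M * (cof k z ^ M * v1 z)" using elim by (simp add: power_mult_distrib)
      qed
    qed
    then have "\<forall>\<^sub>F z in nhds z0. g1 z * v z = (fs ! k) z ^ M * (cof k z ^ M * v1 z)"
      by (rule germ_eq_off_zeros[rotated 4])
        (use 1 v in \<open>auto intro!: Ogerm_intros nz_mult fsO[OF k] cofO\<close>)
    then have "gdvd z0 (\<lambda>z. (fs ! k) z ^ M) (\<lambda>z. g1 z * v z)"
      by (rule gdvdI[rotated]) (use 1 in \<open>auto intro!: Ogerm_intros cofO\<close>)
    then show ?thesis by (rule prime_power_cancel[OF fs_prime[OF k] 1(1,5) v(1)])
  qed
  from gdvd_prod_powers[OF v(1) this le_refl] obtain w where
    w: "w \<in> Ogerm z0" "\<forall>\<^sub>F z in nhds z0. v z = (\<Prod>k<length fs. (fs ! k) z ^ M) * w z"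
    by (auto elim: gdvdE)
  define w' where "w' z = inverse (u z) ^ M * w z" for z
  have "w' \<in> Ogerm z0" unfolding w'_def by (intro Ogerm_intros Ogerm_inverse u w)
  moreover have "\<forall>\<^sub>F z in nhds z0. q z * h z \<noteq> 0 \<longrightarrow> F z = w' z"
    using v(4) w(2) h_eq Ogerm_nonzero_near[OF u]
  proof eventually_elim
    case (elim z)
    show ?case
    proof
      assume "q z * h z \<noteq> 0"
      then have "h z ^ M * F z = v z" using elim by simp
      also have "\<dots> = h z ^ M * w' z"
        using elim by (simp add: w'_def power_mult_distrib prod_power_distrib power_inverse)
      finally show "F z = w' z" using \<open>q z * h z \<noteq> 0\<close> by simp
    qed
  qed
  ultimately show ?thesis
    using v(2,3) by (intro bexI[of _ w'] bexI[of _ "\<lambda>z. q z * h z"] conjI nz_mult hO h_nz Ogerm_intros) auto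
qed

end

section \<open>Determinants of logarithmic two-forms\<close>

text \<open>The matrices whose determinants are the numerators in Cramer's rule for
  \<open>M *v x = b\<close>.\<close>

definition colrep :: "complex^'n^'n \<Rightarrow> 'n \<Rightarrow> complex^'n \<Rightarrow> complex^'n^'n" where
  "colrep M l b = (\<chi> r s. if s = l then b $ r else M $ r $ s)"

lemma det_scale_rows: "det (\<chi> i j. c * (M::complex^'n^'n) $ i $ j) = c ^ CARD('n) * det M"
proof -
  have "(\<chi> i j. c * M $ i $ j) = (\<chi> i. c *s M $ i)" by (simp add: vec_eq_iff)
  then show ?thesis using det_rows_mul[of "\<lambda>_. c" "\<lambda>i. M $ i"] by simp
qed

lemma colrep_scale: "colrep (\<chi> i j. c * (M::complex^'n^'n) $ i $ j) l (c *s b) = (\<chi> i j. c * colrep M l b $ i $ j)"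
  by (simp add: colrep_def vec_eq_iff)

lemma det_row_identity:
  fixes r :: "complex^'n"
  shows "det (\<chi> a j. if a = i then r $ j else if a = j then 1 else 0) = r $ i"
proof -
  have "(\<chi> a j. if a = i then r $ j else if a = j then 1 else 0) =
    (\<chi> a. if a = i then sum (\<lambda>j. r $ j *s row j (mat 1)) UNIV else row a (mat 1))"
    by (simp add: vec_eq_iff row_def mat_def if_distrib cong: if_cong)
  then show ?thesis using cramer_lemma_transpose[of i r "mat 1"] by simp
qed

section \<open>Logarithmic frames and regularity at generic points\<close>

context reduced_germ
begin

definition hd :: "'n \<Rightarrow> complex^'n \<Rightarrow> complex" where
  "hd i z = FD h z (axis i 1)"

lemma hdO: "hd i \<in> Ogerm z0"
  unfolding hd_def by (rule Ogerm_FD[OF hO])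

text \<open>The \<open>i\<close>-th column \<open>E\<^sub>i\<close> satisfies \<open>E\<^sub>i h = h\<close>, the other columns satisfy \<open>E\<^sub>j h = 0\<close>: where
  \<open>\<partial>\<^sub>i h\<close> is a unit they are a frame of the logarithmic vector fields.\<close>

definition frame :: "'n \<Rightarrow> complex^'n \<Rightarrow> complex^'n^'n" where
  "frame i z = (\<chi> a j. if a = i then (if j = i then h z else - hd j z) * inverse (hd i z)
     else if a = j then 1 else 0)"

lemma det_frame: "det (frame i z) = h z * inverse (hd i z)"
proof -
  define r where "r = (\<chi> j. (if j = i then h z else - hd j z) * inverse (hd i z))"
  have "frame i z = (\<chi> a j. if a = i then r $ j else if a = j then 1 else 0)"
    by (simp add: frame_def r_def vec_eq_iff)
  then show ?thesis by (simp add: det_row_identity) (simp add: r_def)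
qed

text \<open>Evaluates covectors, and later the rows and columns of a 2-form, on the
  \<open>j\<close>-th frame vector.\<close>

lemma sum_frame:
  "(\<Sum>a\<in>UNIV. frame i z $ a $ j * x $ a) =
     (if j = i then h z * inverse (hd i z) * x $ i else x $ j - hd j z * inverse (hd i z) * x $ i)"
proof -
  have "(\<Sum>a\<in>UNIV. frame i z $ a $ j * x $ a) = frame i z $ i $ j * x $ i + (\<Sum>a\<in>UNIV-{i}. frame i z $ a $ j * x $ a)"
    by (rule sum.remove) auto
  also have "(\<Sum>a\<in>UNIV-{i}. frame i z $ a $ j * x $ a) = (\<Sum>a\<in>UNIV-{i}. if a = j then x $ a else 0)"
    by (rule sum.cong) (auto simp: frame_def)
  also have "\<dots> = (if j = i then 0 else x $ j)" by (simp add: sum.delta)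
  finally show ?thesis by (auto simp: frame_def)
qed

lemma reg_frame:
  assumes "k < length fs" "\<not> gdvd z0 (fs ! k) (hd i)"
  shows "reg k (\<lambda>z. frame i z $ a $ j)"
proof (cases "a = i")
  case True
  have "(\<lambda>z. if j = i then h z else - hd j z) \<in> Ogerm z0"
    using hO hdO Ogerm_uminus by (cases "j = i") auto
  then have "reg k (\<lambda>z. (if j = i then h z else - hd j z) * inverse (hd i z))"
    by (intro reg_mult reg_germ reg_inverse hdO assms)
  then show ?thesis using True by (simp add: frame_def)
next
  case False
  then show ?thesis using assms by (auto simp: frame_def intro!: reg_germ Ogerm_const)
qed

definition ext_off :: "(complex^'n \<Rightarrow> complex) \<Rightarrow> bool" where
  "ext_off F \<longleftrightarrow> (\<exists>v\<in>Ogerm z0. \<forall>\<^sub>F z in nhds z0. h z \<noteq> 0 \<longrightarrow> F z = v z)"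

text \<open>\<open>reg_mero_holo\<close> yields a \<open>v\<close> that agrees with \<open>F\<close>
  off the zeros of an uncontrolled \<open>q\<close>. As \<open>w\<close> and \<open>h^M * v\<close>
  are germs, they agree everywhere near \<open>z0\<close>, and dividing by \<open>h^M\<close>
  removes \<open>q\<close>.\<close>

lemma ext_offI:
  assumes w: "w \<in> Ogerm z0" "\<forall>\<^sub>F z in nhds z0. h z \<noteq> 0 \<longrightarrow> h z ^ M * F z = w z"
    and r: "\<And>k. k < length fs \<Longrightarrow> reg k F"
  shows "ext_off F"
proof -
  have "mero F" by (rule meroI[OF w(1) hO h_nz w(2)])
  from reg_mero_holo[OF this r] obtain v q where
    v: "v \<in> Ogerm z0" "q \<in> Ogerm z0" "nz z0 q" "\<forall>\<^sub>F z in nhds z0. q z \<noteq> 0 \<longrightarrow> F z = v z" by blast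
  have "\<forall>\<^sub>F z in nhds z0. q z * h z \<noteq> 0 \<longrightarrow> w z = h z ^ M * v z"
    using v(4) w(2) by eventually_elim auto
  then have "\<forall>\<^sub>F z in nhds z0. w z = h z ^ M * v z"
    by (rule germ_eq_off_zeros[OF Ogerm_mult[OF v(2) hO] nz_mult[OF v(2,3) hO h_nz] w(1)
          Ogerm_mult[OF Ogerm_power[OF hO] v(1)]])
  then have "\<forall>\<^sub>F z in nhds z0. h z \<noteq> 0 \<longrightarrow> F z = v z"
    using w(2) by eventually_elim auto
  then show ?thesis unfolding ext_off_def using v(1) by blast
qed

text \<open>The coefficient matrix of a closed logarithmic 2-form: poles of order at most one,
  antisymmetry and closedness, all tested off the zeros of \<open>h\<close>.\<close>

definition log_closed :: "(complex^'n \<Rightarrow> complex^'n^'n) \<Rightarrow> bool" where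
  "log_closed W \<longleftrightarrow> (\<forall>i j. \<exists>v\<in>Ogerm z0. \<forall>\<^sub>F z in nhds z0. h z \<noteq> 0 \<longrightarrow> h z * W z $ i $ j = v z) \<and>
     (\<forall>\<^sub>F z in nhds z0. h z \<noteq> 0 \<longrightarrow> (\<forall>i j. W z $ i $ j = - W z $ j $ i)) \<and>
     (\<forall>\<^sub>F z in nhds z0. h z \<noteq> 0 \<longrightarrow> (\<forall>i j l. FD (\<lambda>z. W z $ j $ l) z (axis i 1)
        - FD (\<lambda>z. W z $ i $ l) z (axis j 1) + FD (\<lambda>z. W z $ i $ j) z (axis l 1) = 0))"

lemma log_closedE:
  assumes "log_closed W"
  obtains \<alpha> :: "'n \<Rightarrow> 'n \<Rightarrow> complex^'n \<Rightarrow> complex" where "\<And>i j. \<alpha> i j \<in> Ogerm z0"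
    "\<forall>\<^sub>F z in nhds z0. h z \<noteq> 0 \<longrightarrow> (\<forall>i j. h z * W z $ i $ j = \<alpha> i j z)"
proof -
  have "\<forall>i j. \<exists>v\<in>Ogerm z0. \<forall>\<^sub>F z in nhds z0. h z \<noteq> 0 \<longrightarrow> h z * W z $ i $ j = v z"
    using assms unfolding log_closed_def by (elim conjE)
  then have "\<forall>i. \<exists>v. \<forall>j. v j \<in> Ogerm z0 \<and> (\<forall>\<^sub>F z in nhds z0. h z \<noteq> 0 \<longrightarrow> h z * W z $ i $ j = v j z)"
    by (intro allI choice) blast
  then have "\<exists>\<alpha>. \<forall>i j. \<alpha> i j \<in> Ogerm z0 \<and> (\<forall>\<^sub>F z in nhds z0. h z \<noteq> 0 \<longrightarrow> h z * W z $ i $ j = \<alpha> i j z)"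
    by (rule choice)
  then obtain \<alpha> where \<alpha>: "\<forall>i j. \<alpha> i j \<in> Ogerm z0 \<and> (\<forall>\<^sub>F z in nhds z0. h z \<noteq> 0 \<longrightarrow> h z * W z $ i $ j = \<alpha> i j z)"
    by (elim exE)
  have "\<forall>\<^sub>F z in nhds z0. \<forall>i j. h z \<noteq> 0 \<longrightarrow> h z * W z $ i $ j = \<alpha> i j z"
    using \<alpha> by (intro eventually_all_finite) simp
  then have "\<forall>\<^sub>F z in nhds z0. h z \<noteq> 0 \<longrightarrow> (\<forall>i j. h z * W z $ i $ j = \<alpha> i j z)"
    by eventually_elim simp
  then show thesis using \<alpha> by (intro that[of \<alpha>]) simp_all
qed

text \<open>As the form is closed, \<open>dh \<and> \<omega> = d(h\<omega>)\<close>, and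
  \<open>h\<omega>\<close> extends holomorphically; \<open>\<beta>\<close> is a coefficient of this
  differential.\<close>

lemma log_closed_dh_wedge:
  assumes W: "log_closed W"
  shows "\<exists>\<beta>. \<beta> \<in> Ogerm z0 \<and> (\<forall>\<^sub>F z in nhds z0. h z \<noteq> 0 \<longrightarrow>
     hd i z * W z $ j $ l - hd j z * W z $ i $ l + hd l z * W z $ i $ j = \<beta> z)"
proof -
  obtain \<alpha> :: "'n \<Rightarrow> 'n \<Rightarrow> complex^'n \<Rightarrow> complex" where \<alpha>: "\<And>i j. \<alpha> i j \<in> Ogerm z0"
    "\<forall>\<^sub>F z in nhds z0. h z \<noteq> 0 \<longrightarrow> (\<forall>i j. h z * W z $ i $ j = \<alpha> i j z)"
    by (rule log_closedE[OF W]) (rule that)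
  have cl: "\<forall>\<^sub>F z in nhds z0. h z \<noteq> 0 \<longrightarrow> (\<forall>i j l. FD (\<lambda>z. W z $ j $ l) z (axis i 1)
        - FD (\<lambda>z. W z $ i $ l) z (axis j 1) + FD (\<lambda>z. W z $ i $ j) z (axis l 1) = 0)"
    using W by (simp add: log_closed_def)
  have ah: "\<forall>\<^sub>F z in nhds z0. \<forall>i j. \<exists>S. open S \<and> z \<in> S \<and> holo_on (\<alpha> i j) S"
    by (intro eventually_all_finite Ogerm_eventually_holo \<alpha>)
  obtain T where T: "open T" "z0 \<in> T"
      "\<And>z. z \<in> T \<Longrightarrow> h z \<noteq> 0 \<longrightarrow> (\<forall>i j. h z * W z $ i $ j = \<alpha> i j z)"
    using \<alpha>(2) by (auto simp: eventually_nhds)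
  obtain r where r: "r > 0" "holo_on h (ball z0 r)" "\<And>z. z \<in> ball z0 r \<Longrightarrow> z \<in> T"
    by (rule Ogerm_ballE[OF hO, of "\<lambda>z. z \<in> T"])
      (use T in \<open>auto simp: eventually_nhds\<close>)
  define X where "X = {z \<in> ball z0 r. h z \<noteq> 0}"
  have "X = ball z0 r \<inter> h -` (- {0})" by (auto simp: X_def)
  then have X: "open X"
    using continuous_open_preimage[OF holo_on_continuous[OF r(2)] open_ball, of "- {0}"] by auto
  \<comment> \<open>The product rule for \<open>h * W = \<alpha>\<close>, valid on the open set
    \<open>X\<close>, where \<open>h\<close> is nonzero and \<open>W\<close> is therefore
    holomorphic.\<close>
  have eq: "FD (\<alpha> i j) z v = h z * FD (\<lambda>z. W z $ i $ j) z v + FD h z v * W z $ i $ j"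
    if z: "z \<in> X" and hol: "\<exists>S. open S \<and> z \<in> S \<and> holo_on (\<alpha> i j) S" for z i j v
  proof -
    obtain S where S: "open S" "z \<in> S" "holo_on (\<alpha> i j) S" using hol by blast
    have hX: "holo_on h X" by (rule holo_on_subset[OF r(2)]) (auto simp: X_def)
    have "holo_on (\<lambda>z. \<alpha> i j z / h z) (X \<inter> S)"
      by (intro holo_intros holo_on_subset[OF S(3)] holo_on_subset[OF hX]) (auto simp: X_def)
    then have "holo_on (\<lambda>z. W z $ i $ j) (X \<inter> S)"
    proof (rule holo_on_cong[rotated 2])
      show "\<alpha> i j x / h x = W x $ i $ j" if "x \<in> X \<inter> S" for x
        using that T(3)[of x] r(3)[of x] by (auto simp: X_def field_simps)
    qed (use X S in auto)
    then have "((\<lambda>z. h z * W z $ i $ j) has_derivative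
        (\<lambda>v. h z * FD (\<lambda>z. W z $ i $ j) z v + FD h z v * W z $ i $ j)) (at z)"
      by (intro has_derivative_mult) (use z S holo_onD(1)[OF hX] holo_onD(1)[of _ "X \<inter> S"] in auto)
    then have "FD (\<lambda>z. h z * W z $ i $ j) z v = h z * FD (\<lambda>z. W z $ i $ j) z v + FD h z v * W z $ i $ j"
      by (rule FD_eq)
    moreover have "FD (\<lambda>z. h z * W z $ i $ j) z = FD (\<alpha> i j) z"
      by (rule FD_cong[OF X z]) (use T(3) r(3) in \<open>auto simp: X_def\<close>)
    ultimately show ?thesis by simp
  qed
  define \<beta> where "\<beta> z = FD (\<alpha> j l) z (axis i 1) - FD (\<alpha> i l) z (axis j 1) + FD (\<alpha> i j) z (axis l 1)" for z
  have "\<beta> \<in> Ogerm z0" unfolding \<beta>_def by (intro Ogerm_intros Ogerm_FD \<alpha>)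
  moreover have "\<forall>\<^sub>F z in nhds z0. z \<in> ball z0 r"
    using r(1) by (auto simp: eventually_nhds intro!: exI[of _ "ball z0 r"])
  then have "\<forall>\<^sub>F z in nhds z0. h z \<noteq> 0 \<longrightarrow>
     hd i z * W z $ j $ l - hd j z * W z $ i $ l + hd l z * W z $ i $ j = \<beta> z"
    using ah cl
  proof eventually_elim
    case (elim z)
    show ?case
    proof
      assume hz: "h z \<noteq> 0"
      then have zX: "z \<in> X" using elim(1) by (simp add: X_def)
      have cl0: "FD (\<lambda>z. W z $ j $ l) z (axis i 1)
        - FD (\<lambda>z. W z $ i $ l) z (axis j 1) + FD (\<lambda>z. W z $ i $ j) z (axis l 1) = 0"
        using elim(3) hz by blast
      from arg_cong[OF cl0, of "\<lambda>x. h z * x"] have "h z * FD (\<lambda>z. W z $ j $ l) z (axis i 1)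
        - h z * FD (\<lambda>z. W z $ i $ l) z (axis j 1) + h z * FD (\<lambda>z. W z $ i $ j) z (axis l 1) = 0"
        by (simp add: distrib_left right_diff_distrib)
      then show "hd i z * W z $ j $ l - hd j z * W z $ i $ l + hd l z * W z $ i $ j = \<beta> z"
        unfolding \<beta>_def using eq[OF zX elim(2)[rule_format]] by (simp add: hd_def algebra_simps)
    qed
  qed
  ultimately show ?thesis by blast
qed

text \<open>The Gram matrix of the 2-form in the frame of logarithmic vector fields.\<close>

definition fmat :: "'n \<Rightarrow> (complex^'n \<Rightarrow> complex^'n^'n) \<Rightarrow> complex^'n \<Rightarrow> complex^'n^'n" where
  "fmat i W z = transpose (frame i z) ** (W z ** frame i z)"

lemma fmat_entry:
  "fmat i W z $ j $ l = (let p = h z * inverse (hd i z); c = (\<lambda>j. hd j z * inverse (hd i z)); W = W z;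
     R = (\<lambda>a. if l = i then p * W $ a $ i else W $ a $ l - c l * W $ a $ i)
     in if j = i then p * R i else R j - c j * R i)"
proof -
  have "(W z ** frame i z) $ a $ l = (if l = i then h z * inverse (hd i z) * W z $ a $ i
      else W z $ a $ l - hd l z * inverse (hd i z) * W z $ a $ i)" for a
    using sum_frame[where x="W z $ a" and j=l and i=i and z=z]
    by (simp add: matrix_matrix_mult_def mult.commute)
  moreover have "fmat i W z $ j $ l = (\<Sum>a\<in>UNIV. frame i z $ a $ j * (\<chi> a. (W z ** frame i z) $ a $ l) $ a)"
    unfolding fmat_def by (subst matrix_matrix_mult_def) (simp add: transpose_def)
  ultimately show ?thesis unfolding sum_frame by (simp add: Let_def)
qed

text \<open>Antisymmetry kills the pairing of \<open>E\<^sub>i\<close> with itself; pairing it with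
  another frame vector gives an entry of \<open>h * W\<close> divided by \<open>hd i\<close>; two
  other frame vectors pair to a coefficient of \<open>dh \<and> \<omega>\<close> divided by
  \<open>hd i\<close>. All numerators are germs, and \<open>hd i\<close> is a unit at the generic
  point of the component.\<close>

lemma reg_fmat:
  assumes W: "log_closed W" and k: "k < length fs" and i: "\<not> gdvd z0 (fs ! k) (hd i)"
  shows "reg k (\<lambda>z. fmat i W z $ j $ l)"
proof -
  obtain \<alpha> :: "'n \<Rightarrow> 'n \<Rightarrow> complex^'n \<Rightarrow> complex" where \<alpha>: "\<And>i j. \<alpha> i j \<in> Ogerm z0"
    "\<forall>\<^sub>F z in nhds z0. h z \<noteq> 0 \<longrightarrow> (\<forall>i j. h z * W z $ i $ j = \<alpha> i j z)"
    by (rule log_closedE[OF W]) (rule that)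
  have asym: "\<forall>\<^sub>F z in nhds z0. h z \<noteq> 0 \<longrightarrow> (\<forall>i j. W z $ i $ j = - W z $ j $ i)"
    using W by (simp add: log_closed_def)
  have asym0: "x = 0" if "x = - x" for x :: complex using that by simp
  have q: "(\<lambda>z. h z * hd i z) \<in> Ogerm z0" "nz z0 (\<lambda>z. h z * hd i z)"
    by (intro Ogerm_intros nz_mult hO hdO h_nz not_gdvd_nz[OF i])+
  obtain \<beta> where \<beta>: "\<beta> \<in> Ogerm z0" "\<forall>\<^sub>F z in nhds z0. h z \<noteq> 0 \<longrightarrow>
     hd i z * W z $ j $ l - hd j z * W z $ i $ l + hd l z * W z $ i $ j = \<beta> z"
    using log_closed_dh_wedge[OF W] by blast
  consider "j = i" "l = i" | "j = i" "l \<noteq> i" | "j \<noteq> i" "l = i" | "j \<noteq> i" "l \<noteq> i" by blast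
  then show ?thesis
  proof cases
    case 1
    have "reg k (\<lambda>z. 0)" by (intro reg_germ k Ogerm_const)
    then show ?thesis
    proof (rule reg_cong[OF _ q])
      show "\<forall>\<^sub>F z in nhds z0. h z * hd i z \<noteq> 0 \<longrightarrow> 0 = fmat i W z $ j $ l"
        using asym
      proof eventually_elim
        case (elim z)
        show ?case
        proof
          assume nz: "h z * hd i z \<noteq> 0"
          then have "h z \<noteq> 0" by auto
          with elim(1) have "\<forall>i j. W z $ i $ j = - W z $ j $ i" by blast
          then have "W z $ i $ i = 0" using asym0[of "W z $ i $ i"] by blast
          then show "0 = fmat i W z $ j $ l" using 1 by (simp add: fmat_entry)
        qed
      qed
    qed
  next
    case 2
    have "reg k (\<lambda>z. \<alpha> i l z * inverse (hd i z))"
      by (intro reg_mult reg_germ k \<alpha> reg_inverse hdO i)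
    then show ?thesis
    proof (rule reg_cong[OF _ q])
      show "\<forall>\<^sub>F z in nhds z0. h z * hd i z \<noteq> 0 \<longrightarrow> \<alpha> i l z * inverse (hd i z) = fmat i W z $ j $ l"
        using asym \<alpha>(2)
      proof eventually_elim
        case (elim z)
        show ?case
        proof
          assume nz: "h z * hd i z \<noteq> 0"
          then have "h z \<noteq> 0" by auto
          with elim(1) have "\<forall>i j. W z $ i $ j = - W z $ j $ i" by blast
          then have "W z $ i $ i = 0" using asym0[of "W z $ i $ i"] by blast
          moreover have "h z * W z $ i $ l = \<alpha> i l z" using elim(2) nz by simp
          ultimately show "\<alpha> i l z * inverse (hd i z) = fmat i W z $ j $ l"
            using 2 by (simp add: fmat_entry algebra_simps)
        qed
      qed
    qed
  next
    case 3
    have "reg k (\<lambda>z. \<alpha> j i z * inverse (hd i z))"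
      by (intro reg_mult reg_germ k \<alpha> reg_inverse hdO i)
    then show ?thesis
    proof (rule reg_cong[OF _ q])
      show "\<forall>\<^sub>F z in nhds z0. h z * hd i z \<noteq> 0 \<longrightarrow> \<alpha> j i z * inverse (hd i z) = fmat i W z $ j $ l"
        using asym \<alpha>(2)
      proof eventually_elim
        case (elim z)
        show ?case
        proof
          assume nz: "h z * hd i z \<noteq> 0"
          then have "h z \<noteq> 0" by auto
          with elim(1) have "\<forall>i j. W z $ i $ j = - W z $ j $ i" by blast
          then have "W z $ i $ i = 0" using asym0[of "W z $ i $ i"] by blast
          moreover have "h z * W z $ j $ i = \<alpha> j i z" using elim(2) nz by simp
          ultimately show "\<alpha> j i z * inverse (hd i z) = fmat i W z $ j $ l"
            using 3 by (simp add: fmat_entry algebra_simps)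
        qed
      qed
    qed
  next
    case 4
    have "reg k (\<lambda>z. \<beta> z * inverse (hd i z))"
      by (intro reg_mult reg_germ k \<beta> reg_inverse hdO i)
    then show ?thesis
    proof (rule reg_cong[OF _ q])
      show "\<forall>\<^sub>F z in nhds z0. h z * hd i z \<noteq> 0 \<longrightarrow> \<beta> z * inverse (hd i z) = fmat i W z $ j $ l"
        using asym \<beta>(2)
      proof eventually_elim
        case (elim z)
        show ?case
        proof
          assume nz: "h z * hd i z \<noteq> 0"
          then have "h z \<noteq> 0" by auto
          with elim(1) have "\<forall>i j. W z $ i $ j = - W z $ j $ i" by blast
          then have a: "W z $ i $ i = 0" "W z $ j $ i = - W z $ i $ j" using asym0[of "W z $ i $ i"] by (blast, blast)
          have b: "\<beta> z = hd i z * W z $ j $ l - hd j z * W z $ i $ l + hd l z * W z $ i $ j" using elim(2) nz by simp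
          show "\<beta> z * inverse (hd i z) = fmat i W z $ j $ l"
          proof -
            define p where "p = inverse (hd i z)"
            have hp: "hd i z * p = 1" using nz by (simp add: p_def)
            have "fmat i W z $ j $ l = W z $ j $ l + hd l z * p * W z $ i $ j - hd j z * p * W z $ i $ l"
              using 4 by (simp add: fmat_entry Let_def a algebra_simps flip: p_def)
            moreover have "\<beta> z * p = (hd i z * p) * W z $ j $ l + hd l z * p * W z $ i $ j - hd j z * p * W z $ i $ l"
              by (simp add: b algebra_simps)
            ultimately show ?thesis by (simp add: hp flip: p_def)
          qed
        qed
      qed
    qed
  qed
qed

text \<open>Logarithmic 1-forms, characterised by duality: at most a simple pole, and regular values
  on the frame at the generic point of each component, for every \<open>i\<close> for which
  \<open>hd i\<close> is a unit there.\<close>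

definition logform :: "(complex^'n \<Rightarrow> complex^'n) \<Rightarrow> bool" where
  "logform b \<longleftrightarrow> (\<exists>c. (\<forall>j. (\<lambda>z. c z $ j) \<in> Ogerm z0) \<and> (\<forall>\<^sub>F z in nhds z0. h z \<noteq> 0 \<longrightarrow> h z *s b z = c z)) \<and>
     (\<forall>k<length fs. \<forall>i j. \<not> gdvd z0 (fs ! k) (hd i) \<longrightarrow> reg k (\<lambda>z. \<Sum>a\<in>UNIV. frame i z $ a $ j * b z $ a))"

lemma logform_const: "logform (\<lambda>z. c)"
  unfolding logform_def
proof (intro conjI allI impI)
  show "\<exists>d. (\<forall>j. (\<lambda>z. d z $ j) \<in> Ogerm z0) \<and> (\<forall>\<^sub>F z in nhds z0. h z \<noteq> 0 \<longrightarrow> h z *s c = d z)"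
    by (intro exI[of _ "\<lambda>z. h z *s c"]) (auto intro!: Ogerm_mult hO Ogerm_const)
qed (intro reg_sum reg_mult reg_frame reg_germ Ogerm_const)

text \<open>Since \<open>E\<^sub>i h = h\<close> and \<open>E\<^sub>j h = 0\<close> for the other
  columns, the values on the frame are the constants 1 and 0.\<close>

lemma logform_dlog_h: "logform (\<lambda>z. \<chi> a. inverse (h z) * FD h z (axis a 1))"
  unfolding logform_def
proof (intro conjI allI impI)
  show "\<exists>d. (\<forall>j. (\<lambda>z. d z $ j) \<in> Ogerm z0) \<and>
      (\<forall>\<^sub>F z in nhds z0. h z \<noteq> 0 \<longrightarrow> h z *s (\<chi> a. inverse (h z) * FD h z (axis a 1)) = d z)"
    by (intro exI[of _ "\<lambda>z. \<chi> a. FD h z (axis a 1)"]) (auto intro!: Ogerm_FD hO simp: vec_eq_iff)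
next
  fix k i j assume k: "k < length fs" and i: "\<not> gdvd z0 (fs ! k) (hd i)"
  have q: "(\<lambda>z. h z * hd i z) \<in> Ogerm z0" "nz z0 (\<lambda>z. h z * hd i z)"
    by (intro Ogerm_intros nz_mult hO hdO h_nz not_gdvd_nz[OF i])+
  have "reg k (\<lambda>z. if j = i then 1 else 0)" by (intro reg_germ k Ogerm_const)
  then show "reg k (\<lambda>z. \<Sum>a\<in>UNIV. frame i z $ a $ j * (\<chi> a. inverse (h z) * FD h z (axis a 1)) $ a)"
    by (rule reg_cong[OF _ q], unfold sum_frame, intro always_eventually allI)
      (auto simp: hd_def field_simps)
qed

lemma reg_dlog_unit:
  assumes k: "k < length fs" and i: "\<not> gdvd z0 (fs ! k) (hd i)"
    and f: "f \<in> Ogerm z0" "\<not> gdvd z0 (fs ! k) f"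
  shows "reg k (\<lambda>z. \<Sum>a\<in>UNIV. frame i z $ a $ j * (inverse (f z) * FD f z (axis a 1)))"
  by (intro reg_sum reg_mult reg_frame reg_inverse reg_germ Ogerm_FD k i f)

lemma dlog_mult:
  assumes "\<exists>S. open S \<and> z \<in> S \<and> holo_on f S" "\<exists>S. open S \<and> z \<in> S \<and> holo_on g S" "f z * g z \<noteq> 0"
  shows "inverse (f z * g z) * FD (\<lambda>z. f z * g z) z v = inverse (f z) * FD f z v + inverse (g z) * FD g z v"
proof -
  have "FD (\<lambda>z. f z * g z) z v = f z * FD g z v + FD f z v * g z"
    by (rule FD_eq[OF has_derivative_mult]) (use assms holo_onD(1) in blast)+
  then show ?thesis using assms(3) by (simp add: field_simps)
qed

text \<open>Along another component \<open>fs ! m\<close> is generically a unit, so nothing has a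
  pole. Along its own component, \<open>dlog (fs ! m)\<close> is \<open>dlog h\<close>, with
  constant values on the frame, minus the \<open>dlog\<close> of the cofactor, which is a unit
  there.\<close>

lemma logform_dlog:
  assumes m: "m < length fs"
  shows "logform (\<lambda>z. \<chi> a. inverse ((fs ! m) z) * FD (fs ! m) z (axis a 1))"
  unfolding logform_def
proof (intro conjI allI impI)
  let ?f = "fs ! m"
  show "\<exists>d. (\<forall>j. (\<lambda>z. d z $ j) \<in> Ogerm z0) \<and>
      (\<forall>\<^sub>F z in nhds z0. h z \<noteq> 0 \<longrightarrow> h z *s (\<chi> a. inverse (?f z) * FD ?f z (axis a 1)) = d z)"
  proof (intro exI[of _ "\<lambda>z. \<chi> a. cof m z * FD ?f z (axis a 1)"] conjI allI)
    show "(\<lambda>z. (\<chi> a. cof m z * FD ?f z (axis a 1)) $ j) \<in> Ogerm z0" for j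
      by (simp add: Ogerm_mult cofO Ogerm_FD fsO m)
    show "\<forall>\<^sub>F z in nhds z0. h z \<noteq> 0 \<longrightarrow>
        h z *s (\<chi> a. inverse (?f z) * FD ?f z (axis a 1)) = (\<chi> a. cof m z * FD ?f z (axis a 1))"
      using h_cof[OF m] by eventually_elim (auto simp: vec_eq_iff)
  qed
  fix k i j assume k: "k < length fs" and i: "\<not> gdvd z0 (fs ! k) (hd i)"
  have "reg k (\<lambda>z. \<Sum>a\<in>UNIV. frame i z $ a $ j * (inverse (?f z) * FD ?f z (axis a 1)))"
  proof (cases "k = m")
    case False
    then show ?thesis by (intro reg_dlog_unit k i fsO m fs_indep)
  next
    case True
    have a: "reg k (\<lambda>z. \<Sum>a\<in>UNIV. frame i z $ a $ j * (inverse (h z) * FD h z (axis a 1)))"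
      using logform_dlog_h k i unfolding logform_def by auto
    have b: "reg k (\<lambda>z. \<Sum>a\<in>UNIV. frame i z $ a $ j * (inverse (cof k z) * FD (cof k) z (axis a 1)))"
      by (intro reg_dlog_unit k i cofO not_gdvd_cof)
    show ?thesis
    proof (rule reg_cong[OF reg_diff[OF k a b] hO h_nz])
      show "\<forall>\<^sub>F z in nhds z0. h z \<noteq> 0 \<longrightarrow>
        (\<Sum>a\<in>UNIV. frame i z $ a $ j * (inverse (h z) * FD h z (axis a 1))) -
        (\<Sum>a\<in>UNIV. frame i z $ a $ j * (inverse (cof k z) * FD (cof k) z (axis a 1))) =
        (\<Sum>a\<in>UNIV. frame i z $ a $ j * (inverse (?f z) * FD ?f z (axis a 1)))"
        using h_cof[OF k] eventually_FD_cong[OF h_cof[OF k]] Ogerm_eventually_holo[OF cofO[of k]]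
          Ogerm_eventually_holo[OF fsO[OF k]]
      proof eventually_elim
        case (elim z)
        show ?case
        proof
          assume "h z \<noteq> 0"
          then have "inverse (h z) * FD h z v = inverse ((fs!k) z) * FD (fs!k) z v + inverse (cof k z) * FD (cof k) z v" for v
            using dlog_mult[OF elim(4,3), of v] elim(1,2) by simp
          then show "(\<Sum>a\<in>UNIV. frame i z $ a $ j * (inverse (h z) * FD h z (axis a 1))) -
            (\<Sum>a\<in>UNIV. frame i z $ a $ j * (inverse (cof k z) * FD (cof k) z (axis a 1))) =
            (\<Sum>a\<in>UNIV. frame i z $ a $ j * (inverse (?f z) * FD ?f z (axis a 1)))"
            using True by (simp add: distrib_left sum.distrib)
        qed
      qed
    qed
  qed
  then show "reg k (\<lambda>z. \<Sum>a\<in>UNIV. frame i z $ a $ j * (\<chi> a. inverse (?f z) * FD ?f z (axis a 1)) $ a)"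
    by simp
qed

text \<open>The determinant of \<open>fmat i W z\<close> is \<open>det (W z)\<close> times the
  square of \<open>det (frame i z) = h z / hd i z\<close>. So
  \<open>(h z)\<^sup>2 * det (W z)\<close> is \<open>(hd i z)\<^sup>2\<close> times a determinant
  with regular entries. The exponent \<open>CARD('n)\<close> is only a crude a priori bound for the
  pole.\<close>

theorem ext_off_det:
  assumes W: "log_closed W"
  shows "ext_off (\<lambda>z. (h z)\<^sup>2 * det (W z))"
proof -
  obtain \<alpha> :: "'n \<Rightarrow> 'n \<Rightarrow> complex^'n \<Rightarrow> complex" where \<alpha>: "\<And>i j. \<alpha> i j \<in> Ogerm z0"
    "\<forall>\<^sub>F z in nhds z0. h z \<noteq> 0 \<longrightarrow> (\<forall>i j. h z * W z $ i $ j = \<alpha> i j z)"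
    by (rule log_closedE[OF W]) (rule that)
  show ?thesis
  proof (rule ext_offI)
    show "(\<lambda>z. (h z)\<^sup>2 * det (\<chi> i j. \<alpha> i j z)) \<in> Ogerm z0"
      by (intro Ogerm_mult Ogerm_power hO Ogerm_det) (simp add: \<alpha>)
    show "\<forall>\<^sub>F z in nhds z0. h z \<noteq> 0 \<longrightarrow> h z ^ CARD('n) * ((h z)\<^sup>2 * det (W z)) = (h z)\<^sup>2 * det (\<chi> i j. \<alpha> i j z)"
      using \<alpha>(2)
    proof eventually_elim
      case (elim z)
      show ?case
      proof
        assume "h z \<noteq> 0"
        then have "(\<chi> i j. \<alpha> i j z) = (\<chi> i j. h z * W z $ i $ j)" using elim by (simp add: vec_eq_iff)
        then show "h z ^ CARD('n) * ((h z)\<^sup>2 * det (W z)) = (h z)\<^sup>2 * det (\<chi> i j. \<alpha> i j z)"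
          by (simp add: det_scale_rows)
      qed
    qed
    fix k assume k: "k < length fs"
    then obtain i where i: "\<not> gdvd z0 (fs ! k) (hd i)"
      using exists_partial_not_gdvd unfolding hd_def by blast
    have "reg k (\<lambda>z. (hd i z)\<^sup>2 * det (fmat i W z))"
      by (intro reg_mult reg_det reg_fmat W k i reg_germ Ogerm_power hdO)
    then show "reg k (\<lambda>z. (h z)\<^sup>2 * det (W z))"
    proof (rule reg_cong[OF _ hdO not_gdvd_nz[OF i]])
      show "\<forall>\<^sub>F z in nhds z0. hd i z \<noteq> 0 \<longrightarrow> (hd i z)\<^sup>2 * det (fmat i W z) = (h z)\<^sup>2 * det (W z)"
        by (intro always_eventually allI impI)
          (simp add: fmat_def det_mul det_transpose det_frame power2_eq_square field_simps)
    qed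
  qed
qed

lemma reg_colrep:
  assumes k: "k < length fs" and M: "\<And>i j. reg k (\<lambda>z. M z $ i $ j)" and b: "\<And>i. reg k (\<lambda>z. b z $ i)"
  shows "reg k (\<lambda>z. det (colrep (M z) l (b z)))"
proof (rule reg_det[OF k])
  show "reg k (\<lambda>z. colrep (M z) l (b z) $ i $ j)" for i j
    using M b by (cases "j = l") (auto simp: colrep_def)
qed

text \<open>By Cramer's rule both sides are determinants times the pairing of a covector with the
  inverse matrix applied to another one. This pairing is invariant under the change of basis
  \<open>E\<close>, and the determinants of the two matrices differ by
  \<open>(det E)\<^sup>2\<close>.\<close>

lemma colrep_frame_identity:
  fixes W E :: "complex^'n^'n" and a b :: "complex^'n"
  assumes "det W \<noteq> 0" "det E \<noteq> 0"
  shows "(\<Sum>l\<in>UNIV. (\<Sum>r\<in>UNIV. E $ r $ l * a $ r) * det (colrep (transpose E ** (W ** E)) l (\<chi> s. \<Sum>r\<in>UNIV. E $ r $ s * b $ r)))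
    = (det E)\<^sup>2 * (\<Sum>l\<in>UNIV. a $ l * det (colrep W l b))"
proof -
  let ?M = "transpose E ** (W ** E)"
  let ?b = "\<chi> s. \<Sum>r\<in>UNIV. E $ r $ s * b $ r"
  have dM: "det ?M = (det E)\<^sup>2 * det W" by (simp add: det_mul det_transpose power2_eq_square)
  \<comment> \<open>\<open>y\<close> and, further down, \<open>x\<close> are the Cramer solutions in
    the two bases; invertibility of \<open>E\<close> and \<open>W\<close> gives
    \<open>E *v x = y\<close>.\<close>
  define y where "y = (\<chi> l. det (colrep W l b) / det W)"
  have Wy: "W *v y = b" using cramer[OF assms(1), of y b] by (simp add: y_def colrep_def)
  define x where "x = (\<chi> l. det (colrep ?M l ?b) / det ?M)"
  have "det ?M \<noteq> 0" using dM assms by simp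
  from cramer[OF this, of x ?b] have Mx: "?M *v x = ?b" by (simp add: x_def colrep_def)
  have tb: "?b = transpose E *v b"
    by (simp add: matrix_vector_mult_def transpose_def)
  have inv: "invertible (transpose E)" "invertible W" using assms by (auto simp: invertible_det_nz det_transpose)
  have "transpose E *v (W *v (E *v x)) = transpose E *v b"
    using Mx tb by (simp add: matrix_vector_mul_assoc matrix_mul_assoc)
  then have "W *v (E *v x) = b" using inv(1)
    by (metis invertible_def matrix_vector_mul_assoc matrix_vector_mul_lid)
  then have Ex: "E *v x = y" using inv(2) Wy
    by (metis invertible_def matrix_vector_mul_assoc matrix_vector_mul_lid)
  have "(\<Sum>l\<in>UNIV. (\<Sum>r\<in>UNIV. E $ r $ l * a $ r) * x $ l) = (\<Sum>r\<in>UNIV. a $ r * y $ r)"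
    unfolding Ex[symmetric] matrix_vector_mult_def
    by (simp add: sum_distrib_left sum_distrib_right, subst sum.swap) (simp add: algebra_simps)
  moreover have "det ?M * x $ l = det (colrep ?M l ?b)" for l
    using \<open>det ?M \<noteq> 0\<close> by (simp add: x_def)
  then have "(\<Sum>l\<in>UNIV. (\<Sum>r\<in>UNIV. E $ r $ l * a $ r) * det (colrep ?M l ?b))
     = det ?M * (\<Sum>l\<in>UNIV. (\<Sum>r\<in>UNIV. E $ r $ l * a $ r) * x $ l)"
    by (simp add: sum_distrib_left mult.left_commute flip: \<open>\<And>l. det ?M * x $ l = det (colrep ?M l ?b)\<close>)
  moreover have "det W * y $ l = det (colrep W l b)" for l
    using assms by (simp add: y_def)
  then have "(\<Sum>l\<in>UNIV. a $ l * det (colrep W l b)) = det W * (\<Sum>r\<in>UNIV. a $ r * y $ r)"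
    by (simp add: sum_distrib_left mult.left_commute flip: \<open>\<And>l. det W * y $ l = det (colrep W l b)\<close>)
  ultimately show ?thesis by (simp add: dM)
qed

text \<open>The sum is \<open>det W\<close> times the pairing of \<open>a\<close> with the vector
  that \<open>W\<close> sends to \<open>b\<close>. Passing to the logarithmic frame again absorbs
  \<open>h\<^sup>2\<close> and leaves regular quantities. With \<open>a\<close> a coordinate
  differential this serves the components of the Moser field, with \<open>a = dlog h\<close> its
  tangency to \<open>D\<close>.\<close>

theorem ext_off_contraction:
  assumes W: "log_closed W" "\<forall>\<^sub>F z in nhds z0. h z \<noteq> 0 \<longrightarrow> det (W z) \<noteq> 0"
    and a: "logform a" and b: "logform b"
  shows "ext_off (\<lambda>z. (h z)\<^sup>2 * (\<Sum>l\<in>UNIV. a z $ l * det (colrep (W z) l (b z))))"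
proof -
  obtain \<alpha> :: "'n \<Rightarrow> 'n \<Rightarrow> complex^'n \<Rightarrow> complex" where \<alpha>: "\<And>i j. \<alpha> i j \<in> Ogerm z0"
    "\<forall>\<^sub>F z in nhds z0. h z \<noteq> 0 \<longrightarrow> (\<forall>i j. h z * W z $ i $ j = \<alpha> i j z)"
    by (rule log_closedE[OF W(1)]) (rule that)
  obtain a' where a': "\<forall>j. (\<lambda>z. a' z $ j) \<in> Ogerm z0" "\<forall>\<^sub>F z in nhds z0. h z \<noteq> 0 \<longrightarrow> h z *s a z = a' z"
    using a unfolding logform_def by (elim conjE exE)
  obtain b' where b': "\<forall>j. (\<lambda>z. b' z $ j) \<in> Ogerm z0" "\<forall>\<^sub>F z in nhds z0. h z \<noteq> 0 \<longrightarrow> h z *s b z = b' z"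
    using b unfolding logform_def by (elim conjE exE)
  let ?A = "\<lambda>z. \<chi> i j. \<alpha> i j z"
  show ?thesis
  proof (rule ext_offI)
    have "(\<lambda>z. colrep (?A z) l (b' z) $ i $ j) \<in> Ogerm z0" for l i j
      using \<alpha>(1) b'(1) by (cases "j = l") (auto simp: colrep_def)
    then show "(\<lambda>z. (h z)\<^sup>2 * (\<Sum>l\<in>UNIV. a' z $ l * det (colrep (?A z) l (b' z)))) \<in> Ogerm z0"
      using a'(1) by (intro Ogerm_mult Ogerm_power hO Ogerm_sum Ogerm_det) simp_all
    show "\<forall>\<^sub>F z in nhds z0. h z \<noteq> 0 \<longrightarrow> h z ^ Suc (CARD('n)) * ((h z)\<^sup>2 * (\<Sum>l\<in>UNIV. a z $ l * det (colrep (W z) l (b z))))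
       = (h z)\<^sup>2 * (\<Sum>l\<in>UNIV. a' z $ l * det (colrep (?A z) l (b' z)))"
      using \<alpha>(2) a'(2) b'(2)
    proof eventually_elim
      case (elim z)
      show ?case
      proof
        assume "h z \<noteq> 0"
        then have e: "?A z = (\<chi> i j. h z * W z $ i $ j)" "a' z = h z *s a z" "b' z = h z *s b z"
          using elim by (auto simp add: vec_eq_iff)
        show "h z ^ Suc (CARD('n)) * ((h z)\<^sup>2 * (\<Sum>l\<in>UNIV. a z $ l * det (colrep (W z) l (b z))))
           = (h z)\<^sup>2 * (\<Sum>l\<in>UNIV. a' z $ l * det (colrep (?A z) l (b' z)))"
          unfolding e colrep_scale det_scale_rows by (simp add: sum_distrib_left algebra_simps)
      qed
    qed
    fix k assume k: "k < length fs"
    then obtain i where i: "\<not> gdvd z0 (fs ! k) (hd i)"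
      using exists_partial_not_gdvd unfolding hd_def by blast
    have rb: "reg k (\<lambda>z. \<Sum>r\<in>UNIV. frame i z $ r $ s * b z $ r)" for s
      using b k i unfolding logform_def by blast
    have ra: "reg k (\<lambda>z. \<Sum>r\<in>UNIV. frame i z $ r $ s * a z $ r)" for s
      using a k i unfolding logform_def by blast
    have rc: "reg k (\<lambda>z. det (colrep (fmat i W z) l (\<chi> s. \<Sum>r\<in>UNIV. frame i z $ r $ s * b z $ r)))" for l
      by (rule reg_colrep[OF k reg_fmat[OF W(1) k i]]) (simp add: rb)
    have "reg k (\<lambda>z. (hd i z)\<^sup>2 * (\<Sum>l\<in>UNIV. (\<Sum>r\<in>UNIV. frame i z $ r $ l * a z $ r) *
        det (colrep (fmat i W z) l (\<chi> s. \<Sum>r\<in>UNIV. frame i z $ r $ s * b z $ r))))"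
      by (intro reg_mult[OF k] reg_sum[OF k] ra rc reg_germ[OF k] Ogerm_power hdO)
    then show "reg k (\<lambda>z. (h z)\<^sup>2 * (\<Sum>l\<in>UNIV. a z $ l * det (colrep (W z) l (b z))))"
    proof (rule reg_cong[OF _ Ogerm_mult[OF hO hdO] nz_mult[OF hO h_nz hdO not_gdvd_nz[OF i]]])
      show "\<forall>\<^sub>F z in nhds z0. h z * hd i z \<noteq> 0 \<longrightarrow> (hd i z)\<^sup>2 * (\<Sum>l\<in>UNIV. (\<Sum>r\<in>UNIV. frame i z $ r $ l * a z $ r) *
        det (colrep (fmat i W z) l (\<chi> s. \<Sum>r\<in>UNIV. frame i z $ r $ s * b z $ r))) =
        (h z)\<^sup>2 * (\<Sum>l\<in>UNIV. a z $ l * det (colrep (W z) l (b z)))"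
        using W(2)
      proof eventually_elim
        case (elim z)
        show ?case
        proof
          assume nz: "h z * hd i z \<noteq> 0"
          then have "det (frame i z) \<noteq> 0" "det (W z) \<noteq> 0" using elim by (auto simp: det_frame)
          from colrep_frame_identity[OF this(2,1), of "a z" "b z"]
          show "(hd i z)\<^sup>2 * (\<Sum>l\<in>UNIV. (\<Sum>r\<in>UNIV. frame i z $ r $ l * a z $ r) *
            det (colrep (fmat i W z) l (\<chi> s. \<Sum>r\<in>UNIV. frame i z $ r $ s * b z $ r))) =
            (h z)\<^sup>2 * (\<Sum>l\<in>UNIV. a z $ l * det (colrep (W z) l (b z)))"
            unfolding fmat_def using nz by (simp add: det_frame power2_eq_square field_simps)
        qed
      qed
    qed
  qed
qed

end

section \<open>Polynomial dependence on the parameter of the pencil\<close>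

lemma poly_degree_sum:
  assumes "degree (p::'a::comm_ring_1 poly) \<le> N" shows "poly p s = (\<Sum>m\<le>N. coeff p m * s ^ m)"
proof -
  have "(\<Sum>m\<le>N. coeff p m * s ^ m) = (\<Sum>m\<le>degree p. coeff p m * s ^ m)"
    by (rule sum.mono_neutral_right) (use assms in \<open>auto simp: coeff_eq_0 not_le\<close>)
  then show ?thesis by (simp add: poly_altdef)
qed

lemma det_poly:
  fixes M :: "complex poly^'n^'n"
  assumes "\<And>i j. degree (M $ i $ j) \<le> 1"
  shows "degree (det M) \<le> CARD('n)" and "poly (det M) s = det (\<chi> i j. poly (M $ i $ j) s)"
proof -
  have "degree (of_int (sign p) * (\<Prod>i\<in>UNIV. M $ i $ p i)) \<le> CARD('n)" for p
  proof -
    have "degree (of_int (sign p) * (\<Prod>i\<in>UNIV. M $ i $ p i)) \<le>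
        degree (of_int (sign p) :: complex poly) + degree (\<Prod>i\<in>UNIV. M $ i $ p i)"
      by (rule degree_mult_le)
    also have "degree (of_int (sign p) :: complex poly) = 0" by (simp add: of_int_poly)
    also have "degree (\<Prod>i\<in>UNIV. M $ i $ p i) \<le> sum (degree \<circ> (\<lambda>i. M $ i $ p i)) UNIV"
      by (rule degree_prod_sum_le) simp
    also have "\<dots> \<le> sum (\<lambda>_. 1) (UNIV :: 'n set)" by (rule sum_mono) (use assms in auto)
    finally show ?thesis by simp
  qed
  then show "degree (det M) \<le> CARD('n)"
    unfolding det_def by (intro degree_sum_le) (auto simp: finite_permutations)
  show "poly (det M) s = det (\<chi> i j. poly (M $ i $ j) s)"
    by (simp add: det_def poly_sum poly_prod of_int_poly)
qed

text \<open>Lagrange interpolation at \<open>N + 1\<close> nodes: the weights \<open>lg a m\<close>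
  do not depend on the polynomial, so the coefficients inherit every property of the values at the
  nodes that is stable under linear combination. Nodes in an arbitrary infinite set can avoid
  finitely many bad parameters.\<close>

lemma coeff_interpolation:
  assumes "infinite (S :: complex set)"
  obtains A lg where "finite A" "A \<subseteq> S"
    "\<And>p m. degree p \<le> N \<Longrightarrow> coeff p m = (\<Sum>a\<in>A. lg a m * poly p a)"
proof -
  obtain A where A: "A \<subseteq> S" "finite A" "card A = Suc N"
    using infinite_arbitrarily_large[OF assms] by blast
  define L where "L a = (\<Prod>b\<in>A-{a}. smult (inverse (a - b)) [:-b, 1:])" for a
  have degL: "degree (L a) \<le> N" if "a \<in> A" for a
  proof -
    have "degree (L a) \<le> sum (degree \<circ> (\<lambda>b. smult (inverse (a - b)) [:-b, 1:])) (A-{a})"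
      unfolding L_def by (rule degree_prod_sum_le) (use A in simp)
    also have "\<dots> \<le> sum (\<lambda>_. 1) (A - {a})" by (rule sum_mono) simp
    also have "\<dots> = N" using A that by simp
    finally show ?thesis .
  qed
  have polyL: "poly (L a) x = (if x = a then 1 else 0)" if "a \<in> A" "x \<in> A" for a x
  proof (cases "x = a")
    case True
    have "poly (L a) a = (\<Prod>b\<in>A-{a}. 1)"
      unfolding L_def poly_prod by (rule prod.cong) (auto simp: field_simps)
    then show ?thesis using True by simp
  next
    case False
    then show ?thesis
      unfolding L_def poly_prod using that A by (auto intro!: prod_zero bexI[of _ x])
  qed
  have "coeff p m = (\<Sum>a\<in>A. coeff (L a) m * poly p a)" if p: "degree p \<le> N" for p m
  proof -
    have "p = (\<Sum>a\<in>A. smult (poly p a) (L a))"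
    proof (rule poly_eqI_degree[of A])
      show "poly p x = poly (\<Sum>a\<in>A. smult (poly p a) (L a)) x" if "x \<in> A" for x
      proof -
        have "(\<Sum>a\<in>A. poly p a * poly (L a) x) = (\<Sum>a\<in>A. if a = x then poly p a else 0)"
          by (rule sum.cong) (auto simp: polyL that)
        then show ?thesis using that A by (simp add: poly_sum)
      qed
      have "degree (\<Sum>a\<in>A. smult (poly p a) (L a)) \<le> N"
        by (rule degree_sum_le) (use A degL in \<open>auto intro: order_trans[OF degree_smult_le]\<close>)
      then show "card A > degree (\<Sum>a\<in>A. smult (poly p a) (L a))" using A by simp
      show "card A > degree p" using A p by simp
    qed
    then have "coeff p m = coeff (\<Sum>a\<in>A. smult (poly p a) (L a)) m" by simp
    then show ?thesis by (simp add: coeff_sum mult.commute)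
  qed
  then show thesis using that[of A "\<lambda>a m. coeff (L a) m"] A by blast
qed

definition pencil :: "(complex^'n \<Rightarrow> complex^'n^'n) \<Rightarrow> (complex^'n \<Rightarrow> complex^'n^'n) \<Rightarrow> complex \<Rightarrow>
    complex^'n \<Rightarrow> complex^'n^'n" where
  "pencil W0 W1 s z = (\<chi> i j. W0 z $ i $ j + s * (W1 z $ i $ j - W0 z $ i $ j))"

context reduced_germ
begin

lemma ext_off_const: "ext_off (\<lambda>z. c)"
  unfolding ext_off_def using Ogerm_const by force

lemma ext_off_add:
  assumes "ext_off F" "ext_off G" shows "ext_off (\<lambda>z. F z + G z)"
proof -
  obtain v w where vw: "v \<in> Ogerm z0" "\<forall>\<^sub>F z in nhds z0. h z \<noteq> 0 \<longrightarrow> F z = v z"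
    "w \<in> Ogerm z0" "\<forall>\<^sub>F z in nhds z0. h z \<noteq> 0 \<longrightarrow> G z = w z"
    using assms unfolding ext_off_def by blast
  show ?thesis unfolding ext_off_def
    by (rule bexI[OF _ Ogerm_add[OF vw(1,3)]]) (use vw(2,4) in \<open>eventually_elim, simp\<close>)
qed

lemma ext_off_cmult:
  assumes "ext_off F" shows "ext_off (\<lambda>z. c * F z)"
proof -
  obtain v where v: "v \<in> Ogerm z0" "\<forall>\<^sub>F z in nhds z0. h z \<noteq> 0 \<longrightarrow> F z = v z"
    using assms unfolding ext_off_def by blast
  show ?thesis unfolding ext_off_def
    by (rule bexI[OF _ Ogerm_mult[OF Ogerm_const[of c] v(1)]]) (use v(2) in \<open>eventually_elim, simp\<close>)
qed

lemma ext_off_sum: "(\<And>i. i \<in> I \<Longrightarrow> ext_off (F i)) \<Longrightarrow> ext_off (\<lambda>z. \<Sum>i\<in>I. F i z)"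
  by (induction I rule: infinite_finite_induct) (auto intro: ext_off_const ext_off_add)

text \<open>For each fixed \<open>s\<close> the extension across \<open>D\<close> holds on a
  neighbourhood that may depend on \<open>s\<close>. Extending the finitely many coefficients
  instead gives one neighbourhood for all \<open>s\<close>.\<close>

lemma ext_off_coeffs:
  assumes P: "\<And>z. degree (P z) \<le> N" and S: "infinite S" "\<And>s. s \<in> S \<Longrightarrow> ext_off (\<lambda>z. poly (P z) s)"
  obtains c where "\<And>m. c m \<in> Ogerm z0"
    "\<forall>\<^sub>F z in nhds z0. h z \<noteq> 0 \<longrightarrow> (\<forall>s. poly (P z) s = (\<Sum>m\<le>N. c m z * s ^ m))"
proof -
  obtain A lg where A: "finite A" "A \<subseteq> S"
    "\<And>p m. degree p \<le> N \<Longrightarrow> coeff p m = (\<Sum>a\<in>A. lg a m * poly p a)"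
    by (rule coeff_interpolation[OF S(1), of N]) (rule that)
  have "ext_off (\<lambda>z. coeff (P z) m)" for m
    unfolding A(3)[OF P] using A(2) S(2) by (intro ext_off_sum ext_off_cmult) auto
  then have "\<forall>m. \<exists>v. v \<in> Ogerm z0 \<and> (\<forall>\<^sub>F z in nhds z0. h z \<noteq> 0 \<longrightarrow> coeff (P z) m = v z)"
    unfolding ext_off_def by blast
  from choice[OF this] obtain c where
    c: "\<forall>m. c m \<in> Ogerm z0 \<and> (\<forall>\<^sub>F z in nhds z0. h z \<noteq> 0 \<longrightarrow> coeff (P z) m = c m z)" by (elim exE)
  have "\<forall>\<^sub>F z in nhds z0. \<forall>m\<in>{..N}. h z \<noteq> 0 \<longrightarrow> coeff (P z) m = c m z"
    using c by (intro eventually_ball_finite) auto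
  then have "\<forall>\<^sub>F z in nhds z0. h z \<noteq> 0 \<longrightarrow> (\<forall>s. poly (P z) s = (\<Sum>m\<le>N. c m z * s ^ m))"
    by eventually_elim (auto simp: poly_degree_sum[OF P] intro!: sum.cong)
  then show thesis using c by (intro that[of c]) auto
qed

lemma log_closed_holo:
  assumes W: "log_closed W"
  shows "\<forall>\<^sub>F z in nhds z0. h z \<noteq> 0 \<longrightarrow> (\<exists>S. open S \<and> z \<in> S \<and> (\<forall>i j. holo_on (\<lambda>z. W z $ i $ j) S))"
proof -
  obtain \<alpha> :: "'n \<Rightarrow> 'n \<Rightarrow> complex^'n \<Rightarrow> complex" where \<alpha>: "\<And>i j. \<alpha> i j \<in> Ogerm z0"
    "\<forall>\<^sub>F z in nhds z0. h z \<noteq> 0 \<longrightarrow> (\<forall>i j. h z * W z $ i $ j = \<alpha> i j z)"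
    by (rule log_closedE[OF W]) (rule that)
  have ev: "\<forall>\<^sub>F z in nhds z0. \<forall>\<^sub>F w in nhds z. h w \<noteq> 0 \<longrightarrow> (\<forall>i j. h w * W w $ i $ j = \<alpha> i j w)"
    using \<alpha>(2) by (simp add: eventually_eventually)
  have "\<forall>\<^sub>F z in nhds z0. \<forall>i j. \<alpha> i j \<in> Ogerm z"
    using Ogerm_eventually_holo[OF \<alpha>(1)]
    by (intro eventually_all_finite) (auto simp: Ogerm_def)
  moreover have "\<forall>\<^sub>F z in nhds z0. h \<in> Ogerm z"
    using Ogerm_eventually_holo[OF hO] by (auto simp: Ogerm_def)
  ultimately show ?thesis using ev
  proof eventually_elim
    case (elim z)
    show ?case
    proof
      assume hz: "h z \<noteq> 0"
      have "(\<lambda>w. W w $ i $ j) \<in> Ogerm z" for i j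
      proof (rule Ogerm_cong[OF Ogerm_mult[OF elim(1)[rule_format, of i j] Ogerm_inverse[OF elim(2) hz]]])
        show "\<forall>\<^sub>F w in nhds z. \<alpha> i j w * inverse (h w) = W w $ i $ j"
          using elim(3) Ogerm_nonzero_near[OF elim(2) hz]
          by eventually_elim (auto simp: field_simps)
      qed
      then have "\<forall>\<^sub>F w in nhds z. \<forall>i j. \<exists>S. open S \<and> w \<in> S \<and> holo_on (\<lambda>w. W w $ i $ j) S"
        by (intro eventually_all_finite Ogerm_eventually_holo)
      then obtain T where T: "open T" "z \<in> T" "\<forall>w\<in>T. \<forall>i j. \<exists>S. open S \<and> w \<in> S \<and> holo_on (\<lambda>w. W w $ i $ j) S"
        unfolding eventually_nhds by blast
      have "holo_on (\<lambda>w. W w $ i $ j) T" for i j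
        using T(3) by (intro holo_on_ballI) blast
      then show "\<exists>S. open S \<and> z \<in> S \<and> (\<forall>i j. holo_on (\<lambda>z. W z $ i $ j) S)" using T by blast
    qed
  qed
qed

lemma log_closed_pencil:
  assumes W0: "log_closed W0" and W1: "log_closed W1"
  shows "log_closed (pencil W0 W1 s)"
  unfolding log_closed_def
proof (intro conjI allI)
  obtain \<alpha> :: "'n \<Rightarrow> 'n \<Rightarrow> complex^'n \<Rightarrow> complex" where \<alpha>: "\<And>i j. \<alpha> i j \<in> Ogerm z0"
    "\<forall>\<^sub>F z in nhds z0. h z \<noteq> 0 \<longrightarrow> (\<forall>i j. h z * W0 z $ i $ j = \<alpha> i j z)"
    by (rule log_closedE[OF W0]) (rule that)
  obtain \<beta> :: "'n \<Rightarrow> 'n \<Rightarrow> complex^'n \<Rightarrow> complex" where \<beta>: "\<And>i j. \<beta> i j \<in> Ogerm z0"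
    "\<forall>\<^sub>F z in nhds z0. h z \<noteq> 0 \<longrightarrow> (\<forall>i j. h z * W1 z $ i $ j = \<beta> i j z)"
    by (rule log_closedE[OF W1]) (rule that)
  fix i j
  show "\<exists>v\<in>Ogerm z0. \<forall>\<^sub>F z in nhds z0. h z \<noteq> 0 \<longrightarrow> h z * pencil W0 W1 s z $ i $ j = v z"
  proof (rule bexI)
    show "\<forall>\<^sub>F z in nhds z0. h z \<noteq> 0 \<longrightarrow> h z * pencil W0 W1 s z $ i $ j = \<alpha> i j z + s * (\<beta> i j z - \<alpha> i j z)"
      using \<alpha>(2) \<beta>(2)
    proof eventually_elim
      case (elim z)
      show ?case
      proof
        assume "h z \<noteq> 0"
        then have "\<alpha> i j z = h z * W0 z $ i $ j" "\<beta> i j z = h z * W1 z $ i $ j" using elim by auto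
        then show "h z * pencil W0 W1 s z $ i $ j = \<alpha> i j z + s * (\<beta> i j z - \<alpha> i j z)"
          by (simp add: pencil_def algebra_simps)
      qed
    qed
  qed (intro Ogerm_add Ogerm_mult Ogerm_diff Ogerm_const \<alpha> \<beta>)
next
  have a0: "\<forall>\<^sub>F z in nhds z0. h z \<noteq> 0 \<longrightarrow> (\<forall>i j. W0 z $ i $ j = - W0 z $ j $ i)"
    and a1: "\<forall>\<^sub>F z in nhds z0. h z \<noteq> 0 \<longrightarrow> (\<forall>i j. W1 z $ i $ j = - W1 z $ j $ i)"
    using W0 W1 by (auto simp: log_closed_def)
  show "\<forall>\<^sub>F z in nhds z0. h z \<noteq> 0 \<longrightarrow> (\<forall>i j. pencil W0 W1 s z $ i $ j = - pencil W0 W1 s z $ j $ i)"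
    using a0 a1
  proof eventually_elim
    case (elim z)
    show ?case
    proof (intro impI allI)
      fix i j assume "h z \<noteq> 0"
      then have "W0 z $ i $ j = - W0 z $ j $ i" "W1 z $ i $ j = - W1 z $ j $ i" using elim by blast+
      then show "pencil W0 W1 s z $ i $ j = - pencil W0 W1 s z $ j $ i"
        by (simp only: pencil_def vec_lambda_beta) (simp add: algebra_simps)
    qed
  qed
  have c0: "\<forall>\<^sub>F z in nhds z0. h z \<noteq> 0 \<longrightarrow> (\<forall>i j l. FD (\<lambda>z. W0 z $ j $ l) z (axis i 1)
        - FD (\<lambda>z. W0 z $ i $ l) z (axis j 1) + FD (\<lambda>z. W0 z $ i $ j) z (axis l 1) = 0)"
    and c1: "\<forall>\<^sub>F z in nhds z0. h z \<noteq> 0 \<longrightarrow> (\<forall>i j l. FD (\<lambda>z. W1 z $ j $ l) z (axis i 1)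
        - FD (\<lambda>z. W1 z $ i $ l) z (axis j 1) + FD (\<lambda>z. W1 z $ i $ j) z (axis l 1) = 0)"
    using W0 W1 by (simp_all add: log_closed_def)
  show "\<forall>\<^sub>F z in nhds z0. h z \<noteq> 0 \<longrightarrow> (\<forall>i j l. FD (\<lambda>z. pencil W0 W1 s z $ j $ l) z (axis i 1)
        - FD (\<lambda>z. pencil W0 W1 s z $ i $ l) z (axis j 1) + FD (\<lambda>z. pencil W0 W1 s z $ i $ j) z (axis l 1) = 0)"
    using c0 c1 log_closed_holo[OF W0] log_closed_holo[OF W1]
  proof eventually_elim
    case (elim z)
    show ?case
    proof (intro impI allI)
      fix i j l assume hz: "h z \<noteq> 0"
      obtain S0 where S0: "z \<in> S0" "\<And>i j. holo_on (\<lambda>z. W0 z $ i $ j) S0" using elim(3) hz by blast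
      obtain S1 where S1: "z \<in> S1" "\<And>i j. holo_on (\<lambda>z. W1 z $ i $ j) S1" using elim(4) hz by blast
      have FDp: "FD (\<lambda>z. pencil W0 W1 s z $ i $ j) z v =
         FD (\<lambda>z. W0 z $ i $ j) z v + s * (FD (\<lambda>z. W1 z $ i $ j) z v - FD (\<lambda>z. W0 z $ i $ j) z v)" for i j v
        unfolding pencil_def vec_lambda_beta
        by (rule FD_eq[OF has_derivative_add[OF _ has_derivative_mult_right[OF has_derivative_diff]]])
          (intro holo_onD(1)[OF S0(2) S0(1)] holo_onD(1)[OF S1(2) S1(1)])+
      have e0: "FD (\<lambda>z. W0 z $ j $ l) z (axis i 1)
        - FD (\<lambda>z. W0 z $ i $ l) z (axis j 1) + FD (\<lambda>z. W0 z $ i $ j) z (axis l 1) = 0"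
        and e1: "FD (\<lambda>z. W1 z $ j $ l) z (axis i 1)
        - FD (\<lambda>z. W1 z $ i $ l) z (axis j 1) + FD (\<lambda>z. W1 z $ i $ j) z (axis l 1) = 0"
        using elim(1,2) hz by blast+
      have "FD (\<lambda>z. pencil W0 W1 s z $ j $ l) z (axis i 1)
        - FD (\<lambda>z. pencil W0 W1 s z $ i $ l) z (axis j 1) + FD (\<lambda>z. pencil W0 W1 s z $ i $ j) z (axis l 1) =
        (1 - s) * (FD (\<lambda>z. W0 z $ j $ l) z (axis i 1)
        - FD (\<lambda>z. W0 z $ i $ l) z (axis j 1) + FD (\<lambda>z. W0 z $ i $ j) z (axis l 1)) +
        s * (FD (\<lambda>z. W1 z $ j $ l) z (axis i 1)
        - FD (\<lambda>z. W1 z $ i $ l) z (axis j 1) + FD (\<lambda>z. W1 z $ i $ j) z (axis l 1))"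
        unfolding FDp by (simp add: algebra_simps)
      then show "FD (\<lambda>z. pencil W0 W1 s z $ j $ l) z (axis i 1)
        - FD (\<lambda>z. pencil W0 W1 s z $ i $ l) z (axis j 1) + FD (\<lambda>z. pencil W0 W1 s z $ i $ j) z (axis l 1) = 0"
        unfolding e0 e1 by simp
    qed
  qed
qed

text \<open>Every member of the pencil is closed and logarithmic, so all values of the polynomial in
  \<open>s\<close> extend across \<open>D\<close>, and hence so do its coefficients.\<close>

theorem pencil_det:
  assumes "log_closed W0" "log_closed W1"
  obtains c where "\<And>m. c m \<in> Ogerm z0"
    "\<forall>\<^sub>F z in nhds z0. h z \<noteq> 0 \<longrightarrow>
      (\<forall>s. (h z)\<^sup>2 * det (pencil W0 W1 s z) = (\<Sum>m\<le>CARD('n). c m z * s ^ m))"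
proof -
  define M where "M z = (\<chi> i j. [:W0 z $ i $ j, W1 z $ i $ j - W0 z $ i $ j:])" for z
  define P where "P z = smult ((h z)\<^sup>2) (det (M z))" for z
  have dM: "degree (M z $ i $ j) \<le> 1" for z i j by (simp add: M_def)
  have P: "poly (P z) s = (h z)\<^sup>2 * det (pencil W0 W1 s z)" for z s
    unfolding P_def poly_smult det_poly(2)[OF dM] by (simp add: M_def pencil_def)
  have dP: "degree (P z) \<le> CARD('n)" for z
    unfolding P_def using order_trans[OF degree_smult_le det_poly(1)[OF dM]] .
  have inf: "infinite (UNIV :: complex set)" by (rule infinite_UNIV_char_0)
  show thesis
  proof (rule ext_off_coeffs[OF dP inf])
    show "ext_off (\<lambda>z. poly (P z) s)" for s
      unfolding P by (intro ext_off_det log_closed_pencil assms)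
    fix c assume "\<And>m. c m \<in> Ogerm z0"
      "\<forall>\<^sub>F z in nhds z0. h z \<noteq> 0 \<longrightarrow> (\<forall>s. poly (P z) s = (\<Sum>m\<le>CARD('n). c m z * s ^ m))"
    then show thesis unfolding P by (rule that)
  qed
qed

text \<open>\<open>ext_off_contraction\<close> wants a nondegenerate form. By \<open>c0\<close> the
  determinant polynomial at \<open>z0\<close> is not zero, so the pencil is nondegenerate off
  \<open>D\<close> near \<open>z0\<close> for all but finitely many \<open>s\<close>. Interpolation
  at the good parameters then covers the degenerate ones too.\<close>

theorem pencil_contraction:
  assumes W: "log_closed W0" "log_closed W1" and ab: "logform a" "logform b"
    and c: "\<And>m. c m \<in> Ogerm z0"
      "\<forall>\<^sub>F z in nhds z0. h z \<noteq> 0 \<longrightarrow>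
        (\<forall>s. (h z)\<^sup>2 * det (pencil W0 W1 s z) = (\<Sum>m\<le>CARD('n). c m z * s ^ m))"
    and c0: "(\<Sum>m\<le>CARD('n). c m z0 * s0 ^ m) \<noteq> 0"
  obtains d where "\<And>m. d m \<in> Ogerm z0"
    "\<forall>\<^sub>F z in nhds z0. h z \<noteq> 0 \<longrightarrow>
      (\<forall>s. (h z)\<^sup>2 * (\<Sum>l\<in>UNIV. a z $ l * det (colrep (pencil W0 W1 s z) l (b z)))
         = (\<Sum>m\<le>CARD('n). d m z * s ^ m))"
proof -
  define M where "M z = (\<chi> i j. [:W0 z $ i $ j, W1 z $ i $ j - W0 z $ i $ j:])" for z
  define R where "R z l = (\<chi> i j. if j = l then [:b z $ i:] else M z $ i $ j)" for z l
  define P where "P z = smult ((h z)\<^sup>2) (\<Sum>l\<in>UNIV. smult (a z $ l) (det (R z l)))" for z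
  have dR: "degree (R z l $ i $ j) \<le> 1" for z l i j by (simp add: R_def M_def)
  have "(\<chi> i j. poly (R z l $ i $ j) s) = colrep (pencil W0 W1 s z) l (b z)" for z l s
    by (auto simp: R_def M_def pencil_def colrep_def vec_eq_iff)
  then have P: "poly (P z) s = (h z)\<^sup>2 * (\<Sum>l\<in>UNIV. a z $ l * det (colrep (pencil W0 W1 s z) l (b z)))" for z s
    unfolding P_def poly_smult poly_sum det_poly(2)[OF dR] by simp
  have dP: "degree (P z) \<le> CARD('n)" for z
    unfolding P_def
    by (intro order_trans[OF degree_smult_le] degree_sum_le order_trans[OF degree_smult_le det_poly(1)] dR) simp
  define Q where "Q = (\<Sum>m\<le>CARD('n). monom (c m z0) m)"
  have Q: "poly Q s = (\<Sum>m\<le>CARD('n). c m z0 * s ^ m)" for s by (simp add: Q_def poly_sum poly_monom)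
  have "Q \<noteq> 0" using c0 Q[of s0] by auto
  then have "finite {s. poly Q s = 0}" by (rule poly_roots_finite)
  moreover have "infinite (UNIV :: complex set)" by (rule infinite_UNIV_char_0)
  ultimately have inf: "infinite (UNIV - {s. poly Q s = 0})" by (rule Diff_infinite_finite)
  show thesis
  proof (rule ext_off_coeffs[OF dP inf])
    fix s assume s: "s \<in> UNIV - {s. poly Q s = 0}"
    have "(\<lambda>z. \<Sum>m\<le>CARD('n). c m z * s ^ m) \<in> Ogerm z0" by (intro Ogerm_sum Ogerm_mult c Ogerm_const)
    from Ogerm_nonzero_near[OF this] s Q
    have "\<forall>\<^sub>F z in nhds z0. (\<Sum>m\<le>CARD('n). c m z * s ^ m) \<noteq> 0" by auto
    then have "\<forall>\<^sub>F z in nhds z0. h z \<noteq> 0 \<longrightarrow> det (pencil W0 W1 s z) \<noteq> 0"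
      using c(2) by eventually_elim (metis mult_zero_right)
    then show "ext_off (\<lambda>z. poly (P z) s)"
      unfolding P by (intro ext_off_contraction log_closed_pencil W ab)
  next
    fix d assume "\<And>m. d m \<in> Ogerm z0"
      "\<forall>\<^sub>F z in nhds z0. h z \<noteq> 0 \<longrightarrow> (\<forall>s. poly (P z) s = (\<Sum>m\<le>CARD('n). d m z * s ^ m))"
    then show thesis unfolding P by (rule that)
  qed
qed

end

section \<open>The Pfaffian\<close>

text \<open>\<open>wedge_power\<close> at a single point. The type of the vectors is arbitrary, so
  that the same expression can be evaluated on lists of indices.\<close>

primrec wpow :: "('v list \<Rightarrow> complex) \<Rightarrow> nat \<Rightarrow> 'v list \<Rightarrow> complex" where
  "wpow B 0 = (\<lambda>vs. 1)"
| "wpow B (Suc m) = (\<lambda>vs. (\<Sum>\<sigma> | \<sigma> permutes {..<2 + 2 * m}.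
      of_int (sign \<sigma>) * B (map (\<lambda>i. vs ! \<sigma> i) [0..<2]) *
      wpow B m (map (\<lambda>i. vs ! \<sigma> i) [2..<2 + 2 * m])) / (fact 2 * fact (2 * m)))"

lemma wedge_power_wpow: "wedge_power \<omega> m x vs = wpow (\<omega> x) m vs"
  by (induction m arbitrary: vs) (auto simp: wedge_def)

lemma wpow_cong:
  assumes "length vs = 2 * m"
    and "\<And>us. length us = 2 \<Longrightarrow> set us \<subseteq> set vs \<Longrightarrow> B us = B' us"
  shows "wpow B m vs = wpow B' m vs"
  using assms
proof (induction m arbitrary: vs)
  case (Suc m)
  have "of_int (sign \<sigma>) * B (map (\<lambda>i. vs ! \<sigma> i) [0..<2]) * wpow B m (map (\<lambda>i. vs ! \<sigma> i) [2..<2 + 2 * m]) =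
     of_int (sign \<sigma>) * B' (map (\<lambda>i. vs ! \<sigma> i) [0..<2]) * wpow B' m (map (\<lambda>i. vs ! \<sigma> i) [2..<2 + 2 * m])"
    if \<sigma>: "\<sigma> permutes {..<2 + 2 * m}" for \<sigma>
  proof -
    have in_set: "vs ! \<sigma> i \<in> set vs" if "i < 2 + 2 * m" for i
    proof -
      have "\<sigma> i < length vs" using permutes_in_image[OF \<sigma>, of i] that Suc.prems(1) by simp
      then show ?thesis by (rule nth_mem)
    qed
    have "B (map (\<lambda>i. vs ! \<sigma> i) [0..<2]) = B' (map (\<lambda>i. vs ! \<sigma> i) [0..<2])"
      by (rule Suc.prems(2)) (auto intro: in_set)
    moreover have "wpow B m (map (\<lambda>i. vs ! \<sigma> i) [2..<2 + 2 * m]) = wpow B' m (map (\<lambda>i. vs ! \<sigma> i) [2..<2 + 2 * m])"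
    proof (rule Suc.IH)
      fix us assume us: "length us = 2" "set us \<subseteq> set (map (\<lambda>i. vs ! \<sigma> i) [2..<2 + 2 * m])"
      have "set (map (\<lambda>i. vs ! \<sigma> i) [2..<2 + 2 * m]) \<subseteq> set vs" by (auto intro: in_set)
      then show "B us = B' us" using us by (intro Suc.prems(2)) auto
    qed (simp, presburger)
    ultimately show ?thesis by simp
  qed
  then show ?case
    unfolding wpow.simps by (intro arg_cong2[where f="(/)"] sum.cong refl) blast
qed simp

lemma wpow_map:
  "length vs = 2 * m \<Longrightarrow> wpow B m (map T vs) = wpow (\<lambda>us. B (map T us)) m vs"
proof (induction m arbitrary: vs)
  case (Suc m)
  have "of_int (sign \<sigma>) * B (map (\<lambda>i. map T vs ! \<sigma> i) [0..<2]) * wpow B m (map (\<lambda>i. map T vs ! \<sigma> i) [2..<2 + 2 * m]) =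
     of_int (sign \<sigma>) * B (map T (map (\<lambda>i. vs ! \<sigma> i) [0..<2])) * wpow (\<lambda>us. B (map T us)) m (map (\<lambda>i. vs ! \<sigma> i) [2..<2 + 2 * m])"
    if \<sigma>: "\<sigma> permutes {..<2 + 2 * m}" for \<sigma>
  proof -
    have nth: "map T vs ! \<sigma> i = T (vs ! \<sigma> i)" if "i < 2 + 2 * m" for i
    proof -
      have "\<sigma> i < length vs" using permutes_in_image[OF \<sigma>, of i] that Suc.prems by simp
      then show ?thesis by simp
    qed
    have "map (\<lambda>i. map T vs ! \<sigma> i) [0..<2] = map T (map (\<lambda>i. vs ! \<sigma> i) [0..<2])"
      by (auto intro!: nth)
    moreover have "map (\<lambda>i. map T vs ! \<sigma> i) [2..<2 + 2 * m] = map T (map (\<lambda>i. vs ! \<sigma> i) [2..<2 + 2 * m])"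
      by (auto intro!: nth)
    ultimately show ?thesis using Suc.IH[of "map (\<lambda>i. vs ! \<sigma> i) [2..<2 + 2 * m]"] by (simp only: length_map length_upt)
  qed
  then show ?case
    unfolding wpow.simps by (intro arg_cong2[where f="(/)"] sum.cong refl) blast
qed simp

text \<open>Expands the slots in \<open>T\<close> one at a time; \<open>v\<close> fills the other
  slots and changes in the induction.\<close>

lemma alternating_multilinear_expand:
  fixes G :: "('n::finite \<Rightarrow> complex^'m) \<Rightarrow> complex"
  assumes lin: "\<And>v i b u w. G (v(i := b *s u + w)) = b * G (v(i := u)) + G (v(i := w))"
  shows "finite T \<Longrightarrow> G (\<lambda>i. if i \<in> T then (\<Sum>j\<in>UNIV. P i j *s (ax :: 'n \<Rightarrow> _) j) else v i) =
    (\<Sum>f\<in>T \<rightarrow>\<^sub>E UNIV. (\<Prod>i\<in>T. P i (f i)) * G (\<lambda>i. if i \<in> T then ax (f i) else v i))"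
proof (induction T arbitrary: v rule: finite_induct)
  case empty
  then show ?case by simp
next
  case (insert x T)
  have zero: "G (v(i := 0)) = 0" for v i
    using lin[of v i 1 0 0] by simp
  have linsum: "G (v(x := (\<Sum>j\<in>J. P x j *s ax j))) = (\<Sum>j\<in>J. P x j * G (v(x := ax j)))" if "finite J" for v J
    using that
  proof (induction J rule: finite_induct)
    case (insert j J)
    then show ?case using lin[of v x "P x j" "ax j" "\<Sum>j\<in>J. P x j *s ax j"] by (simp add: fun_upd_def)
  qed (use zero[of v x] in \<open>simp add: fun_upd_def\<close>)
  let ?v = "\<lambda>w i. if i = x then w else v i"
  have "G (\<lambda>i. if i \<in> insert x T then (\<Sum>j\<in>UNIV. P i j *s ax j) else v i)
    = G (\<lambda>i. if i \<in> T then (\<Sum>j\<in>UNIV. P i j *s ax j) else ?v (\<Sum>j\<in>UNIV. P x j *s ax j) i)"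
    by (rule arg_cong[of _ _ G]) (use insert in auto)
  also have "\<dots> = (\<Sum>f\<in>T \<rightarrow>\<^sub>E UNIV. (\<Prod>i\<in>T. P i (f i)) * G (\<lambda>i. if i \<in> T then ax (f i) else ?v (\<Sum>j\<in>UNIV. P x j *s ax j) i))"
    by (rule insert.IH)
  also have "\<dots> = (\<Sum>f\<in>T \<rightarrow>\<^sub>E UNIV. \<Sum>j\<in>UNIV. (\<Prod>i\<in>insert x T. P i ((f(x := j)) i)) *
       G (\<lambda>i. if i \<in> insert x T then ax ((f(x := j)) i) else v i))"
  proof (rule sum.cong[OF refl])
    fix f assume "f \<in> T \<rightarrow>\<^sub>E (UNIV :: 'n set)"
    have e1: "(\<lambda>i. if i \<in> T then ax (f i) else ?v w i) = (\<lambda>i. if i \<in> T then ax (f i) else v i)(x := w)" for w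
      using insert by auto
    have e2: "(\<lambda>i. if i \<in> T then ax (f i) else v i)(x := ax j) = (\<lambda>i. if i \<in> insert x T then ax ((f(x := j)) i) else v i)" for j
      using insert by auto
    have e3: "(\<Prod>i\<in>insert x T. P i ((f(x := j)) i)) = P x j * (\<Prod>i\<in>T. P i (f i))" for j
      using insert by (simp, intro disjI2 prod.cong) auto
    show "(\<Prod>i\<in>T. P i (f i)) * G (\<lambda>i. if i \<in> T then ax (f i) else ?v (\<Sum>j\<in>UNIV. P x j *s ax j) i) =
       (\<Sum>j\<in>UNIV. (\<Prod>i\<in>insert x T. P i ((f(x := j)) i)) * G (\<lambda>i. if i \<in> insert x T then ax ((f(x := j)) i) else v i))"
      unfolding e1 linsum[OF finite] e2 e3 by (simp add: sum_distrib_left algebra_simps)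
  qed
  also have "\<dots> = (\<Sum>(j, f)\<in>UNIV \<times> (T \<rightarrow>\<^sub>E UNIV). (\<Prod>i\<in>insert x T. P i ((f(x := j)) i)) *
       G (\<lambda>i. if i \<in> insert x T then ax ((f(x := j)) i) else v i))"
    by (subst sum.swap) (simp add: sum.cartesian_product)
  also have "\<dots> = (\<Sum>f\<in>insert x T \<rightarrow>\<^sub>E UNIV. (\<Prod>i\<in>insert x T. P i (f i)) * G (\<lambda>i. if i \<in> insert x T then ax (f i) else v i))"
    unfolding PiE_insert_eq
    by (subst sum.reindex[OF inj_combinator[OF insert.hyps(2)]]) (auto intro!: sum.cong)
  finally show ?case .
qed

text \<open>The universal property of the determinant: in the multilinear expansion the
  non-injective choices of indices vanish, and the permutations contribute their signs.\<close>

lemma alternating_multilinear_det: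
  fixes G :: "('n::finite \<Rightarrow> complex^'m) \<Rightarrow> complex" and ax :: "'n \<Rightarrow> complex^'m"
  assumes lin: "\<And>v i b u w. G (v(i := b *s u + w)) = b * G (v(i := u)) + G (v(i := w))"
    and alt: "\<And>v i j. i \<noteq> j \<Longrightarrow> v i = v j \<Longrightarrow> G v = 0"
  shows "G (\<lambda>i. \<Sum>j\<in>UNIV. P $ i $ j *s ax j) = det P * G ax"
proof -
  have swap: "G (v \<circ> Transposition.transpose i j) = - G v" if "i \<noteq> j" for v i j
  proof -
    define V where "V a b = v(i := a, j := b)" for a b
    have 0: "G (V a a) = 0" for a by (rule alt[OF that]) (use that in \<open>simp add: V_def\<close>)
    have l1: "G (V (a + a') b) = G (V a b) + G (V a' b)" for a a' b
    proof -
      have "V c b = (v(j := b))(i := c)" for c using that by (auto simp: V_def fun_eq_iff)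
      then show ?thesis using lin[of "v(j := b)" i 1 a a'] by simp
    qed
    have l2: "G (V a (b + b')) = G (V a b) + G (V a b')" for a b b'
      using lin[of "v(i := a)" j 1 b b'] by (simp add: V_def)
    \<comment> \<open>Polarisation: expanding in both slots leaves the two mixed terms, as the
      diagonal ones vanish.\<close>
    have "0 = G (V (v i + v j) (v i + v j))" by (simp add: 0)
    also have "\<dots> = G (V (v i) (v j)) + G (V (v j) (v i))"
      unfolding l1 l2 by (simp add: 0)
    finally have "G (V (v j) (v i)) = - G (V (v i) (v j))" by (simp add: eq_neg_iff_add_eq_0 add.commute)
    moreover have "V (v j) (v i) = v \<circ> Transposition.transpose i j"
      using that by (auto simp: V_def fun_eq_iff Transposition.transpose_def)
    moreover have "V (v i) (v j) = v" by (auto simp: V_def)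
    ultimately show ?thesis by simp
  qed
  have perm: "G (ax \<circ> p) = of_int (sign p) * G ax" if "p permutes UNIV" for p :: "'n \<Rightarrow> 'n"
    using finite that
  proof (induction p rule: permutes_rev_induct)
    case (swap a b p)
    have "G (ax \<circ> (p \<circ> Transposition.transpose a b)) = - G (ax \<circ> p)"
      using swap(3) swap(1-5) \<open>a \<noteq> b\<close> by (simp flip: comp_assoc add: swap.hyps \<open>\<And>v i j. i \<noteq> j \<Longrightarrow> G (v \<circ> Transposition.transpose i j) = - G v\<close>)
    note 1 = this
    have "permutation p" using swap by (auto simp: permutation_permutes)
    then have 2: "sign (p \<circ> Transposition.transpose a b) = - sign p"
      using swap by (subst sign_compose) (auto simp: sign_swap_id permutation_swap_id)
    have 3: "G (ax \<circ> p) = of_int (sign p) * G ax" by (rule swap)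
    show ?case unfolding 1 2 3 by simp
  qed simp
  have "G (\<lambda>i. \<Sum>j\<in>UNIV. P $ i $ j *s ax j) = (\<Sum>f\<in>UNIV \<rightarrow>\<^sub>E UNIV. (\<Prod>i\<in>UNIV. P $ i $ f i) * G (ax \<circ> f))"
    using alternating_multilinear_expand[of G UNIV "\<lambda>i j. P $ i $ j" ax undefined, OF lin finite]
    by (simp add: comp_def)
  also have "\<dots> = (\<Sum>f | f permutes UNIV. (\<Prod>i\<in>UNIV. P $ i $ f i) * G (ax \<circ> f))"
  proof (rule sum.mono_neutral_right)
    show "\<forall>f\<in>(UNIV \<rightarrow>\<^sub>E UNIV) - {f. f permutes UNIV}. (\<Prod>i\<in>UNIV. P $ i $ f i) * G (ax \<circ> f) = 0"
    proof
      fix f :: "'n \<Rightarrow> 'n" assume "f \<in> (UNIV \<rightarrow>\<^sub>E UNIV) - {f. f permutes UNIV}"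
      then have "\<not> inj f"
        using finite_UNIV_inj_surj[of f] by (auto simp: permutes_univ bij_iff[symmetric] bij_def)
      then obtain i j where "i \<noteq> j" "f i = f j" by (auto simp: inj_def)
      then have "G (ax \<circ> f) = 0" by (intro alt[of i j]) auto
      then show "(\<Prod>i\<in>UNIV. P $ i $ f i) * G (ax \<circ> f) = 0" by simp
    qed
  qed (auto simp: PiE_def extensional_def)
  also have "\<dots> = det P * G ax"
    by (simp add: perm det_def sum_distrib_left sum_distrib_right algebra_simps)
  finally show ?thesis .
qed

text \<open>Transfers the determinant rule from families indexed by \<open>'n\<close> to lists,
  along the enumeration \<open>e\<close> of the index type.\<close>

lemma alternating_form_det:
  fixes a :: "(complex^'n) list \<Rightarrow> complex" and e :: "nat \<Rightarrow> 'n"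
  assumes a: "alternating_form N a" and e: "bij_betw e {..<N} UNIV"
  shows "a (map (\<lambda>i. \<Sum>j\<in>UNIV. P $ e i $ j *s ax j) [0..<N]) = det P * a (map (\<lambda>i. ax (e i)) [0..<N])"
proof -
  define G where "G v = a (map (\<lambda>i. v (e i)) [0..<N])" for v
  define e' where "e' = inv_into {..<N} e"
  have e': "e (e' k) = k" "e' k < N" for k
    using e by (auto simp: e'_def bij_betw_def f_inv_into_f) (metis UNIV_I inv_into_into lessThan_iff)
  have ee: "e i = k \<longleftrightarrow> i = e' k" if "i < N" for i k
    using that e e' by (metis bij_betw_inv_into_left e'_def lessThan_iff)
  have upd: "map (\<lambda>i. (v(k := u)) (e i)) [0..<N] = (map (\<lambda>i. v (e i)) [0..<N])[e' k := u]" for v k u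
    by (rule nth_equalityI) (auto simp: nth_list_update ee)
  have "G (\<lambda>i. \<Sum>j\<in>UNIV. P $ i $ j *s ax j) = det P * G ax"
  proof (rule alternating_multilinear_det)
    show "G (v(k := b *s u + w)) = b * G (v(k := u)) + G (v(k := w))" for v k b u w
      unfolding G_def upd using a e'(2)[of k] by (auto simp: alternating_form_def)
    show "G v = 0" if "i \<noteq> j" "v i = v j" for v i j
    proof -
      have *: "a (map (\<lambda>i. v (e i)) [0..<N]) = 0" if "x < y" "y < N" "v (e x) = v (e y)" for x y
      proof -
        have "\<forall>vs i j. length vs = N \<and> i < j \<and> j < N \<and> vs ! i = vs ! j \<longrightarrow> a vs = 0"
          using a by (simp add: alternating_form_def)
        from this[rule_format, of "map (\<lambda>i. v (e i)) [0..<N]" x y] show ?thesis using that by simp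
      qed
      have "e' i \<noteq> e' j" using that e' by metis
      then show ?thesis
        unfolding G_def using *[of "e' i" "e' j"] *[of "e' j" "e' i"] e' that by (cases "e' i < e' j") auto
    qed
  qed
  then show ?thesis by (simp add: G_def)
qed

section \<open>Bilinear forms and symplectic bases\<close>

definition bil :: "complex^'n^'n \<Rightarrow> complex^'n \<Rightarrow> complex^'n \<Rightarrow> complex" where
  "bil W u v = (\<Sum>i\<in>UNIV. \<Sum>j\<in>UNIV. u $ i * W $ i $ j * v $ j)"

lemma bil_add: "bil W (u + u') v = bil W u v + bil W u' v" "bil W u (v + v') = bil W u v + bil W u v'"
  by (simp_all add: bil_def algebra_simps sum.distrib)

lemma bil_smult: "bil W (a *s u) v = a * bil W u v" "bil W u (a *s v) = a * bil W u v"
  by (simp_all add: bil_def sum_distrib_left algebra_simps)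

lemma bil_0: "bil W 0 v = 0" "bil W u 0 = 0"
  by (simp_all add: bil_def)

lemma bil_sum: "bil W (\<Sum>k\<in>K. f k) v = (\<Sum>k\<in>K. bil W (f k) v)" "bil W u (\<Sum>k\<in>K. f k) = (\<Sum>k\<in>K. bil W u (f k))"
  by (induction K rule: infinite_finite_induct) (simp_all add: bil_0 bil_add)

lemma bil_axis: "bil W (axis i 1) (axis j 1) = W $ i $ j"
proof -
  have "bil W (axis i 1) (axis j 1) = (\<Sum>k\<in>UNIV. \<Sum>l\<in>UNIV. if l = j then (if k = i then W $ k $ l else 0) else 0)"
    unfolding bil_def by (intro sum.cong refl) (auto simp: axis_def)
  then show ?thesis by simp
qed

lemma bil_vmult: "bil W u v = (\<Sum>i\<in>UNIV. u $ i * (W *v v) $ i)"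
  by (simp add: bil_def matrix_vector_mult_def sum_distrib_left algebra_simps)

lemma bil_antisym:
  assumes "\<And>i j. W $ i $ j = - W $ j $ i" shows "bil W u v = - bil W v u"
proof -
  have "bil W u v = (\<Sum>j\<in>UNIV. \<Sum>i\<in>UNIV. u $ i * W $ i $ j * v $ j)"
    unfolding bil_def by (rule sum.swap)
  also have "\<dots> = (\<Sum>j\<in>UNIV. \<Sum>i\<in>UNIV. - (v $ j * W $ j $ i * u $ i))"
    by (intro sum.cong refl) (subst assms, simp)
  finally show ?thesis by (simp add: bil_def sum_negf)
qed

lemma bil_self: assumes "\<And>i j. W $ i $ j = - W $ j $ i" shows "bil W u u = 0"
proof -
  have "bil W u u = - bil W u u" by (rule bil_antisym) (rule assms)
  then show ?thesis by simp
qed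

text \<open>The standard symplectic matrix, pairing the indices \<open>2m\<close> and
  \<open>2m + 1\<close>.\<close>

definition Jst :: "nat \<Rightarrow> nat \<Rightarrow> complex" where
  "Jst i j = (if even i \<and> j = Suc i then 1 else if odd i \<and> i = Suc j then -1 else 0)"

lemma Jst_square:
  assumes "i < 2 * k" "l < 2 * k"
  shows "(\<Sum>j<2*k. Jst i j * Jst j l) = (if i = l then -1 else 0)"
proof (cases "even i")
  case True
  then have "Suc i < 2 * k" using assms by (metis Suc_lessI dvd_triv_left even_Suc)
  have "(\<Sum>j<2*k. Jst i j * Jst j l) = (\<Sum>j<2*k. if j = Suc i then Jst (Suc i) l else 0)"
    by (rule sum.cong) (use True in \<open>auto simp: Jst_def\<close>)
  also have "\<dots> = Jst (Suc i) l" using \<open>Suc i < 2 * k\<close> by simp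
  finally show ?thesis using True by (auto simp: Jst_def)
next
  case False
  then obtain i' where i': "i = Suc i'" "even i'" by (cases i) auto
  have "(\<Sum>j<2*k. Jst i j * Jst j l) = (\<Sum>j<2*k. if j = i' then - Jst i' l else 0)"
    by (rule sum.cong) (use False i' in \<open>auto simp: Jst_def\<close>)
  also have "\<dots> = - Jst i' l" using i' assms by simp
  finally show ?thesis using i' by (auto simp: Jst_def)
qed

lemma nondegenerate_ex:
  assumes "det W \<noteq> 0" "x \<noteq> 0" "\<And>i j. W $ i $ j = - W $ j $ (i::'n::finite)"
  shows "\<exists>y. bil W x y \<noteq> 0"
proof (rule ccontr)
  assume "\<not> ?thesis"
  then have 0: "bil W y x = 0" for y using bil_antisym[of W x y, OF assms(3)] by auto
  have "(W *v x) $ i = 0" for i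
  proof -
    have "bil W (axis i 1) x = (\<Sum>k\<in>UNIV. if k = i then (W *v x) $ k else 0)"
      unfolding bil_vmult by (intro sum.cong refl) (auto simp: axis_def)
    then show ?thesis using 0 by simp
  qed
  then have "W *v x = 0" by (simp add: vec_eq_iff)
  then show False
    using assms(1,2) by (metis invertible_det_nz invertible_def matrix_vector_mul_assoc matrix_vector_mul_lid matrix_vector_mult_0_right)
qed

text \<open>Symplectic Gram-Schmidt: a vector outside the span is projected to the orthogonal
  complement of the pairs found so far, and nondegeneracy supplies a partner, which is projected and
  normalised.\<close>

lemma symplectic_basis:
  fixes W :: "complex^'n^'n"
  assumes W: "det W \<noteq> 0" "\<And>i j. W $ i $ j = - W $ j $ i"
  shows "2 * k \<le> CARD('n) \<Longrightarrow> \<exists>b. \<forall>i<2*k. \<forall>j<2*k. bil W (b i) (b j) = Jst i j"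
proof (induction k)
  case (Suc k)
  then obtain b where b: "\<And>i j. i < 2*k \<Longrightarrow> j < 2*k \<Longrightarrow> bil W (b i) (b j) = Jst i j" by auto
  note asym = bil_antisym[OF W(2)]
  \<comment> \<open>The projection to the orthogonal complement; the sign is plus because the square
    of the matrix \<open>Jst\<close> is minus the identity.\<close>
  define pr where "pr y = y + (\<Sum>i<2*k. \<Sum>j<2*k. (bil W y (b i) * Jst i j) *s b j)" for y
  have pr0: "bil W (pr y) (b l) = 0" if "l < 2*k" for y l
  proof -
    have "bil W (pr y) (b l) = bil W y (b l) + (\<Sum>i<2*k. \<Sum>j<2*k. bil W y (b i) * Jst i j * bil W (b j) (b l))"
      by (simp add: pr_def bil_add bil_sum bil_smult)
    also have "\<dots> = bil W y (b l) + (\<Sum>i<2*k. bil W y (b i) * (\<Sum>j<2*k. Jst i j * Jst j l))"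
      unfolding sum_distrib_left
      by (intro arg_cong2[where f="(+)"] sum.cong refl) (simp add: b that mult.assoc)
    also have "\<dots> = bil W y (b l) + (\<Sum>i<2*k. if i = l then - bil W y (b i) else 0)"
      by (intro arg_cong2[where f="(+)"] sum.cong refl) (simp add: Jst_square that)
    finally show ?thesis using that by simp
  qed
  have "\<exists>y. y \<notin> vec.span (b ` {..<2*k})"
  proof (rule ccontr)
    assume "\<not> ?thesis"
    then have "UNIV \<subseteq> vec.span (b ` {..<2*k})" by blast
    then have "vec.dim (UNIV :: (complex^'n) set) \<le> card (b ` {..<2*k})"
      by (intro vec.dim_le_card) auto
    also have "\<dots> \<le> 2 * k" using card_image_le[of "{..<2*k}" b] by simp
    finally have "CARD('n) \<le> 2 * k" by (simp only: vec_dim_card)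
    then show False using Suc.prems by simp
  qed
  then obtain y where y: "y \<notin> vec.span (b ` {..<2*k})" by blast
  have "pr y \<noteq> 0"
  proof
    assume "pr y = 0"
    then have "y = - (\<Sum>i<2*k. \<Sum>j<2*k. (bil W y (b i) * Jst i j) *s b j)"
      unfolding pr_def by (simp add: eq_neg_iff_add_eq_0)
    moreover have "\<dots> \<in> vec.span (b ` {..<2*k})"
      by (intro vec.span_neg vec.span_sum vec.span_scale vec.span_base) auto
    ultimately show False using y by simp
  qed
  then obtain y' where y': "bil W (pr y) y' \<noteq> 0" using nondegenerate_ex[OF W(1) _ W(2)] by blast
  define x where "x = pr y"
  define z where "z = inverse (bil W x (pr y')) *s pr y'"
  \<comment> \<open>\<open>x\<close> is already orthogonal to the earlier vectors, so projecting the
    partner does not change its pairing with \<open>x\<close>.\<close>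
  have "bil W x (pr y') = bil W x y'"
    unfolding pr_def[of y'] using pr0[of _ y] by (simp add: bil_add bil_sum bil_smult x_def)
  then have xz: "bil W x z = 1" using y' by (simp add: z_def bil_smult x_def)
  have xb: "bil W x (b l) = 0" "bil W z (b l) = 0" if "l < 2*k" for l
    using pr0[OF that] by (simp_all add: x_def z_def bil_smult)
  define b' where "b' = b(2*k := x, Suc (2*k) := z)"
  have "bil W (b' i) (b' j) = Jst i j" if "i < 2 * Suc k" "j < 2 * Suc k" for i j
  proof -
    have c: "i < 2*k \<or> i = 2*k \<or> i = Suc (2*k)" "j < 2*k \<or> j = 2*k \<or> j = Suc (2*k)" using that by auto
    have J: "Jst i' (2*k) = 0" "Jst i' (Suc (2*k)) = 0" "Jst (2*k) i' = 0" "Jst (Suc (2*k)) i' = 0" if "i' < 2*k" for i'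
      using that by (auto simp: Jst_def) presburger+
    have J': "Jst (2*k) (Suc (2*k)) = 1" "Jst (Suc (2*k)) (2*k) = -1" "Jst (2*k) (2*k) = 0" "Jst (Suc (2*k)) (Suc (2*k)) = 0"
      by (auto simp: Jst_def)
    have s: "bil W x x = 0" "bil W z z = 0" "bil W z x = -1"
      using bil_self[OF W(2)] asym[of z x] xz by auto
    have r: "bil W (b l) x = 0" "bil W (b l) z = 0" if "l < 2*k" for l
      using xb[OF that] asym[of "b l"] by auto
    show ?thesis using c by (auto simp: b'_def b xb r J J' s xz)
  qed
  then show ?case by (intro exI[of _ b']) blast
qed simp

lemma bil_matrix: "bil W (P *v u) (P *v v) = bil (transpose P ** (W ** P)) u v"
proof -
  have "bil W (P *v u) (P *v v) = (\<Sum>i\<in>UNIV. (P *v u) $ i * (W *v (P *v v)) $ i)" by (rule bil_vmult)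
  also have "\<dots> = (\<Sum>i\<in>UNIV. \<Sum>k\<in>UNIV. P $ i $ k * u $ k * (W *v (P *v v)) $ i)"
    by (simp add: matrix_vector_mult_def[of P u] sum_distrib_right)
  also have "\<dots> = (\<Sum>k\<in>UNIV. \<Sum>i\<in>UNIV. P $ i $ k * u $ k * (W *v (P *v v)) $ i)" by (rule sum.swap)
  also have "\<dots> = (\<Sum>k\<in>UNIV. u $ k * (transpose P *v (W *v (P *v v))) $ k)"
    by (subst (2) matrix_vector_mult_def) (simp add: transpose_def sum_distrib_left algebra_simps)
  finally show ?thesis by (simp add: bil_vmult matrix_vector_mul_assoc matrix_mul_assoc)
qed

text \<open>The value of \<open>\<omega>^n\<close> on the coordinate basis, a constant multiple of
  the Pfaffian.\<close>

definition pf :: "(nat \<Rightarrow> 'n) \<Rightarrow> nat \<Rightarrow> complex^'n^'n \<Rightarrow> complex" where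
  "pf e n W = wpow (\<lambda>us. bil W (us ! 0) (us ! 1)) n (map (\<lambda>i. axis (e i) 1) [0..<2*n])"

text \<open>The constant \<open>\<kappa>\<close> only depends on the normalisation of the wedge product.\<close>

theorem pf_square:
  fixes e :: "nat \<Rightarrow> 'n::finite"
  assumes n: "CARD('n) = 2 * n" and e: "bij_betw e {..<2*n} UNIV"
  obtains \<kappa> :: complex where "\<And>W. \<lbrakk>\<And>i j. W $ i $ j = - W $ j $ i;
      alternating_form (2*n) (wpow (\<lambda>us. bil W (us ! 0) (us ! 1)) n)\<rbrakk> \<Longrightarrow> (pf e n W)\<^sup>2 = \<kappa> * det W"
proof -
  define e' where "e' = inv_into {..<2*n} e"
  have e': "e (e' k) = k" "e' k < 2*n" for k
    using e by (auto simp: e'_def bij_betw_def f_inv_into_f) (metis UNIV_I inv_into_into lessThan_iff)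
  have ee: "e' (e i) = i" if "i < 2*n" for i
    using that e by (simp add: e'_def bij_betw_inv_into_left)
  define J where "J = (\<chi> i j. Jst (e' i) (e' j))"
  have JJ: "J ** J = - mat 1"
  proof -
    have "(J ** J) $ i $ l = (- mat 1) $ i $ l" for i l
    proof -
      have "(J ** J) $ i $ l = (\<Sum>j\<in>UNIV. Jst (e' i) (e' j) * Jst (e' j) (e' l))"
        by (simp add: matrix_matrix_mult_def J_def)
      also have "\<dots> = (\<Sum>j<2*n. Jst (e' i) (e' (e j)) * Jst (e' (e j)) (e' l))"
        using sum.reindex_bij_betw[OF e, of "\<lambda>j. Jst (e' i) (e' j) * Jst (e' j) (e' l)"] by simp
      also have "\<dots> = (\<Sum>j<2*n. Jst (e' i) j * Jst j (e' l))"
        by (rule sum.cong) (simp_all add: ee)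
      also have "\<dots> = (if e' i = e' l then -1 else 0)" by (rule Jst_square) (rule e')+
      also have "\<dots> = (- mat 1) $ i $ l" using e' by (auto simp: mat_def) metis
      finally show ?thesis .
    qed
    then show ?thesis by (simp add: vec_eq_iff)
  qed
  have detJ: "det J \<noteq> 0"
  proof -
    have "J ** (- J) = - (J ** J)" by (simp add: matrix_matrix_mult_def vec_eq_iff sum_negf)
    then have "J ** (- J) = mat 1" using JJ by simp
    then have "det J * det (- J) = 1" by (metis det_mul det_I)
    then show ?thesis by auto
  qed
  \<comment> \<open>The standard form on indices: \<open>k0\<close> is the value of
    \<open>wpow\<close> on a symplectic basis, whatever \<open>W\<close> is.\<close>
  define jl :: "nat list \<Rightarrow> complex" where "jl us = Jst (us ! 0) (us ! 1)" for us
  define k0 where "k0 = wpow jl n [0..<2*n]"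
  have main: "(pf e n W)\<^sup>2 = (k0\<^sup>2 / det J) * det W"
    if asym: "\<And>i j. W $ i $ j = - W $ j $ i"
      and a: "alternating_form (2*n) (wpow (\<lambda>us. bil W (us ! 0) (us ! 1)) n)" for W
  proof -
    let ?a = "wpow (\<lambda>us. bil W (us ! 0) (us ! 1)) n"
    have col: "?a (map (\<lambda>i. P *v axis (e i) 1) [0..<2*n]) = det P * pf e n W" for P
    proof -
      have "P *v axis k 1 = (\<Sum>j\<in>UNIV. transpose P $ k $ j *s axis j 1)" for k
        using vec_axis_expand[of "P *v axis k 1"]
        by (simp add: matrix_vector_mult_def axis_def transpose_def if_distrib cong: if_cong)
      then have "?a (map (\<lambda>i. P *v axis (e i) 1) [0..<2*n]) =
         ?a (map (\<lambda>i. \<Sum>j\<in>UNIV. transpose P $ e i $ j *s axis j 1) [0..<2*n])" by simp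
      also have "\<dots> = det P * pf e n W"
        unfolding alternating_form_det[OF a e] by (simp add: pf_def)
      finally show ?thesis .
    qed
    show ?thesis
    proof (cases "det W = 0")
      case True
      then have "\<exists>v. v \<noteq> 0 \<and> W *v v = 0"
        by (metis invertible_det_nz invertible_left_inverse matrix_left_invertible_ker)
      then obtain v where v: "v \<noteq> 0" "W *v v = 0" by blast
      then obtain m where m: "v $ m \<noteq> 0" by (auto simp: vec_eq_iff)
      \<comment> \<open>A projection along the kernel vector \<open>v\<close> of \<open>W\<close>.
        It preserves the form but is singular, so
        \<open>pf e n W = det P * pf e n W = 0\<close>.\<close>
      define P where "P = (\<chi> i j. (if i = j then 1 else 0) - (if j = m then v $ i / v $ m else 0))"
      have Pu: "P *v u = u + (- (u $ m / v $ m)) *s v" for u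
      proof -
        have "(P *v u) $ i = u $ i - u $ m / v $ m * v $ i" for i
        proof -
          have "(P *v u) $ i = (\<Sum>j\<in>UNIV. (if i = j then u $ j else 0) - (if j = m then u $ m / v $ m * v $ i else 0))"
            unfolding P_def matrix_vector_mult_def vec_lambda_beta by (rule sum.cong) (auto simp: algebra_simps)
          then show ?thesis by (simp add: sum_subtractf)
        qed
        then show ?thesis by (simp add: vec_eq_iff)
      qed
      have Wv: "bil W u v = 0" "bil W v u = 0" for u
        using bil_antisym[of W v u, OF asym] v(2) by (auto simp: bil_vmult)
      have PW: "bil W (P *v u) (P *v u') = bil W u u'" for u u'
        unfolding Pu by (simp only: bil_add bil_smult Wv) simp
      have "P *v v = 0" using m unfolding Pu by (simp add: vec_eq_iff)
      then have "det P = 0"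
        using v(1) by (metis invertible_det_nz invertible_left_inverse matrix_left_invertible_ker)
      moreover have "?a (map (\<lambda>i. P *v axis (e i) 1) [0..<2*n]) = pf e n W"
      proof -
        have "map (\<lambda>i. P *v axis (e i) 1) [0..<2*n] = map ((*v) P) (map (\<lambda>i. axis (e i) 1) [0..<2*n])" by simp
        also have "?a \<dots> = wpow (\<lambda>us. bil W (map ((*v) P) us ! 0) (map ((*v) P) us ! 1)) n (map (\<lambda>i. axis (e i) 1) [0..<2*n])"
          by (rule wpow_map) simp
        also have "\<dots> = pf e n W"
          unfolding pf_def by (rule wpow_cong) (auto simp: PW)
        finally show ?thesis .
      qed
      ultimately show ?thesis using True col[of P] by simp
    next
      case False
      from symplectic_basis[OF False asym, of n] n
      obtain b where b: "\<And>i j. i < 2*n \<Longrightarrow> j < 2*n \<Longrightarrow> bil W (b i) (b j) = Jst i j" by auto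
      \<comment> \<open>The columns of \<open>P\<close> are a symplectic basis, whence
        \<open>(det P)\<^sup>2 * det W = det J\<close> and \<open>det P * pf e n W = k0\<close>;
        eliminating \<open>det P\<close> gives the claim.\<close>
      define P where "P = (\<chi> i j. b (e' j) $ i)"
      have Pax: "P *v axis k 1 = b (e' k)" for k
        by (simp add: P_def vec_eq_iff matrix_vector_mult_def axis_def if_distrib cong: if_cong)
      have "transpose P ** (W ** P) = J"
      proof -
        have "(transpose P ** (W ** P)) $ i $ j = J $ i $ j" for i j
          using bil_axis[of "transpose P ** (W ** P)" i j] b[OF e'(2) e'(2), of i j]
          by (simp add: J_def Pax flip: bil_matrix)
        then show ?thesis by (simp add: vec_eq_iff)
      qed
      then have d: "(det P)\<^sup>2 * det W = det J"
        by (metis det_mul det_transpose mult.commute mult.left_commute power2_eq_square)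
      have eq: "map (\<lambda>i. P *v axis (e i) 1) [0..<2*n] = map b [0..<2*n]"
        by (simp add: Pax ee)
      have "?a (map b [0..<2*n]) = det P * pf e n W" unfolding eq[symmetric] by (rule col)
      moreover have "?a (map b [0..<2*n]) = k0"
      proof -
        have "?a (map b [0..<2*n]) = wpow (\<lambda>us. bil W (map b us ! 0) (map b us ! 1)) n [0..<2*n]"
          by (rule wpow_map) simp
        also have "\<dots> = k0"
          unfolding k0_def
        proof (rule wpow_cong)
          fix us assume us: "length us = 2" "set us \<subseteq> set [0..<2*n]"
          then have "us ! 0 \<in> set us" "us ! 1 \<in> set us" by (simp_all add: nth_mem)
          then have "us ! 0 < 2*n" "us ! 1 < 2*n" using us(2) by auto
          then show "bil W (map b us ! 0) (map b us ! 1) = jl us" using us b by (simp add: jl_def)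
        qed simp
        finally show ?thesis .
      qed
      ultimately have "k0 = det P * pf e n W" by simp
      then have "k0\<^sup>2 * det W = (pf e n W)\<^sup>2 * det J"
        by (simp add: power_mult_distrib mult.commute mult.left_commute flip: d)
      then show ?thesis using detJ by (simp add: field_simps)
    qed
  qed
  show thesis by (rule that[of "k0\<^sup>2 / det J"]) (rule main)
qed

section \<open>Holomorphic flows\<close>

text \<open>Points of \<open>\<complex> \<times> \<complex>\<^sup>n\<close> are encoded as vectors indexed by \<open>'n option\<close>; the coordinate
  \<open>None\<close> is the time, which is complex, so that smoothness in time and space of the flow follows
  from holomorphy.\<close>

definition pt :: "complex \<Rightarrow> complex^'n \<Rightarrow> complex^('n option)" where
  "pt \<tau> z = (\<chi> k. case k of None \<Rightarrow> \<tau> | Some i \<Rightarrow> z $ i)"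

definition sp :: "complex^('n option) \<Rightarrow> complex^'n" where
  "sp w = (\<chi> i. w $ Some i)"

lemma pt_simps [simp]: "pt \<tau> z $ None = \<tau>" "pt \<tau> z $ Some i = z $ i" "sp (pt \<tau> z) = z" "pt (w $ None) (sp w) = w"
  by (auto simp: pt_def sp_def vec_eq_iff split: option.splits)

lemma sp_simps [simp]: "sp (a + b) = sp a + sp b" "sp (c *s a) = c *s sp a" "sp (r *\<^sub>R a) = r *\<^sub>R sp a"
    "sp (axis None x) = 0" "sp w $ i = w $ Some i"
  by (auto simp: sp_def vec_eq_iff axis_def)

lemma pt_split: "pt \<tau> z = \<tau> *s axis None 1 + pt 0 z"
  by (auto simp: vec_eq_iff pt_def axis_def split: option.splits)

lemma sum_option: "(\<Sum>k\<in>(UNIV :: 'n::finite option set). f k) = f None + (\<Sum>i\<in>UNIV. f (Some i))"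
  by (simp add: UNIV_option_conv sum.reindex)

lemma norm_pt0: "norm (pt 0 z) = norm z"
  by (simp add: norm_vec_def L2_set_def sum_option)

lemma norm_sp: "norm (sp w) \<le> norm w"
  unfolding norm_vec_def L2_set_def by (rule real_sqrt_le_mono) (simp add: sum_option)

lemma norm_pt: "norm (pt \<tau> (z::complex^'n)) \<le> cmod \<tau> + norm z"
proof -
  have "norm (pt \<tau> z) \<le> norm (\<tau> *s axis None 1 :: complex^('n option)) + norm (pt 0 z)"
    unfolding pt_split[of \<tau> z] by (rule norm_triangle_ineq)
  moreover have "norm (axis None 1 :: complex^('n option)) = 1"
    by (simp add: norm_vec_def L2_set_def sum_option axis_def)
  ultimately show ?thesis by (simp add: norm_smult_vec norm_pt0)
qed

lemma pt_diff: "pt \<tau> z - pt \<tau>' z' = pt (\<tau> - \<tau>') (z - z')"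
  by (auto simp: vec_eq_iff pt_def split: option.splits)

lemma pt_add: "pt \<tau> z + pt \<tau>' z' = pt (\<tau> + \<tau>') (z + z')"
  by (auto simp: vec_eq_iff pt_def split: option.splits)

lemma dist_pt: "dist (pt \<tau> z) (pt \<tau>' z') \<le> dist \<tau> \<tau>' + dist z z'"
  unfolding dist_norm pt_diff by (rule norm_pt)

lemma bounded_linear_sp: "bounded_linear sp"
  by (rule bounded_linear_intro[where K=1]) (simp_all add: norm_sp)

lemma bounded_linear_pt_real: "bounded_linear (\<lambda>(t, z). pt (complex_of_real t) z)"
proof (rule bounded_linear_intro[where K=2])
  fix x :: "real \<times> (complex^'a)"
  obtain t z where x: "x = (t, z)" by (cases x)
  have "norm (pt (complex_of_real t) z) \<le> \<bar>t\<bar> + norm z" using norm_pt[of "complex_of_real t" z] by simp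
  also have "\<dots> \<le> norm (t, z) + norm (t, z)"
    by (intro add_mono) (metis norm_fst_le fst_conv real_norm_def, metis norm_snd_le snd_conv)
  finally show "norm (case x of (t, z) \<Rightarrow> pt (complex_of_real t) z) \<le> norm x * 2" by (simp add: x)
qed (auto simp: pt_add vec_eq_iff pt_def scaleR_conv_of_real[of _ "_::complex"] split: option.splits)

lemma continuous_on_pt [continuous_intros]:
  assumes "continuous_on S f" "continuous_on S g" shows "continuous_on S (\<lambda>x. pt (f x) (g x))"
proof -
  have "continuous_on S (\<lambda>x. \<chi> k. case k of None \<Rightarrow> f x | Some i \<Rightarrow> g x $ i)"
  proof (rule continuous_on_vec_lambda)
    fix k :: "'b option"
    show "continuous_on S (\<lambda>x. case k of None \<Rightarrow> f x | Some i \<Rightarrow> g x $ i)"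
      using assms by (cases k) (auto intro: continuous_intros)
  qed
  then show ?thesis by (simp add: pt_def)
qed

lemma hmap_pt:
  assumes "holo_on f S" "hmap g S" shows "hmap (\<lambda>w. pt (f w) (g w)) S"
  unfolding hmap_def
proof
  fix k show "holo_on (\<lambda>z. pt (f z) (g z) $ k) S"
    using assms by (cases k) (auto simp: hmap_def)
qed

lemma hmap_sp: "hmap sp S"
  unfolding hmap_def sp_simps by (intro allI holo_on_coord)

text \<open>Scales the time and keeps the point: for \<open>\<sigma>\<close> in
  \<open>{0..1}\<close> it runs through the segment from time 0 to the complex time of
  \<open>w\<close>.\<close>

definition dil :: "real \<Rightarrow> complex^('n::finite option) \<Rightarrow> complex^('n option)" where
  "dil \<sigma> w = pt (of_real \<sigma> * w $ None) (sp w)"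

lemma hmap_dil: "hmap (dil \<sigma>) S"
  unfolding dil_def[abs_def] by (intro hmap_pt hmap_sp holo_intros)

lemma FD_dil:
  fixes w v :: "complex^('n::finite option)"
  shows "FD (dil \<sigma>) w v = dil \<sigma> v"
proof -
  have "bounded_linear (dil \<sigma> :: complex^('n option) \<Rightarrow> _)"
  proof (rule bounded_linear_intro[where K="\<bar>\<sigma>\<bar> + 1"])
    fix w :: "complex^('n option)"
    have "norm (dil \<sigma> w) \<le> \<bar>\<sigma>\<bar> * norm (w $ None) + norm (sp w)"
      unfolding dil_def using norm_pt[of "of_real \<sigma> * w $ None" "sp w"] by (simp add: norm_mult)
    also have "\<dots> \<le> \<bar>\<sigma>\<bar> * norm w + norm w"
      by (intro add_mono mult_left_mono norm_sp Finite_Cartesian_Product.norm_nth_le) auto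
    finally show "norm (dil \<sigma> w) \<le> norm w * (\<bar>\<sigma>\<bar> + 1)" by (simp add: algebra_simps)
  qed (auto simp: dil_def vec_eq_iff pt_def algebra_simps split: option.splits)
  then show ?thesis by (intro FD_eq bounded_linear_imp_has_derivative)
qed

lemma dil_1 [simp]: "dil 1 w = w" by (simp add: dil_def)

lemma dil_split: "dil \<sigma> v = (of_real \<sigma> * v $ None) *s axis None 1 + pt 0 (sp v)"
  unfolding dil_def by (rule pt_split)

lemma continuous_on_dil [continuous_intros]:
  assumes "continuous_on S f" "continuous_on S g" shows "continuous_on S (\<lambda>x. dil (f x) (g x))"
  unfolding dil_def
  by (intro continuous_intros assms bounded_linear.continuous_on[OF bounded_linear_sp])

text \<open>The complex line integral of \<open>G\<close> in time from 0 to \<open>w $ None\<close>,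
  along the segment parametrised by \<open>\<sigma>\<close>.\<close>

definition time_integral :: "(complex^('n::finite option) \<Rightarrow> complex) \<Rightarrow> complex^('n option) \<Rightarrow> complex" where
  "time_integral G w = integral {0..1} (\<lambda>\<sigma>. w $ None * G (dil \<sigma> w))"

lemma time_integral_integrable:
  assumes "holo_on G \<Omega>" "\<And>\<sigma>. \<sigma> \<in> {0..1} \<Longrightarrow> dil \<sigma> w \<in> \<Omega>"
  shows "(\<lambda>\<sigma>. w $ None * G (dil \<sigma> w)) integrable_on {0..1}"
proof (rule integrable_continuous_real)
  show "continuous_on {0..1} (\<lambda>\<sigma>. w $ None * G (dil \<sigma> w))"
    by (intro continuous_intros continuous_on_compose2[OF holo_on_continuous[OF assms(1)]]) (use assms(2) in auto)
qed

text \<open>Holomorphy is differentiation under the integral sign, with a complex linear integrand.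
  In the time direction that integrand is itself the \<open>\<sigma>\<close>-derivative of
  \<open>\<sigma> *\<^sub>R G (dil \<sigma> w)\<close>, so the fundamental theorem of calculus
  returns \<open>G w\<close>.\<close>

theorem time_integral_holo:
  fixes G :: "complex^('n::finite option) \<Rightarrow> complex"
  assumes \<Omega>: "open \<Omega>" and G: "holo_on G \<Omega>"
    and star: "\<And>w \<sigma>. w \<in> \<Omega> \<Longrightarrow> \<sigma> \<in> {0..1} \<Longrightarrow> dil \<sigma> w \<in> \<Omega>"
  shows "holo_on (time_integral G) \<Omega>"
    and "w \<in> \<Omega> \<Longrightarrow> FD (time_integral G) w (axis None 1) = G w"
proof -
  define D where "D w \<sigma> v = v $ None * G (dil \<sigma> w) + w $ None * FD G (dil \<sigma> w) (dil \<sigma> v)" for w v :: "complex^('n option)" and \<sigma>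
  have Dder: "((\<lambda>w. w $ None * G (dil \<sigma> w)) has_derivative D w \<sigma>) (at w)" if "w \<in> \<Omega>" "\<sigma> \<in> {0..1}" for w \<sigma>
  proof -
    have GS: "((\<lambda>w. G (dil \<sigma> w)) has_derivative (\<lambda>v. FD G (dil \<sigma> w) (dil \<sigma> v))) (at w)"
    proof -
      have c: "holo_on (\<lambda>w. G (dil \<sigma> w)) \<Omega>"
        using that star by (intro holo_on_compose(1)[OF G hmap_dil]) auto
      have "FD (\<lambda>w. G (dil \<sigma> w)) w v = FD G (dil \<sigma> w) (dil \<sigma> v)" for v
        using holo_on_compose(2)[OF G hmap_dil, of \<sigma> \<Omega> w v] that star by (auto simp: FD_dil)
      then show ?thesis using holo_onD(1)[OF c that(1)] by (metis (no_types, lifting) ext)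
    qed
    have "((\<lambda>w. w $ None) has_derivative (\<lambda>v. v $ None)) (at w)"
      by (intro bounded_linear_imp_has_derivative bounded_linear_vec_nth)
    from has_derivative_mult[OF this GS] show ?thesis
      by (simp add: D_def[abs_def] add.commute)
  qed
  have Dlin: "D w \<sigma> (c *s v) = c * D w \<sigma> v" if "w \<in> \<Omega>" "\<sigma> \<in> {0..1}" for w v \<sigma> c
  proof -
    have "dil \<sigma> (c *s v) = c *s dil \<sigma> v"
      by (auto simp: dil_def vec_eq_iff pt_def algebra_simps split: option.splits)
    then show ?thesis
      unfolding D_def using holo_onD(2)[OF G star[OF that]] by (simp add: algebra_simps)
  qed
  define fx where "fx w \<sigma> = Blinfun (D w \<sigma>)" for w \<sigma>
  have fx: "blinfun_apply (fx w \<sigma>) = D w \<sigma>" if "w \<in> \<Omega>" "\<sigma> \<in> {0..1}" for w \<sigma>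
    unfolding fx_def by (rule bounded_linear_Blinfun_apply) (use Dder[OF that] has_derivative_bounded_linear in blast)
  have Dcont: "continuous_on (\<Omega> \<times> {0..1}) (\<lambda>(w, \<sigma>). D w \<sigma> v)" for v
  proof -
    have "D w \<sigma> v = v $ None * G (dil \<sigma> w) + w $ None *
        (of_real \<sigma> * v $ None * FD G (dil \<sigma> w) (axis None 1) + FD G (dil \<sigma> w) (pt 0 (sp v)))"
      if "w \<in> \<Omega>" "\<sigma> \<in> {0..1}" for w \<sigma>
      unfolding D_def dil_split[of \<sigma> v]
      by (simp add: FD_add[OF G star[OF that]] holo_onD(2)[OF G star[OF that]])
    moreover have "continuous_on (\<Omega> \<times> {0..1}) (\<lambda>(w, \<sigma>). v $ None * G (dil \<sigma> w) + w $ None *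
        (of_real \<sigma> * v $ None * FD G (dil \<sigma> w) (axis None 1) + FD G (dil \<sigma> w) (pt 0 (sp v))))"
      unfolding split_beta
      by (intro continuous_intros continuous_on_compose2[OF holo_on_continuous[OF G]]
          continuous_on_compose2[OF holo_FD_continuous[OF \<Omega> G]]) (use star in auto)
    ultimately show ?thesis by (subst continuous_on_cong[OF refl]) (auto simp: split_beta)
  qed
  have fxcont: "continuous_on (\<Omega> \<times> {0..1}) (\<lambda>(w, \<sigma>). fx w \<sigma>)"
  proof (rule continuous_on_blinfun_componentwise)
    fix v :: "complex^('n option)"
    show "continuous_on (\<Omega> \<times> {0..1}) (\<lambda>x. blinfun_apply (case x of (w, \<sigma>) \<Rightarrow> fx w \<sigma>) v)"
      by (rule continuous_on_cong[THEN iffD1, OF refl _ Dcont[of v]]) (auto simp: fx)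
  qed
  have pc: "continuous_on {0..1::real} (\<lambda>\<sigma>. (w, \<sigma>))" for w :: "complex^('n option)"
    by (intro continuous_intros)
  have I: "(time_integral G has_derivative (\<lambda>v. integral {0..1} (\<lambda>\<sigma>. D w \<sigma> v))) (at w)" if w: "w \<in> \<Omega>" for w
  proof -
    obtain r where r: "r > 0" "ball w r \<subseteq> \<Omega>" using w \<Omega> open_contains_ball by blast
    have "((\<lambda>w. integral (cbox 0 1) (\<lambda>\<sigma>. w $ None * G (dil \<sigma> w))) has_derivative
        blinfun_apply (integral (cbox 0 1) (fx w))) (at w within ball w r)"
    proof (rule leibniz_rule)
      show "((\<lambda>w. w $ None * G (dil \<sigma> w)) has_derivative blinfun_apply (fx x \<sigma>)) (at x within ball w r)"
        if "x \<in> ball w r" "\<sigma> \<in> cbox 0 1" for x \<sigma>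
      proof -
        have x: "x \<in> \<Omega>" "\<sigma> \<in> {0..1}" using that r by auto
        show ?thesis unfolding fx[OF x] by (rule has_derivative_at_withinI[OF Dder[OF x]])
      qed
      show "(\<lambda>\<sigma>. x $ None * G (dil \<sigma> x)) integrable_on cbox 0 1" if "x \<in> ball w r" for x
        using time_integral_integrable[OF G, of x] star that r by auto
      show "continuous_on (ball w r \<times> cbox 0 1) (\<lambda>(x, t). fx x t)"
        by (rule continuous_on_subset[OF fxcont]) (use r in auto)
    qed (use r in auto)
    moreover have "blinfun_apply (integral (cbox 0 1) (fx w)) = (\<lambda>v. integral {0..1} (\<lambda>\<sigma>. D w \<sigma> v))"
    proof
      fix v
      have "continuous_on {0..1} (fx w)"
        using continuous_on_compose2[OF fxcont pc[of w]] w by auto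
      then have "fx w integrable_on {0..1}" by (rule integrable_continuous_real)
      then have "blinfun_apply (integral {0..1} (fx w)) v = integral {0..1} (\<lambda>\<sigma>. blinfun_apply (fx w \<sigma>) v)"
        by (rule blinfun_apply_integral)
      also have "\<dots> = integral {0..1} (\<lambda>\<sigma>. D w \<sigma> v)"
        by (rule integral_cong) (simp add: fx w)
      finally show "blinfun_apply (integral (cbox 0 1) (fx w)) v = integral {0..1} (\<lambda>\<sigma>. D w \<sigma> v)" by simp
    qed
    ultimately show ?thesis
      using r at_within_open[of w "ball w r"] by (simp add: time_integral_def[abs_def])
  qed
  show "holo_on (time_integral G) \<Omega>"
  proof (rule holo_onI[OF I])
    fix w c v assume w: "w \<in> \<Omega>"
    have "integral {0..1} (\<lambda>\<sigma>. D w \<sigma> (c *s v)) = integral {0..1} (\<lambda>\<sigma>. c * D w \<sigma> v)"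
      by (rule integral_cong) (simp add: Dlin w)
    then show "integral {0..1} (\<lambda>\<sigma>. D w \<sigma> (c *s v)) = c * integral {0..1} (\<lambda>\<sigma>. D w \<sigma> v)" by simp
  qed
  assume w: "w \<in> \<Omega>"
  have "((\<lambda>\<sigma>. D w \<sigma> (axis None 1)) has_integral (1 *\<^sub>R G (dil 1 w) - 0 *\<^sub>R G (dil 0 w))) {0..1}"
  proof (rule fundamental_theorem_of_calculus)
    fix \<sigma> :: real assume \<sigma>: "\<sigma> \<in> {0..1}"
    have sc: "dil \<sigma> (axis None 1) = complex_of_real \<sigma> *s axis None 1" for \<sigma> :: real
      by (simp add: dil_split pt_def axis_def vec_eq_iff split: option.splits)
    have d1: "((\<lambda>\<sigma>. dil \<sigma> w) has_derivative (\<lambda>s. s *\<^sub>R (w $ None *s axis None 1))) (at \<sigma> within {0..1})"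
    proof -
      have eq: "dil \<sigma> w = \<sigma> *\<^sub>R (w $ None *s axis None 1) + pt 0 (sp w)" for \<sigma>
        by (simp add: dil_split[of \<sigma> w] scaleR_vec_smult)
      show ?thesis unfolding eq by (auto intro!: derivative_eq_intros)
    qed
    have d2: "((\<lambda>\<sigma>. G (dil \<sigma> w)) has_derivative (\<lambda>s. FD G (dil \<sigma> w) (s *\<^sub>R (w $ None *s axis None 1)))) (at \<sigma> within {0..1})"
      by (rule has_derivative_compose[OF d1 holo_onD(1)[OF G star[OF w \<sigma>]]])
    have e: "FD G (dil \<sigma> w) (s *\<^sub>R (w $ None *s axis None 1)) = s *\<^sub>R (w $ None * FD G (dil \<sigma> w) (axis None 1))" for s
      using holo_onD(2)[OF G star[OF w \<sigma>]] by (simp add: scaleR_vec_smult scaleR_conv_of_real)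
    have "((\<lambda>\<sigma>. \<sigma> *\<^sub>R G (dil \<sigma> w)) has_derivative
        (\<lambda>s. \<sigma> *\<^sub>R (s *\<^sub>R (w $ None * FD G (dil \<sigma> w) (axis None 1))) + s *\<^sub>R G (dil \<sigma> w))) (at \<sigma> within {0..1})"
      using has_derivative_scaleR[OF has_derivative_ident d2] unfolding e .
    moreover have "(\<lambda>s. \<sigma> *\<^sub>R (s *\<^sub>R (w $ None * FD G (dil \<sigma> w) (axis None 1))) + s *\<^sub>R G (dil \<sigma> w)) =
      (\<lambda>s. s *\<^sub>R D w \<sigma> (axis None 1))"
      unfolding D_def sc using holo_onD(2)[OF G star[OF w \<sigma>]]
      by (auto simp: fun_eq_iff algebra_simps scaleR_conv_of_real axis_def)
    ultimately show "((\<lambda>\<sigma>. \<sigma> *\<^sub>R G (dil \<sigma> w)) has_vector_derivative D w \<sigma> (axis None 1)) (at \<sigma> within {0..1})"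
      by (simp add: has_vector_derivative_def)
  qed simp
  then have "integral {0..1} (\<lambda>\<sigma>. D w \<sigma> (axis None 1)) = G w" by (simp add: integral_unique)
  then show "FD (time_integral G) w (axis None 1) = G w" by (rule FD_eqI[OF I[OF w]])
qed

text \<open>A closed tube around the compact segment stays inside \<open>U\<close>, and there the
  partial derivatives of \<open>X\<close> are bounded. Complex times within \<open>e\<close> of the
  real interval are included, as the flow is to be holomorphic in time.\<close>

lemma local_lipschitz:
  fixes X :: "complex^('n option) \<Rightarrow> complex^'n"
  assumes U: "open U" and X: "hmap X U" and seg: "\<And>t. t \<in> {0..1} \<Longrightarrow> pt (complex_of_real t) z0 \<in> U"
  obtains e L where "0 < e" "e < 1" "0 < L"
    "\<And>t \<tau> z. t \<in> {0..1} \<Longrightarrow> dist \<tau> (complex_of_real t) < e \<Longrightarrow> z \<in> ball z0 e \<Longrightarrow> pt \<tau> z \<in> U"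
    "\<And>t \<tau> z z'. t \<in> {0..1} \<Longrightarrow> dist \<tau> (complex_of_real t) < e \<Longrightarrow> z \<in> ball z0 e \<Longrightarrow> z' \<in> ball z0 e \<Longrightarrow>
        norm (X (pt \<tau> z) - X (pt \<tau> z')) \<le> L * norm (z - z')"
proof -
  define C where "C = (\<lambda>t. pt (complex_of_real t) z0) ` {0..1}"
  have C: "compact C" unfolding C_def by (intro compact_continuous_image continuous_intros) auto
  have CU: "C \<subseteq> U" using seg by (auto simp: C_def)
  obtain d where d: "d > 0" "(\<Union>x\<in>C. ball x d) \<subseteq> U"
    by (rule compact_subset_open_imp_ball_epsilon_subset[OF C U CU])
  define N where "N = {x + y | x y. x \<in> C \<and> y \<in> cball 0 (d/2)}"
  have "compact N" unfolding N_def by (intro compact_sums C compact_cball)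
  have NU: "N \<subseteq> U"
  proof
    fix w assume "w \<in> N"
    then obtain x y where "w = x + y" "x \<in> C" "y \<in> cball 0 (d/2)" by (auto simp: N_def)
    then have "w \<in> ball x d" using d(1) by (simp add: dist_norm)
    then show "w \<in> U" using d(2) \<open>x \<in> C\<close> by blast
  qed
  have bnd: "\<exists>B>0. \<forall>w\<in>N. norm (FD X w (axis k 1)) \<le> B" for k
  proof -
    have "compact ((\<lambda>w. FD X w (axis k 1)) ` N)"
      by (rule compact_continuous_image[OF continuous_on_subset[OF hmap_continuous[OF hmap_FD[OF U X]] NU] \<open>compact N\<close>])
    then have "bounded ((\<lambda>w. FD X w (axis k 1)) ` N)" by (rule compact_imp_bounded)
    then show ?thesis unfolding bounded_pos by simp
  qed
  then have "\<forall>k. \<exists>B>0. \<forall>w\<in>N. norm (FD X w (axis k 1)) \<le> B" by (rule allI)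
  from choice[OF this] obtain B where B': "\<forall>k. B k > 0 \<and> (\<forall>w\<in>N. norm (FD X w (axis k 1)) \<le> B k)" by (elim exE)
  have B: "B k > 0" "w \<in> N \<Longrightarrow> norm (FD X w (axis k 1)) \<le> B k" for k w using B' by auto
  define L where "L = (\<Sum>k\<in>UNIV. B k)"
  have Lpos: "L > 0" unfolding L_def by (intro sum_pos B(1)) auto
  \<comment> \<open>Errors of size \<open>d/4\<close> in time and in space add up to at most
    \<open>d/2\<close>, the radius of the tube \<open>N\<close>; the bound \<open>1/2\<close> gives
    \<open>e < 1\<close>.\<close>
  define e where "e = min (d/4) (1/2)"
  have e: "0 < e" "e < 1" "e \<le> d/4" using d(1) by (auto simp: e_def)
  have inN: "pt \<tau> z \<in> N" if "t \<in> {0..1}" "dist \<tau> (complex_of_real t) < e" "z \<in> ball z0 e" for t \<tau> z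
  proof -
    have "dist (pt \<tau> z) (pt (complex_of_real t) z0) \<le> dist \<tau> (complex_of_real t) + dist z z0" by (rule dist_pt)
    also have "\<dots> \<le> d/2" using that e by (auto simp: dist_commute)
    finally have "pt \<tau> z - pt (complex_of_real t) z0 \<in> cball 0 (d/2)" by (simp add: dist_norm norm_minus_commute)
    moreover have "pt (complex_of_real t) z0 \<in> C" using that by (auto simp: C_def)
    ultimately show ?thesis
      unfolding N_def mem_Collect_eq
      by (intro exI[of _ "pt (complex_of_real t) z0"] exI[of _ "pt \<tau> z - pt (complex_of_real t) z0"]) simp
  qed
  have lip: "norm (X (pt \<tau> z) - X (pt \<tau> z')) \<le> L * norm (z - z')"
    if "t \<in> {0..1}" "dist \<tau> (complex_of_real t) < e" "z \<in> ball z0 e" "z' \<in> ball z0 e" for t \<tau> z z'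
  proof (rule differentiable_bound[where S="ball z0 e" and f'="\<lambda>z v. FD X (pt \<tau> z) (pt 0 v)"])
    show "((\<lambda>z. X (pt \<tau> z)) has_derivative (\<lambda>v. FD X (pt \<tau> x) (pt 0 v))) (at x within ball z0 e)"
      if x: "x \<in> ball z0 e" for x
    proof -
      have "pt \<tau> x \<in> U" using inN[OF \<open>t \<in> {0..1}\<close> \<open>dist \<tau> (complex_of_real t) < e\<close> x] NU by blast
      have "bounded_linear (\<lambda>v :: complex^'n. pt 0 v)"
      proof (rule bounded_linear_intro[where K=1])
        show "norm (pt 0 x) \<le> norm x * 1" for x :: "complex^'n" by (simp add: norm_pt0)
      qed (auto simp: vec_eq_iff pt_def split: option.splits)
      then have "((\<lambda>z. \<tau> *s axis None 1 + pt 0 z) has_derivative (\<lambda>v. pt 0 v)) (at x within ball z0 e)"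
        by (auto intro!: derivative_eq_intros dest: bounded_linear_imp_has_derivative)
      then have "((\<lambda>z. pt \<tau> z) has_derivative (\<lambda>v. pt 0 v)) (at x within ball z0 e)"
        by (simp add: pt_split[of \<tau>])
      then show ?thesis by (rule has_derivative_compose) (rule hmap_deriv(3)[OF X \<open>pt \<tau> x \<in> U\<close>])
    qed
    show "onorm (\<lambda>v. FD X (pt \<tau> x) (pt 0 v)) \<le> L" if x: "x \<in> ball z0 e" for x
    proof (rule onorm_bound)
      fix v :: "complex^'n"
      have N: "pt \<tau> x \<in> N" using inN[OF \<open>t \<in> {0..1}\<close> \<open>dist \<tau> (complex_of_real t) < e\<close> x] .
      then have U': "pt \<tau> x \<in> U" using NU by blast
      have "FD X (pt \<tau> x) (pt 0 v) = FD X (pt \<tau> x) (\<Sum>k\<in>UNIV. (pt 0 v $ k) *s axis k 1)"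
        by (subst vec_axis_expand[of "pt 0 v"]) (rule refl)
      also have "\<dots> = (\<Sum>k\<in>UNIV. (pt 0 v $ k) *s FD X (pt \<tau> x) (axis k 1))"
        using hmap_deriv(3)[OF X U'] hmap_deriv(4)[OF X U']
        by (simp add: has_derivative_linear linear_sum)
      also have "norm \<dots> \<le> (\<Sum>k\<in>UNIV. norm v * B k)"
      proof (rule sum_norm_le)
        fix k
        have "norm (pt 0 v $ k) \<le> norm (pt 0 v)" by (rule Finite_Cartesian_Product.norm_nth_le)
        then show "norm ((pt 0 v $ k) *s FD X (pt \<tau> x) (axis k 1)) \<le> norm v * B k"
          unfolding norm_smult_vec norm_pt0 using B(2)[OF N] by (intro mult_mono) auto
      qed
      finally show "norm (FD X (pt \<tau> x) (pt 0 v)) \<le> L * norm v"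
        by (simp add: L_def sum_distrib_left sum_distrib_right mult.commute)
    qed (use Lpos in simp)
  qed (use that in auto)
  show thesis by (rule that[OF e(1,2) Lpos _ lip]) (use inN NU in blast)+
qed

lemma FD_hmap_component:
  assumes "hmap f S" "z \<in> S" shows "FD f z v $ j = FD (\<lambda>z. f z $ j) z v"
  by (simp add: hmap_deriv(2)[OF assms])

text \<open>Picard iteration with the weight \<open>exp (2 * L * cmod \<tau>)\<close>, in which the
  integral operator halves distances, so that the time interval need not be short. As
  \<open>X\<close> vanishes at \<open>z0\<close>, the iteration can start at the constant solution
  \<open>z0\<close>, and all iterates stay within a distance of \<open>z0\<close> proportional to
  that of the initial point.\<close>

theorem holomorphic_flow:
  fixes X :: "complex^('n::finite option) \<Rightarrow> complex^'n"
  assumes U: "open U" and X: "hmap X U" and seg: "\<And>t. t \<in> {0..1} \<Longrightarrow> pt (complex_of_real t) z0 \<in> U"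
    and fix0: "\<And>\<tau>. pt \<tau> z0 \<in> U \<Longrightarrow> X (pt \<tau> z0) = 0"
  obtains \<Omega> \<phi> \<rho> C where "open \<Omega>" "\<rho> > 0" "C > 0" "hmap \<phi> \<Omega>"
    "\<And>t z. t \<in> {0..1} \<Longrightarrow> z \<in> ball z0 \<rho> \<Longrightarrow> pt (complex_of_real t) z \<in> \<Omega>"
    "\<And>w. w \<in> \<Omega> \<Longrightarrow> pt (w $ None) (\<phi> w) \<in> U"
    "\<And>w. w \<in> \<Omega> \<Longrightarrow> norm (\<phi> w - z0) \<le> C * norm (sp w - z0)"
    "\<And>z. pt 0 z \<in> \<Omega> \<Longrightarrow> \<phi> (pt 0 z) = z"
    "\<And>w. w \<in> \<Omega> \<Longrightarrow> FD \<phi> w (axis None 1) = X (pt (w $ None) (\<phi> w))"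
proof -
  obtain e L where e: "0 < e" "e < 1" "0 < L"
    and inU: "\<And>t \<tau> z. t \<in> {0..1} \<Longrightarrow> dist \<tau> (complex_of_real t) < e \<Longrightarrow> z \<in> ball z0 e \<Longrightarrow> pt \<tau> z \<in> U"
    and lip: "\<And>t \<tau> z z'. t \<in> {0..1} \<Longrightarrow> dist \<tau> (complex_of_real t) < e \<Longrightarrow> z \<in> ball z0 e \<Longrightarrow> z' \<in> ball z0 e \<Longrightarrow>
        norm (X (pt \<tau> z) - X (pt \<tau> z')) \<le> L * norm (z - z')"
    by (rule local_lipschitz[OF U X seg]) (assumption, rule that)
  \<comment> \<open>Times in \<open>K\<close> have modulus at most 2, so the weight is at most
    \<open>exp (4 * L)\<close>; the factor 2 is the sum of the geometric series of the iteration.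
    With \<open>\<rho> = e / C\<close> all iterates remain in the ball of radius
    \<open>e\<close>.\<close>
  define C where "C = 2 * exp (4 * L)"
  define \<rho> where "\<rho> = e / C"
  have C: "C > 0" by (simp add: C_def)
  have \<rho>: "\<rho> > 0" using e C by (simp add: \<rho>_def)
  \<comment> \<open>An open neighbourhood of the real interval that is star-shaped about 0, so that
    the segments of integration stay inside.\<close>
  define K where "K = (\<Union>t\<in>{0..1}. ball (complex_of_real t) e)"
  define \<Omega> where "\<Omega> = {w. w $ None \<in> K \<and> sp w \<in> ball z0 \<rho>}"
  have "open K" unfolding K_def by (intro open_UN) auto
  have \<Omega>open: "open \<Omega>"
  proof -
    have "\<Omega> = (\<lambda>w. w $ None) -` K \<inter> sp -` ball z0 \<rho>" by (auto simp: \<Omega>_def)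
    moreover have "open ((\<lambda>w :: complex^('n option). w $ None) -` K)"
      by (intro open_vimage \<open>open K\<close> linear_continuous_on[OF bounded_linear_vec_nth])
    moreover have "open (sp -` ball z0 \<rho>)"
      by (intro open_vimage open_ball linear_continuous_on[OF bounded_linear_sp])
    ultimately show ?thesis by (simp add: open_Int)
  qed
  have Knorm: "cmod \<tau> \<le> 2" if \<tau>: "\<tau> \<in> K" for \<tau>
  proof -
    obtain t where t: "t \<in> {0..1}" "dist (complex_of_real t) \<tau> < e" using \<tau> by (auto simp: K_def)
    have "cmod \<tau> \<le> cmod (complex_of_real t) + dist (complex_of_real t) \<tau>"
      using norm_triangle_sub[of \<tau> "complex_of_real t"] by (simp add: dist_norm norm_minus_commute)
    also have "\<dots> \<le> 1 + 1" using t e by (intro add_mono) auto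
    finally show ?thesis by simp
  qed
  have Kstar: "of_real \<sigma> * \<tau> \<in> K" if \<tau>: "\<tau> \<in> K" and \<sigma>: "\<sigma> \<in> {0..1}" for \<sigma> :: real and \<tau>
  proof -
    obtain t where t: "t \<in> {0..1}" "dist (complex_of_real t) \<tau> < e" using \<tau> by (auto simp: K_def)
    have "complex_of_real (\<sigma> * t) - of_real \<sigma> * \<tau> = of_real \<sigma> * (complex_of_real t - \<tau>)" by (simp add: algebra_simps)
    then have "dist (complex_of_real (\<sigma> * t)) (of_real \<sigma> * \<tau>) = \<sigma> * dist (complex_of_real t) \<tau>"
      using \<sigma> by (simp add: dist_norm norm_mult)
    also have "\<dots> \<le> 1 * dist (complex_of_real t) \<tau>" using \<sigma> by (intro mult_right_mono) auto
    finally have "dist (complex_of_real (\<sigma> * t)) (of_real \<sigma> * \<tau>) < e" using t(2) by simp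
    moreover have "\<sigma> * t \<in> {0..1}" using \<sigma> t(1) by (auto intro: mult_le_one)
    ultimately show ?thesis unfolding K_def by (intro UN_I[of "\<sigma> * t"]) auto
  qed
  have star: "dil \<sigma> w \<in> \<Omega>" if "w \<in> \<Omega>" "\<sigma> \<in> {0..1}" for w \<sigma>
    using that Kstar by (auto simp: \<Omega>_def dil_def)
  have inUK: "pt \<tau> z \<in> U" if "\<tau> \<in> K" "z \<in> ball z0 e" for \<tau> z
    using that inU by (auto simp: K_def dist_commute)
  have lipK: "norm (X (pt \<tau> z) - X (pt \<tau> z')) \<le> L * norm (z - z')" if "\<tau> \<in> K" "z \<in> ball z0 e" "z' \<in> ball z0 e" for \<tau> z z'
    using that(1) lip[OF _ _ that(2,3)] by (auto simp: K_def dist_commute)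
  define bd where "bd w = norm (sp w - z0) * exp (2 * L * cmod (w $ None))" for w :: "complex^('n option)"
  have bd: "0 \<le> bd w" "2 * bd w \<le> C * norm (sp w - z0)" "2 * bd w < e" "bd w \<le> \<rho> * exp (4 * L)" if "w \<in> \<Omega>" for w
  proof -
    have n: "norm (sp w - z0) < \<rho>" using that by (auto simp: \<Omega>_def dist_norm norm_minus_commute)
    have "2 * L * cmod (w $ None) \<le> 2 * L * 2" by (rule mult_left_mono) (use that Knorm e in \<open>auto simp: \<Omega>_def\<close>)
    then have ex: "exp (2 * L * cmod (w $ None)) \<le> exp (4 * L)" by simp
    show "0 \<le> bd w" by (simp add: bd_def)
    have b: "bd w \<le> norm (sp w - z0) * exp (4 * L)" unfolding bd_def using ex by (intro mult_left_mono) auto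
    then show "2 * bd w \<le> C * norm (sp w - z0)" by (simp add: C_def algebra_simps)
    also have "\<dots> < C * \<rho>" using n C by (intro mult_strict_left_mono)
    also have "\<dots> = e" using C by (simp add: \<rho>_def)
    finally show "2 * bd w < e" .
    show "bd w \<le> \<rho> * exp (4 * L)" using b n by (meson exp_ge_zero less_imp_le mult_right_mono order_trans)
  qed
  have bd_dil: "bd (dil \<sigma> w) = norm (sp w - z0) * exp (2 * L * cmod (w $ None) * \<sigma>)" if "\<sigma> \<in> {0..1}" for \<sigma> w
    using that by (simp add: bd_def dil_def norm_mult algebra_simps)
  \<comment> \<open>The weight is made so that integrating it along the segment against
    \<open>cmod (w $ None) * L\<close> reproduces it with the factor \<open>1/2\<close>, up to a
    term of favourable sign: the contraction factor in \<open>T_diff\<close>.\<close>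
  have bd_int: "((\<lambda>\<sigma>. cmod (w $ None) * (L * (c * bd (dil \<sigma> w)))) has_integral
      c/2 * bd w - c/2 * norm (sp w - z0)) {0..1}" for w c
  proof -
    let ?a = "2 * L * cmod (w $ None)"
    have "((\<lambda>\<sigma>. ?a * exp (?a * \<sigma>)) has_integral (exp (?a * 1) - exp (?a * 0))) {0..1}"
      by (rule fundamental_theorem_of_calculus)
        (auto intro!: derivative_eq_intros simp flip: has_real_derivative_iff_has_vector_derivative)
    then have "((\<lambda>\<sigma>. (c/2 * norm (sp w - z0)) * (?a * exp (?a * \<sigma>))) has_integral
        (c/2 * norm (sp w - z0)) * (exp (?a * 1) - exp (?a * 0))) {0..1}"
      by (rule has_integral_mult_right)
    moreover have "(c/2 * norm (sp w - z0)) * (exp (?a * 1) - exp (?a * 0)) = c/2 * bd w - c/2 * norm (sp w - z0)"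
      by (simp add: bd_def algebra_simps)
    ultimately have "((\<lambda>\<sigma>. (c/2 * norm (sp w - z0)) * (?a * exp (?a * \<sigma>))) has_integral
        c/2 * bd w - c/2 * norm (sp w - z0)) {0..1}" by (simp only:)
    then show ?thesis
      by (rule has_integral_eq[rotated]) (simp add: bd_dil)
  qed
  \<comment> \<open>The Picard operator; its fixed points are the solutions with value
    \<open>sp w\<close> at time 0.\<close>
  define T where "T \<psi> w = sp w + (\<chi> j. time_integral (\<lambda>w. X (pt (w $ None) (\<psi> w)) $ j) w)" for \<psi> w
  define \<phi> where "\<phi> k = (T ^^ k) (\<lambda>w. z0)" for k
  have \<phi>Suc: "\<phi> (Suc k) = T (\<phi> k)" for k by (simp add: \<phi>_def)
  define good where "good \<psi> \<longleftrightarrow> hmap \<psi> \<Omega> \<and> (\<forall>w\<in>\<Omega>. \<psi> w \<in> ball z0 e)" for \<psi>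
  have good_comp: "holo_on (\<lambda>w. X (pt (w $ None) (\<psi> w)) $ j) \<Omega>" if "good \<psi>" for \<psi> j
  proof -
    have "hmap (\<lambda>w. pt (w $ None) (\<psi> w)) \<Omega>" using that by (intro hmap_pt holo_on_coord) (simp add: good_def)
    moreover have "(\<lambda>w. pt (w $ None) (\<psi> w)) ` \<Omega> \<subseteq> U"
      using that by (auto simp: good_def \<Omega>_def intro!: inUK)
    moreover have "holo_on (\<lambda>w. X w $ j) U" using X by (simp add: hmap_def)
    ultimately show ?thesis by (rule holo_on_compose(1)[rotated])
  qed
  have T_hmap: "hmap (T \<psi>) \<Omega>" if "good \<psi>" for \<psi>
    unfolding hmap_def T_def vector_add_component vec_lambda_beta sp_simps
    using time_integral_holo(1)[OF \<Omega>open good_comp[OF that] star] by (intro allI holo_on_add holo_on_coord)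
  have T_diff: "norm (T \<psi> w - T \<psi>' w) \<le> c/2 * bd w"
    if g: "good \<psi>" "good \<psi>'" and c: "c \<ge> 0" "\<And>w. w \<in> \<Omega> \<Longrightarrow> norm (\<psi> w - \<psi>' w) \<le> c * bd w" and w: "w \<in> \<Omega>" for \<psi> \<psi>' c w
  proof -
    let ?Y = "\<lambda>\<psi> \<sigma>. w $ None *s X (pt (dil \<sigma> w $ None) (\<psi> (dil \<sigma> w)))"
    have int: "?Y \<psi> integrable_on {0..1}" if "good \<psi>" for \<psi>
    proof (rule integrable_continuous_real)
      have "continuous_on {0..1} (\<lambda>\<sigma>. \<chi> j. w $ None * X (pt (dil \<sigma> w $ None) (\<psi> (dil \<sigma> w))) $ j)"
        by (intro continuous_on_vec_lambda continuous_intros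
            continuous_on_compose2[OF holo_on_continuous[OF good_comp[OF that]]]) (use star w in auto)
      then show "continuous_on {0..1} (?Y \<psi>)" by (simp add: vector_scalar_mult_def)
    qed
    have comp: "(\<chi> j. time_integral (\<lambda>w. X (pt (w $ None) (\<psi> w)) $ j) w) = integral {0..1} (?Y \<psi>)" if "good \<psi>" for \<psi>
    proof -
      have "integral {0..1} (?Y \<psi>) $ j = integral {0..1} (\<lambda>\<sigma>. ?Y \<psi> \<sigma> $ j)" for j
        using integral_linear[OF int[OF that] bounded_linear_vec_nth[of j]] by (simp add: o_def)
      then show ?thesis by (simp add: vec_eq_iff time_integral_def)
    qed
    have "T \<psi> w - T \<psi>' w = integral {0..1} (?Y \<psi>) - integral {0..1} (?Y \<psi>')"
      by (simp add: T_def comp g)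
    also have "\<dots> = integral {0..1} (\<lambda>\<sigma>. ?Y \<psi> \<sigma> - ?Y \<psi>' \<sigma>)"
      by (rule integral_diff[symmetric]) (intro int g)+
    also have "norm \<dots> \<le> integral {0..1} (\<lambda>\<sigma>. cmod (w $ None) * (L * (c * bd (dil \<sigma> w))))"
    proof (rule integral_norm_bound_integral)
      show "(\<lambda>\<sigma>. ?Y \<psi> \<sigma> - ?Y \<psi>' \<sigma>) integrable_on {0..1}" by (intro integrable_diff int g)
      show "(\<lambda>\<sigma>. cmod (w $ None) * (L * (c * bd (dil \<sigma> w)))) integrable_on {0..1}" using bd_int by blast
      fix \<sigma> :: real assume \<sigma>: "\<sigma> \<in> {0..1}"
      have s: "dil \<sigma> w \<in> \<Omega>" by (rule star[OF w \<sigma>])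
      have "norm (?Y \<psi> \<sigma> - ?Y \<psi>' \<sigma>) = cmod (w $ None) *
          norm (X (pt (dil \<sigma> w $ None) (\<psi> (dil \<sigma> w))) - X (pt (dil \<sigma> w $ None) (\<psi>' (dil \<sigma> w))))"
        by (simp add: norm_smult_vec flip: vector_ssub_ldistrib)
      also have "\<dots> \<le> cmod (w $ None) * (L * norm (\<psi> (dil \<sigma> w) - \<psi>' (dil \<sigma> w)))"
        by (intro mult_left_mono lipK) (use s g in \<open>auto simp: good_def \<Omega>_def\<close>)
      also have "\<dots> \<le> cmod (w $ None) * (L * (c * bd (dil \<sigma> w)))"
        by (intro mult_left_mono c s) (use e in auto)
      finally show "norm (?Y \<psi> \<sigma> - ?Y \<psi>' \<sigma>) \<le> cmod (w $ None) * (L * (c * bd (dil \<sigma> w)))" .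
    qed
    also have "\<dots> = c/2 * bd w - c/2 * norm (sp w - z0)" by (rule integral_unique[OF bd_int])
    also have "\<dots> \<le> c/2 * bd w" using c(1) by simp
    finally show ?thesis .
  qed
  \<comment> \<open>Here the vanishing of \<open>X\<close> at \<open>z0\<close> enters: the first
    iterate is just the initial point.\<close>
  have T0: "T (\<lambda>w. z0) w = sp w" if "w \<in> \<Omega>" for w
  proof -
    have "time_integral (\<lambda>w. X (pt (w $ None) z0) $ j) w = 0" for j
    proof -
      have "time_integral (\<lambda>w. X (pt (w $ None) z0) $ j) w = integral {0..1} (\<lambda>\<sigma>::real. 0)"
        unfolding time_integral_def
        by (rule integral_cong) (use star[OF that] fix0 inUK e in \<open>auto simp: \<Omega>_def\<close>)
      then show ?thesis by simp
    qed
    then show ?thesis by (simp add: T_def vec_eq_iff)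
  qed
  \<comment> \<open>The factor \<open>2 - (1/2)^k\<close> is the partial sum of the geometric series
    \<open>1 + 1/2 + ... + (1/2)^k\<close>.\<close>
  have ind: "good (\<phi> k) \<and> good (\<phi> (Suc k)) \<and> (\<forall>w\<in>\<Omega>. norm (\<phi> (Suc k) w - \<phi> k w) \<le> (1/2)^k * bd w)
      \<and> (\<forall>w\<in>\<Omega>. norm (\<phi> (Suc k) w - z0) \<le> (2 - (1/2)^k) * bd w)" for k
  proof (induction k)
    case 0
    have 0: "\<phi> 0 = (\<lambda>w. z0)" by (simp add: \<phi>_def)
    have g0: "good (\<phi> 0)" using e by (simp add: good_def 0 hmap_def holo_on_const)
    have p1: "\<phi> (Suc 0) w = sp w" if "w \<in> \<Omega>" for w using T0[OF that] by (simp only: \<phi>Suc 0)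
    have nb: "norm (sp w - z0) \<le> bd w" for w
      unfolding bd_def using mult_left_mono[of 1 "exp (2 * L * cmod (w $ None))" "norm (sp w - z0)"] e by simp
    have "hmap (\<phi> (Suc 0)) \<Omega>" unfolding \<phi>Suc by (rule T_hmap[OF g0])
    moreover have "sp w \<in> ball z0 e" if "w \<in> \<Omega>" for w
      using nb[of w] bd(1,3)[OF that] by (simp add: dist_norm norm_minus_commute)
    ultimately have "good (\<phi> (Suc 0))" by (simp add: good_def p1)
    then show ?case using g0 nb by (simp add: p1) (simp add: 0)
  next
    case (Suc k)
    have d: "norm (\<phi> (Suc (Suc k)) w - \<phi> (Suc k) w) \<le> (1/2)^Suc k * bd w" if "w \<in> \<Omega>" for w
      using T_diff[of "\<phi> (Suc k)" "\<phi> k" "(1/2)^k" w] Suc that by (simp add: \<phi>Suc)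
    have n: "norm (\<phi> (Suc (Suc k)) w - z0) \<le> (2 - (1/2)^Suc k) * bd w" if "w \<in> \<Omega>" for w
    proof -
      have "norm (\<phi> (Suc (Suc k)) w - z0) \<le> norm (\<phi> (Suc (Suc k)) w - \<phi> (Suc k) w) + norm (\<phi> (Suc k) w - z0)"
        using norm_triangle_ineq[of "\<phi> (Suc (Suc k)) w - \<phi> (Suc k) w" "\<phi> (Suc k) w - z0"] by simp
      also have "\<dots> \<le> (1/2)^Suc k * bd w + (2 - (1/2)^k) * bd w" using d[OF that] Suc that by (intro add_mono) auto
      also have "\<dots> = (2 - (1/2)^Suc k) * bd w" by (simp add: algebra_simps)
      finally show ?thesis .
    qed
    have "norm (\<phi> (Suc (Suc k)) w - z0) < e" if "w \<in> \<Omega>" for w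
    proof -
      have "(2 - (1/2)^Suc k) * bd w \<le> 2 * bd w" by (intro mult_right_mono bd that) simp
      then show ?thesis using n[OF that] bd(3)[OF that] by linarith
    qed
    then have "good (\<phi> (Suc (Suc k)))"
      using T_hmap[of "\<phi> (Suc k)"] Suc by (auto simp: good_def \<phi>Suc dist_norm norm_minus_commute)
    then show ?case using Suc d n by blast
  qed
  define F where "F w = z0 + (\<Sum>k. \<phi> (Suc k) w - \<phi> k w)" for w
  have part: "\<phi> n w = z0 + (\<Sum>k<n. \<phi> (Suc k) w - \<phi> k w)" for n w
    by (induction n) (simp_all add: \<phi>_def)
  \<comment> \<open>Convergence is uniform on all of \<open>\<Omega>\<close>, as the weighted bound
    is bounded there; the limit is then holomorphic by Weierstrass' theorem.\<close>
  have ul: "uniform_limit \<Omega> \<phi> F sequentially"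
  proof -
    have "uniform_limit \<Omega> (\<lambda>n w. \<Sum>k<n. \<phi> (Suc k) w - \<phi> k w) (\<lambda>w. \<Sum>k. \<phi> (Suc k) w - \<phi> k w) sequentially"
    proof (rule Weierstrass_m_test)
      show "norm (\<phi> (Suc k) w - \<phi> k w) \<le> (1/2)^k * (\<rho> * exp (4 * L))" if "w \<in> \<Omega>" for k w
      proof -
        have "norm (\<phi> (Suc k) w - \<phi> k w) \<le> (1/2)^k * bd w" using ind that by blast
        also have "\<dots> \<le> (1/2)^k * (\<rho> * exp (4 * L))" using bd(4)[OF that] by (intro mult_left_mono) auto
        finally show ?thesis .
      qed
      show "summable (\<lambda>k. (1/2)^k * (\<rho> * exp (4 * L)))" by (intro summable_mult2 summable_geometric) simp
    qed
    then have "uniform_limit \<Omega> (\<lambda>n w. z0 + (\<Sum>k<n. \<phi> (Suc k) w - \<phi> k w)) F sequentially"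
      unfolding F_def by (intro uniform_limit_add uniform_limit_const)
    then show ?thesis by (simp flip: part)
  qed
  have lim: "(\<lambda>k. \<phi> k w) \<longlonglongrightarrow> F w" if "w \<in> \<Omega>" for w by (rule tendsto_uniform_limitI[OF ul that])
  have Fbound: "norm (F w - z0) \<le> 2 * bd w" if "w \<in> \<Omega>" for w
  proof (rule tendsto_upperbound)
    show "(\<lambda>k. norm (\<phi> (Suc k) w - z0)) \<longlonglongrightarrow> norm (F w - z0)"
      using LIMSEQ_Suc[OF lim[OF that]] by (intro tendsto_intros)
    have "norm (\<phi> (Suc k) w - z0) \<le> 2 * bd w" for k
    proof -
      have "norm (\<phi> (Suc k) w - z0) \<le> (2 - (1/2)^k) * bd w" using ind that by blast
      also have "\<dots> \<le> 2 * bd w" by (intro mult_right_mono bd that) simp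
      finally show ?thesis .
    qed
    then show "\<forall>\<^sub>F k in sequentially. norm (\<phi> (Suc k) w - z0) \<le> 2 * bd w" by simp
  qed simp
  have Fball: "F w \<in> ball z0 e" if "w \<in> \<Omega>" for w
    using Fbound[OF that] bd(3)[OF that] by (simp add: dist_norm norm_minus_commute)
  have Fhmap: "hmap F \<Omega>"
    unfolding hmap_def
  proof (intro allI holo_on_ballI)
    fix j w assume w: "w \<in> \<Omega>"
    obtain r where r: "r > 0" "ball w r \<subseteq> \<Omega>" using w \<Omega>open open_contains_ball by blast
    have "holo_on (\<lambda>w. F w $ j) (ball w (r/2))"
    proof (rule holo_uniform_limit(1)[OF r(1)])
      show "holo_on (\<lambda>w. \<phi> k w $ j) (ball w r)" for k
        using ind[of k] r by (auto simp: good_def hmap_def intro: holo_on_subset)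
      show "uniform_limit (ball w r) (\<lambda>k w. \<phi> k w $ j) (\<lambda>w. F w $ j) sequentially"
        by (rule bounded_linear.uniform_limit[OF bounded_linear_vec_nth uniform_limit_on_subset[OF ul r(2)]])
    qed
    then show "\<exists>T. w \<in> T \<and> holo_on (\<lambda>w. F w $ j) T" using r(1) by (intro exI[of _ "ball w (r/2)"]) auto
  qed
  have Fgood: "good F" using Fhmap Fball by (simp add: good_def)
  \<comment> \<open>The tail estimate passes through \<open>T\<close> with the contraction factor:
    \<open>T F\<close> is the limit of the iterates \<open>\<phi> (Suc k)\<close>, which is
    \<open>F\<close>.\<close>
  have Ffix: "F w = T F w" if w: "w \<in> \<Omega>" for w
  proof -
    have diff: "norm (F w - \<phi> k w) \<le> 2 * (1/2)^k * bd w" if "w \<in> \<Omega>" for k w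
    proof (rule tendsto_upperbound)
      show "(\<lambda>m. norm (\<phi> (k + m) w - \<phi> k w)) \<longlonglongrightarrow> norm (F w - \<phi> k w)"
        using LIMSEQ_ignore_initial_segment[OF lim[OF that], of k] by (intro tendsto_intros) (simp add: add.commute)
      have "norm (\<phi> (k + m) w - \<phi> k w) \<le> (2 - 2 * (1/2)^m) * (1/2)^k * bd w" for m
      proof (induction m)
        case (Suc m)
        have "norm (\<phi> (k + Suc m) w - \<phi> k w) \<le> norm (\<phi> (Suc (k + m)) w - \<phi> (k + m) w) + norm (\<phi> (k + m) w - \<phi> k w)"
          using norm_triangle_ineq[of "\<phi> (Suc (k + m)) w - \<phi> (k + m) w" "\<phi> (k + m) w - \<phi> k w"] by simp
        also have "\<dots> \<le> (1/2)^(k + m) * bd w + (2 - 2 * (1/2)^m) * (1/2)^k * bd w"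
          using ind that Suc by (intro add_mono) blast+
        also have "\<dots> = (2 - 2 * (1/2)^Suc m) * (1/2)^k * bd w" by (simp add: algebra_simps power_add)
        finally show ?case .
      qed simp
      moreover have "(2 - 2 * (1/2)^m) * (1/2)^k * bd w \<le> 2 * (1/2)^k * bd w" for m :: nat
        by (intro mult_right_mono bd that) auto
      ultimately show "\<forall>\<^sub>F m in sequentially. norm (\<phi> (k + m) w - \<phi> k w) \<le> 2 * (1/2)^k * bd w"
        by (intro always_eventually allI) (meson order_trans)
    qed simp
    have "(\<lambda>k. T F w - \<phi> (Suc k) w) \<longlonglongrightarrow> 0"
    proof (rule Lim_null_comparison)
      have "norm (T F w - \<phi> (Suc k) w) \<le> (1/2)^k * bd w" for k
        unfolding \<phi>Suc using T_diff[of F "\<phi> k" "2 * (1/2)^k" w] Fgood ind[of k] diff w by simp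
      then show "\<forall>\<^sub>F k in sequentially. norm (T F w - \<phi> (Suc k) w) \<le> (1/2)^k * bd w" by simp
      have "(\<lambda>k. (1/2)^k * bd w) \<longlonglongrightarrow> 0 * bd w" by (intro tendsto_intros LIMSEQ_power_zero) simp
      then show "(\<lambda>k. (1/2)^k * bd w) \<longlonglongrightarrow> 0" by simp
    qed
    moreover have "(\<lambda>k. T F w - \<phi> (Suc k) w) \<longlonglongrightarrow> T F w - F w"
      using LIMSEQ_Suc[OF lim[OF w]] by (intro tendsto_intros)
    ultimately have "T F w - F w = 0" using LIMSEQ_unique by blast
    then show ?thesis by simp
  qed
  show thesis
  proof (rule that[OF \<Omega>open \<rho> C Fhmap])
    show "pt (complex_of_real t) z \<in> \<Omega>" if "t \<in> {0..1}" "z \<in> ball z0 \<rho>" for t z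
      using that e by (auto simp: \<Omega>_def K_def intro!: bexI[of _ t])
    show "pt (w $ None) (F w) \<in> U" if "w \<in> \<Omega>" for w
      using that Fball[OF that] by (auto simp: \<Omega>_def intro!: inUK)
    show "norm (F w - z0) \<le> C * norm (sp w - z0)" if "w \<in> \<Omega>" for w
      using Fbound[OF that] bd(2)[OF that] by linarith
    show "F (pt 0 z) = z" if "pt 0 z \<in> \<Omega>" for z
      using Ffix[OF that] by (simp add: T_def time_integral_def vec_eq_iff)
    show "FD F w (axis None 1) = X (pt (w $ None) (F w))" if w: "w \<in> \<Omega>" for w
    proof -
      have "FD (\<lambda>w. F w $ j) w (axis None 1) = X (pt (w $ None) (F w)) $ j" for j
      proof -
        have "FD (\<lambda>w. F w $ j) w = FD (\<lambda>w. w $ Some j + time_integral (\<lambda>w. X (pt (w $ None) (F w)) $ j) w) w"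
        proof (rule FD_cong[OF \<Omega>open w])
          fix x assume "x \<in> \<Omega>"
          from Ffix[OF this] have "F x $ j = T F x $ j" by simp
          then show "F x $ j = x $ Some j + time_integral (\<lambda>w. X (pt (w $ None) (F w)) $ j) x"
            by (simp add: T_def)
        qed
        moreover have "FD (\<lambda>w. w $ Some j + time_integral (\<lambda>w. X (pt (w $ None) (F w)) $ j) w) w (axis None 1)
            = axis None 1 $ Some j + FD (time_integral (\<lambda>w. X (pt (w $ None) (F w)) $ j)) w (axis None 1)"
          using time_integral_holo(1)[OF \<Omega>open good_comp[OF Fgood] star] w
          by (intro FD_eq[OF has_derivative_add] bounded_linear_imp_has_derivative bounded_linear_vec_nth holo_onD(1)[of _ \<Omega>])
            auto
        ultimately show ?thesis
          using time_integral_holo(2)[OF \<Omega>open good_comp[OF Fgood] star w, of j] by (simp add: axis_def)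
      qed
      then show ?thesis by (simp add: vec_eq_iff FD_hmap_component[OF Fhmap w])
    qed
  qed
qed

section \<open>Moser's argument in coordinates\<close>

lemma holo_vector_chain:
  assumes f: "holo_on f S" "\<alpha> t \<in> S" and \<alpha>: "(\<alpha> has_vector_derivative a) (at t within T)"
  shows "((\<lambda>t. f (\<alpha> t)) has_vector_derivative FD f (\<alpha> t) a) (at t within T)"
proof -
  note d = holo_onD(1)[OF f]
  have "((\<lambda>t. f (\<alpha> t)) has_derivative (\<lambda>s. FD f (\<alpha> t) (s *\<^sub>R a))) (at t within T)"
    by (rule has_derivative_compose[OF \<alpha>[unfolded has_vector_derivative_def] d])
  then show ?thesis
    unfolding has_vector_derivative_def using linear_scale[OF has_derivative_linear[OF d]] by simp
qed

lemma hmap_vector_chain: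
  assumes f: "hmap f S" "\<alpha> t \<in> S" and \<alpha>: "(\<alpha> has_vector_derivative a) (at t within T)"
  shows "((\<lambda>t. f (\<alpha> t)) has_vector_derivative FD f (\<alpha> t) a) (at t within T)"
proof -
  note d = hmap_deriv(3)[OF f]
  have "((\<lambda>t. f (\<alpha> t)) has_derivative (\<lambda>s. FD f (\<alpha> t) (s *\<^sub>R a))) (at t within T)"
    by (rule has_derivative_compose[OF \<alpha>[unfolded has_vector_derivative_def] d])
  then show ?thesis
    unfolding has_vector_derivative_def using linear_scale[OF has_derivative_linear[OF d]] by simp
qed

text \<open>Unlike \<open>germ_eq_off_zeros\<close>, this keeps the given ball.\<close>

lemma holo_zero_dense:
  assumes h: "holo_on h (ball z0 r)" "nz z0 h" "r > 0" and F: "holo_on F (ball z0 r)"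
    and 0: "\<And>z. z \<in> ball z0 r \<Longrightarrow> h z \<noteq> 0 \<Longrightarrow> F z = 0" and z: "z \<in> ball z0 r"
  shows "F z = 0"
proof (rule ccontr)
  assume "F z \<noteq> 0"
  define V where "V = ball z0 r \<inter> F -` (- {0})"
  have V: "open V" "z \<in> V"
    using continuous_open_preimage[OF holo_on_continuous[OF F] open_ball, of "- {0}"] z \<open>F z \<noteq> 0\<close> by (auto simp: V_def)
  have "h w = 0" if "w \<in> ball z0 r" for w
    by (rule holo_identity[OF h(1) V(1) _ _ _ that]) (use V(2) 0 in \<open>auto simp: V_def\<close>)
  then have "\<forall>\<^sub>F z in nhds z0. h z = 0"
    unfolding eventually_nhds using h(3) by (intro exI[of _ "ball z0 r"]) auto
  then show False using h(2) by (simp add: nz_def)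
qed

lemma eventually_ball_germ:
  assumes "f \<in> Ogerm z0" shows "\<forall>\<^sub>F r in at_right 0. holo_on f (ball z0 r)"
proof -
  obtain r where r: "r > 0" "holo_on f (ball z0 r)" by (rule Ogerm_ballE[OF assms eventually_True]) (rule that)
  then show ?thesis
    unfolding eventually_at_right_field by (intro exI[of _ r]) (auto intro: holo_on_subset)
qed

lemma eventually_ball_nhds:
  assumes "\<forall>\<^sub>F z in nhds (z0::'a::metric_space). P z" shows "\<forall>\<^sub>F r in at_right 0. \<forall>z\<in>ball z0 r. P z"
proof -
  obtain d where "d > 0" "\<And>z. dist z z0 < d \<Longrightarrow> P z" using assms by (auto simp: eventually_nhds_metric)
  then show ?thesis
    unfolding eventually_at_right_field by (intro exI[of _ d]) (auto simp: dist_commute)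
qed

lemma eventually_at_right_0E:
  assumes "eventually P (at_right (0::real))" obtains r where "r > 0" "P r"
proof -
  have "eventually (\<lambda>r. P r \<and> r > 0) (at_right (0::real))"
    using assms eventually_at_right_less by (rule eventually_conj)
  from eventually_happens'[OF trivial_limit_at_right_real this]
  obtain r where "P r \<and> r > 0" by (rule exE)
  then show thesis by (intro that[of r]) simp_all
qed

section \<open>Algebra of the Moser equation and the choice of the path\<close>

lemma det_colrep_linear:
  "det (colrep M l (b + b')) = det (colrep M l b) + det (colrep M l b')"
  "det (colrep M l (c *s b)) = c * det (colrep M l b)"
proof -
  have e: "det (colrep M l b) = det (\<chi> i. if i = l then b else column i M)" for b
  proof -
    have "colrep M l b = transpose (\<chi> i. if i = l then b else column i M)"
      by (auto simp: colrep_def transpose_def column_def vec_eq_iff)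
    then show ?thesis by simp
  qed
  show "det (colrep M l (b + b')) = det (colrep M l b) + det (colrep M l b')"
    unfolding e by (rule det_row_add)
  show "det (colrep M l (c *s b)) = c * det (colrep M l b)"
    unfolding e by (rule det_row_mul)
qed

lemma det_colrep_sum: "det (colrep M l (\<Sum>i\<in>I. a i *s b i)) = (\<Sum>i\<in>I. a i * det (colrep M l (b i)))"
proof (induction I rule: infinite_finite_induct)
  case empty
  show ?case using det_colrep_linear(2)[of M l 0 0] by simp
next
  case (infinite A)
  then show ?case using det_colrep_linear(2)[of M l 0 0] by simp
qed (simp add: det_colrep_linear)

text \<open>Cartan's formula in coordinates, with \<open>DW\<close>, \<open>D\<xi>\<close>,
  \<open>D\<eta>\<close> for partial derivatives. \<open>A\<close> is the differentiated equation
  \<open>W \<xi> = s' \<eta>\<close>, so inserting \<open>\<xi>\<close> into the first slot of the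
  form gives \<open>- s' \<eta>\<close>. By closedness \<open>C\<close> the Lie derivative along
  \<open>\<xi>\<close> is then \<open>- s' d\<eta>\<close>, which cancels the change
  \<open>s' \<Delta>\<close> of the form itself.\<close>

lemma moser_cancellation:
  fixes W :: "'n::finite \<Rightarrow> 'n \<Rightarrow> complex"
  assumes A: "\<And>a i. (\<Sum>j\<in>UNIV. W i j * D\<xi> a j) + (\<Sum>j\<in>UNIV. DW a i j * \<xi> j) = s' * D\<eta> a i"
    and B: "\<And>i j. W i j = - W j i" "\<And>k i j. DW k i j = - DW k j i"
    and C: "\<And>k a b. DW k a b - DW a k b + DW b k a = 0"
    and D: "\<And>a b. \<Delta> a b = D\<eta> a b - D\<eta> b a"
  shows "s' * \<Delta> a b + (\<Sum>k\<in>UNIV. DW k a b * \<xi> k) + (\<Sum>i\<in>UNIV. W i b * D\<xi> a i) + (\<Sum>j\<in>UNIV. W a j * D\<xi> b j) = 0"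
proof -
  have 1: "(\<Sum>j\<in>UNIV. W a j * D\<xi> b j) = s' * D\<eta> b a - (\<Sum>k\<in>UNIV. DW b a k * \<xi> k)"
    using A[of a b] by (simp add: eq_diff_eq)
  have "(\<Sum>i\<in>UNIV. W i b * D\<xi> a i) = (\<Sum>i\<in>UNIV. - (W b i * D\<xi> a i))"
    by (intro sum.cong refl) (subst B(1), simp)
  also have "\<dots> = - (s' * D\<eta> a b) + (\<Sum>k\<in>UNIV. DW a b k * \<xi> k)"
  proof -
    have "x = s' * D\<eta> a b - y" if "x + y = s' * D\<eta> a b" for x y using that by (simp add: eq_diff_eq)
    from this[OF A[of b a]] show ?thesis by (simp add: sum_negf)
  qed
  finally have 2: "(\<Sum>i\<in>UNIV. W i b * D\<xi> a i) = - (s' * D\<eta> a b) + (\<Sum>k\<in>UNIV. DW a b k * \<xi> k)" .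
  have 3: "DW k a b = DW b a k - DW a b k" for k
  proof -
    have "x = z - y" if "x - u + v = 0" "u = - y" "v = - z" for x y z u v :: complex
      using that by (simp add: eq_diff_eq)
    from this[OF C[of k a b] B(2)[of a k b] B(2)[of b k a]] show ?thesis .
  qed
  show ?thesis unfolding 1 2 3 D by (simp add: algebra_simps sum_subtractf)
qed

text \<open>The product rule for the pulled-back form on two transported vectors, regrouped so that
  the coefficient of \<open>u a * v b\<close> is the expression that vanishes by
  \<open>Z\<close>.\<close>

lemma moser_sum:
  fixes W :: "'n::finite \<Rightarrow> 'n \<Rightarrow> complex"
  assumes Z: "\<And>a b. K a b + (\<Sum>i\<in>UNIV. W i b * D a i) + (\<Sum>j\<in>UNIV. W a j * D b j) = 0"
  shows "(\<Sum>i\<in>UNIV. \<Sum>j\<in>UNIV. (\<Sum>a\<in>UNIV. D a i * u a) * W i j * v j + u i * K i j * v j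
     + u i * W i j * (\<Sum>b\<in>UNIV. D b j * v b)) = 0"
proof -
  have 1: "(\<Sum>i\<in>UNIV. \<Sum>j\<in>UNIV. (\<Sum>a\<in>UNIV. D a i * u a) * W i j * v j) =
     (\<Sum>a\<in>UNIV. \<Sum>b\<in>UNIV. u a * (\<Sum>i\<in>UNIV. W i b * D a i) * v b)"
  proof -
    have "(\<Sum>i\<in>UNIV. \<Sum>j\<in>UNIV. (\<Sum>a\<in>UNIV. D a i * u a) * W i j * v j) =
      (\<Sum>i\<in>UNIV. \<Sum>j\<in>UNIV. \<Sum>a\<in>UNIV. u a * (W i j * D a i) * v j)"
      by (simp add: sum_distrib_left sum_distrib_right algebra_simps)
    also have "\<dots> = (\<Sum>j\<in>UNIV. \<Sum>i\<in>UNIV. \<Sum>a\<in>UNIV. u a * (W i j * D a i) * v j)" by (rule sum.swap)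
    also have "\<dots> = (\<Sum>j\<in>UNIV. \<Sum>a\<in>UNIV. \<Sum>i\<in>UNIV. u a * (W i j * D a i) * v j)"
      by (intro sum.cong refl sum.swap)
    also have "\<dots> = (\<Sum>a\<in>UNIV. \<Sum>j\<in>UNIV. \<Sum>i\<in>UNIV. u a * (W i j * D a i) * v j)" by (rule sum.swap)
    finally show ?thesis by (simp add: sum_distrib_left sum_distrib_right)
  qed
  have 2: "(\<Sum>i\<in>UNIV. \<Sum>j\<in>UNIV. u i * W i j * (\<Sum>b\<in>UNIV. D b j * v b)) =
     (\<Sum>a\<in>UNIV. \<Sum>b\<in>UNIV. u a * (\<Sum>j\<in>UNIV. W a j * D b j) * v b)"
  proof -
    have "(\<Sum>i\<in>UNIV. \<Sum>j\<in>UNIV. u i * W i j * (\<Sum>b\<in>UNIV. D b j * v b)) =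
      (\<Sum>i\<in>UNIV. \<Sum>j\<in>UNIV. \<Sum>b\<in>UNIV. u i * (W i j * D b j) * v b)"
      by (simp add: sum_distrib_left algebra_simps)
    also have "\<dots> = (\<Sum>i\<in>UNIV. \<Sum>b\<in>UNIV. \<Sum>j\<in>UNIV. u i * (W i j * D b j) * v b)"
      by (intro sum.cong refl sum.swap)
    finally show ?thesis by (simp add: sum_distrib_left sum_distrib_right)
  qed
  have "(\<Sum>i\<in>UNIV. \<Sum>j\<in>UNIV. (\<Sum>a\<in>UNIV. D a i * u a) * W i j * v j + u i * K i j * v j
     + u i * W i j * (\<Sum>b\<in>UNIV. D b j * v b)) =
     (\<Sum>a\<in>UNIV. \<Sum>b\<in>UNIV. u a * (K a b + (\<Sum>i\<in>UNIV. W i b * D a i) + (\<Sum>j\<in>UNIV. W a j * D b j)) * v b)"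
    unfolding sum.distrib 1 2 by (simp add: algebra_simps sum.distrib)
  then show ?thesis by (simp add: Z)
qed

text \<open>Second derivatives of \<open>f\<close> commute. This makes constant multiples of
  \<open>dlog f\<close> closed, so that they may be subtracted from a primitive.\<close>

lemma dlog_closed:
  assumes S: "open S" and f: "holo_on f S" and z: "z \<in> S" "f z \<noteq> 0"
  shows "((\<lambda>z. inverse (f z) * FD f z (axis i 1)) has_derivative
      FD (\<lambda>z. inverse (f z) * FD f z (axis i 1)) z) (at z)"
    and "FD (\<lambda>z. inverse (f z) * FD f z (axis i 1)) z (axis j 1) =
      FD (\<lambda>z. inverse (f z) * FD f z (axis j 1)) z (axis i 1)"
proof -
  have d: "((\<lambda>z. inverse (f z) * FD f z (axis i 1)) has_derivative
     (\<lambda>v. inverse (f z) * FD (\<lambda>z. FD f z (axis i 1)) z v +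
       - (inverse (f z) * FD f z v * inverse (f z)) * FD f z (axis i 1))) (at z)" for i
    by (rule has_derivative_mult[OF Deriv.has_derivative_inverse])
      (use z in \<open>auto intro!: holo_onD(1)[OF f] holo_onD(1)[OF holo_on_FD[OF S f]]\<close>)
  show "((\<lambda>z. inverse (f z) * FD f z (axis i 1)) has_derivative
      FD (\<lambda>z. inverse (f z) * FD f z (axis i 1)) z) (at z)"
    using d frechet_derivative_at[OF d] by simp
  show "FD (\<lambda>z. inverse (f z) * FD f z (axis i 1)) z (axis j 1) =
      FD (\<lambda>z. inverse (f z) * FD f z (axis j 1)) z (axis i 1)"
    unfolding FD_eq[OF d] FD_symmetric[OF S f z(1), of "axis i 1" "axis j 1"] by simp
qed

text \<open>Away from the common end points a root lies on at most one of the arcs: its real part is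
  the parameter \<open>t\<close>, and then its imaginary part determines \<open>\<mu>\<close>.
  Finitely many roots exclude finitely many \<open>\<mu>\<close>.\<close>

lemma path_avoiding_roots:
  fixes Q :: "complex poly"
  assumes "poly Q 0 \<noteq> 0" "poly Q 1 \<noteq> 0"
  obtains \<mu> :: real where "\<And>t. t \<in> {0..1} \<Longrightarrow> poly Q (complex_of_real t + \<i> * \<mu> * t * (1 - t)) \<noteq> 0"
proof -
  have fin: "finite {r. poly Q r = 0}" using assms by (intro poly_roots_finite) auto
  define bad where "bad = (\<lambda>r. Im r / (Re r * (1 - Re r))) ` {r. poly Q r = 0}"
  have "finite bad" unfolding bad_def using fin by simp
  then obtain \<mu> where \<mu>: "\<mu> \<notin> bad" using ex_new_if_finite[OF infinite_UNIV_char_0] by blast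
  have "poly Q (complex_of_real t + \<i> * \<mu> * t * (1 - t)) \<noteq> 0" if t: "t \<in> {0..1}" for t
  proof
    let ?r = "complex_of_real t + \<i> * \<mu> * t * (1 - t)"
    assume 0: "poly Q ?r = 0"
    have "t \<noteq> 0" "t \<noteq> 1" using 0 assms by auto
    moreover have "Re ?r = t" "Im ?r = \<mu> * t * (1 - t)" by simp_all
    ultimately have "\<mu> = Im ?r / (Re ?r * (1 - Re ?r))" by simp
    then have "\<mu> \<in> bad" unfolding bad_def using 0 by blast
    then show False using \<mu> by simp
  qed
  then show thesis by (rule that)
qed

lemma holo_on_poly_family:
  assumes "\<And>m. m \<le> N \<Longrightarrow> holo_on (c m) B" and "holo_on \<gamma> S" and "\<And>w. w \<in> S \<Longrightarrow> sp w \<in> B"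
  shows "holo_on (\<lambda>w. \<Sum>m\<le>N. c m (sp w) * \<gamma> w ^ m) S"
  using assms by (intro holo_on_sum holo_on_mult holo_on_power holo_on_compose(1)[OF _ hmap_sp]) auto

context reduced_germ
begin

text \<open>Contraction with the coordinate differentials gives \<open>dv\<close>, the numerators of
  the components of the field; contraction with \<open>dlog h\<close> gives \<open>de\<close> and
  says that the field sends \<open>h\<close> to a multiple of \<open>h\<close>.\<close>

lemma contraction_coeffs:
  assumes W: "log_closed W0" "log_closed W1" and b: "logform b"
    and c: "\<And>m. c m \<in> Ogerm z0"
      "\<forall>\<^sub>F z in nhds z0. h z \<noteq> 0 \<longrightarrow>
        (\<forall>s. (h z)\<^sup>2 * det (pencil W0 W1 s z) = (\<Sum>m\<le>CARD('n). c m z * s ^ m))"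
    and c0: "(\<Sum>m\<le>CARD('n). c m z0 * s0 ^ m) \<noteq> 0"
  shows "\<exists>dv de. (\<forall>l m. dv l m \<in> Ogerm z0) \<and> (\<forall>m. de m \<in> Ogerm z0) \<and>
    (\<forall>\<^sub>F z in nhds z0. h z \<noteq> 0 \<longrightarrow>
      (\<forall>s l. (h z)\<^sup>2 * det (colrep (pencil W0 W1 s z) l (b z)) = (\<Sum>m\<le>CARD('n). dv l m z * s ^ m))) \<and>
    (\<forall>\<^sub>F z in nhds z0. h z \<noteq> 0 \<longrightarrow>
      (\<forall>s. (\<Sum>l\<in>UNIV. FD h z (axis l 1) * (\<Sum>m\<le>CARD('n). dv l m z * s ^ m)) = h z * (\<Sum>m\<le>CARD('n). de m z * s ^ m)))"
proof -
  have "\<exists>d. (\<forall>m. d m \<in> Ogerm z0) \<and> (\<forall>\<^sub>F z in nhds z0. h z \<noteq> 0 \<longrightarrow>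
      (\<forall>s. (h z)\<^sup>2 * det (colrep (pencil W0 W1 s z) l (b z)) = (\<Sum>m\<le>CARD('n). d m z * s ^ m)))" for l
  proof (rule pencil_contraction[OF W logform_const[of "axis l 1"] b c c0])
    fix d assume d: "\<And>m. d m \<in> Ogerm z0"
      "\<forall>\<^sub>F z in nhds z0. h z \<noteq> 0 \<longrightarrow>
      (\<forall>s. (h z)\<^sup>2 * (\<Sum>k\<in>UNIV. axis l 1 $ k * det (colrep (pencil W0 W1 s z) k (b z)))
         = (\<Sum>m\<le>CARD('n). d m z * s ^ m))"
    have "(\<Sum>k\<in>UNIV. axis l 1 $ k * det (colrep (pencil W0 W1 s z) k (b z))) = det (colrep (pencil W0 W1 s z) l (b z))" for s z
    proof -
      have "(\<Sum>k\<in>UNIV. axis l 1 $ k * det (colrep (pencil W0 W1 s z) k (b z))) =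
        (\<Sum>k\<in>UNIV. if k = l then det (colrep (pencil W0 W1 s z) k (b z)) else 0)"
        by (intro sum.cong refl) (simp add: axis_def)
      then show ?thesis by simp
    qed
    then show ?thesis using d by auto
  qed
  then have "\<forall>l. \<exists>d. (\<forall>m. d m \<in> Ogerm z0) \<and> (\<forall>\<^sub>F z in nhds z0. h z \<noteq> 0 \<longrightarrow>
      (\<forall>s. (h z)\<^sup>2 * det (colrep (pencil W0 W1 s z) l (b z)) = (\<Sum>m\<le>CARD('n). d m z * s ^ m)))" by (rule allI)
  from choice[OF this] obtain dv where dv: "\<forall>l. (\<forall>m. dv l m \<in> Ogerm z0) \<and> (\<forall>\<^sub>F z in nhds z0. h z \<noteq> 0 \<longrightarrow>
      (\<forall>s. (h z)\<^sup>2 * det (colrep (pencil W0 W1 s z) l (b z)) = (\<Sum>m\<le>CARD('n). dv l m z * s ^ m)))" by (elim exE)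
  have "\<forall>\<^sub>F z in nhds z0. \<forall>l. h z \<noteq> 0 \<longrightarrow>
      (\<forall>s. (h z)\<^sup>2 * det (colrep (pencil W0 W1 s z) l (b z)) = (\<Sum>m\<le>CARD('n). dv l m z * s ^ m))"
    using dv by (intro eventually_all_finite) simp
  then have v: "\<forall>\<^sub>F z in nhds z0. h z \<noteq> 0 \<longrightarrow>
      (\<forall>s l. (h z)\<^sup>2 * det (colrep (pencil W0 W1 s z) l (b z)) = (\<Sum>m\<le>CARD('n). dv l m z * s ^ m))"
    by eventually_elim simp
  show ?thesis
  proof (rule pencil_contraction[OF W logform_dlog_h b c c0])
    fix de assume de: "\<And>m. de m \<in> Ogerm z0"
      "\<forall>\<^sub>F z in nhds z0. h z \<noteq> 0 \<longrightarrow>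
      (\<forall>s. (h z)\<^sup>2 * (\<Sum>k\<in>UNIV. (\<chi> a. inverse (h z) * FD h z (axis a 1)) $ k * det (colrep (pencil W0 W1 s z) k (b z)))
         = (\<Sum>m\<le>CARD('n). de m z * s ^ m))"
    have "\<forall>\<^sub>F z in nhds z0. h z \<noteq> 0 \<longrightarrow>
      (\<forall>s. (\<Sum>l\<in>UNIV. FD h z (axis l 1) * (\<Sum>m\<le>CARD('n). dv l m z * s ^ m)) = h z * (\<Sum>m\<le>CARD('n). de m z * s ^ m))"
      using v de(2)
    proof eventually_elim
      case (elim z)
      show ?case
      proof (intro impI allI)
        fix s assume hz: "h z \<noteq> 0"
        have "(\<Sum>m\<le>CARD('n). de m z * s ^ m) = (h z)\<^sup>2 * (\<Sum>k\<in>UNIV. (\<chi> a. inverse (h z) * FD h z (axis a 1)) $ k * det (colrep (pencil W0 W1 s z) k (b z)))"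
          using elim(2) hz by simp
        also have "h z * \<dots> = (\<Sum>k\<in>UNIV. FD h z (axis k 1) * ((h z)\<^sup>2 * det (colrep (pencil W0 W1 s z) k (b z))))"
          using hz by (simp add: sum_distrib_left) (intro sum.cong refl, simp)
        also have "\<dots> = (\<Sum>l\<in>UNIV. FD h z (axis l 1) * (\<Sum>m\<le>CARD('n). dv l m z * s ^ m))"
          using elim(1) hz by simp
        finally show "(\<Sum>l\<in>UNIV. FD h z (axis l 1) * (\<Sum>m\<le>CARD('n). dv l m z * s ^ m)) = h z * (\<Sum>m\<le>CARD('n). de m z * s ^ m)" by simp
      qed
    qed
    then show ?thesis using dv v de(1) by blast
  qed
qed

text \<open>The combination is treated term by term: its numerators are then combinations of germs
  with the coefficients \<open>a i\<close>, and so vanish at \<open>z0\<close> along with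
  these.\<close>

lemma contraction_coeffs_sum:
  fixes I :: "'i set"
  assumes W: "log_closed W0" "log_closed W1" and b: "\<And>i. i \<in> I \<Longrightarrow> logform (b i)" and I: "finite I"
    and a: "\<And>i. i \<in> I \<Longrightarrow> a i \<in> Ogerm z0" "\<And>i. i \<in> I \<Longrightarrow> a i z0 = 0"
    and c: "\<And>m. c m \<in> Ogerm z0"
      "\<forall>\<^sub>F z in nhds z0. h z \<noteq> 0 \<longrightarrow>
        (\<forall>s. (h z)\<^sup>2 * det (pencil W0 W1 s z) = (\<Sum>m\<le>CARD('n). c m z * s ^ m))"
    and c0: "(\<Sum>m\<le>CARD('n). c m z0 * s0 ^ m) \<noteq> 0"
  obtains dv de where "\<And>l m. dv l m \<in> Ogerm z0" "\<And>m. de m \<in> Ogerm z0" "\<And>l m. dv l m z0 = 0"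
    "\<forall>\<^sub>F z in nhds z0. h z \<noteq> 0 \<longrightarrow>
      (\<forall>s l. (h z)\<^sup>2 * det (colrep (pencil W0 W1 s z) l (\<Sum>i\<in>I. a i z *s b i z)) = (\<Sum>m\<le>CARD('n). dv l m z * s ^ m))"
    "\<forall>\<^sub>F z in nhds z0. h z \<noteq> 0 \<longrightarrow>
      (\<forall>s. (\<Sum>l\<in>UNIV. FD h z (axis l 1) * (\<Sum>m\<le>CARD('n). dv l m z * s ^ m)) = h z * (\<Sum>m\<le>CARD('n). de m z * s ^ m))"
proof -
  let ?P = "\<lambda>i dv de. (\<forall>l m. dv l m \<in> Ogerm z0) \<and> (\<forall>m. de m \<in> Ogerm z0) \<and>
    (\<forall>\<^sub>F z in nhds z0. h z \<noteq> 0 \<longrightarrow>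
      (\<forall>s l. (h z)\<^sup>2 * det (colrep (pencil W0 W1 s z) l (b i z)) = (\<Sum>m\<le>CARD('n). dv l m z * s ^ m))) \<and>
    (\<forall>\<^sub>F z in nhds z0. h z \<noteq> 0 \<longrightarrow>
      (\<forall>s. (\<Sum>l\<in>UNIV. FD h z (axis l 1) * (\<Sum>m\<le>CARD('n). dv l m z * s ^ m)) = h z * (\<Sum>m\<le>CARD('n). de m z * s ^ m)))"
  have "\<forall>i\<in>I. \<exists>dv de. ?P i dv de"
    using contraction_coeffs[OF W b c c0] by (rule ballI)
  then have "\<exists>dv. \<forall>i\<in>I. \<exists>de. ?P i (dv i) de" by (rule bchoice)
  then obtain dv where "\<forall>i\<in>I. \<exists>de. ?P i (dv i) de" by (elim exE)
  then have "\<exists>de. \<forall>i\<in>I. ?P i (dv i) (de i)" by (rule bchoice)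
  then obtain de where P: "\<forall>i\<in>I. ?P i (dv i) (de i)" by (elim exE)
  define v where "v l m z = (\<Sum>i\<in>I. a i z * dv i l m z)" for l m z
  define e where "e m z = (\<Sum>i\<in>I. a i z * de i m z)" for m z
  have vs: "(\<Sum>m\<le>CARD('n). v l m z * s ^ m) = (\<Sum>i\<in>I. a i z * (\<Sum>m\<le>CARD('n). dv i l m z * s ^ m))" for l z s
    unfolding v_def sum_distrib_left sum_distrib_right by (subst sum.swap) (simp add: algebra_simps)
  have es: "(\<Sum>m\<le>CARD('n). e m z * s ^ m) = (\<Sum>i\<in>I. a i z * (\<Sum>m\<le>CARD('n). de i m z * s ^ m))" for z s
    unfolding e_def sum_distrib_left sum_distrib_right by (subst sum.swap) (simp add: algebra_simps)
  have ev1: "\<forall>\<^sub>F z in nhds z0. \<forall>i\<in>I. h z \<noteq> 0 \<longrightarrow>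
      (\<forall>s l. (h z)\<^sup>2 * det (colrep (pencil W0 W1 s z) l (b i z)) = (\<Sum>m\<le>CARD('n). dv i l m z * s ^ m))"
    using P by (intro eventually_ball_finite I) blast
  have ev2: "\<forall>\<^sub>F z in nhds z0. \<forall>i\<in>I. h z \<noteq> 0 \<longrightarrow>
      (\<forall>s. (\<Sum>l\<in>UNIV. FD h z (axis l 1) * (\<Sum>m\<le>CARD('n). dv i l m z * s ^ m)) = h z * (\<Sum>m\<le>CARD('n). de i m z * s ^ m))"
    using P by (intro eventually_ball_finite I) blast
  show thesis
  proof (rule that[of v e])
    show "v l m \<in> Ogerm z0" "e m \<in> Ogerm z0" for l m
      unfolding v_def e_def using P a(1) by (auto intro!: Ogerm_sum Ogerm_mult)
    show "v l m z0 = 0" for l m by (simp add: v_def a(2))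
    show "\<forall>\<^sub>F z in nhds z0. h z \<noteq> 0 \<longrightarrow>
      (\<forall>s l. (h z)\<^sup>2 * det (colrep (pencil W0 W1 s z) l (\<Sum>i\<in>I. a i z *s b i z)) = (\<Sum>m\<le>CARD('n). v l m z * s ^ m))"
      using ev1
    proof eventually_elim
      case (elim z)
      show ?case
      proof (intro impI allI)
        fix s l assume hz: "h z \<noteq> 0"
        have "(h z)\<^sup>2 * det (colrep (pencil W0 W1 s z) l (\<Sum>i\<in>I. a i z *s b i z)) =
          (\<Sum>i\<in>I. a i z * ((h z)\<^sup>2 * det (colrep (pencil W0 W1 s z) l (b i z))))"
          by (simp add: det_colrep_sum sum_distrib_left algebra_simps)
        also have "\<dots> = (\<Sum>i\<in>I. a i z * (\<Sum>m\<le>CARD('n). dv i l m z * s ^ m))"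
          using elim hz by (intro sum.cong refl) simp
        finally show "(h z)\<^sup>2 * det (colrep (pencil W0 W1 s z) l (\<Sum>i\<in>I. a i z *s b i z)) = (\<Sum>m\<le>CARD('n). v l m z * s ^ m)"
          by (simp add: vs)
      qed
    qed
    show "\<forall>\<^sub>F z in nhds z0. h z \<noteq> 0 \<longrightarrow>
      (\<forall>s. (\<Sum>l\<in>UNIV. FD h z (axis l 1) * (\<Sum>m\<le>CARD('n). v l m z * s ^ m)) = h z * (\<Sum>m\<le>CARD('n). e m z * s ^ m))"
      using ev2
    proof eventually_elim
      case (elim z)
      show ?case
      proof (intro impI allI)
        fix s assume hz: "h z \<noteq> 0"
        have "(\<Sum>l\<in>UNIV. FD h z (axis l 1) * (\<Sum>m\<le>CARD('n). v l m z * s ^ m)) =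
          (\<Sum>i\<in>I. a i z * (\<Sum>l\<in>UNIV. FD h z (axis l 1) * (\<Sum>m\<le>CARD('n). dv i l m z * s ^ m)))"
          unfolding vs sum_distrib_left[where r="FD h z _"] sum_distrib_left[where r="a _ z"]
          by (subst sum.swap) (simp add: algebra_simps)
        also have "\<dots> = (\<Sum>i\<in>I. a i z * (h z * (\<Sum>m\<le>CARD('n). de i m z * s ^ m)))"
          using elim hz by (intro sum.cong refl) simp
        also have "\<dots> = h z * (\<Sum>m\<le>CARD('n). e m z * s ^ m)"
          unfolding es by (simp add: sum_distrib_left algebra_simps)
        finally show "(\<Sum>l\<in>UNIV. FD h z (axis l 1) * (\<Sum>m\<le>CARD('n). v l m z * s ^ m)) = h z * (\<Sum>m\<le>CARD('n). e m z * s ^ m)" .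
      qed
    qed
  qed
qed

end

section \<open>Curves of the flow, uniqueness and inversion\<close>

lemma pt_line_vd: "((\<lambda>t. pt (complex_of_real (a + b * t)) z) has_vector_derivative (b *\<^sub>R axis None 1)) (at t within T)"
proof -
  have eq: "pt (complex_of_real (a + b * t)) z = pt (complex_of_real a) z + t *\<^sub>R (b *\<^sub>R axis None 1)" for t
    by (simp add: vec_eq_iff pt_def axis_def scaleR_conv_of_real[of _ "_::complex"] split: option.splits)
  show ?thesis unfolding eq by (auto intro!: derivative_eq_intros)
qed

lemma flow_vd:
  assumes \<phi>: "hmap \<phi> \<Omega>" and w: "pt (complex_of_real (a + b * t)) z \<in> \<Omega>"
    and ode: "\<And>w. w \<in> \<Omega> \<Longrightarrow> FD \<phi> w (axis None 1) = X (pt (w $ None) (\<phi> w))"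
  shows "((\<lambda>t. \<phi> (pt (complex_of_real (a + b * t)) z)) has_vector_derivative
      b *\<^sub>R X (pt (complex_of_real (a + b * t)) (\<phi> (pt (complex_of_real (a + b * t)) z)))) (at t within T)"
proof -
  have "FD \<phi> (pt (complex_of_real (a + b * t)) z) (b *\<^sub>R axis None 1) =
      b *\<^sub>R X (pt (complex_of_real (a + b * t)) (\<phi> (pt (complex_of_real (a + b * t)) z)))"
    using linear_scale[OF has_derivative_linear[OF hmap_deriv(3)[OF \<phi> w]]] ode[OF w] by simp
  then show ?thesis using hmap_vector_chain[OF \<phi> w pt_line_vd, of T] by simp
qed

lemma ode_unique:
  fixes X :: "complex^('n::finite option) \<Rightarrow> complex^'n"
  assumes \<alpha>: "\<And>t. t \<in> {0..1} \<Longrightarrow> (\<alpha> has_vector_derivative X (pt (complex_of_real t) (\<alpha> t))) (at t within {0..1})"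
    and \<beta>: "\<And>t. t \<in> {0..1} \<Longrightarrow> (\<beta> has_vector_derivative X (pt (complex_of_real t) (\<beta> t))) (at t within {0..1})"
    and ball: "\<And>t. t \<in> {0..1} \<Longrightarrow> \<alpha> t \<in> B" "\<And>t. t \<in> {0..1} \<Longrightarrow> \<beta> t \<in> B"
    and lip: "\<And>t z z'. t \<in> {0..1} \<Longrightarrow> z \<in> B \<Longrightarrow> z' \<in> B \<Longrightarrow>
        norm (X (pt (complex_of_real t) z) - X (pt (complex_of_real t) z')) \<le> L * norm (z - z')"
    and t: "t1 \<in> {0..1}" "\<alpha> t1 = \<beta> t1" "t \<in> {0..1}"
  shows "\<alpha> t = \<beta> t"
proof -
  have "\<alpha> t - \<beta> t = 0"
  proof (rule linear_ode_zero[where \<delta>="\<lambda>t. \<alpha> t - \<beta> t" and a=0 and b=1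
      and \<delta>'="\<lambda>t. X (pt (complex_of_real t) (\<alpha> t)) - X (pt (complex_of_real t) (\<beta> t))" and ?t1.0=t1 and L=L])
    fix t :: real assume "t \<in> {0..1}"
    then show "((\<lambda>t. \<alpha> t - \<beta> t) has_vector_derivative
        X (pt (complex_of_real t) (\<alpha> t)) - X (pt (complex_of_real t) (\<beta> t))) (at t within {0..1})"
      by (intro has_vector_derivative_diff \<alpha> \<beta>)
  qed (use t lip ball in auto)
  then show ?thesis by simp
qed

text \<open>The inverse of the time-\<open>t\<close> map is the time-1 map of the reversed field,
  \<open>- t\<close> times \<open>X\<close> at time \<open>t * (1 - s)\<close>. Uniqueness for the
  reversed equation identifies its solutions with the curves of \<open>\<phi>\<close> run backwards,
  in both orders of composition.\<close>

lemma holomorphic_flow_inverse: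
  fixes X :: "complex^('n::finite option) \<Rightarrow> complex^'n"
  assumes U: "open U" and X: "hmap X U" and seg: "\<And>t. t \<in> {0..1} \<Longrightarrow> pt (complex_of_real t) z0 \<in> U"
    and fix0: "\<And>\<tau>. pt \<tau> z0 \<in> U \<Longrightarrow> X (pt \<tau> z0) = 0"
    and \<Omega>: "open \<Omega>" "\<rho> > 0" "C > 0" "hmap \<phi> \<Omega>"
    "\<And>t z. t \<in> {0..1} \<Longrightarrow> z \<in> ball z0 \<rho> \<Longrightarrow> pt (complex_of_real t) z \<in> \<Omega>"
    "\<And>w. w \<in> \<Omega> \<Longrightarrow> pt (w $ None) (\<phi> w) \<in> U"
    "\<And>w. w \<in> \<Omega> \<Longrightarrow> norm (\<phi> w - z0) \<le> C * norm (sp w - z0)"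
    "\<And>z. pt 0 z \<in> \<Omega> \<Longrightarrow> \<phi> (pt 0 z) = z"
    and ode: "\<And>w. w \<in> \<Omega> \<Longrightarrow> FD \<phi> w (axis None 1) = X (pt (w $ None) (\<phi> w))"
    and t: "t \<in> {0..1}"
  obtains G r where "r > 0" "hmap G (ball z0 r)" "G z0 = z0"
    "\<And>z. z \<in> ball z0 r \<Longrightarrow> G (\<phi> (pt (complex_of_real t) z)) = z"
    "\<And>z. z \<in> ball z0 r \<Longrightarrow> G z \<in> ball z0 \<rho> \<and> \<phi> (pt (complex_of_real t) (G z)) = z"
proof -
  define rv where "rv w = pt (of_real t * (1 - w $ None)) (sp w)" for w :: "complex^('n option)"
  have rv: "hmap rv S" for S unfolding rv_def[abs_def] by (intro hmap_pt hmap_sp holo_intros)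
  define V where "V = rv -` U"
  define Y where "Y w = (- complex_of_real t) *s X (rv w)" for w
  have V: "open V" unfolding V_def by (intro open_vimage U hmap_continuous rv)
  have Y: "hmap Y V"
  proof -
    have "hmap (\<lambda>w. X (rv w)) V" by (rule hmap_compose(1)[OF X rv]) (auto simp: V_def)
    then show ?thesis unfolding hmap_def Y_def by (auto intro!: holo_intros)
  qed
  have tt: "t * (1 - s) \<in> {0..1}" if "s \<in> {0..1}" for s using t that by (auto intro: mult_le_one)
  have rvr: "rv (pt (complex_of_real s) z) = pt (complex_of_real (t * (1 - s))) z" for s z
    by (simp add: rv_def)
  have segY: "pt (complex_of_real s) z0 \<in> V" if "s \<in> {0..1}" for s
    using seg[OF tt[OF that]] by (simp add: V_def rvr)
  have Y0: "Y (pt \<tau> z0) = 0" if "pt \<tau> z0 \<in> V" for \<tau>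
    using that fix0 by (auto simp: V_def Y_def rv_def)
  obtain \<Psi> \<psi> \<rho>' C' where \<Psi>: "open \<Psi>" "\<rho>' > 0" "C' > 0" "hmap \<psi> \<Psi>"
    "\<And>t z. t \<in> {0..1} \<Longrightarrow> z \<in> ball z0 \<rho>' \<Longrightarrow> pt (complex_of_real t) z \<in> \<Psi>"
    "\<And>w. w \<in> \<Psi> \<Longrightarrow> pt (w $ None) (\<psi> w) \<in> V"
    "\<And>w. w \<in> \<Psi> \<Longrightarrow> norm (\<psi> w - z0) \<le> C' * norm (sp w - z0)"
    "\<And>z. pt 0 z \<in> \<Psi> \<Longrightarrow> \<psi> (pt 0 z) = z"
    "\<And>w. w \<in> \<Psi> \<Longrightarrow> FD \<psi> w (axis None 1) = Y (pt (w $ None) (\<psi> w))"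
    by (rule holomorphic_flow[OF V Y segY Y0]) (assumption | rule that)+
  obtain e L where e: "0 < e" "e < 1" "0 < L"
    "\<And>t \<tau> z. t \<in> {0..1} \<Longrightarrow> dist \<tau> (complex_of_real t) < e \<Longrightarrow> z \<in> ball z0 e \<Longrightarrow> pt \<tau> z \<in> V"
    "\<And>t \<tau> z z'. t \<in> {0..1} \<Longrightarrow> dist \<tau> (complex_of_real t) < e \<Longrightarrow> z \<in> ball z0 e \<Longrightarrow> z' \<in> ball z0 e \<Longrightarrow>
        norm (Y (pt \<tau> z) - Y (pt \<tau> z')) \<le> L * norm (z - z')"
    by (rule local_lipschitz[OF V Y segY]) (assumption | rule that)+
  have lipY: "norm (Y (pt (complex_of_real t) z) - Y (pt (complex_of_real t) z')) \<le> L * norm (z - z')"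
    if "t \<in> {0..1}" "z \<in> ball z0 e" "z' \<in> ball z0 e" for t z z'
    using e(5)[OF that(1) _ that(2,3), of "complex_of_real t"] e(1) by simp
  have \<phi>curve: "((\<lambda>s. \<phi> (pt (complex_of_real (t * (1 - s))) z)) has_vector_derivative
      Y (pt (complex_of_real s) (\<phi> (pt (complex_of_real (t * (1 - s))) z)))) (at s within {0..1})"
    if "z \<in> ball z0 \<rho>" "s \<in> {0..1}" for z s
  proof -
    have eq: "t * (1 - s) = t + (-t) * s" for s by (simp add: algebra_simps)
    have "pt (complex_of_real (t + (-t) * s)) z \<in> \<Omega>"
      unfolding eq[symmetric] by (rule \<Omega>(5)[OF tt[OF that(2)] that(1)])
    from flow_vd[OF \<Omega>(4) this ode, of "{0..1}"] show ?thesis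
      unfolding Y_def rvr eq by (simp add: scaleR_vec_smult)
  qed
  have \<psi>curve: "((\<lambda>s. \<psi> (pt (complex_of_real s) z)) has_vector_derivative
      Y (pt (complex_of_real s) (\<psi> (pt (complex_of_real s) z)))) (at s within {0..1})"
    if "z \<in> ball z0 \<rho>'" "s \<in> {0..1}" for z s
    using flow_vd[OF \<Psi>(4) _ \<Psi>(9), of 0 1 s z "{0..1}"] \<Psi>(5)[OF that(2,1)] by simp
  have small: "\<exists>r>0. \<forall>z\<in>ball z0 r. norm (z - z0) < d \<and> K * norm (z - z0) < d" if "d > 0" for d K :: real
  proof (intro exI[of _ "d / (\<bar>K\<bar> + 1)"] conjI ballI)
    fix z assume "z \<in> ball z0 (d / (\<bar>K\<bar> + 1))"
    then have z: "norm (z - z0) * (\<bar>K\<bar> + 1) < d" by (simp add: dist_norm norm_minus_commute pos_less_divide_eq)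
    have "norm (z - z0) * 1 \<le> norm (z - z0) * (\<bar>K\<bar> + 1)" by (rule mult_left_mono) auto
    moreover have "norm (z - z0) * K \<le> norm (z - z0) * (\<bar>K\<bar> + 1)" by (rule mult_left_mono) auto
    then have "K * norm (z - z0) \<le> norm (z - z0) * (\<bar>K\<bar> + 1)" by (simp add: mult.commute)
    ultimately show "norm (z - z0) < d" "K * norm (z - z0) < d" using z by linarith+
  qed (use that in simp)
  define m where "m = min (min \<rho> \<rho>') e"
  have m: "m > 0" "m \<le> \<rho>" "m \<le> \<rho>'" "m \<le> e" using \<Omega>(2) \<Psi>(2) e(1) by (auto simp: m_def)
  obtain r1 where r1: "r1 > 0" "\<And>z. z \<in> ball z0 r1 \<Longrightarrow> norm (z - z0) < m \<and> C * norm (z - z0) < m"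
    using small[OF m(1), of C] by blast
  obtain r2 where r2: "r2 > 0" "\<And>z. z \<in> ball z0 r2 \<Longrightarrow> norm (z - z0) < m \<and> C' * norm (z - z0) < m"
    using small[OF m(1), of C'] by blast
  obtain r3 where r3: "r3 > 0" "\<And>z. z \<in> ball z0 r3 \<Longrightarrow> norm (z - z0) < r2 \<and> C * norm (z - z0) < r2"
    using small[OF r2(1), of C] by blast
  obtain r4 where r4: "r4 > 0" "\<And>z. z \<in> ball z0 r4 \<Longrightarrow> norm (z - z0) < r1 \<and> C' * norm (z - z0) < r1"
    using small[OF r1(1), of C'] by blast
  \<comment> \<open>\<open>r1\<close> and \<open>r2\<close> keep the curves of \<open>\<phi>\<close>
    and of the reversed flow in the tube; \<open>r3\<close> and \<open>r4\<close> make the end point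
    of one an admissible starting point of the other.\<close>
  define r where "r = min (min r1 r2) (min r3 r4)"
  have r: "r > 0" "r \<le> r1" "r \<le> r2" "r \<le> r3" "r \<le> r4" using r1 r2 r3 r4 by (auto simp: r_def)
  define G where "G z = \<psi> (pt 1 z)" for z
  have \<phi>b: "norm (\<phi> (pt (complex_of_real s) z) - z0) \<le> C * norm (z - z0)" if "s \<in> {0..1}" "z \<in> ball z0 \<rho>" for s z
    using \<Omega>(7)[OF \<Omega>(5)[OF that]] by simp
  have \<psi>b: "norm (\<psi> (pt (complex_of_real s) z) - z0) \<le> C' * norm (z - z0)" if "s \<in> {0..1}" "z \<in> ball z0 \<rho>'" for s z
    using \<Psi>(7)[OF \<Psi>(5)[OF that]] by simp
  have nb: "z \<in> ball z0 d \<longleftrightarrow> norm (z - z0) < d" for z d by (simp add: dist_norm norm_minus_commute)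
  show thesis
  proof (rule that[OF r(1), of G])
    have "ball z0 r \<subseteq> ball z0 \<rho>'" using r r2 m nb by (meson less_le_trans subset_iff)
    then have "(\<lambda>z. pt 1 z) ` ball z0 r \<subseteq> \<Psi>" using \<Psi>(5)[of 1] by auto
    moreover have "hmap (\<lambda>z. pt 1 z) (ball z0 r)"
      by (intro hmap_pt holo_intros) (simp add: hmap_def holo_on_coord)
    ultimately show "hmap G (ball z0 r)" unfolding G_def by (intro hmap_compose(1)[OF \<Psi>(4)])
    have "norm (\<psi> (pt (complex_of_real 1) z0) - z0) \<le> C' * norm (z0 - z0)" using \<Psi>(2) by (intro \<psi>b) auto
    then show "G z0 = z0" by (simp add: G_def)
    show "G (\<phi> (pt (complex_of_real t) z)) = z" if z: "z \<in> ball z0 r" for z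
    proof -
      let ?x = "\<phi> (pt (complex_of_real t) z)"
      have z1: "norm (z - z0) < m" "C * norm (z - z0) < m" "C * norm (z - z0) < r2"
        using r1(2)[of z] r3(2)[of z] r z unfolding nb by auto
      have x: "norm (?x - z0) < r2" using \<phi>b[OF t, of z] z1 m nb by auto
      then have x': "norm (?x - z0) < m" "C' * norm (?x - z0) < m" using r2(2)[of ?x] nb by auto
      have "\<psi> (pt (complex_of_real 1) ?x) = \<phi> (pt (complex_of_real (t * (1 - 1))) z)"
      proof (rule ode_unique[where X=Y and B="ball z0 e" and L=L and ?t1.0=0 and t=1
            and \<alpha>="\<lambda>s. \<psi> (pt (complex_of_real s) ?x)" and \<beta>="\<lambda>s. \<phi> (pt (complex_of_real (t * (1 - s))) z)"])
        fix s :: real assume s: "s \<in> {0..1}"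
        show "((\<lambda>s. \<psi> (pt (complex_of_real s) ?x)) has_vector_derivative
          Y (pt (complex_of_real s) (\<psi> (pt (complex_of_real s) ?x)))) (at s within {0..1})"
          using x' m nb s by (intro \<psi>curve) auto
        show "((\<lambda>s. \<phi> (pt (complex_of_real (t * (1 - s))) z)) has_vector_derivative
          Y (pt (complex_of_real s) (\<phi> (pt (complex_of_real (t * (1 - s))) z)))) (at s within {0..1})"
          using z1 m nb s by (intro \<phi>curve) auto
        show "\<psi> (pt (complex_of_real s) ?x) \<in> ball z0 e"
          using \<psi>b[OF s, of ?x] x' m unfolding nb by auto
        show "\<phi> (pt (complex_of_real (t * (1 - s))) z) \<in> ball z0 e"
          using \<phi>b[OF tt[OF s], of z] z1 m unfolding nb by auto
      next
        have "pt 0 ?x \<in> \<Psi>" using \<Psi>(5)[of 0 ?x] x' m nb by auto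
        then show "\<psi> (pt (complex_of_real 0) ?x) = \<phi> (pt (complex_of_real (t * (1 - 0))) z)"
          using \<Psi>(8) by simp
      qed (use lipY in auto)
      moreover have "pt 0 z \<in> \<Omega>" using \<Omega>(5)[of 0 z] z1 m nb by auto
      ultimately show ?thesis using \<Omega>(8) by (simp add: G_def)
    qed
    show "G z \<in> ball z0 \<rho> \<and> \<phi> (pt (complex_of_real t) (G z)) = z" if z: "z \<in> ball z0 r" for z
    proof -
      have z1: "norm (z - z0) < m" "C' * norm (z - z0) < m" "C' * norm (z - z0) < r1"
        using r2(2)[of z] r4(2)[of z] r z unfolding nb by auto
      have x: "norm (G z - z0) < r1" using \<psi>b[of 1 z] z1 m nb by (auto simp: G_def)
      then have x': "norm (G z - z0) < m" "C * norm (G z - z0) < m" using r1(2)[of "G z"] nb by auto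
      have "\<psi> (pt (complex_of_real 0) z) = \<phi> (pt (complex_of_real (t * (1 - 0))) (G z))"
      proof (rule ode_unique[where X=Y and B="ball z0 e" and L=L and ?t1.0=1 and t=0
            and \<alpha>="\<lambda>s. \<psi> (pt (complex_of_real s) z)" and \<beta>="\<lambda>s. \<phi> (pt (complex_of_real (t * (1 - s))) (G z))"])
        fix s :: real assume s: "s \<in> {0..1}"
        show "((\<lambda>s. \<psi> (pt (complex_of_real s) z)) has_vector_derivative
          Y (pt (complex_of_real s) (\<psi> (pt (complex_of_real s) z)))) (at s within {0..1})"
          using z1 m nb s by (intro \<psi>curve) auto
        show "((\<lambda>s. \<phi> (pt (complex_of_real (t * (1 - s))) (G z))) has_vector_derivative
          Y (pt (complex_of_real s) (\<phi> (pt (complex_of_real (t * (1 - s))) (G z))))) (at s within {0..1})"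
          using x' m nb s by (intro \<phi>curve) auto
        show "\<psi> (pt (complex_of_real s) z) \<in> ball z0 e"
          using \<psi>b[OF s, of z] z1 m unfolding nb by auto
        show "\<phi> (pt (complex_of_real (t * (1 - s))) (G z)) \<in> ball z0 e"
          using \<phi>b[OF tt[OF s], of "G z"] x' m unfolding nb by auto
      next
        have "pt 0 (G z) \<in> \<Omega>" using \<Omega>(5)[of 0 "G z"] x' m nb by auto
        then show "\<psi> (pt (complex_of_real 1) z) = \<phi> (pt (complex_of_real (t * (1 - 1))) (G z))"
          using \<Omega>(8) by (simp add: G_def)
      qed (use lipY in auto)
      moreover have "pt 0 z \<in> \<Psi>" using \<Psi>(5)[of 0 z] z1 m nb by auto
      ultimately show ?thesis using \<Psi>(8) x' m nb by auto
    qed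
  qed
qed

lemma hmap_pt_space: "hmap (\<lambda>y. pt \<tau> y) S"
  by (intro hmap_pt holo_on_const) (simp add: hmap_def holo_on_coord)

lemma FD_pt_space: "FD (\<lambda>y. pt \<tau> y) z v = pt 0 v"
proof -
  have "FD (\<lambda>y. pt \<tau> y) z v $ k = pt 0 v $ k" for k
    unfolding FD_hmap_component[OF hmap_pt_space UNIV_I]
    by (cases k) (simp_all add: FD_coord FD_eq[OF has_derivative_const])
  then show ?thesis by (simp add: vec_eq_iff)
qed

section \<open>The Moser flow in coordinates\<close>

context reduced_germ
begin

lemma flow_preserves_zeros:
  fixes x :: "real \<Rightarrow> complex^'n"
  assumes B: "holo_on h B" "\<And>t. t \<in> {0..1} \<Longrightarrow> x t \<in> B"
    and x: "\<And>t. t \<in> {0..1} \<Longrightarrow> (x has_vector_derivative x' t) (at t within {0..1})"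
    and k: "continuous_on {0..1} k" "\<And>t. t \<in> {0..1} \<Longrightarrow> FD h (x t) (x' t) = k t * h (x t)"
    and t: "s \<in> {0..1}" "t \<in> {0..1}" "h (x s) = 0"
  shows "h (x t) = 0"
proof -
  have "bounded (k ` {0..1})" by (intro compact_imp_bounded compact_continuous_image k) simp
  then obtain L where L: "\<And>t. t \<in> {0..1} \<Longrightarrow> cmod (k t) \<le> L" unfolding bounded_iff by blast
  show ?thesis
  proof (rule linear_ode_zero[where \<delta>="\<lambda>t. h (x t)" and a=0 and b=1 and \<delta>'="\<lambda>t. FD h (x t) (x' t)" and L=L and ?t1.0=s])
    fix t :: real assume t: "t \<in> {0..1}"
    show "((\<lambda>t. h (x t)) has_vector_derivative FD h (x t) (x' t)) (at t within {0..1})"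
      by (rule holo_vector_chain[OF B(1) B(2)[OF t] x[OF t]])
    show "norm (FD h (x t) (x' t)) \<le> L * norm (h (x t))"
      using L[OF t] by (simp add: k(2)[OF t] norm_mult mult_right_mono)
  qed (use t in auto)
qed

theorem moser_isotopy:
  fixes g :: "nat \<Rightarrow> complex^'n \<Rightarrow> complex" and \<theta> :: "'n \<Rightarrow> complex^'n \<Rightarrow> complex"
  assumes W: "log_closed W0" "log_closed W1"
    and q: "q0 \<in> Ogerm z0" "q0 z0 \<noteq> 0" "\<forall>\<^sub>F z in nhds z0. h z \<noteq> 0 \<longrightarrow> (h z)\<^sup>2 * det (W0 z) = q0 z"
      "q1 \<in> Ogerm z0" "q1 z0 \<noteq> 0" "\<forall>\<^sub>F z in nhds z0. h z \<noteq> 0 \<longrightarrow> (h z)\<^sup>2 * det (W1 z) = q1 z"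
    and g: "\<And>k. k < length fs \<Longrightarrow> g k \<in> Ogerm z0" and \<theta>: "\<And>j. \<theta> j \<in> Ogerm z0"
    and d\<eta>: "\<forall>\<^sub>F z in nhds z0. h z \<noteq> 0 \<longrightarrow> (\<forall>i j. W1 z $ i $ j - W0 z $ i $ j =
      FD (\<lambda>z. (\<Sum>k<length fs. g k z * (inverse ((fs ! k) z) * FD (fs ! k) z (axis j 1))) + \<theta> j z) z (axis i 1) -
      FD (\<lambda>z. (\<Sum>k<length fs. g k z * (inverse ((fs ! k) z) * FD (fs ! k) z (axis i 1))) + \<theta> i z) z (axis j 1))"
  obtains \<Omega> \<phi> \<rho> where "open \<Omega>" "\<rho> > 0" "hmap \<phi> \<Omega>"
    "\<And>t z. t \<in> {0..1} \<Longrightarrow> z \<in> ball z0 \<rho> \<Longrightarrow> pt (complex_of_real t) z \<in> \<Omega>"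
    "\<And>t. t \<in> {0..1} \<Longrightarrow> \<phi> (pt (complex_of_real t) z0) = z0"
    "\<And>z. z \<in> ball z0 \<rho> \<Longrightarrow> \<phi> (pt 0 z) = z"
    "\<And>t. t \<in> {0..1} \<Longrightarrow> \<exists>G r. r > 0 \<and> hmap G (ball z0 r) \<and> G z0 = z0 \<and>
       (\<forall>z\<in>ball z0 r. G (\<phi> (pt (complex_of_real t) z)) = z \<and> \<phi> (pt (complex_of_real t) (G z)) = z)"
    "\<And>t z. t \<in> {0..1} \<Longrightarrow> z \<in> ball z0 \<rho> \<Longrightarrow> h (\<phi> (pt (complex_of_real t) z)) = 0 \<longleftrightarrow> h z = 0"
    "\<And>z u v. z \<in> ball z0 \<rho> \<Longrightarrow> h z \<noteq> 0 \<Longrightarrow>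
       bil (W1 (\<phi> (pt 1 z))) (FD \<phi> (pt 1 z) (pt 0 u)) (FD \<phi> (pt 1 z) (pt 0 v)) = bil (W0 z) u v"
proof -
  let ?N = "CARD('n)"
  obtain c where c: "\<And>m. c m \<in> Ogerm z0"
    "\<forall>\<^sub>F z in nhds z0. h z \<noteq> 0 \<longrightarrow> (\<forall>s. (h z)\<^sup>2 * det (pencil W0 W1 s z) = (\<Sum>m\<le>?N. c m z * s ^ m))"
    by (rule pencil_det[OF W]) (rule that)
  \<comment> \<open>The determinant polynomial at the base point; that \<open>q0\<close> and
    \<open>q1\<close> are units says that it does not vanish at 0 and 1.\<close>
  define Q where "Q = (\<Sum>m\<le>?N. monom (c m z0) m)"
  have Q: "poly Q s = (\<Sum>m\<le>?N. c m z0 * s ^ m)" for s by (simp add: Q_def poly_sum poly_monom)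
  have Qs: "poly Q s = q z0" if "q \<in> Ogerm z0" "\<forall>\<^sub>F z in nhds z0. h z \<noteq> 0 \<longrightarrow> (h z)\<^sup>2 * det (pencil W0 W1 s z) = q z" for s q
  proof -
    have "\<forall>\<^sub>F z in nhds z0. h z \<noteq> 0 \<longrightarrow> (\<Sum>m\<le>?N. c m z * s ^ m) = q z"
      using c(2) that(2) by eventually_elim auto
    then have "\<forall>\<^sub>F z in nhds z0. (\<Sum>m\<le>?N. c m z * s ^ m) = q z"
      by (intro germ_eq_off_zeros[OF hO h_nz _ that(1)] Ogerm_sum Ogerm_mult c Ogerm_const)
    from eventually_nhds_x_imp_x[OF this] show ?thesis by (simp add: Q)
  qed
  have pen0: "pencil W0 W1 0 z = W0 z" and pen1: "pencil W0 W1 1 z = W1 z" for z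
    by (simp_all add: pencil_def vec_eq_iff)
  have Q0: "poly Q 0 \<noteq> 0" using Qs[OF q(1), of 0] q by (simp add: pen0)
  have Q1: "poly Q 1 \<noteq> 0" using Qs[OF q(4), of 1] q by (simp add: pen1)
  obtain \<mu> :: real where \<mu>: "\<And>t. t \<in> {0..1} \<Longrightarrow> poly Q (complex_of_real t + \<i> * \<mu> * t * (1 - t)) \<noteq> 0"
    by (rule path_avoiding_roots[OF Q0 Q1]) (rule that)
  define \<gamma> where "\<gamma> \<tau> = \<tau> + \<i> * complex_of_real \<mu> * \<tau> * (1 - \<tau>)" for \<tau>
  define \<gamma>' where "\<gamma>' \<tau> = 1 + \<i> * complex_of_real \<mu> * (1 - 2 * \<tau>)" for \<tau>
  have \<gamma>: "poly Q (\<gamma> (complex_of_real t)) \<noteq> 0" if "t \<in> {0..1}" for t using \<mu>[OF that] by (simp add: \<gamma>_def)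
  have \<gamma>01: "\<gamma> 0 = 0" "\<gamma> 1 = 1" by (simp_all add: \<gamma>_def)
  have \<gamma>d: "((\<lambda>t. \<gamma> (complex_of_real t)) has_vector_derivative \<gamma>' (complex_of_real t)) (at t within T)" for t T
  proof -
    have "(\<gamma> has_field_derivative \<gamma>' (complex_of_real t)) (at (complex_of_real t))"
      unfolding \<gamma>_def[abs_def] \<gamma>'_def by (auto intro!: derivative_eq_intros simp: algebra_simps)
    then show ?thesis by (rule has_vector_derivative_real_field)
  qed
  \<comment> \<open>The terms of the primitive: \<open>Inl k\<close> for \<open>dlog\<close> of the
    \<open>k\<close>-th factor, \<open>Inr j\<close> for the \<open>j\<close>-th coordinate
    differential. Subtracting the values at \<open>z0\<close> makes every coefficient
    \<open>a i\<close> vanish there.\<close>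
  define I :: "(nat + 'n) set" where "I = {..<length fs} <+> UNIV"
  define a where "a i z = (case i of Inl k \<Rightarrow> g k z - g k z0 | Inr j \<Rightarrow> \<theta> j z - \<theta> j z0)" for i z
  define b where "b i z = (case i of Inl k \<Rightarrow> (\<chi> j. inverse ((fs ! k) z) * FD (fs ! k) z (axis j 1)) | Inr j \<Rightarrow> axis j 1)" for i z
  have aO: "a i \<in> Ogerm z0" "a i z0 = 0" if "i \<in> I" for i
    using that g \<theta> by (auto simp: I_def a_def[abs_def] intro!: Ogerm_diff Ogerm_const)
  have bl: "logform (b i)" if "i \<in> I" for i
    using that by (auto simp: I_def b_def[abs_def] intro!: logform_dlog logform_const)
  have "finite I" by (simp add: I_def)
  define \<eta> where "\<eta> z = (\<Sum>i\<in>I. a i z *s b i z)" for z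
  have c00: "(\<Sum>m\<le>?N. c m z0 * 0 ^ m) \<noteq> 0" using Q0 unfolding Q .
  obtain dv de where dv0: "\<And>l m. dv l m \<in> Ogerm z0" "\<And>m. de m \<in> Ogerm z0" "\<And>l m. dv l m z0 = 0"
    "\<forall>\<^sub>F z in nhds z0. h z \<noteq> 0 \<longrightarrow>
      (\<forall>s l. (h z)\<^sup>2 * det (colrep (pencil W0 W1 s z) l (\<Sum>i\<in>I. a i z *s b i z)) = (\<Sum>m\<le>?N. dv l m z * s ^ m))"
    "\<forall>\<^sub>F z in nhds z0. h z \<noteq> 0 \<longrightarrow>
      (\<forall>s. (\<Sum>l\<in>UNIV. FD h z (axis l 1) * (\<Sum>m\<le>?N. dv l m z * s ^ m)) = h z * (\<Sum>m\<le>?N. de m z * s ^ m))"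
    by (rule contraction_coeffs_sum[OF W bl \<open>finite I\<close> aO c c00]) (assumption | rule that)+
  have dv: "\<And>l m. dv l m \<in> Ogerm z0" "\<And>m. de m \<in> Ogerm z0" "\<And>l m. dv l m z0 = 0"
    "\<forall>\<^sub>F z in nhds z0. h z \<noteq> 0 \<longrightarrow>
      (\<forall>s l. (h z)\<^sup>2 * det (colrep (pencil W0 W1 s z) l (\<eta> z)) = (\<Sum>m\<le>?N. dv l m z * s ^ m))"
    "\<forall>\<^sub>F z in nhds z0. h z \<noteq> 0 \<longrightarrow>
      (\<forall>s. (\<Sum>l\<in>UNIV. FD h z (axis l 1) * (\<Sum>m\<le>?N. dv l m z * s ^ m)) = h z * (\<Sum>m\<le>?N. de m z * s ^ m))"
    unfolding \<eta>_def by (rule dv0)+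
  define L where "L k j z = inverse ((fs ! k) z) * FD (fs ! k) z (axis j 1)" for k j z
  define \<eta>0 where "\<eta>0 j z = (\<Sum>k<length fs. g k z * L k j z) + \<theta> j z" for j z
  have \<eta>c: "\<eta> z $ j = \<eta>0 j z - (\<Sum>k<length fs. g k z0 * L k j z) - \<theta> j z0" for z j
  proof -
    have "\<eta> z = (\<Sum>k<length fs. a (Inl k) z *s b (Inl k) z) + (\<Sum>j\<in>UNIV. a (Inr j) z *s b (Inr j) z)"
      unfolding \<eta>_def I_def by (subst sum.Plus) (auto simp: o_def)
    then have "\<eta> z $ j = (\<Sum>k<length fs. (a (Inl k) z *s b (Inl k) z) $ j) + (\<Sum>i\<in>UNIV. (a (Inr i) z *s b (Inr i) z) $ j)"
      by (simp only: vector_add_component sum_component)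
    also have "(\<Sum>k<length fs. (a (Inl k) z *s b (Inl k) z) $ j) = (\<Sum>k<length fs. (g k z - g k z0) * L k j z)"
      by (rule sum.cong[OF refl]) (simp add: a_def b_def L_def algebra_simps)
    also have "(\<Sum>i\<in>UNIV. (a (Inr i) z *s b (Inr i) z) $ j) = (\<Sum>i\<in>UNIV. if i = j then \<theta> i z - \<theta> i z0 else 0)"
      by (rule sum.cong[OF refl]) (auto simp: a_def b_def axis_def algebra_simps)
    finally show ?thesis by (simp add: \<eta>0_def left_diff_distrib sum_subtractf)
  qed
  have d\<eta>0: "\<forall>\<^sub>F z in nhds z0. h z \<noteq> 0 \<longrightarrow> (\<forall>i j. W1 z $ i $ j - W0 z $ i $ j =
      FD (\<eta>0 j) z (axis i 1) - FD (\<eta>0 i) z (axis j 1))"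
    using d\<eta> unfolding \<eta>0_def[abs_def] L_def .
  have as0: "\<forall>\<^sub>F z in nhds z0. h z \<noteq> 0 \<longrightarrow> (\<forall>i j. W0 z $ i $ j = - W0 z $ j $ i)"
    and as1: "\<forall>\<^sub>F z in nhds z0. h z \<noteq> 0 \<longrightarrow> (\<forall>i j. W1 z $ i $ j = - W1 z $ j $ i)"
    and cl0: "\<forall>\<^sub>F z in nhds z0. h z \<noteq> 0 \<longrightarrow> (\<forall>i j l. FD (\<lambda>z. W0 z $ j $ l) z (axis i 1)
        - FD (\<lambda>z. W0 z $ i $ l) z (axis j 1) + FD (\<lambda>z. W0 z $ i $ j) z (axis l 1) = 0)"
    and cl1: "\<forall>\<^sub>F z in nhds z0. h z \<noteq> 0 \<longrightarrow> (\<forall>i j l. FD (\<lambda>z. W1 z $ j $ l) z (axis i 1)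
        - FD (\<lambda>z. W1 z $ i $ l) z (axis j 1) + FD (\<lambda>z. W1 z $ i $ j) z (axis l 1) = 0)"
    using W unfolding log_closed_def by blast+
  \<comment> \<open>Only finitely many germs and identities are involved, so one ball around
    \<open>z0\<close> serves for all of them.\<close>
  let ?H = "\<lambda>r. holo_on h (ball z0 r) \<and> (\<forall>m\<in>{..?N}. holo_on (c m) (ball z0 r)) \<and>
     (\<forall>m\<in>{..?N}. \<forall>l. holo_on (dv l m) (ball z0 r)) \<and> (\<forall>m\<in>{..?N}. holo_on (de m) (ball z0 r)) \<and>
     (\<forall>k\<in>{..<length fs}. holo_on (g k) (ball z0 r)) \<and> (\<forall>k\<in>{..<length fs}. holo_on (fs ! k) (ball z0 r)) \<and>
     (\<forall>j. holo_on (\<theta> j) (ball z0 r))"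
  have hols: "\<forall>\<^sub>F r in at_right 0. ?H r"
    by (intro eventually_conj eventually_ball_finite eventually_all_finite ballI finite_atMost finite_lessThan
        eventually_ball_germ hO c(1) dv(1,2) \<theta> g fsO) auto
  let ?PP = "\<lambda>z. (h z \<noteq> 0 \<longrightarrow> (\<forall>s. (h z)\<^sup>2 * det (pencil W0 W1 s z) = (\<Sum>m\<le>?N. c m z * s ^ m))) \<and>
      (h z \<noteq> 0 \<longrightarrow> (\<forall>s l. (h z)\<^sup>2 * det (colrep (pencil W0 W1 s z) l (\<eta> z)) = (\<Sum>m\<le>?N. dv l m z * s ^ m))) \<and>
      (h z \<noteq> 0 \<longrightarrow> (\<forall>s. (\<Sum>l\<in>UNIV. FD h z (axis l 1) * (\<Sum>m\<le>?N. dv l m z * s ^ m)) = h z * (\<Sum>m\<le>?N. de m z * s ^ m))) \<and>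
      (h z \<noteq> 0 \<longrightarrow> (\<forall>i j. W1 z $ i $ j - W0 z $ i $ j = FD (\<eta>0 j) z (axis i 1) - FD (\<eta>0 i) z (axis j 1))) \<and>
      (h z \<noteq> 0 \<longrightarrow> (\<forall>i j. W0 z $ i $ j = - W0 z $ j $ i)) \<and> (h z \<noteq> 0 \<longrightarrow> (\<forall>i j. W1 z $ i $ j = - W1 z $ j $ i)) \<and>
      (h z \<noteq> 0 \<longrightarrow> (\<forall>i j l. FD (\<lambda>z. W0 z $ j $ l) z (axis i 1)
        - FD (\<lambda>z. W0 z $ i $ l) z (axis j 1) + FD (\<lambda>z. W0 z $ i $ j) z (axis l 1) = 0)) \<and>
      (h z \<noteq> 0 \<longrightarrow> (\<forall>i j l. FD (\<lambda>z. W1 z $ j $ l) z (axis i 1)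
        - FD (\<lambda>z. W1 z $ i $ l) z (axis j 1) + FD (\<lambda>z. W1 z $ i $ j) z (axis l 1) = 0)) \<and>
      (h z \<noteq> 0 \<longrightarrow> (\<exists>S. open S \<and> z \<in> S \<and> (\<forall>i j. holo_on (\<lambda>z. W0 z $ i $ j) S))) \<and>
      (h z \<noteq> 0 \<longrightarrow> (\<exists>S. open S \<and> z \<in> S \<and> (\<forall>i j. holo_on (\<lambda>z. W1 z $ i $ j) S))) \<and>
      h z = u z * (\<Prod>k<length fs. (fs ! k) z)"
  have "\<forall>\<^sub>F z in nhds z0. ?PP z"
    by (intro eventually_conj) (rule c(2) dv(4) dv(5) d\<eta>0 as0 as1 cl0 cl1 log_closed_holo[OF W(1)] log_closed_holo[OF W(2)] h_eq)+
  from eventually_conj[OF hols eventually_ball_nhds[OF this]]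
  obtain r where r: "r > 0" "?H r \<and> (\<forall>z\<in>ball z0 r. ?PP z)"
    by (rule eventually_at_right_0E) (rule that)
  define B where "B = ball z0 r"
  have hB: "holo_on h B" and cB: "\<And>m. m \<le> ?N \<Longrightarrow> holo_on (c m) B" and dvB: "\<And>m l. m \<le> ?N \<Longrightarrow> holo_on (dv l m) B"
    and deB: "\<And>m. m \<le> ?N \<Longrightarrow> holo_on (de m) B" and gB: "\<And>k. k < length fs \<Longrightarrow> holo_on (g k) B"
    and fB: "\<And>k. k < length fs \<Longrightarrow> holo_on (fs ! k) B" and \<theta>B: "\<And>j. holo_on (\<theta> j) B"
    using conjunct1[OF r(2)] unfolding B_def[symmetric] by simp_all
  note rB = bspec[OF conjunct2[OF r(2)], folded B_def]
  have detB: "(h z)\<^sup>2 * det (pencil W0 W1 s z) = (\<Sum>m\<le>?N. c m z * s ^ m)" if "z \<in> B" "h z \<noteq> 0" for z s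
    using rB[OF that(1)] that(2) by (elim conjE) blast
  have colB: "(h z)\<^sup>2 * det (colrep (pencil W0 W1 s z) l (\<eta> z)) = (\<Sum>m\<le>?N. dv l m z * s ^ m)" if "z \<in> B" "h z \<noteq> 0" for z s l
    using rB[OF that(1)] that(2) by (elim conjE) blast
  have logB: "(\<Sum>l\<in>UNIV. FD h z (axis l 1) * (\<Sum>m\<le>?N. dv l m z * s ^ m)) = h z * (\<Sum>m\<le>?N. de m z * s ^ m)" if "z \<in> B" "h z \<noteq> 0" for z s
    using rB[OF that(1)] that(2) by (elim conjE) blast
  have \<eta>0B: "W1 z $ i $ j - W0 z $ i $ j = FD (\<eta>0 j) z (axis i 1) - FD (\<eta>0 i) z (axis j 1)" if "z \<in> B" "h z \<noteq> 0" for z i j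
    using rB[OF that(1)] that(2) by (elim conjE) blast
  have asB: "W0 z $ i $ j = - W0 z $ j $ i" "W1 z $ i $ j = - W1 z $ j $ i" if "z \<in> B" "h z \<noteq> 0" for z i j
    using rB[OF that(1)] that(2) by (elim conjE, blast)+
  have clB: "FD (\<lambda>z. W0 z $ j $ l) z (axis i 1)
        - FD (\<lambda>z. W0 z $ i $ l) z (axis j 1) + FD (\<lambda>z. W0 z $ i $ j) z (axis l 1) = 0"
     "FD (\<lambda>z. W1 z $ j $ l) z (axis i 1)
        - FD (\<lambda>z. W1 z $ i $ l) z (axis j 1) + FD (\<lambda>z. W1 z $ i $ j) z (axis l 1) = 0" if "z \<in> B" "h z \<noteq> 0" for z i j l
    using rB[OF that(1)] that(2) by (elim conjE, blast)+
  \<comment> \<open>The complement of \<open>D\<close> in \<open>B\<close>, where \<open>W0\<close>,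
    \<open>W1\<close> and the primitive are honest holomorphic functions.\<close>
  define Y where "Y = B \<inter> h -` (- {0})"
  have Y: "open Y" unfolding Y_def B_def
    by (rule continuous_open_preimage[OF _ open_ball]) (use holo_on_continuous[OF hB] B_def in auto)
  have YB: "z \<in> Y \<longleftrightarrow> z \<in> B \<and> h z \<noteq> 0" for z by (auto simp: Y_def)
  have W0Y: "holo_on (\<lambda>z. W0 z $ i $ j) Y" for i j
  proof (rule holo_on_ballI)
    fix z assume "z \<in> Y"
    then have z: "z \<in> B" "h z \<noteq> 0" by (simp_all add: YB)
    have "h z \<noteq> 0 \<longrightarrow> (\<exists>S. open S \<and> z \<in> S \<and> (\<forall>i j. holo_on (\<lambda>z. W0 z $ i $ j) S))"
      using rB[OF z(1)] by (elim conjE)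
    then obtain S where "z \<in> S" "\<forall>i j. holo_on (\<lambda>z. W0 z $ i $ j) S" using z(2) by (elim impE exE conjE)
    then show "\<exists>T. z \<in> T \<and> holo_on (\<lambda>z. W0 z $ i $ j) T" by (intro exI[of _ S]) simp
  qed
  have W1Y: "holo_on (\<lambda>z. W1 z $ i $ j) Y" for i j
  proof (rule holo_on_ballI)
    fix z assume "z \<in> Y"
    then have z: "z \<in> B" "h z \<noteq> 0" by (simp_all add: YB)
    have "h z \<noteq> 0 \<longrightarrow> (\<exists>S. open S \<and> z \<in> S \<and> (\<forall>i j. holo_on (\<lambda>z. W1 z $ i $ j) S))"
      using rB[OF z(1)] by (elim conjE)
    then obtain S where "z \<in> S" "\<forall>i j. holo_on (\<lambda>z. W1 z $ i $ j) S" using z(2) by (elim impE exE conjE)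
    then show "\<exists>T. z \<in> T \<and> holo_on (\<lambda>z. W1 z $ i $ j) T" by (intro exI[of _ S]) simp
  qed
  have hB': "holo_on h Y" "\<And>k. k < length fs \<Longrightarrow> holo_on (fs ! k) Y" "\<And>k. k < length fs \<Longrightarrow> holo_on (g k) Y" "\<And>j. holo_on (\<theta> j) Y"
    using hB fB gB \<theta>B by (auto intro: holo_on_subset simp: Y_def)
  have fY: "(fs ! k) z \<noteq> 0" if "k < length fs" "z \<in> Y" for k z
  proof -
    have z: "z \<in> B" "h z \<noteq> 0" using that by (simp_all add: YB)
    have "h z = u z * (\<Prod>k<length fs. (fs ! k) z)" using rB[OF z(1)] by (elim conjE)
    then have "(\<Prod>k<length fs. (fs ! k) z) \<noteq> 0" using z(2) by auto
    then show ?thesis using that(1) by (metis finite_lessThan lessThan_iff prod_zero)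
  qed
  have LY: "holo_on (L k j) Y" if "k < length fs" for k j
    unfolding L_def[abs_def] by (intro holo_on_mult holo_on_inverse holo_on_FD Y hB' that fY)
  have Lsym: "FD (L k j) z (axis i 1) = FD (L k i) z (axis j 1)" if "k < length fs" "z \<in> Y" for k i j z
    unfolding L_def[abs_def] by (rule dlog_closed(2)[OF Y hB'(2)[OF that(1)] that(2) fY[OF that]])
  have \<eta>0Y: "holo_on (\<eta>0 j) Y" for j
    unfolding \<eta>0_def[abs_def] by (intro holo_on_add holo_on_sum holo_on_mult LY hB') auto
  have \<eta>Y: "holo_on (\<lambda>z. \<eta> z $ j) Y" for j
    unfolding \<eta>c by (intro holo_on_diff holo_on_sum holo_on_mult holo_on_const \<eta>0Y LY) auto
  have FD\<eta>: "FD (\<lambda>z. \<eta> z $ j) z v = FD (\<eta>0 j) z v - (\<Sum>k<length fs. g k z0 * FD (L k j) z v)" if z: "z \<in> Y" for z j v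
  proof -
    have "((\<lambda>z. \<eta>0 j z - (\<Sum>k<length fs. g k z0 * L k j z) - \<theta> j z0) has_derivative
        (\<lambda>v. FD (\<eta>0 j) z v - (\<Sum>k<length fs. g k z0 * FD (L k j) z v) - 0)) (at z)"
      using z by (intro has_derivative_diff has_derivative_sum has_derivative_mult_right has_derivative_const
          holo_onD(1)[OF \<eta>0Y] holo_onD(1)[OF LY]) auto
    then show ?thesis unfolding \<eta>c by (intro FD_eqI) auto
  qed
  \<comment> \<open>The subtracted combination of the \<open>dlog\<close> and coordinate
    differentials has constant coefficients, so it is closed and \<open>\<eta>\<close> still is a
    primitive.\<close>
  have \<Delta>Y: "W1 z $ i $ j - W0 z $ i $ j = FD (\<lambda>z. \<eta> z $ j) z (axis i 1) - FD (\<lambda>z. \<eta> z $ i) z (axis j 1)" if z: "z \<in> Y" for z i j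
  proof -
    have "(\<Sum>k<length fs. g k z0 * FD (L k j) z (axis i 1)) = (\<Sum>k<length fs. g k z0 * FD (L k i) z (axis j 1))"
      by (intro sum.cong refl) (simp add: Lsym z)
    then show ?thesis using \<eta>0B[of z i j] z by (simp add: FD\<eta> YB)
  qed
  \<comment> \<open>Extended over the zeros of \<open>h\<close> by density, because trajectories
    that start on \<open>D\<close> have to be controlled as well.\<close>
  have logB': "(\<Sum>l\<in>UNIV. FD h z (axis l 1) * (\<Sum>m\<le>?N. dv l m z * s ^ m)) = h z * (\<Sum>m\<le>?N. de m z * s ^ m)" if "z \<in> B" for z s
  proof -
    have "(\<lambda>z. (\<Sum>l\<in>UNIV. FD h z (axis l 1) * (\<Sum>m\<le>?N. dv l m z * s ^ m)) - h z * (\<Sum>m\<le>?N. de m z * s ^ m)) z = 0"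
    proof (rule holo_zero_dense[of h z0 r])
      show "holo_on (\<lambda>z. (\<Sum>l\<in>UNIV. FD h z (axis l 1) * (\<Sum>m\<le>?N. dv l m z * s ^ m)) - h z * (\<Sum>m\<le>?N. de m z * s ^ m)) (ball z0 r)"
        using hB dvB deB unfolding B_def
        by (intro holo_on_diff holo_on_sum holo_on_mult holo_on_const holo_on_FD open_ball) auto
    qed (use hB h_nz r(1) logB that in \<open>auto simp: B_def\<close>)
    then show ?thesis by simp
  qed
  define U0 where "U0 = sp -` B"
  define Qw where "Qw w = (\<Sum>m\<le>?N. c m (sp w) * \<gamma> (w $ None) ^ m)" for w
  define Vw where "Vw l w = (\<Sum>m\<le>?N. dv l m (sp w) * \<gamma> (w $ None) ^ m)" for l w
  define Ew where "Ew w = (\<Sum>m\<le>?N. de m (sp w) * \<gamma> (w $ None) ^ m)" for w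
  have U0: "open U0"
    unfolding U0_def B_def by (intro open_vimage open_ball linear_continuous_on[OF bounded_linear_sp])
  have \<gamma>h: "holo_on (\<lambda>w. \<gamma> (w $ None)) S" "holo_on (\<lambda>w. \<gamma>' (w $ None)) S" for S :: "(complex^('n option)) set"
    unfolding \<gamma>_def \<gamma>'_def by (intro holo_intros)+
  have hol: "holo_on Qw U0" "holo_on (Vw l) U0" "holo_on Ew U0" for l
    unfolding Qw_def[abs_def] Vw_def[abs_def] Ew_def[abs_def]
    by (intro holo_on_poly_family[of ?N _ B] cB dvB deB \<gamma>h; simp add: U0_def)+
  \<comment> \<open>Numerators and denominator are holomorphic across \<open>D\<close>, so the field
    is defined there too; only the zeros of the denominator \<open>Qw\<close> are removed.\<close>
  define U where "U = U0 \<inter> Qw -` (- {0})"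
  have U: "open U" unfolding U_def
    by (rule continuous_open_preimage[OF holo_on_continuous[OF hol(1)] U0]) auto
  have UU: "w \<in> U \<longleftrightarrow> sp w \<in> B \<and> Qw w \<noteq> 0" for w by (auto simp: U_def U0_def)
  have holU: "holo_on Qw U" "holo_on (Vw l) U" "holo_on Ew U" for l
    using hol by (auto intro: holo_on_subset simp: U_def)
  \<comment> \<open>Cramer's rule for \<open>\<omega>\<^sub>s X = \<gamma>' \<eta>\<close> at
    \<open>s = \<gamma> \<tau>\<close>; the common factor \<open>h\<^sup>2\<close> of numerator and
    denominator cancels. The factor \<open>\<gamma>'\<close> is the speed of the path.\<close>
  define X where "X w = (\<chi> l. \<gamma>' (w $ None) * Vw l w / Qw w)" for w
  have X: "hmap X U"
    unfolding hmap_def X_def vec_lambda_beta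
    by (intro allI holo_on_divide holo_on_mult holU \<gamma>h) (simp add: UU)
  have Vw0: "Vw l (pt \<tau> z0) = 0" for l \<tau> by (simp add: Vw_def dv(3))
  have seg: "pt (complex_of_real t) z0 \<in> U" if "t \<in> {0..1}" for t
    using \<gamma>[OF that] r(1) by (simp add: UU B_def Qw_def Q)
  have fix0: "X (pt \<tau> z0) = 0" for \<tau> by (simp add: X_def Vw0 vec_eq_iff)
  obtain \<Omega> \<phi> \<rho> C where \<Omega>: "open \<Omega>" "\<rho> > 0" "C > 0" "hmap \<phi> \<Omega>"
    "\<And>t z. t \<in> {0..1} \<Longrightarrow> z \<in> ball z0 \<rho> \<Longrightarrow> pt (complex_of_real t) z \<in> \<Omega>"
    "\<And>w. w \<in> \<Omega> \<Longrightarrow> pt (w $ None) (\<phi> w) \<in> U"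
    "\<And>w. w \<in> \<Omega> \<Longrightarrow> norm (\<phi> w - z0) \<le> C * norm (sp w - z0)"
    "\<And>z. pt 0 z \<in> \<Omega> \<Longrightarrow> \<phi> (pt 0 z) = z"
    "\<And>w. w \<in> \<Omega> \<Longrightarrow> FD \<phi> w (axis None 1) = X (pt (w $ None) (\<phi> w))"
    by (rule holomorphic_flow[OF U X seg fix0]) (assumption | rule that)+
  have curve: "((\<lambda>t. \<phi> (pt (complex_of_real t) z)) has_vector_derivative
      X (pt (complex_of_real t) (\<phi> (pt (complex_of_real t) z)))) (at t within {0..1})" if "t \<in> {0..1}" "z \<in> ball z0 \<rho>" for t z
    using flow_vd[OF \<Omega>(4) _ \<Omega>(9), of 0 1 t z "{0..1}"] \<Omega>(5)[OF that] by simp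
  have inB: "\<phi> (pt (complex_of_real t) z) \<in> B" "pt (complex_of_real t) (\<phi> (pt (complex_of_real t) z)) \<in> U"
    if "t \<in> {0..1}" "z \<in> ball z0 \<rho>" for t z
    using \<Omega>(6)[OF \<Omega>(5)[OF that]] by (simp_all add: UU)
  have hX: "FD h (sp w) (X w) = \<gamma>' (w $ None) * Ew w / Qw w * h (sp w)" if w: "w \<in> U" for w
  proof -
    have "FD h (sp w) (X w) = (\<Sum>l\<in>UNIV. X w $ l * FD h (sp w) (axis l 1))"
      using w by (intro FD_expand[OF hB]) (simp add: UU)
    also have "\<dots> = \<gamma>' (w $ None) / Qw w * (\<Sum>l\<in>UNIV. FD h (sp w) (axis l 1) * Vw l w)"
      by (simp add: X_def sum_distrib_left algebra_simps)
    also have "\<dots> = \<gamma>' (w $ None) / Qw w * (h (sp w) * Ew w)"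
      unfolding Vw_def Ew_def using w by (simp add: logB' UU)
    finally show ?thesis by simp
  qed
  \<comment> \<open>The linear equation for \<open>h\<close> along a trajectory can be used in both
    time directions, so vanishing at one time is equivalent to vanishing at any other.\<close>
  have pres: "h (\<phi> (pt (complex_of_real t) z)) = 0 \<longleftrightarrow> h (\<phi> (pt (complex_of_real s) z)) = 0"
    if s: "s \<in> {0..1}" and t: "t \<in> {0..1}" and z: "z \<in> ball z0 \<rho>" for s t z
  proof -
    define k where "k w = \<gamma>' (w $ None) * Ew w / Qw w" for w
    have kU: "holo_on k U" unfolding k_def[abs_def] by (intro holo_on_divide holo_on_mult holU \<gamma>h) (simp add: UU)
    have cc: "continuous_on {0..1} (\<lambda>t. k (pt (complex_of_real t) (\<phi> (pt (complex_of_real t) z))))"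
    proof (rule continuous_on_compose2[OF holo_on_continuous[OF kU]])
      show "continuous_on {0..1} (\<lambda>t. pt (complex_of_real t) (\<phi> (pt (complex_of_real t) z)))"
        by (intro continuous_intros continuous_on_compose2[OF hmap_continuous[OF \<Omega>(4)]]) (use \<Omega>(5) z in auto)
    qed (use inB z in auto)
    have "h (\<phi> (pt (complex_of_real t) z)) = 0" if st: "s \<in> {0..1}" "t \<in> {0..1}" "h (\<phi> (pt (complex_of_real s) z)) = 0" for s t
    proof (rule flow_preserves_zeros[where B=B and x="\<lambda>t. \<phi> (pt (complex_of_real t) z)" and s=s
        and x'="\<lambda>t. X (pt (complex_of_real t) (\<phi> (pt (complex_of_real t) z)))"
        and k="\<lambda>t. k (pt (complex_of_real t) (\<phi> (pt (complex_of_real t) z)))"])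
      fix t :: real assume t: "t \<in> {0..1}"
      show "\<phi> (pt (complex_of_real t) z) \<in> B" by (rule inB(1)[OF t z])
      show "((\<lambda>t. \<phi> (pt (complex_of_real t) z)) has_vector_derivative
        X (pt (complex_of_real t) (\<phi> (pt (complex_of_real t) z)))) (at t within {0..1})" by (rule curve[OF t z])
      show "FD h (\<phi> (pt (complex_of_real t) z)) (X (pt (complex_of_real t) (\<phi> (pt (complex_of_real t) z)))) =
          k (pt (complex_of_real t) (\<phi> (pt (complex_of_real t) z))) * h (\<phi> (pt (complex_of_real t) z))"
        using hX[OF inB(2)[OF t z]] by (simp add: k_def)
    qed (rule hB cc st)+
    then show ?thesis using s t by blast
  qed
  have \<phi>0: "\<phi> (pt 0 z) = z" if "z \<in> ball z0 \<rho>" for z using \<Omega>(8) \<Omega>(5)[of 0 z] that by simp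
  have moser: "bil (W1 (\<phi> (pt 1 z))) (FD \<phi> (pt 1 z) (pt 0 p)) (FD \<phi> (pt 1 z) (pt 0 p')) = bil (W0 z) p p'"
    if z: "z \<in> ball z0 \<rho>" and hz: "h z \<noteq> 0" for z p p'
  proof -
    \<comment> \<open>\<open>A p t\<close> is the differential of the time-\<open>t\<close> map
      applied to \<open>p\<close>, so \<open>\<Psi> t\<close> is the pullback of the form with
      parameter \<open>\<gamma> t\<close>, evaluated on \<open>p\<close> and \<open>p'\<close>. It
      is shown to be constant.\<close>
    define x where "x t = \<phi> (pt (complex_of_real t) z)" for t
    define A where "A p t = FD \<phi> (pt (complex_of_real t) z) (pt 0 p)" for p t
    define \<Psi> where "\<Psi> t = bil (pencil W0 W1 (\<gamma> (complex_of_real t)) (x t)) (A p t) (A p' t)" for t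
    \<comment> \<open>A trajectory that starts off \<open>D\<close> stays off \<open>D\<close>, so
      the poles of the forms are never met.\<close>
    have xY: "x t \<in> Y" if t: "t \<in> {0..1}" for t
      using pres[of 0 t z] t z hz inB(1)[OF t z] by (auto simp: YB x_def \<phi>0)
    \<comment> \<open>The variational equation: time and space derivatives of the flow commute, and
      the time derivative is \<open>X\<close> along the flow.\<close>
    have Ad: "((\<lambda>t. A p t $ i) has_vector_derivative
        (\<Sum>k\<in>UNIV. FD X (pt (complex_of_real t) (x t)) (pt 0 (axis k 1)) $ i * A p t $ k)) (at t within {0..1})"
      if t: "t \<in> {0..1}" for t i p
    proof -
      let ?w = "pt (complex_of_real t) z"
      have w: "?w \<in> \<Omega>" by (rule \<Omega>(5)[OF t z])
      have \<phi>i: "holo_on (\<lambda>w. \<phi> w $ i) \<Omega>" using \<Omega>(4) by (simp add: hmap_def)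
      have d1: "((\<lambda>t. FD (\<lambda>w. \<phi> w $ i) (pt (complex_of_real t) z) (pt 0 p)) has_vector_derivative
          FD (\<lambda>w. FD (\<lambda>w. \<phi> w $ i) w (pt 0 p)) ?w (axis None 1)) (at t within {0..1})"
        using holo_vector_chain[OF holo_on_FD[OF \<Omega>(1) \<phi>i] _ pt_line_vd[of 0 1 z t "{0..1}"]] w by simp
      have eqA: "A p s $ i = FD (\<lambda>w. \<phi> w $ i) (pt (complex_of_real s) z) (pt 0 p)" if "s \<in> {0..1}" for s
        unfolding A_def by (rule FD_hmap_component[OF \<Omega>(4) \<Omega>(5)[OF that z]])
      have 1: "((\<lambda>t. A p t $ i) has_vector_derivative
          FD (\<lambda>w. FD (\<lambda>w. \<phi> w $ i) w (pt 0 p)) ?w (axis None 1)) (at t within {0..1})"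
        by (rule has_vector_derivative_transform[OF t eqA d1])
      have "FD (\<lambda>w. FD (\<lambda>w. \<phi> w $ i) w (pt 0 p)) ?w (axis None 1) = FD (\<lambda>w. FD (\<lambda>w. \<phi> w $ i) w (axis None 1)) ?w (pt 0 p)"
        by (rule FD_symmetric[OF \<Omega>(1) \<phi>i w])
      also have "FD (\<lambda>w. FD (\<lambda>w. \<phi> w $ i) w (axis None 1)) ?w = FD (\<lambda>w. X (pt (w $ None) (\<phi> w)) $ i) ?w"
        by (rule FD_cong[OF \<Omega>(1) w]) (simp add: \<Omega>(9) flip: FD_hmap_component[OF \<Omega>(4)])
      also have "\<dots> (pt 0 p) = FD (\<lambda>w. X w $ i) (pt (?w $ None) (\<phi> ?w)) (FD (\<lambda>w. pt (w $ None) (\<phi> w)) ?w (pt 0 p))"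
        by (rule holo_on_compose(2)[of _ U _ \<Omega>]) (use X \<Omega>(4,6) w in \<open>auto simp: hmap_def intro!: hmap_pt[unfolded hmap_def, rule_format] holo_on_coord\<close>)
      also have "FD (\<lambda>w. pt (w $ None) (\<phi> w)) ?w (pt 0 p) = pt 0 (A p t)"
      proof -
        have hm: "hmap (\<lambda>w. pt (w $ None) (\<phi> w)) \<Omega>" by (intro hmap_pt holo_on_coord \<Omega>(4))
        have "FD (\<lambda>w. pt (w $ None) (\<phi> w)) ?w (pt 0 p) $ k = pt 0 (A p t) $ k" for k
          unfolding FD_hmap_component[OF hm w] A_def
          by (cases k) (simp_all add: FD_coord FD_hmap_component[OF \<Omega>(4) w])
        then show ?thesis by (simp add: vec_eq_iff)
      qed
      also have "FD (\<lambda>w. X w $ i) (pt (?w $ None) (\<phi> ?w)) (pt 0 (A p t)) =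
          (\<Sum>k\<in>UNIV. FD X (pt (complex_of_real t) (x t)) (pt 0 (axis k 1)) $ i * A p t $ k)"
      proof -
        have wU: "pt (complex_of_real t) (x t) \<in> U" unfolding x_def by (rule inB(2)[OF t z])
        have Xi: "holo_on (\<lambda>w. X w $ i) U" using X by (simp add: hmap_def)
        have e: "pt 0 (axis k 1) = axis (Some k) 1" for k :: 'n
          by (auto simp: vec_eq_iff pt_def axis_def split: option.splits)
        have "FD (\<lambda>w. X w $ i) (pt (complex_of_real t) (x t)) (pt 0 (A p t)) =
          (\<Sum>k\<in>UNIV. pt 0 (A p t) $ k * FD (\<lambda>w. X w $ i) (pt (complex_of_real t) (x t)) (axis k 1))"
          by (rule FD_expand[OF Xi wU])
        also have "\<dots> = (\<Sum>k\<in>UNIV. A p t $ k * FD (\<lambda>w. X w $ i) (pt (complex_of_real t) (x t)) (axis (Some k) 1))"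
          by (simp add: sum_option)
        finally show ?thesis
          by (simp add: FD_hmap_component[OF X inB(2)[OF t z]] e x_def mult.commute)
      qed
      finally show ?thesis using 1 by simp
    qed
    \<comment> \<open>With \<open>L = 0\<close> the uniqueness lemma says that a function with zero
      derivative is constant.\<close>
    have "\<Psi> 1 - \<Psi> 0 = 0"
    proof (rule linear_ode_zero[where \<delta>="\<lambda>t. \<Psi> t - \<Psi> 0" and a=0 and b=1 and \<delta>'="\<lambda>t. 0" and L=0 and ?t1.0=0])
      fix t :: real assume t: "t \<in> {0..1}"
      let ?s = "\<gamma> (complex_of_real t)" and ?s' = "\<gamma>' (complex_of_real t)"
      have xB: "x t \<in> B" "h (x t) \<noteq> 0" using xY[OF t] by (auto simp: YB)
      have wU: "pt (complex_of_real t) (x t) \<in> U" unfolding x_def by (rule inB(2)[OF t z])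
      have xd: "(x has_vector_derivative X (pt (complex_of_real t) (x t))) (at t within {0..1})"
        unfolding x_def[abs_def] by (rule curve[OF t z])
      define \<xi> where "\<xi> y = X (pt (complex_of_real t) y)" for y
      define P where "P = pencil W0 W1 ?s"
      define DW where "DW k i j = FD (\<lambda>y. P y $ i $ j) (x t) (axis k 1)" for k i j
      define D\<xi> where "D\<xi> k j = FD X (pt (complex_of_real t) (x t)) (pt 0 (axis k 1)) $ j" for k j
      define D\<eta> where "D\<eta> k j = FD (\<lambda>y. \<eta> y $ j) (x t) (axis k 1)" for k j
      define \<Delta> where "\<Delta> i j = W1 (x t) $ i $ j - W0 (x t) $ i $ j" for i j
      have PY: "holo_on (\<lambda>y. P y $ i $ j) Y" for i j
        unfolding P_def pencil_def vec_lambda_beta by (intro holo_on_add holo_on_mult holo_on_diff holo_on_const W0Y W1Y)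
      have FDP: "FD (\<lambda>y. P y $ i $ j) (x t) v = FD (\<lambda>y. W0 y $ i $ j) (x t) v +
          ?s * (FD (\<lambda>y. W1 y $ i $ j) (x t) v - FD (\<lambda>y. W0 y $ i $ j) (x t) v)" for i j v
        unfolding P_def pencil_def vec_lambda_beta
        by (rule FD_eq[OF has_derivative_add[OF _ has_derivative_mult_right[OF has_derivative_diff]]])
          (intro holo_onD(1)[OF W0Y xY[OF t]] holo_onD(1)[OF W1Y xY[OF t]])+
      have Pas: "P y $ i $ j = - P y $ j $ i" if "y \<in> Y" for y i j
      proof -
        have "W0 y $ i $ j = - W0 y $ j $ i" "W1 y $ i $ j = - W1 y $ j $ i" using asB that YB by blast+
        then show ?thesis unfolding P_def by (simp only: pencil_def vec_lambda_beta) (simp add: algebra_simps)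
      qed
      have DWas: "DW k i j = - DW k j i" for k i j
      proof -
        have "FD (\<lambda>y. P y $ i $ j) (x t) = FD (\<lambda>y. - P y $ j $ i) (x t)"
          by (rule FD_cong[OF Y xY[OF t]]) (rule Pas)
        moreover have "FD (\<lambda>y. - P y $ j $ i) (x t) (axis k 1) = - FD (\<lambda>y. P y $ j $ i) (x t) (axis k 1)"
          by (rule FD_eq[OF has_derivative_minus[OF holo_onD(1)[OF PY xY[OF t]]]])
        ultimately show ?thesis by (simp add: DW_def)
      qed
      have DWcl: "DW k a b - DW a k b + DW b k a = 0" for k a b
      proof -
        have "DW k a b - DW a k b + DW b k a =
          (1 - ?s) * (FD (\<lambda>z. W0 z $ a $ b) (x t) (axis k 1)
            - FD (\<lambda>z. W0 z $ k $ b) (x t) (axis a 1) + FD (\<lambda>z. W0 z $ k $ a) (x t) (axis b 1)) +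
          ?s * (FD (\<lambda>z. W1 z $ a $ b) (x t) (axis k 1)
            - FD (\<lambda>z. W1 z $ k $ b) (x t) (axis a 1) + FD (\<lambda>z. W1 z $ k $ a) (x t) (axis b 1))"
          unfolding DW_def FDP by (simp add: algebra_simps)
        then show ?thesis unfolding clB[OF xB] by simp
      qed
      have \<xi>h: "hmap \<xi> ((\<lambda>y. pt (complex_of_real t) y) -` U)"
        unfolding \<xi>_def by (rule hmap_compose(1)[OF X hmap_pt_space]) auto
      have openU: "open ((\<lambda>y. pt (complex_of_real t) y) -` U)"
        by (intro open_vimage U continuous_intros)
      \<comment> \<open>Needed on an open set and not just at \<open>x t\<close>, because the
        equation is differentiated in space next.\<close>
      have W\<xi>: "(\<Sum>j\<in>UNIV. P y $ i $ j * \<xi> y $ j) = ?s' * \<eta> y $ i"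
        if y: "y \<in> Y" "pt (complex_of_real t) y \<in> U" for y i
      proof -
        let ?w = "pt (complex_of_real t) y"
        have hy: "y \<in> B" "h y \<noteq> 0" using y by (auto simp: YB)
        have Qy: "Qw ?w = (h y)\<^sup>2 * det (P y)" unfolding P_def using detB[OF hy] by (simp add: Qw_def)
        have "Qw ?w \<noteq> 0" using y(2) by (simp add: UU)
        then have dP: "det (P y) \<noteq> 0" using Qy by auto
        have Vy: "Vw l ?w = (h y)\<^sup>2 * det (colrep (P y) l (\<eta> y))" for l
          unfolding P_def using colB[OF hy] by (simp add: Vw_def)
        define v where "v = (\<chi> l. Vw l ?w / Qw ?w)"
        have "v = (\<chi> l. det (colrep (P y) l (\<eta> y)) / det (P y))"
          unfolding v_def Vy Qy using hy(2) by (simp add: vec_eq_iff)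
        then have "P y *v v = \<eta> y" using cramer[OF dP, of v "\<eta> y"] by (simp add: colrep_def)
        then have "(P y *v v) $ i = \<eta> y $ i" by simp
        then have Pv: "(\<Sum>j\<in>UNIV. P y $ i $ j * v $ j) = \<eta> y $ i"
          unfolding matrix_vector_mult_def vec_lambda_beta .
        have \<xi>v: "\<xi> y $ j = ?s' * v $ j" for j by (simp add: \<xi>_def X_def v_def)
        show ?thesis unfolding \<xi>v Pv[symmetric] by (simp add: sum_distrib_left mult.left_commute)
      qed
      have \<xi>d: "FD (\<lambda>y. \<xi> y $ j) (x t) (axis k 1) = D\<xi> k j" for j k
      proof -
        have "FD (\<lambda>y. X (pt (complex_of_real t) y)) (x t) (axis k 1) =
          FD X (pt (complex_of_real t) (x t)) (FD (\<lambda>y. pt (complex_of_real t) y) (x t) (axis k 1))"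
          by (rule hmap_compose(2)[OF X hmap_pt_space, of _ "(\<lambda>y. pt (complex_of_real t) y) -` U"]) (use wU in auto)
        then have "FD \<xi> (x t) (axis k 1) $ j = D\<xi> k j" unfolding \<xi>_def[abs_def] D\<xi>_def FD_pt_space by simp
        then show ?thesis using FD_hmap_component[OF \<xi>h, of "x t"] wU by simp
      qed
      have A: "(\<Sum>j\<in>UNIV. P (x t) $ i $ j * D\<xi> a j) + (\<Sum>j\<in>UNIV. DW a i j * \<xi> (x t) $ j) = ?s' * D\<eta> a i" for a i
      proof -
        have "((\<lambda>y. \<Sum>j\<in>UNIV. P y $ i $ j * \<xi> y $ j) has_derivative
          (\<lambda>v. \<Sum>j\<in>UNIV. P (x t) $ i $ j * FD (\<lambda>y. \<xi> y $ j) (x t) v + FD (\<lambda>y. P y $ i $ j) (x t) v * \<xi> (x t) $ j)) (at (x t))"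
          using \<xi>h wU by (intro has_derivative_sum has_derivative_mult holo_onD(1)[OF PY xY[OF t]] holo_onD(1)[of _ "(\<lambda>y. pt (complex_of_real t) y) -` U"])
            (auto simp: hmap_def)
        from FD_eq[OF this, of "axis a 1"]
        have "FD (\<lambda>y. \<Sum>j\<in>UNIV. P y $ i $ j * \<xi> y $ j) (x t) (axis a 1) =
          (\<Sum>j\<in>UNIV. P (x t) $ i $ j * D\<xi> a j) + (\<Sum>j\<in>UNIV. DW a i j * \<xi> (x t) $ j)"
          by (simp add: \<xi>d DW_def sum.distrib)
        moreover have "FD (\<lambda>y. \<Sum>j\<in>UNIV. P y $ i $ j * \<xi> y $ j) (x t) = FD (\<lambda>y. ?s' * \<eta> y $ i) (x t)"
          by (rule FD_cong[of "Y \<inter> (\<lambda>y. pt (complex_of_real t) y) -` U"])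
            (use Y openU xY[OF t] wU W\<xi> in auto)
        moreover have "FD (\<lambda>y. ?s' * \<eta> y $ i) (x t) (axis a 1) = ?s' * D\<eta> a i"
          unfolding D\<eta>_def by (rule FD_eq[OF has_derivative_mult_right[OF holo_onD(1)[OF \<eta>Y xY[OF t]]]])
        ultimately show ?thesis by simp
      qed
      have canc: "?s' * \<Delta> a b + (\<Sum>k\<in>UNIV. DW k a b * \<xi> (x t) $ k) + (\<Sum>i\<in>UNIV. P (x t) $ i $ b * D\<xi> a i) +
          (\<Sum>j\<in>UNIV. P (x t) $ a $ j * D\<xi> b j) = 0" for a b
      proof (rule moser_cancellation[where W="\<lambda>i j. P (x t) $ i $ j" and D\<eta>=D\<eta>])
        show "\<Delta> a b = D\<eta> a b - D\<eta> b a" for a b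
          unfolding \<Delta>_def D\<eta>_def by (rule \<Delta>Y[OF xY[OF t]])
      qed (use A Pas[OF xY[OF t]] DWas DWcl in blast)+
      have Pd: "((\<lambda>t. pencil W0 W1 (\<gamma> (complex_of_real t)) (x t) $ i $ j) has_vector_derivative
          ?s' * \<Delta> i j + (\<Sum>k\<in>UNIV. DW k i j * \<xi> (x t) $ k)) (at t within {0..1})" for i j
      proof -
        have w0: "((\<lambda>t. W0 (x t) $ i $ j) has_vector_derivative FD (\<lambda>y. W0 y $ i $ j) (x t) (\<xi> (x t))) (at t within {0..1})"
          unfolding \<xi>_def by (rule holo_vector_chain[OF W0Y xY[OF t] xd])
        have w1: "((\<lambda>t. W1 (x t) $ i $ j) has_vector_derivative FD (\<lambda>y. W1 y $ i $ j) (x t) (\<xi> (x t))) (at t within {0..1})"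
          unfolding \<xi>_def by (rule holo_vector_chain[OF W1Y xY[OF t] xd])
        have "((\<lambda>t. W0 (x t) $ i $ j + \<gamma> (complex_of_real t) * (W1 (x t) $ i $ j - W0 (x t) $ i $ j)) has_vector_derivative
          FD (\<lambda>y. W0 y $ i $ j) (x t) (\<xi> (x t)) + (?s * (FD (\<lambda>y. W1 y $ i $ j) (x t) (\<xi> (x t)) - FD (\<lambda>y. W0 y $ i $ j) (x t) (\<xi> (x t))) +
            ?s' * (W1 (x t) $ i $ j - W0 (x t) $ i $ j))) (at t within {0..1})"
          by (intro has_vector_derivative_add has_vector_derivative_mult has_vector_derivative_diff w0 w1 \<gamma>d)
        moreover have "FD (\<lambda>y. P y $ i $ j) (x t) (\<xi> (x t)) = (\<Sum>k\<in>UNIV. DW k i j * \<xi> (x t) $ k)"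
          unfolding DW_def by (subst FD_expand[OF PY xY[OF t]]) (simp add: mult.commute)
        ultimately show ?thesis by (simp add: pencil_def \<Delta>_def FDP algebra_simps)
      qed
      have "(\<Psi> has_vector_derivative (\<Sum>i\<in>UNIV. \<Sum>j\<in>UNIV.
          A p t $ i * P (x t) $ i $ j * (\<Sum>k\<in>UNIV. D\<xi> k j * A p' t $ k) +
          (A p t $ i * (?s' * \<Delta> i j + (\<Sum>k\<in>UNIV. DW k i j * \<xi> (x t) $ k)) +
            (\<Sum>k\<in>UNIV. D\<xi> k i * A p t $ k) * P (x t) $ i $ j) * A p' t $ j)) (at t within {0..1})"
        unfolding \<Psi>_def[abs_def] bil_def P_def D\<xi>_def
        by (intro has_vector_derivative_sum has_vector_derivative_mult Pd[unfolded P_def] Ad t)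
      moreover have "(\<Sum>i\<in>UNIV. \<Sum>j\<in>UNIV.
          A p t $ i * P (x t) $ i $ j * (\<Sum>k\<in>UNIV. D\<xi> k j * A p' t $ k) +
          (A p t $ i * (?s' * \<Delta> i j + (\<Sum>k\<in>UNIV. DW k i j * \<xi> (x t) $ k)) +
            (\<Sum>k\<in>UNIV. D\<xi> k i * A p t $ k) * P (x t) $ i $ j) * A p' t $ j) = 0"
        using moser_sum[where K="\<lambda>i j. ?s' * \<Delta> i j + (\<Sum>k\<in>UNIV. DW k i j * \<xi> (x t) $ k)"
            and W="\<lambda>i j. P (x t) $ i $ j" and D=D\<xi> and u="\<lambda>i. A p t $ i" and v="\<lambda>i. A p' t $ i", OF canc]
        by (simp add: distrib_right add.commute add.left_commute)
      ultimately have "(\<Psi> has_vector_derivative 0) (at t within {0..1})" by simp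
      then show "((\<lambda>t. \<Psi> t - \<Psi> 0) has_vector_derivative 0) (at t within {0..1})"
        using has_vector_derivative_diff[of \<Psi> 0 "at t within {0..1}" "\<lambda>_. \<Psi> 0" 0] by simp
    qed auto
    then have "\<Psi> 1 = \<Psi> 0" by simp
    moreover have "A p 0 = p" for p
    proof -
      have "A p 0 $ i = p $ i" for i
      proof -
        have w: "pt 0 z \<in> \<Omega>" using \<Omega>(5)[of 0 z] z by simp
        have "FD (\<lambda>y. \<phi> (pt 0 y)) z p = FD \<phi> (pt 0 z) (FD (\<lambda>y. pt 0 y) z p)"
          by (rule hmap_compose(2)[OF \<Omega>(4) hmap_pt_space[of 0 "ball z0 \<rho>"]]) (use \<Omega>(5)[of 0] z in auto)
        moreover have "FD (\<lambda>y. \<phi> (pt 0 y)) z = FD (\<lambda>y. y) z"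
          by (rule FD_cong[OF open_ball z]) (rule \<phi>0)
        moreover have "FD (\<lambda>y. y) z p = p" by (rule FD_eq[OF has_derivative_ident])
        ultimately show ?thesis by (simp add: A_def FD_pt_space)
      qed
      then show ?thesis by (simp add: vec_eq_iff)
    qed
    ultimately show ?thesis
      unfolding \<Psi>_def x_def by (simp add: \<gamma>01 pen0 pen1 \<phi>0[OF z]) (simp add: A_def)
  qed
  show thesis
  proof (rule that[OF \<Omega>(1,2,4,5)])
    show "\<phi> (pt (complex_of_real t) z0) = z0" if "t \<in> {0..1}" for t
      using \<Omega>(7)[OF \<Omega>(5)[OF that, of z0]] \<Omega>(2) by simp
    show "\<phi> (pt 0 z) = z" if "z \<in> ball z0 \<rho>" for z using that by (rule \<phi>0)
    show "\<exists>G r. r > 0 \<and> hmap G (ball z0 r) \<and> G z0 = z0 \<and>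
       (\<forall>z\<in>ball z0 r. G (\<phi> (pt (complex_of_real t) z)) = z \<and> \<phi> (pt (complex_of_real t) (G z)) = z)"
      if t: "t \<in> {0..1}" for t
    proof (rule holomorphic_flow_inverse[OF U X seg fix0 \<Omega> t])
      fix G r assume "r > 0" "hmap G (ball z0 r)" "G z0 = z0"
        "\<And>z. z \<in> ball z0 r \<Longrightarrow> G (\<phi> (pt (complex_of_real t) z)) = z"
        "\<And>z. z \<in> ball z0 r \<Longrightarrow> G z \<in> ball z0 \<rho> \<and> \<phi> (pt (complex_of_real t) (G z)) = z"
      then show ?thesis by blast
    qed
    show "h (\<phi> (pt (complex_of_real t) z)) = 0 \<longleftrightarrow> h z = 0" if "t \<in> {0..1}" "z \<in> ball z0 \<rho>" for t z
      using pres[of 0 t z] that by (simp add: \<phi>0)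
  qed (assumption | rule moser)+
qed

end

section \<open>Charts, germs and tangent vectors\<close>

lemma Ogerm_compose:
  assumes f: "f \<in> Ogerm (g z)" and g: "open S" "z \<in> S" "hmap g S"
  shows "(\<lambda>w. f (g w)) \<in> Ogerm z" and "FD (\<lambda>w. f (g w)) z v = FD f (g z) (FD g z v)"
proof -
  obtain T where T: "open T" "g z \<in> T" "holo_on f T" using f by (rule OgermE)
  define R where "R = S \<inter> g -` T"
  have R: "open R" "z \<in> R" "hmap g R" "g ` R \<subseteq> T"
    unfolding R_def using continuous_open_preimage[OF hmap_continuous[OF g(3)] g(1) T(1)] g T
    by (auto intro: hmap_subset)
  show "(\<lambda>w. f (g w)) \<in> Ogerm z" by (rule OgermI[OF R(1,2) holo_on_compose(1)[OF T(3) R(3,4)]])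
  show "FD (\<lambda>w. f (g w)) z v = FD f (g z) (FD g z v)" by (rule holo_on_compose(2)[OF T(3) R(3,4,2)])
qed

lemma FD_cong_eventually:
  assumes "\<forall>\<^sub>F w in nhds z. f w = g w" shows "FD f z = FD g z"
  using eventually_nhds_x_imp_x[OF eventually_FD_cong[OF assms]] .

locale atlas =
  fixes A :: "('m::{t2_space,second_countable_topology}, 'n::finite) chart set"
  assumes atlas: "complex_atlas A"
begin

lemma chart_facts:
  assumes "c \<in> A"
  shows "open (fst c)" "open (snd c ` fst c)" "continuous_on (fst c) (snd c)"
    "continuous_on (snd c ` fst c) (chart_inv c)"
    "x \<in> fst c \<Longrightarrow> chart_inv c (snd c x) = x" "z \<in> snd c ` fst c \<Longrightarrow> snd c (chart_inv c z) = z"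
    "z \<in> snd c ` fst c \<Longrightarrow> chart_inv c z \<in> fst c"
proof -
  have *: "open (fst c) \<and> open (snd c ` fst c) \<and>
             homeomorphism (fst c) (snd c ` fst c) (snd c) (chart_inv c)"
    using atlas assms unfolding complex_atlas_def by blast
  then show "open (fst c)" "open (snd c ` fst c)" "continuous_on (fst c) (snd c)"
    "continuous_on (snd c ` fst c) (chart_inv c)"
    "x \<in> fst c \<Longrightarrow> chart_inv c (snd c x) = x" "z \<in> snd c ` fst c \<Longrightarrow> snd c (chart_inv c z) = z"
    "z \<in> snd c ` fst c \<Longrightarrow> chart_inv c z \<in> fst c"
    by (auto simp: homeomorphism_def)
qed

lemma chart_image_open:
  assumes "c \<in> A" "open S" shows "open (snd c ` (fst c \<inter> S))"
proof -
  have "snd c ` (fst c \<inter> S) = snd c ` fst c \<inter> chart_inv c -` S"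
    using chart_facts[OF assms(1)] by (force simp: image_iff)
  then show ?thesis
    using continuous_open_preimage[OF chart_facts(4,2)[OF assms(1)] assms(2)] by simp
qed

lemma transition:
  assumes "c \<in> A" "c' \<in> A"
  shows "open (snd c ` (fst c \<inter> fst c'))" "hmap (\<lambda>z. snd c' (chart_inv c z)) (snd c ` (fst c \<inter> fst c'))"
proof -
  show "open (snd c ` (fst c \<inter> fst c'))" by (rule chart_image_open[OF assms(1) chart_facts(1)[OF assms(2)]])
  show "hmap (\<lambda>z. snd c' (chart_inv c z)) (snd c ` (fst c \<inter> fst c'))"
    using atlas assms unfolding complex_atlas_def hmap_def by blast
qed

lemma charts_atD: "c \<in> charts_at A x \<Longrightarrow> c \<in> A" "c \<in> charts_at A x \<Longrightarrow> x \<in> fst c"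
  by (auto simp: charts_at_def)

lemma ex_chart: "\<exists>c. c \<in> charts_at A x"
  using atlas unfolding complex_atlas_def charts_at_def by blast

text \<open>Transports every statement about germs at \<open>x\<close> to the image of a
  chart.\<close>

lemma eventually_chart:
  assumes c: "c \<in> charts_at A x"
  shows "(\<forall>\<^sub>F y in nhds x. P y) \<longleftrightarrow> (\<forall>\<^sub>F z in nhds (snd c x). P (chart_inv c z))"
proof -
  note cA = charts_atD[OF c] and f = chart_facts[OF charts_atD(1)[OF c]]
  show ?thesis
  proof
    assume "\<forall>\<^sub>F y in nhds x. P y"
    then obtain S where S: "open S" "x \<in> S" "\<forall>y\<in>S. P y" by (auto simp: eventually_nhds)
    show "\<forall>\<^sub>F z in nhds (snd c x). P (chart_inv c z)"
      unfolding eventually_nhds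
      by (intro exI[of _ "snd c ` (fst c \<inter> S)"]) (use chart_image_open[OF cA(1) S(1)] S cA f in auto)
  next
    assume "\<forall>\<^sub>F z in nhds (snd c x). P (chart_inv c z)"
    then obtain S where S: "open S" "snd c x \<in> S" "\<forall>z\<in>S. P (chart_inv c z)" by (auto simp: eventually_nhds)
    have "open (fst c \<inter> snd c -` S)" by (rule continuous_open_preimage[OF f(3,1) S(1)])
    moreover have "P y" if "y \<in> fst c \<inter> snd c -` S" for y
      using S(3) that f(5) by (metis IntD1 IntD2 vimageD)
    ultimately show "\<forall>\<^sub>F y in nhds x. P y"
      unfolding eventually_nhds using S cA by (intro exI[of _ "fst c \<inter> snd c -` S"]) auto
  qed
qed

lemma eventually_in_chart: "c \<in> charts_at A x \<Longrightarrow> \<forall>\<^sub>F z in nhds (snd c x). z \<in> snd c ` fst c"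
  using chart_facts(2)[of c] charts_atD unfolding eventually_nhds by blast

lemma chart_inv_charts_at: "c \<in> A \<Longrightarrow> z \<in> snd c ` fst c \<Longrightarrow> c \<in> charts_at A (chart_inv c z)"
  using chart_facts by (auto simp: charts_at_def)

lemma transition_germ:
  assumes "c \<in> charts_at A x" "c' \<in> charts_at A x"
  shows "snd c x \<in> snd c ` (fst c \<inter> fst c')" "snd c' (chart_inv c (snd c x)) = snd c' x"
    "\<forall>\<^sub>F z in nhds (snd c x). chart_inv c' (snd c' (chart_inv c z)) = chart_inv c z"
proof -
  note c = charts_atD[OF assms(1)] and c' = charts_atD[OF assms(2)]
  show 1: "snd c x \<in> snd c ` (fst c \<inter> fst c')" using c c' by blast
  show "snd c' (chart_inv c (snd c x)) = snd c' x" using chart_facts(5)[OF c(1,2)] by simp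
  have "chart_inv c' (snd c' (chart_inv c z)) = chart_inv c z" if "z \<in> snd c ` (fst c \<inter> fst c')" for z
    using that chart_facts(5)[OF c(1)] chart_facts(5)[OF c'(1)] by auto
  then show "\<forall>\<^sub>F z in nhds (snd c x). chart_inv c' (snd c' (chart_inv c z)) = chart_inv c z"
    unfolding eventually_nhds using transition(1)[OF c(1) c'(1)] 1 by blast
qed

text \<open>The definition asks for holomorphy in every chart; the transition maps reduce it to
  one.\<close>

lemma hol_germ_iff:
  assumes c: "c \<in> charts_at A x"
  shows "f \<in> hol_germ A x \<longleftrightarrow> (\<lambda>z. f (chart_inv c z)) \<in> Ogerm (snd c x)"
proof
  assume "f \<in> hol_germ A x"
  then show "(\<lambda>z. f (chart_inv c z)) \<in> Ogerm (snd c x)" using c by (auto simp: hol_germ_def Ogerm_def)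
next
  assume f: "(\<lambda>z. f (chart_inv c z)) \<in> Ogerm (snd c x)"
  show "f \<in> hol_germ A x"
    unfolding hol_germ_def
  proof (safe)
    fix a b assume c': "(a, b) \<in> charts_at A x"
    let ?c = "(a, b)"
    note t = transition_germ[OF c' c] and tr = transition[OF charts_atD(1)[OF c'] charts_atD(1)[OF c]]
    have "(\<lambda>z. f (chart_inv c (snd c (chart_inv ?c z)))) \<in> Ogerm (snd ?c x)"
      by (rule Ogerm_compose(1)[where f="\<lambda>z. f (chart_inv c z)" and g="\<lambda>z. snd c (chart_inv ?c z)", OF _ tr(1) t(1) tr(2)])
        (simp only: t(2) f)
    then have "(\<lambda>z. f (chart_inv ?c z)) \<in> Ogerm (snd ?c x)"
      by (rule Ogerm_cong) (use t(3) in \<open>eventually_elim, simp\<close>)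
    then show "\<exists>S. open S \<and> snd ?c x \<in> S \<and> holo_on (\<lambda>z. f (chart_inv ?c z)) S" by (auto simp: Ogerm_def)
  qed
qed

lemma hol_germ_pull:
  assumes c: "c \<in> charts_at A x" and g: "g \<in> Ogerm (snd c x)"
  shows "(\<lambda>y. g (snd c y)) \<in> hol_germ A x"
  unfolding hol_germ_iff[OF c]
  by (rule Ogerm_cong[OF g]) (use eventually_in_chart[OF c] chart_facts(6)[OF charts_atD(1)[OF c]] in \<open>auto elim: eventually_mono\<close>)

lemma hol_germ_near:
  assumes c: "c \<in> charts_at A x" and f: "f \<in> hol_germ A x"
  shows "\<forall>\<^sub>F z in nhds (snd c x). f \<in> hol_germ A (chart_inv c z)"
  using Ogerm_eventually_holo[OF f[unfolded hol_germ_iff[OF c]]] eventually_in_chart[OF c]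
proof eventually_elim
  case (elim z)
  have "(\<lambda>z. f (chart_inv c z)) \<in> Ogerm (snd c (chart_inv c z))"
    using elim chart_facts(6)[OF charts_atD(1)[OF c]] by (auto simp: Ogerm_def)
  then show ?case using hol_germ_iff[OF chart_inv_charts_at[OF charts_atD(1)[OF c] elim(2)]] by simp
qed

lemma tangent_apply:
  "f \<in> hol_germ A x \<Longrightarrow> tangent A c x v f = FD (\<lambda>z. f (chart_inv c z)) (snd c x) v"
  by (simp add: tangent_def)

lemma tangent_in_tspace: "c \<in> charts_at A x \<Longrightarrow> tangent A c x v \<in> tspace A x"
  unfolding tspace_def by blast

lemma tangent_change:
  assumes c: "c \<in> charts_at A x" and c': "c' \<in> charts_at A x"
  shows "tangent A c' x v = tangent A c x (FD (\<lambda>z. snd c (chart_inv c' z)) (snd c' x) v)"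
proof
  fix f
  note t = transition_germ[OF c' c] and tr = transition[OF charts_atD(1)[OF c'] charts_atD(1)[OF c]]
  show "tangent A c' x v f = tangent A c x (FD (\<lambda>z. snd c (chart_inv c' z)) (snd c' x) v) f"
  proof (cases "f \<in> hol_germ A x")
    case True
    have "FD (\<lambda>z. f (chart_inv c' z)) (snd c' x) v = FD (\<lambda>z. f (chart_inv c (snd c (chart_inv c' z)))) (snd c' x) v"
      by (rule arg_cong[where f="\<lambda>g. g v"], rule FD_cong_eventually) (use t(3) in \<open>eventually_elim, simp\<close>)
    also have "\<dots> = FD (\<lambda>z. f (chart_inv c z)) (snd c x) (FD (\<lambda>z. snd c (chart_inv c' z)) (snd c' x) v)"
      using Ogerm_compose(2)[where f="\<lambda>z. f (chart_inv c z)" and g="\<lambda>z. snd c (chart_inv c' z)", OF _ tr(1) t(1) tr(2), of v]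
        True[unfolded hol_germ_iff[OF c]] by (simp only: t(2))
    finally show ?thesis using True by (simp add: tangent_apply)
  qed (simp add: tangent_def)
qed

lemma coord_hol_germ: "c \<in> charts_at A x \<Longrightarrow> (\<lambda>y. snd c y $ j) \<in> hol_germ A x"
  by (rule hol_germ_pull[where g="\<lambda>z. z $ j"]) (auto intro: Ogerm_coord)

lemma coords_tangent_change:
  assumes c: "c \<in> charts_at A x" and c': "c' \<in> charts_at A x"
  shows "coords c (tangent A c' x v) = FD (\<lambda>z. snd c (chart_inv c' z)) (snd c' x) v"
proof -
  note t = transition_germ[OF c' c] and tr = transition[OF charts_atD(1)[OF c'] charts_atD(1)[OF c]]
  show ?thesis
    by (simp add: coords_def tangent_apply[OF coord_hol_germ[OF c]] hmap_deriv(2)[OF tr(2) t(1)])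
qed

lemma coords_tangent:
  assumes c: "c \<in> charts_at A x" shows "coords c (tangent A c x v) = v"
proof -
  have "FD (\<lambda>z. snd c (chart_inv c z)) (snd c x) = FD (\<lambda>z. z) (snd c x)"
    by (rule FD_cong_eventually)
      (use eventually_in_chart[OF c] chart_facts(6)[OF charts_atD(1)[OF c]] in \<open>auto elim: eventually_mono\<close>)
  then show ?thesis unfolding coords_tangent_change[OF c c] using FD_eq[OF has_derivative_ident] by metis
qed

lemma tspace_chart:
  assumes c: "c \<in> charts_at A x" and t: "t \<in> tspace A x"
  obtains v where "t = tangent A c x v"
proof -
  obtain c' v where "c' \<in> charts_at A x" "t = tangent A c' x v" using t by (auto simp: tspace_def)
  then show thesis using tangent_change[OF c, of c' v] that by blast
qed

text \<open>As \<open>hol_map_germ\<close> quantifies over all pairs of charts, \<open>h\<close> is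
  composed with a transition map on either side, on the successively smaller sets \<open>S1\<close>
  and \<open>S\<close>.\<close>

lemma local_map:
  assumes c: "c \<in> charts_at A p" and T: "open T" "snd c p \<in> T" and h: "hmap h T" "h (snd c p) = snd c p"
  shows "hol_map_germ A p (\<lambda>x. chart_inv c (h (snd c x)))"
  unfolding hol_map_germ_def
proof (intro ballI)
  note cA = charts_atD(1)[OF c]
  have Fp: "chart_inv c (h (snd c p)) = p" using h(2) chart_facts(5)[OF charts_atD[OF c]] by simp
  fix c1 c2 assume c1: "c1 \<in> charts_at A p" and c2: "c2 \<in> charts_at A (chart_inv c (h (snd c p)))"
  then have c2: "c2 \<in> charts_at A p" by (simp only: Fp)
  note c1A = charts_atD(1)[OF c1] and c2A = charts_atD(1)[OF c2]
  note t1 = transition[OF c1A cA] and t2 = transition[OF cA c2A]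
  let ?g = "\<lambda>z. snd c (chart_inv c1 z)"
  define S1 where "S1 = snd c1 ` (fst c1 \<inter> fst c) \<inter> ?g -` T"
  have S1: "open S1" "hmap ?g S1" "?g ` S1 \<subseteq> T"
    unfolding S1_def using continuous_open_preimage[OF hmap_continuous[OF t1(2)] t1(1) T(1)] t1(2)
    by (auto intro: hmap_subset)
  have hg: "hmap (\<lambda>z. h (?g z)) S1" by (rule hmap_compose(1)[OF h(1) S1(2,3)])
  define S where "S = S1 \<inter> (\<lambda>z. h (?g z)) -` (snd c ` (fst c \<inter> fst c2))"
  have S: "open S" "hmap (\<lambda>z. h (?g z)) S" "(\<lambda>z. h (?g z)) ` S \<subseteq> snd c ` (fst c \<inter> fst c2)"
    unfolding S_def using continuous_open_preimage[OF hmap_continuous[OF hg] S1(1) t2(1)] hg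
    by (auto intro: hmap_subset)
  have hh: "hmap (\<lambda>z. snd c2 (chart_inv c (h (?g z)))) S" by (rule hmap_compose(1)[OF t2(2) S(2,3)])
  have g1: "?g (snd c1 p) = snd c p" using chart_facts(5)[OF charts_atD[OF c1]] by simp
  show "\<exists>S. open S \<and> snd c1 p \<in> S \<and> S \<subseteq> snd c1 ` fst c1 \<and>
     (\<forall>z\<in>S. chart_inv c (h (snd c (chart_inv c1 z))) \<in> fst c2) \<and>
     (\<forall>j. holo_on (\<lambda>z. snd c2 (chart_inv c (h (snd c (chart_inv c1 z)))) $ j) S)"
  proof (intro exI[of _ S] conjI)
    show "snd c1 p \<in> S"
      using transition_germ(1)[OF c1 c] transition_germ(1)[OF c c2] T(2) h(2) g1 by (simp add: S_def S1_def)
    show "S \<subseteq> snd c1 ` fst c1" by (auto simp: S_def S1_def)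
    show "\<forall>z\<in>S. chart_inv c (h (?g z)) \<in> fst c2"
    proof
      fix z assume "z \<in> S"
      then have "h (?g z) \<in> snd c ` (fst c \<inter> fst c2)" using S(3) by blast
      then show "chart_inv c (h (?g z)) \<in> fst c2" using chart_facts(5)[OF cA] by auto
    qed
  qed (use S(1) hh in \<open>auto simp: hmap_def\<close>)
qed

lemma pushforward_tangent:
  assumes c: "c \<in> charts_at A x" and T: "open T" "snd c x \<in> T" and h: "hmap h T" "h (snd c x) \<in> snd c ` fst c"
  shows "pushforward A (\<lambda>x. chart_inv c (h (snd c x))) x (tangent A c x v) =
    tangent A c (chart_inv c (h (snd c x))) (FD h (snd c x) v)"
proof
  fix f
  note cA = charts_atD(1)[OF c]
  let ?F = "\<lambda>x. chart_inv c (h (snd c x))"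
  have cF: "c \<in> charts_at A (?F x)" by (rule chart_inv_charts_at[OF cA h(2)])
  show "pushforward A ?F x (tangent A c x v) f = tangent A c (?F x) (FD h (snd c x) v) f"
  proof (cases "f \<in> hol_germ A (?F x)")
    case True
    have f: "(\<lambda>z. f (chart_inv c z)) \<in> Ogerm (h (snd c x))"
      using True hol_germ_iff[OF cF] chart_facts(6)[OF cA h(2)] by simp
    have ev: "\<forall>\<^sub>F z in nhds (snd c x). f (chart_inv c (h z)) = f (?F (chart_inv c z))"
      using eventually_in_chart[OF c] by eventually_elim (simp add: chart_facts(6)[OF cA])
    note comp = Ogerm_compose[where f="\<lambda>z. f (chart_inv c z)" and g=h, OF f T h(1)]
    have "(\<lambda>y. f (?F y)) \<in> hol_germ A x"
      unfolding hol_germ_iff[OF c] by (rule Ogerm_cong[OF comp(1) ev])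
    then have "pushforward A ?F x (tangent A c x v) f = FD (\<lambda>z. f (?F (chart_inv c z))) (snd c x) v"
      using True by (simp add: pushforward_def tangent_apply)
    also have "\<dots> = FD (\<lambda>z. f (chart_inv c (h z))) (snd c x) v"
      using FD_cong_eventually[OF ev] by simp
    also have "\<dots> = FD (\<lambda>z. f (chart_inv c z)) (h (snd c x)) (FD h (snd c x) v)" by (rule comp(2))
    finally show ?thesis using True chart_facts(6)[OF cA h(2)] by (simp add: tangent_apply)
  qed (simp add: pushforward_def tangent_def)
qed

end

section \<open>Primality of the component equations and factorisation of \<open>h\<close>\<close>

context atlas
begin

lemma gdvd_chart:
  assumes c: "c \<in> charts_at A p"
  shows "gdvd (snd c p) (\<lambda>z. f (chart_inv c z)) (\<lambda>z. a (chart_inv c z)) \<longleftrightarrow>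
    (\<exists>b\<in>hol_germ A p. \<forall>\<^sub>F x in nhds p. a x = f x * b x)"
proof
  assume "gdvd (snd c p) (\<lambda>z. f (chart_inv c z)) (\<lambda>z. a (chart_inv c z))"
  then obtain b where b: "b \<in> Ogerm (snd c p)"
    "\<forall>\<^sub>F z in nhds (snd c p). a (chart_inv c z) = f (chart_inv c z) * b z" by (rule gdvdE)
  have "\<forall>\<^sub>F x in nhds p. a x = f x * b (snd c x)"
    unfolding eventually_chart[OF c] using b(2) eventually_in_chart[OF c]
    by eventually_elim (simp add: chart_facts(6)[OF charts_atD(1)[OF c]])
  then show "\<exists>b\<in>hol_germ A p. \<forall>\<^sub>F x in nhds p. a x = f x * b x"
    using hol_germ_pull[OF c b(1)] by (intro bexI[of _ "\<lambda>x. b (snd c x)"])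
next
  assume "\<exists>b\<in>hol_germ A p. \<forall>\<^sub>F x in nhds p. a x = f x * b x"
  then obtain b where "b \<in> hol_germ A p" "\<forall>\<^sub>F x in nhds p. a x = f x * b x" by blast
  then show "gdvd (snd c p) (\<lambda>z. f (chart_inv c z)) (\<lambda>z. a (chart_inv c z))"
    unfolding hol_germ_iff[OF c] eventually_chart[OF c] by (intro gdvdI)
qed

text \<open>The finitely many equations of \<open>C\<close> lie in its vanishing ideal, so they are
  multiples of \<open>f\<close> and vanish where \<open>f\<close> does.\<close>

lemma reduced_equation_zeros:
  assumes "analytic_germ A p C" "reduced_equation A C p f"
  shows "\<forall>\<^sub>F x in nhds p. x \<in> C \<longleftrightarrow> f x = 0"
proof -
  obtain F where F: "finite F" "F \<subseteq> hol_germ A p" "\<forall>\<^sub>F x in nhds p. x \<in> C \<longleftrightarrow> (\<forall>g\<in>F. g x = 0)"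
    using assms(1) by (auto simp: analytic_germ_def)
  have f: "\<forall>\<^sub>F x in nhds p. x \<in> C \<longrightarrow> f x = 0"
    using assms(2) by (auto simp: reduced_equation_def vanishing_ideal_def)
  have "\<forall>g\<in>F. \<forall>\<^sub>F x in nhds p. f x = 0 \<longrightarrow> g x = 0"
  proof
    fix g assume g: "g \<in> F"
    have "\<forall>\<^sub>F x in nhds p. x \<in> C \<longrightarrow> g x = 0" using F(3) by eventually_elim (use g in blast)
    then have "g \<in> vanishing_ideal A C p" using g F(2) by (auto simp: vanishing_ideal_def)
    then obtain k where "\<forall>\<^sub>F x in nhds p. g x = k x * f x" using assms(2) by (auto simp: reduced_equation_def)
    then show "\<forall>\<^sub>F x in nhds p. f x = 0 \<longrightarrow> g x = 0" by eventually_elim simp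
  qed
  then have "\<forall>\<^sub>F x in nhds p. \<forall>g\<in>F. f x = 0 \<longrightarrow> g x = 0" by (rule eventually_ball_finite[OF F(1)])
  with f F(3) show ?thesis by eventually_elim blast
qed

lemma analytic_germ_Int_zeros:
  assumes "analytic_germ A p C" "a \<in> hol_germ A p"
  shows "analytic_germ A p {x \<in> C. a x = 0}"
proof -
  obtain F where F: "finite F" "F \<subseteq> hol_germ A p" "\<forall>\<^sub>F x in nhds p. x \<in> C \<longleftrightarrow> (\<forall>g\<in>F. g x = 0)"
    using assms(1) by (auto simp: analytic_germ_def)
  have "\<forall>\<^sub>F x in nhds p. x \<in> {x \<in> C. a x = 0} \<longleftrightarrow> (\<forall>g\<in>insert a F. g x = 0)"
    using F(3) by eventually_elim auto
  then show ?thesis unfolding analytic_germ_def using F(1,2) assms(2) by (intro exI[of _ "insert a F"]) simp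
qed

text \<open>If \<open>f\<close> divides \<open>a * b\<close>, then \<open>C\<close> is the union of
  its intersections with the zeros of \<open>a\<close> and of \<open>b\<close>. By irreducibility
  one of the factors vanishes on \<open>C\<close> and thus is a multiple of the reduced equation
  \<open>f\<close>.\<close>

lemma prime_germ_irreducible:
  assumes c: "c \<in> charts_at A p" and C: "irreducible_germ A p C" and f: "reduced_equation A C p f"
    and ne: "\<not> (\<forall>\<^sub>F x in nhds p. f x = 0)"
  shows "prime_germ (snd c p) (\<lambda>z. f (chart_inv c z))"
  unfolding prime_germ_def
proof (intro conjI ballI impI)
  have an: "analytic_germ A p C" and pC: "p \<in> C" using C by (auto simp: irreducible_germ_def)
  note zeros = reduced_equation_zeros[OF an f]
  show "(\<lambda>z. f (chart_inv c z)) \<in> Ogerm (snd c p)"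
    using f hol_germ_iff[OF c] by (auto simp: reduced_equation_def vanishing_ideal_def)
  show "nz (snd c p) (\<lambda>z. f (chart_inv c z))" using ne unfolding nz_def eventually_chart[OF c] .
  show "f (chart_inv c (snd c p)) = 0"
    using eventually_nhds_x_imp_x[OF zeros] pC chart_facts(5)[OF charts_atD[OF c]] by simp
  fix a b assume ab: "a \<in> Ogerm (snd c p)" "b \<in> Ogerm (snd c p)"
    and dvd: "gdvd (snd c p) (\<lambda>z. f (chart_inv c z)) (\<lambda>z. a z * b z)"
  let ?a = "\<lambda>x. a (snd c x)" and ?b = "\<lambda>x. b (snd c x)"
  have near: "\<forall>\<^sub>F z in nhds (snd c p). snd c (chart_inv c z) = z"
    using eventually_in_chart[OF c] by eventually_elim (simp add: chart_facts(6)[OF charts_atD(1)[OF c]])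
  have "gdvd (snd c p) (\<lambda>z. f (chart_inv c z)) (\<lambda>z. ?a (chart_inv c z) * ?b (chart_inv c z))"
    by (rule gdvd_cong[OF _ dvd]) (use near in \<open>eventually_elim, simp\<close>)
  then obtain k where "\<forall>\<^sub>F x in nhds p. ?a x * ?b x = f x * k x"
    unfolding gdvd_chart[OF c, of f "\<lambda>x. ?a x * ?b x"] by blast
  with zeros have "\<forall>\<^sub>F x in nhds p. x \<in> C \<longleftrightarrow> x \<in> {x \<in> C. ?a x = 0} \<or> x \<in> {x \<in> C. ?b x = 0}"
    by eventually_elim auto
  then have "(\<forall>\<^sub>F x in nhds p. x \<in> C \<longleftrightarrow> x \<in> {x \<in> C. ?a x = 0}) \<or> (\<forall>\<^sub>F x in nhds p. x \<in> C \<longleftrightarrow> x \<in> {x \<in> C. ?b x = 0})"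
    using C analytic_germ_Int_zeros[OF an hol_germ_pull[OF c ab(1)]] analytic_germ_Int_zeros[OF an hol_germ_pull[OF c ab(2)]]
    unfolding irreducible_germ_def by blast
  moreover have "gdvd (snd c p) (\<lambda>z. f (chart_inv c z)) g"
    if g: "g \<in> Ogerm (snd c p)" and van: "\<forall>\<^sub>F x in nhds p. x \<in> C \<longleftrightarrow> x \<in> {x \<in> C. g (snd c x) = 0}" for g
  proof -
    have "\<forall>\<^sub>F x in nhds p. x \<in> C \<longrightarrow> g (snd c x) = 0" using van by eventually_elim auto
    then have "(\<lambda>x. g (snd c x)) \<in> vanishing_ideal A C p"
      using hol_germ_pull[OF c g] by (auto simp: vanishing_ideal_def)
    then obtain k where k: "k \<in> hol_germ A p" "\<forall>\<^sub>F x in nhds p. g (snd c x) = k x * f x"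
      using f by (auto simp: reduced_equation_def)
    have "\<exists>b\<in>hol_germ A p. \<forall>\<^sub>F x in nhds p. g (snd c x) = f x * b x"
      by (rule bexI[OF _ k(1)]) (use k(2) in \<open>eventually_elim, simp\<close>)
    from this[folded gdvd_chart[OF c]] show ?thesis
      by (rule gdvd_cong[rotated]) (use near in \<open>eventually_elim, simp\<close>)
  qed
  ultimately show "gdvd (snd c p) (\<lambda>z. f (chart_inv c z)) a \<or> gdvd (snd c p) (\<lambda>z. f (chart_inv c z)) b"
    using ab by blast
qed

text \<open>Each \<open>fs ! k\<close> divides \<open>h\<close>, since \<open>h\<close> vanishes on
  the component; as these are primes not dividing each other, their product divides
  \<open>h\<close>. Conversely the product vanishes on \<open>D\<close>, so it is a multiple of
  \<open>h\<close>. The quotient is therefore a unit.\<close>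

lemma reduced_germ_chart:
  assumes c: "c \<in> charts_at A p" and D: "hypersurface A D" "p \<in> D"
    and h: "reduced_equation A D p h" and fs: "component_equations A D p fs"
  obtains u where "reduced_germ (snd c p) (map (\<lambda>f z. f (chart_inv c z)) fs) u (\<lambda>z. h (chart_inv c z))"
    and "\<forall>\<^sub>F x in nhds p. x \<in> D \<longleftrightarrow> h x = 0"
proof -
  let ?z = "snd c p" and ?f = "\<lambda>f z. f (chart_inv c z) :: complex"
  let ?h = "?f h" and ?fs = "map ?f fs"
  obtain Cs where Cs: "irreducible_components A D p Cs" "list_all2 (\<lambda>C f. reduced_equation A C p f) Cs fs"
    using fs by (auto simp: component_equations_def)
  have len: "length Cs = length fs" and red: "k < length fs \<Longrightarrow> reduced_equation A (Cs ! k) p (fs ! k)" for k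
    using Cs(2) by (auto simp: list_all2_conv_all_nth)
  have irr: "k < length fs \<Longrightarrow> irreducible_germ A p (Cs ! k)" for k
    using Cs(1) len by (auto simp: irreducible_components_def)
  have DC: "\<forall>\<^sub>F x in nhds p. x \<in> D \<longleftrightarrow> (\<exists>k<length fs. x \<in> Cs ! k)"
    using Cs(1) len unfolding irreducible_components_def by (auto simp: set_conv_nth Bex_def elim!: eventually_mono)
  have zeros: "k < length fs \<Longrightarrow> \<forall>\<^sub>F x in nhds p. x \<in> Cs ! k \<longleftrightarrow> (fs ! k) x = 0" for k
    using reduced_equation_zeros[OF _ red] irr by (auto simp: irreducible_germ_def)
  have hI: "h \<in> hol_germ A p" "\<forall>\<^sub>F x in nhds p. x \<in> D \<longrightarrow> h x = 0"
    using h by (auto simp: reduced_equation_def vanishing_ideal_def)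
  \<comment> \<open>A hypersurface has a local equation that is not identically zero; it shows that
    \<open>h\<close>, and with it every factor, is a nonzero germ.\<close>
  obtain f where f: "f \<in> hol_germ A p" "\<not> (\<forall>\<^sub>F x in nhds p. f x = 0)" "\<forall>\<^sub>F x in nhds p. x \<in> D \<longleftrightarrow> f x = 0"
    using D by (auto simp: hypersurface_def)
  have "\<forall>\<^sub>F x in nhds p. x \<in> D \<longrightarrow> f x = 0" using f(3) by eventually_elim simp
  then obtain g where g: "\<forall>\<^sub>F x in nhds p. f x = g x * h x"
    using h f(1) by (auto simp: reduced_equation_def vanishing_ideal_def)
  have Dh: "\<forall>\<^sub>F x in nhds p. x \<in> D \<longleftrightarrow> h x = 0"
    using g f(3) hI(2) by eventually_elim auto
  have h_ne: "\<not> (\<forall>\<^sub>F x in nhds p. h x = 0)"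
  proof
    assume "\<forall>\<^sub>F x in nhds p. h x = 0"
    with g have "\<forall>\<^sub>F x in nhds p. f x = 0" by eventually_elim simp
    with f(2) show False by contradiction
  qed
  have dvd_h: "\<exists>b\<in>hol_germ A p. \<forall>\<^sub>F x in nhds p. h x = (fs ! k) x * b x" if k: "k < length fs" for k
  proof -
    have "\<forall>\<^sub>F x in nhds p. x \<in> Cs ! k \<longrightarrow> h x = 0"
      using DC hI(2) by eventually_elim (use k in blast)
    then have "h \<in> vanishing_ideal A (Cs ! k) p" using hI(1) by (auto simp: vanishing_ideal_def)
    then obtain b where b: "b \<in> hol_germ A p" "\<forall>\<^sub>F x in nhds p. h x = b x * (fs ! k) x"
      using red[OF k] by (auto simp: reduced_equation_def)
    show ?thesis by (rule bexI[OF _ b(1)]) (use b(2) in \<open>eventually_elim, simp\<close>)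
  qed
  have f_ne: "\<not> (\<forall>\<^sub>F x in nhds p. (fs ! k) x = 0)" if k: "k < length fs" for k
  proof
    assume "\<forall>\<^sub>F x in nhds p. (fs ! k) x = 0"
    moreover obtain b where "\<forall>\<^sub>F x in nhds p. h x = (fs ! k) x * b x" using dvd_h[OF k] by blast
    ultimately have "\<forall>\<^sub>F x in nhds p. h x = 0" by eventually_elim simp
    with h_ne show False by contradiction
  qed
  let ?P = "\<lambda>z. \<Prod>k<length ?fs. (?fs ! k) z"
  have prime: "k < length ?fs \<Longrightarrow> prime_germ ?z (?fs ! k)" for k
    using prime_germ_irreducible[OF c irr red f_ne] by simp
  have indep: "\<not> gdvd ?z (?fs ! k) (?fs ! j)" if kj: "k < length ?fs" "j < length ?fs" "k \<noteq> j" for k j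
  proof
    assume "gdvd ?z (?fs ! k) (?fs ! j)"
    then obtain b where b: "\<forall>\<^sub>F x in nhds p. (fs ! j) x = (fs ! k) x * b x"
      using kj gdvd_chart[OF c, of "fs ! k" "fs ! j"] by auto
    have "k < length fs" "j < length fs" using kj by simp_all
    from zeros[OF this(1)] zeros[OF this(2)] b have "\<forall>\<^sub>F x in nhds p. x \<in> Cs ! k \<longrightarrow> x \<in> Cs ! j"
      by eventually_elim simp
    then show False using Cs(1) kj len by (auto simp: irreducible_components_def)
  qed
  \<comment> \<open>A provisional instance with the product itself as equation and unit 1, so that
    the divisibility lemma is available before the true unit is known.\<close>
  interpret one: reduced_germ ?z ?fs "\<lambda>_. 1" ?P
    by unfold_locales (auto simp: prime indep Ogerm_const simp del: nth_map length_map)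
  have hO: "?h \<in> Ogerm ?z" using hI(1) hol_germ_iff[OF c] by simp
  have "gdvd ?z (\<lambda>z. \<Prod>k<length ?fs. (?fs ! k) z ^ 1) ?h"
    by (rule one.gdvd_prod_powers[OF hO]) (use dvd_h gdvd_chart[OF c] in auto)
  then obtain w where w: "w \<in> Ogerm ?z" "\<forall>\<^sub>F z in nhds ?z. ?h z = ?P z * w z"
    by (auto elim!: gdvdE)
  have PO: "?P \<in> Ogerm ?z" by (rule one.prod_fsO)
  let ?Q = "\<lambda>x. \<Prod>k<length fs. (fs ! k) x"
  have "?Q \<in> hol_germ A p" unfolding hol_germ_iff[OF c] using PO by simp
  moreover have "\<forall>\<^sub>F x in nhds p. \<forall>k\<in>{..<length fs}. x \<in> Cs ! k \<longleftrightarrow> (fs ! k) x = 0"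
    by (rule eventually_ball_finite) (use zeros in auto)
  then have "\<forall>\<^sub>F x in nhds p. x \<in> D \<longrightarrow> ?Q x = 0"
    using DC by eventually_elim auto
  ultimately obtain b where b: "b \<in> hol_germ A p" "\<forall>\<^sub>F x in nhds p. ?Q x = b x * h x"
    using h by (auto simp: reduced_equation_def vanishing_ideal_def)
  have bO: "?f b \<in> Ogerm ?z" using b(1) hol_germ_iff[OF c] by simp
  have "\<forall>\<^sub>F z in nhds ?z. ?P z * 1 = ?P z * (?f b z * w z)"
    using b(2)[unfolded eventually_chart[OF c]] w(2) by eventually_elim simp
  from germ_cancel[OF PO one.h_nz Ogerm_const Ogerm_mult[OF bO w(1)] this]
  have "w ?z \<noteq> 0" using eventually_nhds_x_imp_x by fastforce
  have "reduced_germ ?z ?fs w ?h"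
  proof
    show "\<forall>\<^sub>F z in nhds ?z. ?h z = w z * ?P z" using w(2) by eventually_elim simp
  qed (use prime indep w(1) \<open>w ?z \<noteq> 0\<close> in auto)
  then show thesis using that Dh by blast
qed

end

section \<open>Coordinate expressions of forms and cohomology classes\<close>

lemma alternating_form_scale:
  assumes a: "alternating_form k a" and b: "\<And>vs. length vs = k \<Longrightarrow> b vs = s * a vs"
  shows "alternating_form k b"
  using a unfolding alternating_form_def by (simp add: b algebra_simps)

lemma alternating_form_2_bil:
  assumes a: "alternating_form 2 a" and W: "\<And>i j. W $ i $ j = a [axis i 1, axis j 1]"
  shows "a [u, v] = bil W u v" and "a [u, v] = - a [v, u]"
proof -
  have lin1: "a [b *s x + y, v] = b * a [x, v] + a [y, v]" for b x y v
    using a[unfolded alternating_form_def, THEN conjunct1, rule_format, of "[0, v]" 0 b x y] by simp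
  have lin2: "a [u, b *s x + y] = b * a [u, x] + a [u, y]" for b x y u
    using a[unfolded alternating_form_def, THEN conjunct1, rule_format, of "[u, 0]" 1 b x y] by simp
  have alt: "a [x, x] = 0" for x
    using a[unfolded alternating_form_def, THEN conjunct2, rule_format, of "[x, x]" 0 1] by simp
  have zero: "a [0, v] = 0" "a [v, 0] = 0" for v
    using lin1[of 1 0 0 v] lin2[of v 1 0 0] by simp_all
  have sum1: "a [\<Sum>i\<in>I. x i *s y i, v] = (\<Sum>i\<in>I. x i * a [y i, v])" for I :: "'a set" and x y v
    by (induction I rule: infinite_finite_induct) (simp_all add: zero lin1)
  have sum2: "a [v, \<Sum>i\<in>I. x i *s y i] = (\<Sum>i\<in>I. x i * a [v, y i])" for I :: "'a set" and x y v
    by (induction I rule: infinite_finite_induct) (simp_all add: zero lin2)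
  have "a [u, v] = a [\<Sum>i\<in>UNIV. u $ i *s axis i 1, \<Sum>j\<in>UNIV. v $ j *s axis j 1]"
    using vec_axis_expand[of u] vec_axis_expand[of v] by simp
  also have "\<dots> = bil W u v"
    by (simp only: sum1, simp add: sum2 bil_def W sum_distrib_left algebra_simps)
  finally show "a [u, v] = bil W u v" .
  have "0 = a [u + v, u + v]" by (simp add: alt)
  also have "\<dots> = a [u, v] + a [v, u]"
    using lin1[of 1 u v "u + v"] lin2[of u 1 u v] lin2[of v 1 u v] by (simp add: alt)
  finally show "a [u, v] = - a [v, u]" by (simp add: eq_neg_iff_add_eq_0)
qed

text \<open>Serves for coordinate volume forms in other charts: the row \<open>e m\<close> of the
  matrix depends linearly on \<open>vs ! m\<close>, and the other rows do not depend on it.\<close>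

lemma alternating_form_det_rows:
  fixes e :: "nat \<Rightarrow> 'n::finite" and T :: "complex^'m \<Rightarrow> complex^'n"
  assumes e: "bij_betw e {..<N} UNIV"
    and T: "\<And>u w. T (u + w) = T u + T w" "\<And>b u. T (b *s u) = b *s T u"
  shows "alternating_form N (\<lambda>vs. det (\<chi> i. T (vs ! inv_into {..<N} e i)))"
proof -
  define e' where "e' = inv_into {..<N} e"
  have e': "e (e' k) = k" "e' k < N" for k
    using e by (auto simp: e'_def bij_betw_def f_inv_into_f) (metis UNIV_I inv_into_into lessThan_iff)
  have ee: "e' i = m \<longleftrightarrow> i = e m" if "m < N" for i m
    using that e e' by (auto simp: e'_def bij_betw_inv_into_left)
  have upd: "(\<chi> i. T (vs[m := x] ! e' i)) = (\<chi> i. if i = e m then T x else T (vs ! e' i))"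
    if "length vs = N" "m < N" for vs m x
  proof -
    have "m = e' i \<longleftrightarrow> i = e m" for i using ee[OF that(2), of i] by auto
    then show ?thesis using that by (simp add: vec_eq_iff nth_list_update)
  qed
  show ?thesis
    unfolding alternating_form_def e'_def[symmetric]
  proof (intro conjI allI impI; elim conjE)
    fix vs :: "(complex^'m) list" and m b u w assume l: "length vs = N" "m < N"
    show "det (\<chi> i. T (vs[m := b *s u + w] ! e' i)) =
        b * det (\<chi> i. T (vs[m := u] ! e' i)) + det (\<chi> i. T (vs[m := w] ! e' i))"
      unfolding upd[OF l] T
      by (simp add: det_row_add[of "e m" "\<lambda>_. b *s T u" "\<lambda>_. T w"] det_row_mul[of "e m" b "\<lambda>_. T u"])
  next
    fix vs :: "(complex^'m) list" and k m assume "length vs = N" "k < m" "m < N" "vs ! k = vs ! m"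
    then show "det (\<chi> i. T (vs ! e' i)) = 0"
      using ee[of k "e k"] ee[of m "e m"] ee[of k "e m"]
      by (intro det_identical_rows[of "e k" "e m"]) (auto simp: row_def)
  qed
qed

context atlas
begin

definition form_matrix :: "('m, 'n) chart \<Rightarrow> 'm dform \<Rightarrow> complex^'n \<Rightarrow> complex^'n^'n" where
  "form_matrix c \<omega> z = (\<chi> i j. coord_form A c \<omega> z [axis i 1, axis j 1])"

lemma form_eq_chart:
  assumes c: "c \<in> charts_at A p" and eq: "form_eq A D p k \<alpha> \<beta>"
  shows "\<forall>\<^sub>F z in nhds (snd c p). chart_inv c z \<notin> D \<longrightarrow>
    (\<forall>vs. length vs = k \<longrightarrow> coord_form A c \<alpha> z vs = coord_form A c \<beta> z vs)"
  using eq[unfolded form_eq_def eventually_chart[OF c]] eventually_in_chart[OF c]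
proof eventually_elim
  case (elim z)
  have "set (map (tangent A c (chart_inv c z)) vs) \<subseteq> tspace A (chart_inv c z)" for vs
    using tangent_in_tspace[OF chart_inv_charts_at[OF charts_atD(1)[OF c] elim(2)]] by auto
  then show ?case using elim(1) unfolding coord_form_def by (metis length_map)
qed

lemma is_holomorphic_chart:
  assumes c: "c \<in> charts_at A p" and \<alpha>: "is_holomorphic A D p k \<alpha>"
  obtains a where "\<And>vs. length vs = k \<Longrightarrow> (\<lambda>z. a z vs) \<in> Ogerm (snd c p)"
    "\<forall>\<^sub>F z in nhds (snd c p). alternating_form k (a z)"
    "\<forall>\<^sub>F z in nhds (snd c p). chart_inv c z \<notin> D \<longrightarrow> (\<forall>vs. length vs = k \<longrightarrow> coord_form A c \<alpha> z vs = a z vs)"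
proof -
  obtain \<theta> where \<theta>: "hol_form A p k \<theta>" "form_eq A D p k \<alpha> \<theta>" using \<alpha> by (auto simp: is_holomorphic_def)
  obtain S where S: "open S" "snd c p \<in> S" "\<forall>z\<in>S. alternating_form k (coord_form A c \<theta> z)"
    "\<forall>vs. length vs = k \<longrightarrow> holo_on (\<lambda>z. coord_form A c \<theta> z vs) S"
    using \<theta>(1) c unfolding hol_form_def by blast
  show thesis
  proof
    show "\<And>vs. length vs = k \<Longrightarrow> (\<lambda>z. coord_form A c \<theta> z vs) \<in> Ogerm (snd c p)"
      using S by (auto intro: OgermI)
    show "\<forall>\<^sub>F z in nhds (snd c p). alternating_form k (coord_form A c \<theta> z)"
      using S unfolding eventually_nhds by blast
  qed (rule form_eq_chart[OF c \<theta>(2)])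
qed

lemma coord_d_3:
  "coord_d \<alpha> z [u, v, w] = FD (\<lambda>y. \<alpha> y [v, w]) z u - FD (\<lambda>y. \<alpha> y [u, w]) z v + FD (\<lambda>y. \<alpha> y [u, v]) z w"
  by (simp add: coord_d_def numeral_3_eq_3)

lemma coord_d_2: "coord_d \<alpha> z [u, v] = FD (\<lambda>y. \<alpha> y [v]) z u - FD (\<lambda>y. \<alpha> y [u]) z v"
  by (simp add: coord_d_def numeral_2_eq_2)

lemma coord_form_ext_d:
  assumes c: "c \<in> A" and z: "z \<in> snd c ` fst c"
  shows "coord_form A c (ext_d A c \<omega>) z vs = coord_d (coord_form A c \<omega>) z vs"
  unfolding ext_d_def
  by (subst coord_form_def) (simp add: chart_facts(6)[OF c z] o_def coords_tangent[OF chart_inv_charts_at[OF c z]])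

end

locale log_chart = atlas A + reduced_germ "snd c p" "map (\<lambda>f z. f (chart_inv c z)) fs" u "\<lambda>z. h (chart_inv c z)"
  for A :: "('m::{t2_space,second_countable_topology}, 'n::finite) chart set"
    and c :: "('m, 'n) chart" and p fs u and h :: "'m \<Rightarrow> complex" +
  fixes D :: "'m set"
  assumes c: "c \<in> charts_at A p" and Dh: "\<forall>\<^sub>F x in nhds p. x \<in> D \<longleftrightarrow> h x = 0"
begin

abbreviation "hc \<equiv> \<lambda>z. h (chart_inv c z)"

lemma Dhc: "\<forall>\<^sub>F z in nhds (snd c p). chart_inv c z \<in> D \<longleftrightarrow> hc z = 0"
  using Dh unfolding eventually_chart[OF c] .

text \<open>A \<open>dform\<close> is arbitrary on \<open>D\<close>, so multilinearity and
  antisymmetry of \<open>\<omega>\<close> are obtained off \<open>D\<close>, by dividing the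
  holomorphic form \<open>h\<omega>\<close> by \<open>h\<close>.\<close>

lemma closed_log_form_chart:
  assumes \<omega>: "\<omega> \<in> closed_log_forms A D h p 2"
  shows "log_closed (form_matrix c \<omega>)"
    and "\<forall>\<^sub>F z in nhds (snd c p). hc z \<noteq> 0 \<longrightarrow> (\<forall>u v. coord_form A c \<omega> z [u, v] = bil (form_matrix c \<omega> z) u v)"
proof -
  have "is_holomorphic A D p 2 (fmult h \<omega>)" and cl: "form_eq A D p (Suc 2) (ext_d A c \<omega>) (\<lambda>x ts. 0)"
    using \<omega> c by (auto simp: closed_log_forms_def log_forms_def)
  then obtain a where a: "\<And>vs. length vs = 2 \<Longrightarrow> (\<lambda>z. a z vs) \<in> Ogerm (snd c p)"
    "\<forall>\<^sub>F z in nhds (snd c p). alternating_form 2 (a z)"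
    "\<forall>\<^sub>F z in nhds (snd c p). chart_inv c z \<notin> D \<longrightarrow> (\<forall>vs. length vs = 2 \<longrightarrow> coord_form A c (fmult h \<omega>) z vs = a z vs)"
    using is_holomorphic_chart[OF c, of D 2 "fmult h \<omega>"] by blast
  have ha: "\<forall>\<^sub>F z in nhds (snd c p). hc z \<noteq> 0 \<longrightarrow> (\<forall>vs. length vs = 2 \<longrightarrow> hc z * coord_form A c \<omega> z vs = a z vs)"
    using a(3) Dhc by eventually_elim (simp add: coord_form_def fmult_def)
  have "\<forall>\<^sub>F z in nhds (snd c p). hc z \<noteq> 0 \<longrightarrow> alternating_form 2 (coord_form A c \<omega> z)"
    using ha a(2)
  proof eventually_elim
    case (elim z)
    show ?case
    proof
      assume hz: "hc z \<noteq> 0"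
      show "alternating_form 2 (coord_form A c \<omega> z)"
      proof (rule alternating_form_scale[OF elim(2)])
        fix vs :: "(complex^'n) list" assume "length vs = 2"
        then have "a z vs = hc z * coord_form A c \<omega> z vs" using elim(1) hz by simp
        then show "coord_form A c \<omega> z vs = inverse (hc z) * a z vs" using hz by simp
      qed
    qed
  qed
  then have alt: "\<forall>\<^sub>F z in nhds (snd c p). hc z \<noteq> 0 \<longrightarrow>
      (\<forall>u v. coord_form A c \<omega> z [u, v] = bil (form_matrix c \<omega> z) u v \<and>
        coord_form A c \<omega> z [u, v] = - coord_form A c \<omega> z [v, u])"
  proof eventually_elim
    case (elim z)
    have "form_matrix c \<omega> z $ i $ j = coord_form A c \<omega> z [axis i 1, axis j 1]" for i j
      by (simp add: form_matrix_def)
    then show ?case using elim alternating_form_2_bil by blast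
  qed
  then show "\<forall>\<^sub>F z in nhds (snd c p). hc z \<noteq> 0 \<longrightarrow> (\<forall>u v. coord_form A c \<omega> z [u, v] = bil (form_matrix c \<omega> z) u v)"
    by eventually_elim blast
  show "log_closed (form_matrix c \<omega>)"
    unfolding log_closed_def
  proof (intro conjI allI)
    fix i j
    show "\<exists>v\<in>Ogerm (snd c p). \<forall>\<^sub>F z in nhds (snd c p). hc z \<noteq> 0 \<longrightarrow> hc z * form_matrix c \<omega> z $ i $ j = v z"
      by (rule bexI[OF _ a(1)[of "[axis i 1, axis j 1]"]]) (use ha in \<open>auto simp: form_matrix_def elim: eventually_mono\<close>)
    show "\<forall>\<^sub>F z in nhds (snd c p). hc z \<noteq> 0 \<longrightarrow> (\<forall>i j. form_matrix c \<omega> z $ i $ j = - form_matrix c \<omega> z $ j $ i)"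
      using alt unfolding form_matrix_def vec_lambda_beta by eventually_elim blast
    show "\<forall>\<^sub>F z in nhds (snd c p). hc z \<noteq> 0 \<longrightarrow> (\<forall>i j l. FD (\<lambda>z. form_matrix c \<omega> z $ j $ l) z (axis i 1)
        - FD (\<lambda>z. form_matrix c \<omega> z $ i $ l) z (axis j 1) + FD (\<lambda>z. form_matrix c \<omega> z $ i $ j) z (axis l 1) = 0)"
      using form_eq_chart[OF c cl] Dhc eventually_in_chart[OF c]
    proof eventually_elim
      case (elim z)
      show ?case
      proof (intro impI allI)
        fix i j l assume "hc z \<noteq> 0"
        then have "\<forall>vs. length vs = Suc 2 \<longrightarrow> coord_form A c (ext_d A c \<omega>) z vs = 0"
          using elim(1,2) by (simp add: coord_form_def)
        then have "coord_form A c (ext_d A c \<omega>) z [axis i 1, axis j 1, axis l 1] = 0" by simp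
        then show "FD (\<lambda>z. form_matrix c \<omega> z $ j $ l) z (axis i 1)
          - FD (\<lambda>z. form_matrix c \<omega> z $ i $ l) z (axis j 1) + FD (\<lambda>z. form_matrix c \<omega> z $ i $ j) z (axis l 1) = 0"
          unfolding coord_form_ext_d[OF charts_atD(1)[OF c] elim(3)] coord_d_3 by (simp add: form_matrix_def)
      qed
    qed
  qed
qed

end

context atlas
begin

text \<open>The coordinate volume form of the chart \<open>c\<close>. In another chart its
  coefficients are determinants of vectors transformed by the derivative of the transition map,
  hence holomorphic.\<close>

lemma hol_form_det_coords:
  fixes e :: "nat \<Rightarrow> 'n"
  assumes c: "c \<in> charts_at A p" and e: "bij_betw e {..<N} UNIV"
  shows "hol_form A p N (\<lambda>x ts. det (\<chi> i. coords c (ts ! inv_into {..<N} e i)))" (is "hol_form A p N ?\<theta>")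
  unfolding hol_form_def
proof
  fix c1 assume c1: "c1 \<in> charts_at A p"
  define e' where "e' = inv_into {..<N} e"
  have e': "e' k < N" for k
    using e by (auto simp: e'_def bij_betw_def) (metis UNIV_I inv_into_into lessThan_iff)
  let ?T = "\<lambda>z. snd c (chart_inv c1 z)"
  define S where "S = snd c1 ` (fst c1 \<inter> fst c)"
  note c1A = charts_atD(1)[OF c1] and cA = charts_atD(1)[OF c]
  have S: "open S" "hmap ?T S" unfolding S_def by (rule transition[OF c1A cA])+
  have pS: "snd c1 p \<in> S" unfolding S_def by (rule transition_germ(1)[OF c1 c])
  have \<theta>: "coord_form A c1 ?\<theta> z vs = det (\<chi> i. FD ?T z (vs ! e' i))" if z: "z \<in> S" and "length vs = N" for z vs
  proof -
    obtain x where x: "x \<in> fst c1" "x \<in> fst c" "z = snd c1 x" using z by (auto simp: S_def)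
    have "c1 \<in> charts_at A x" "c \<in> charts_at A x" using x c1A cA by (auto simp: charts_at_def)
    then show ?thesis
      using x e' that by (simp add: coord_form_def chart_facts(5)[OF c1A] coords_tangent_change flip: e'_def)
  qed
  show "\<exists>S. open S \<and> snd c1 p \<in> S \<and> (\<forall>z\<in>S. alternating_form N (coord_form A c1 ?\<theta> z)) \<and>
      (\<forall>vs. length vs = N \<longrightarrow> holo_on (\<lambda>z. coord_form A c1 ?\<theta> z vs) S)"
  proof (intro exI[of _ S] conjI ballI allI impI S(1) pS)
    fix z assume z: "z \<in> S"
    have "linear (FD ?T z)" by (rule has_derivative_linear[OF hmap_deriv(3)[OF S(2) z]])
    then have "alternating_form N (\<lambda>vs. det (\<chi> i. FD ?T z (vs ! e' i)))"
      unfolding e'_def by (intro alternating_form_det_rows[OF e] hmap_deriv(4)[OF S(2) z] linear_add)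
    then show "alternating_form N (coord_form A c1 ?\<theta> z)"
      by (rule alternating_form_scale[where s=1]) (simp add: \<theta>[OF z])
  next
    fix vs :: "(complex^'n) list" assume vs: "length vs = N"
    have "holo_on (\<lambda>z. det (\<chi> i. FD ?T z (vs ! e' i))) S"
      using hmap_FD[OF S] by (intro holo_on_det) (simp add: hmap_def)
    then show "holo_on (\<lambda>z. coord_form A c1 ?\<theta> z vs) S"
      by (rule holo_on_cong[OF S(1), rotated]) (simp add: \<theta> vs)
  qed
qed

lemma zero_log_form: "(\<lambda>x ts. 0) \<in> log_forms A D h p k" "ext_d A c (\<lambda>x ts. 0) = (\<lambda>x ts. 0)"
proof -
  have *: "coord_form A c (\<lambda>x ts. 0) = (\<lambda>z vs. 0)" for c :: "('m, 'n) chart" by (simp add: coord_form_def fun_eq_iff)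
  have "hol_form A p k (\<lambda>x ts. 0)" for k
    unfolding hol_form_def * by (intro ballI exI[of _ UNIV]) (simp add: alternating_form_def holo_on_const)
  then have 0: "is_holomorphic A D p k (\<lambda>x ts. 0)" for k
    unfolding is_holomorphic_def form_eq_def by (intro exI[of _ "\<lambda>x ts. 0"]) simp
  show 1: "ext_d A c (\<lambda>x ts. 0) = (\<lambda>x ts. 0)" for c
    by (simp add: ext_d_def * coord_d_def FD_eq[OF has_derivative_const])
  show "(\<lambda>x ts. 0) \<in> log_forms A D h p k"
    using 0 by (simp add: log_forms_def 1 fmult_def)
qed

text \<open>A class is the set of cohomologous forms, so an equality of classes has to be turned
  into a relation: \<open>\<omega>1\<close> lies in its own class because 0 is exact, hence in the
  class of \<open>\<omega>0\<close>.\<close>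

lemma same_class_exact:
  assumes \<omega>: "\<omega>1 \<in> closed_log_forms A D h p 2"
    and eq: "log_de_rham_class A D h p 2 \<omega>0 = log_de_rham_class A D h p 2 \<omega>1"
  obtains \<eta> where "\<eta> \<in> log_forms A D h p 1"
    "\<And>c. c \<in> charts_at A p \<Longrightarrow> form_eq A D p 2 (\<lambda>x ts. \<omega>1 x ts - \<omega>0 x ts) (ext_d A c \<eta>)"
proof -
  have ex: "exact_log_forms A D h p 2 =
      {\<omega>. \<exists>\<eta>\<in>log_forms A D h p 1. \<forall>c\<in>charts_at A p. form_eq A D p 2 \<omega> (ext_d A c \<eta>)}"
    by (simp add: exact_log_forms_def numeral_2_eq_2)
  have "(\<lambda>x ts. 0) \<in> exact_log_forms A D h p 2"
    unfolding ex by (intro CollectI bexI[OF _ zero_log_form(1)]) (simp add: zero_log_form(2) form_eq_def)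
  then have "\<omega>1 \<in> log_de_rham_class A D h p 2 \<omega>1"
    using \<omega> by (simp add: log_de_rham_class_def log_cohomologous_def)
  then have "(\<lambda>x ts. \<omega>1 x ts - \<omega>0 x ts) \<in> exact_log_forms A D h p 2"
    unfolding eq[symmetric] by (simp add: log_de_rham_class_def log_cohomologous_def)
  then show thesis using that unfolding ex by blast
qed

end

context log_chart
begin

text \<open>On the coordinate basis, \<open>h\<close> times the top power extends to a germ
  \<open>v\<close>, which is \<open>h\<close> times the Pfaffian up to a constant. As the top power
  generates the forms with simple pole, \<open>v\<close> is a unit; its square is
  \<open>h\<^sup>2 * det\<close> up to the constant \<open>\<kappa>\<close>.\<close>

lemma log_symplectic_det:
  assumes n: "CARD('n) = 2 * n" and \<omega>: "log_symplectic A D h p n \<omega>"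
  obtains q where "q \<in> Ogerm (snd c p)" "q (snd c p) \<noteq> 0"
    "\<forall>\<^sub>F z in nhds (snd c p). hc z \<noteq> 0 \<longrightarrow> (hc z)\<^sup>2 * det (form_matrix c \<omega> z) = q z"
proof -
  let ?W = "form_matrix c \<omega>" and ?z0 = "snd c p"
  let ?wp = "\<lambda>z. wpow (\<lambda>us. bil (?W z) (us ! 0) (us ! 1)) n"
  have cl: "\<omega> \<in> closed_log_forms A D h p 2" and pole: "wedge_power \<omega> n \<in> pole_forms A D h p (2 * n)"
    and gen: "\<And>\<eta>. \<eta> \<in> pole_forms A D h p (2 * n) \<Longrightarrow>
       \<exists>g\<in>hol_germ A p. form_eq A D p (2 * n) \<eta> (fmult g (wedge_power \<omega> n))"
    using \<omega> by (auto simp: log_symplectic_def)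
  obtain e0 :: "nat \<Rightarrow> 'n" where "bij_betw e0 {0..<CARD('n)} UNIV" using ex_bij_betw_nat_finite[OF finite] by blast
  then obtain e :: "nat \<Rightarrow> 'n" where e: "bij_betw e {..<2*n} UNIV" by (simp add: n atLeast0LessThan)
  define es where "es = map (\<lambda>i. axis (e i) (1::complex)) [0..<2*n]"
  have len: "length es = 2 * n" by (simp add: es_def)
  have wp: "\<forall>\<^sub>F z in nhds ?z0. hc z \<noteq> 0 \<longrightarrow>
     (\<forall>vs. length vs = 2 * n \<longrightarrow> coord_form A c (wedge_power \<omega> n) z vs = ?wp z vs)"
    using closed_log_form_chart(2)[OF cl]
  proof eventually_elim
    case (elim z)
    show ?case
    proof (intro impI allI)
      fix vs :: "(complex^'n) list" assume hz: "hc z \<noteq> 0" and l: "length vs = 2 * n"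
      have "coord_form A c (wedge_power \<omega> n) z vs = wpow (coord_form A c \<omega> z) n vs"
        by (simp add: coord_form_def[abs_def] wedge_power_wpow wpow_map[OF l])
      also have "\<dots> = ?wp z vs"
      proof (rule wpow_cong[OF l])
        fix us :: "(complex^'n) list" assume "length us = 2"
        then obtain a b where "us = [a, b]" by (auto simp: numeral_2_eq_2 length_Suc_conv)
        then show "coord_form A c \<omega> z us = bil (?W z) (us ! 0) (us ! 1)" using elim hz by simp
      qed
      finally show "coord_form A c (wedge_power \<omega> n) z vs = ?wp z vs" .
    qed
  qed
  obtain a where a: "\<And>vs. length vs = 2 * n \<Longrightarrow> (\<lambda>z. a z vs) \<in> Ogerm ?z0"
    "\<forall>\<^sub>F z in nhds ?z0. alternating_form (2 * n) (a z)"
    "\<forall>\<^sub>F z in nhds ?z0. chart_inv c z \<notin> D \<longrightarrow>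
      (\<forall>vs. length vs = 2 * n \<longrightarrow> coord_form A c (fmult h (wedge_power \<omega> n)) z vs = a z vs)"
    using is_holomorphic_chart[OF c, of D "2 * n" "fmult h (wedge_power \<omega> n)"] pole
    unfolding pole_forms_def mem_Collect_eq by blast
  have ha: "\<forall>\<^sub>F z in nhds ?z0. hc z \<noteq> 0 \<longrightarrow> (\<forall>vs. length vs = 2 * n \<longrightarrow> hc z * ?wp z vs = a z vs)"
    using a(3) Dhc wp by eventually_elim (auto simp: coord_form_def fmult_def)
  \<comment> \<open>That the top power is alternating, as \<open>pf_square\<close> requires, is read
    off from the holomorphic form \<open>h \<omega>^n\<close>.\<close>
  have alt: "\<forall>\<^sub>F z in nhds ?z0. hc z \<noteq> 0 \<longrightarrow> alternating_form (2 * n) (?wp z)"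
    using ha a(2)
  proof eventually_elim
    case (elim z)
    show ?case
    proof
      assume hz: "hc z \<noteq> 0"
      show "alternating_form (2 * n) (?wp z)"
      proof (rule alternating_form_scale[OF elim(2)])
        fix vs :: "(complex^'n) list" assume "length vs = 2 * n"
        then have "a z vs = hc z * ?wp z vs" using elim(1) hz by simp
        then show "?wp z vs = inverse (hc z) * a z vs" using hz by simp
      qed
    qed
  qed
  obtain \<kappa> where \<kappa>: "\<And>W. \<lbrakk>\<And>i j. W $ i $ j = - W $ j $ i;
      alternating_form (2*n) (wpow (\<lambda>us. bil W (us ! 0) (us ! 1)) n)\<rbrakk> \<Longrightarrow> (pf e n W)\<^sup>2 = \<kappa> * det W"
  proof (rule pf_square[OF n e])
    fix \<kappa> assume "\<And>W. \<lbrakk>\<And>i j. W $ i $ j = - W $ j $ i;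
      alternating_form (2*n) (wpow (\<lambda>us. bil W (us ! 0) (us ! 1)) n)\<rbrakk> \<Longrightarrow> (pf e n W)\<^sup>2 = \<kappa> * det W"
    then show thesis by (rule that[of \<kappa>])
  qed
  have anti: "\<forall>\<^sub>F z in nhds ?z0. hc z \<noteq> 0 \<longrightarrow> (\<forall>i j. ?W z $ i $ j = - ?W z $ j $ i)"
    using closed_log_form_chart(1)[OF cl] by (simp add: log_closed_def)
  define v where "v z = a z es" for z
  have v: "v \<in> Ogerm ?z0" unfolding v_def[abs_def] by (rule a(1)[OF len])
  have hpf: "\<forall>\<^sub>F z in nhds ?z0. hc z \<noteq> 0 \<longrightarrow> hc z * pf e n (?W z) = v z"
    using ha by eventually_elim (use len in \<open>simp add: pf_def v_def flip: es_def\<close>)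
  \<comment> \<open>The generator property is tested on \<open>1/h\<close> times the coordinate
    volume form: its value \<open>1/h\<close> on the coordinate basis forces
    \<open>g * v = 1\<close>.\<close>
  define \<theta> :: "'m dform" where "\<theta> = (\<lambda>x ts. det (\<chi> i. coords c (ts ! inv_into {..<2*n} e i)))"
  define \<eta> where "\<eta> = fmult (\<lambda>x. inverse (h x)) \<theta>"
  have "is_holomorphic A D p (2 * n) (fmult h \<eta>)"
    unfolding is_holomorphic_def
  proof (intro exI conjI)
    show "hol_form A p (2 * n) \<theta>" unfolding \<theta>_def by (rule hol_form_det_coords[OF c e])
    show "form_eq A D p (2 * n) (fmult h \<eta>) \<theta>"
      unfolding form_eq_def using Dh by eventually_elim (simp add: fmult_def \<eta>_def)
  qed
  then obtain g where g: "g \<in> hol_germ A p" "form_eq A D p (2 * n) \<eta> (fmult g (wedge_power \<omega> n))"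
    using gen by (auto simp: pole_forms_def)
  let ?g = "\<lambda>z. g (chart_inv c z)"
  have gO: "?g \<in> Ogerm ?z0" using g(1) hol_germ_iff[OF c] by simp
  have "\<forall>\<^sub>F z in nhds ?z0. hc z \<noteq> 0 \<longrightarrow> ?g z * v z = 1"
    using form_eq_chart[OF c g(2)] Dhc wp hpf eventually_in_chart[OF c]
  proof eventually_elim
    case (elim z)
    show ?case
    proof
      assume hz: "hc z \<noteq> 0"
      have "coord_form A c \<theta> z es = det (mat 1 :: complex^'n^'n)"
      proof -
        have "coords c (map (tangent A c (chart_inv c z)) es ! inv_into {..<2*n} e i) = axis i 1" for i
        proof -
          have "inv_into {..<2*n} e i < 2 * n" "e (inv_into {..<2*n} e i) = i"
            using e by (auto simp: bij_betw_def f_inv_into_f) (metis UNIV_I inv_into_into lessThan_iff)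
          then show ?thesis
            using coords_tangent[OF chart_inv_charts_at[OF charts_atD(1)[OF c] elim(5)]] by (simp add: es_def)
        qed
        then have "coord_form A c \<theta> z es = det (\<chi> i. (axis i 1 :: complex^'n))"
          unfolding coord_form_def \<theta>_def by simp
        also have "(\<chi> i. (axis i 1 :: complex^'n)) = mat 1" by (simp add: vec_eq_iff mat_def axis_def)
        finally show ?thesis .
      qed
      moreover have "coord_form A c \<eta> z es = coord_form A c (fmult g (wedge_power \<omega> n)) z es"
        using elim(1,2) hz len by blast
      ultimately have "inverse (hc z) = ?g z * pf e n (?W z)"
        using elim(3) hz len by (simp add: coord_form_def \<eta>_def fmult_def pf_def flip: es_def)
      then have "1 = ?g z * (hc z * pf e n (?W z))" using hz by (simp add: field_simps)
      then show "?g z * v z = 1" using elim(4) hz by simp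
    qed
  qed
  from germ_eq_off_zeros[OF hO h_nz Ogerm_mult[OF gO v] Ogerm_const this]
  have v0: "v ?z0 \<noteq> 0" using eventually_nhds_x_imp_x by fastforce
  have sq: "\<forall>\<^sub>F z in nhds ?z0. hc z \<noteq> 0 \<longrightarrow> (v z)\<^sup>2 = \<kappa> * ((hc z)\<^sup>2 * det (?W z))"
    using hpf anti alt
  proof eventually_elim
    case (elim z)
    show ?case
    proof
      assume hz: "hc z \<noteq> 0"
      have "(pf e n (?W z))\<^sup>2 = \<kappa> * det (?W z)" by (rule \<kappa>) (use elim hz in blast)+
      moreover have "v z = hc z * pf e n (?W z)" using elim(1) hz by simp
      ultimately show "(v z)\<^sup>2 = \<kappa> * ((hc z)\<^sup>2 * det (?W z))" by (simp add: power_mult_distrib)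
    qed
  qed
  \<comment> \<open>Otherwise \<open>v\<close> would vanish off \<open>D\<close>, hence as a germ,
    although it is a unit.\<close>
  have "\<kappa> \<noteq> 0"
  proof
    assume "\<kappa> = 0"
    then have "\<forall>\<^sub>F z in nhds ?z0. hc z \<noteq> 0 \<longrightarrow> v z = 0" using sq by simp
    from germ_eq_off_zeros[OF hO h_nz v Ogerm_const this] v0 show False
      using eventually_nhds_x_imp_x by fastforce
  qed
  show thesis
  proof (rule that[of "\<lambda>z. inverse \<kappa> * (v z)\<^sup>2"])
    show "(\<lambda>z. inverse \<kappa> * (v z)\<^sup>2) \<in> Ogerm ?z0" by (intro Ogerm_intros v)
    show "inverse \<kappa> * (v ?z0)\<^sup>2 \<noteq> 0" using v0 \<open>\<kappa> \<noteq> 0\<close> by simp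
    show "\<forall>\<^sub>F z in nhds ?z0. hc z \<noteq> 0 \<longrightarrow> (hc z)\<^sup>2 * det (?W z) = inverse \<kappa> * (v z)\<^sup>2"
      using sq by eventually_elim (use \<open>\<kappa> \<noteq> 0\<close> in simp)
  qed
qed

lemma eventually_FD_cong_off:
  assumes "\<forall>\<^sub>F z in nhds (snd c p). hc z \<noteq> 0 \<longrightarrow> f z = g z"
  shows "\<forall>\<^sub>F z in nhds (snd c p). hc z \<noteq> 0 \<longrightarrow> FD f z = FD g z"
proof -
  obtain r where r: "r > 0" "holo_on hc (ball (snd c p) r)" "\<And>z. z \<in> ball (snd c p) r \<Longrightarrow> hc z \<noteq> 0 \<longrightarrow> f z = g z"
    by (rule Ogerm_ballE[OF hO assms]) (rule that)
  have "open (ball (snd c p) r \<inter> hc -` (- {0}))"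
    by (rule continuous_open_preimage[OF holo_on_continuous[OF r(2)]]) auto
  then have "FD f z = FD g z" if "z \<in> ball (snd c p) r" "hc z \<noteq> 0" for z
    by (rule FD_cong) (use that r(3) in auto)
  then show ?thesis unfolding eventually_nhds using r(1) by (intro exI[of _ "ball (snd c p) r"]) auto
qed

lemma log_exact_chart:
  assumes gen: "generated_by_log_differentials A D h p fs"
    and \<omega>: "\<omega>1 \<in> closed_log_forms A D h p 2"
    and eq: "log_de_rham_class A D h p 2 \<omega>0 = log_de_rham_class A D h p 2 \<omega>1"
  obtains g \<theta> where "\<And>k. k < length fs \<Longrightarrow> g k \<in> Ogerm (snd c p)" "\<And>j :: 'n. \<theta> j \<in> Ogerm (snd c p)"
    "\<forall>\<^sub>F z in nhds (snd c p). hc z \<noteq> 0 \<longrightarrow> (\<forall>i j. form_matrix c \<omega>1 z $ i $ j - form_matrix c \<omega>0 z $ i $ j =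
      FD (\<lambda>z. (\<Sum>k<length fs. g k z * (inverse ((fs ! k) (chart_inv c z)) *
          FD (\<lambda>z. (fs ! k) (chart_inv c z)) z (axis j 1))) + \<theta> j z) z (axis i 1) -
      FD (\<lambda>z. (\<Sum>k<length fs. g k z * (inverse ((fs ! k) (chart_inv c z)) *
          FD (\<lambda>z. (fs ! k) (chart_inv c z)) z (axis i 1))) + \<theta> i z) z (axis j 1))"
proof -
  let ?z0 = "snd c p"
  obtain \<eta> where \<eta>: "\<eta> \<in> log_forms A D h p 1"
    "form_eq A D p 2 (\<lambda>x ts. \<omega>1 x ts - \<omega>0 x ts) (ext_d A c \<eta>)"
    using same_class_exact[OF \<omega> eq] c by blast
  obtain g \<theta> where g: "\<And>k. k < length fs \<Longrightarrow> g k \<in> hol_germ A p" and \<theta>: "hol_form A p 1 \<theta>"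
    and \<eta>g: "form_eq A D p 1 \<eta> (\<lambda>x ts. (\<Sum>k<length fs. fmult (g k) (dlog (fs ! k)) x ts) + \<theta> x ts)"
    using gen \<eta>(1) unfolding generated_by_log_differentials_def by blast
  \<comment> \<open>The coefficients of the generated expression in the chart. They agree with those
    of \<open>\<eta>\<close> on the open complement of \<open>D\<close> near \<open>p\<close>, so
    the derivatives agree there as well.\<close>
  define R where "R j z = (\<Sum>k<length fs. g k (chart_inv c z) * (inverse ((fs ! k) (chart_inv c z)) *
          FD (\<lambda>z. (fs ! k) (chart_inv c z)) z (axis j 1))) + coord_form A c \<theta> z [axis j 1]" for j z
  have "\<forall>k\<in>{..<length fs}. \<forall>\<^sub>F z in nhds ?z0. fs ! k \<in> hol_germ A (chart_inv c z)"
  proof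
    fix k assume "k \<in> {..<length fs}"
    then show "\<forall>\<^sub>F z in nhds ?z0. fs ! k \<in> hol_germ A (chart_inv c z)"
      using fsO[of k] by (intro hol_germ_near[OF c]) (simp add: hol_germ_iff[OF c])
  qed
  then have near: "\<forall>\<^sub>F z in nhds ?z0. \<forall>k\<in>{..<length fs}. fs ! k \<in> hol_germ A (chart_inv c z)"
    by (rule eventually_ball_finite[OF finite_lessThan])
  have ER: "\<forall>\<^sub>F z in nhds ?z0. hc z \<noteq> 0 \<longrightarrow> coord_form A c \<eta> z [axis j 1] = R j z" for j
    using form_eq_chart[OF c \<eta>g] near Dhc eventually_in_chart[OF c]
  proof eventually_elim
    case (elim z)
    show ?case
    proof
      assume "hc z \<noteq> 0"
      then have "coord_form A c \<eta> z [axis j 1] =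
          coord_form A c (\<lambda>x ts. (\<Sum>k<length fs. fmult (g k) (dlog (fs ! k)) x ts) + \<theta> x ts) z [axis j 1]"
        using elim(1,3) by (simp del: One_nat_def)
      also have "\<dots> = R j z"
        unfolding R_def using elim(2)
        by (simp add: coord_form_def fmult_def dlog_def differential_def tangent_apply chart_facts(6)[OF charts_atD(1)[OF c] elim(4)])
      finally show "coord_form A c \<eta> z [axis j 1] = R j z" .
    qed
  qed
  have "\<forall>\<^sub>F z in nhds ?z0. \<forall>j\<in>UNIV. hc z \<noteq> 0 \<longrightarrow> FD (\<lambda>z. coord_form A c \<eta> z [axis j 1]) z = FD (R j) z"
    by (rule eventually_ball_finite[OF finite]) (use eventually_FD_cong_off[OF ER] in blast)
  then have "\<forall>\<^sub>F z in nhds ?z0. hc z \<noteq> 0 \<longrightarrow> (\<forall>i j. form_matrix c \<omega>1 z $ i $ j - form_matrix c \<omega>0 z $ i $ j =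
      FD (R j) z (axis i 1) - FD (R i) z (axis j 1))"
    using form_eq_chart[OF c \<eta>(2)] Dhc eventually_in_chart[OF c]
  proof eventually_elim
    case (elim z)
    show ?case
    proof (intro impI allI)
      fix i j assume hz: "hc z \<noteq> 0"
      then have "\<forall>vs. length vs = 2 \<longrightarrow> coord_form A c (\<lambda>x ts. \<omega>1 x ts - \<omega>0 x ts) z vs = coord_form A c (ext_d A c \<eta>) z vs"
        using elim(2,3) by blast
      then have "coord_form A c (\<lambda>x ts. \<omega>1 x ts - \<omega>0 x ts) z [axis i 1, axis j 1] = coord_form A c (ext_d A c \<eta>) z [axis i 1, axis j 1]"
        by simp
      also have "\<dots> = FD (R j) z (axis i 1) - FD (R i) z (axis j 1)"
        unfolding coord_form_ext_d[OF charts_atD(1)[OF c] elim(4)] coord_d_2 using elim(1) hz by simp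
      finally show "form_matrix c \<omega>1 z $ i $ j - form_matrix c \<omega>0 z $ i $ j = FD (R j) z (axis i 1) - FD (R i) z (axis j 1)"
        by (simp add: form_matrix_def coord_form_def)
    qed
  qed
  moreover have "(\<lambda>z. coord_form A c \<theta> z [axis j 1]) \<in> Ogerm ?z0" for j
    using \<theta> c unfolding hol_form_def Ogerm_def by fastforce
  moreover have "(\<lambda>z. g k (chart_inv c z)) \<in> Ogerm ?z0" if "k < length fs" for k
    using g[OF that] hol_germ_iff[OF c] by simp
  ultimately show thesis
    using that[of "\<lambda>k z. g k (chart_inv c z)" "\<lambda>j z. coord_form A c \<theta> z [axis j 1]"] unfolding R_def[abs_def] by blast
qed

end

section \<open>The isotopy on the manifold\<close>

lemma time_tube:
  fixes z0 :: "complex^'n::finite"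
  assumes \<Omega>: "open \<Omega>" and z0: "\<And>t. t \<in> {0..1} \<Longrightarrow> pt (complex_of_real t) z0 \<in> \<Omega>"
  obtains d where "d > 0" "\<And>t z. t \<in> {0..1} \<Longrightarrow> z \<in> ball z0 d \<Longrightarrow> pt (complex_of_real t) z \<in> \<Omega>"
proof -
  let ?K = "(\<lambda>t. pt (complex_of_real t) z0) ` {0..1}"
  have "compact ?K" by (intro compact_continuous_image continuous_intros) auto
  moreover have "?K \<subseteq> \<Omega>" using z0 by blast
  ultimately obtain d where d: "d > 0" "(\<Union>x\<in>?K. ball x d) \<subseteq> \<Omega>"
    using compact_subset_open_imp_ball_epsilon_subset[OF _ \<Omega>] by blast
  show thesis
  proof (rule that[OF d(1)])
    fix t :: real and z assume "t \<in> {0..1}" "z \<in> ball z0 d"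
    then have "pt (complex_of_real t) z \<in> ball (pt (complex_of_real t) z0) d"
      using dist_pt[of "complex_of_real t" z0 "complex_of_real t" z] by simp
    with d(2) \<open>t \<in> {0..1}\<close> show "pt (complex_of_real t) z \<in> \<Omega>" by blast
  qed
qed

lemma eventually_hmap:
  assumes f: "open S" "z \<in> S" "hmap f S" and P: "\<forall>\<^sub>F w in nhds (f z). P w"
  shows "\<forall>\<^sub>F w in nhds z. P (f w)"
proof -
  obtain T where T: "open T" "f z \<in> T" "\<forall>w\<in>T. P w" using P by (auto simp: eventually_nhds)
  have "open (S \<inter> f -` T)" by (rule continuous_open_preimage[OF hmap_continuous[OF f(3)] f(1) T(1)])
  then show ?thesis unfolding eventually_nhds using f(2) T by (intro exI[of _ "S \<inter> f -` T"]) auto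
qed

context atlas
begin

text \<open>In an arbitrary chart \<open>c'\<close> the family is a holomorphic map of complex time
  and space, restricted to real times, which gives joint smoothness up to the end points of the
  interval. The sets \<open>O1\<close>, \<open>O2\<close>, \<open>O3\<close> are the successive
  domains of the composition.\<close>

lemma smooth_family_flow:
  assumes c: "c \<in> charts_at A p" and \<phi>: "open \<Omega>" "hmap \<phi> \<Omega>"
    and p: "\<And>t. t \<in> {0..1} \<Longrightarrow> pt (complex_of_real t) (snd c p) \<in> \<Omega>"
      "\<And>t. t \<in> {0..1} \<Longrightarrow> \<phi> (pt (complex_of_real t) (snd c p)) = snd c p"
  shows "smooth_family A p (\<lambda>t x. chart_inv c (\<phi> (pt (complex_of_real t) (snd c x))))"
  unfolding smooth_family_def
proof
  fix c' assume c': "c' \<in> charts_at A p"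
  note cA = charts_atD(1)[OF c] and c'A = charts_atD(1)[OF c']
  note t1 = transition[OF c'A cA] and t2 = transition[OF cA c'A]
  let ?S1 = "snd c' ` (fst c' \<inter> fst c)" and ?S2 = "snd c ` (fst c \<inter> fst c')"
  define f1 where "f1 w = pt (w $ None) (snd c (chart_inv c' (sp w)))" for w :: "complex^('n option)"
  define O1 where "O1 = (sp -` ?S1 :: (complex^('n option)) set)"
  have O1: "open O1" unfolding O1_def
    using continuous_open_preimage[OF hmap_continuous[OF hmap_sp[of UNIV]] open_UNIV t1(1)] by simp
  have f1: "hmap f1 O1" unfolding f1_def[abs_def] O1_def
    by (intro hmap_pt holo_on_coord hmap_compose(1)[OF t1(2) hmap_sp]) auto
  define O2 where "O2 = O1 \<inter> f1 -` \<Omega>"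
  have O2: "open O2" unfolding O2_def by (rule continuous_open_preimage[OF hmap_continuous[OF f1] O1 \<phi>(1)])
  have f2: "hmap (\<lambda>w. \<phi> (f1 w)) O2"
    by (rule hmap_compose(1)[OF \<phi>(2) hmap_subset[OF f1]]) (auto simp: O2_def)
  define O3 where "O3 = O2 \<inter> (\<lambda>w. \<phi> (f1 w)) -` ?S2"
  have O3: "open O3" unfolding O3_def by (rule continuous_open_preimage[OF hmap_continuous[OF f2] O2 t2(1)])
  have f3: "hmap (\<lambda>w. snd c' (chart_inv c (\<phi> (f1 w)))) O3"
    by (rule hmap_compose(1)[OF t2(2) hmap_subset[OF f2]]) (auto simp: O3_def)
  have f1p: "f1 (pt (complex_of_real t) (snd c' p)) = pt (complex_of_real t) (snd c p)" for t
    using chart_facts(5)[OF charts_atD[OF c']] by (simp add: f1_def)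
  have in3: "pt (complex_of_real t) (snd c' p) \<in> O3" if "t \<in> {0..1}" for t
    using transition_germ(1)[OF c' c] transition_germ(1)[OF c c'] p[OF that]
    by (simp add: O3_def O2_def O1_def f1p del: image_Int)
  obtain d where d: "d > 0" "\<And>t z. t \<in> {0..1} \<Longrightarrow> z \<in> ball (snd c' p) d \<Longrightarrow> pt (complex_of_real t) z \<in> O3"
    by (rule time_tube[OF O3 in3]) (assumption, rule that)
  let ?W = "ball (snd c' p) d" and ?\<Phi> = "\<lambda>t x. chart_inv c (\<phi> (pt (complex_of_real t) (snd c x)))"
  show "\<exists>W. open W \<and> snd c' p \<in> W \<and> W \<subseteq> snd c' ` fst c' \<and>
      (\<forall>t\<in>{0..1}. \<forall>z\<in>W. ?\<Phi> t (chart_inv c' z) \<in> fst c') \<and>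
      smooth_on (\<lambda>(t, z). snd c' (?\<Phi> t (chart_inv c' z))) ({0..1} \<times> W)"
  proof (intro exI[of _ ?W] conjI ballI)
    show "?W \<subseteq> snd c' ` fst c'"
    proof
      fix z assume "z \<in> ?W"
      then have "pt (complex_of_real 0) z \<in> O3" by (intro d(2)) auto
      then show "z \<in> snd c' ` fst c'" by (auto simp: O3_def O2_def O1_def)
    qed
    fix t :: real and z assume "t \<in> {0..1}" "z \<in> ?W"
    then have "\<phi> (pt (complex_of_real t) (snd c (chart_inv c' z))) \<in> ?S2"
      using d(2)[of t z] by (simp add: O3_def f1_def del: image_Int)
    then show "?\<Phi> t (chart_inv c' z) \<in> fst c'" using chart_facts(5)[OF cA] by auto
  next
    show "smooth_on (\<lambda>(t, z). snd c' (?\<Phi> t (chart_inv c' z))) ({0..1} \<times> ?W)"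
      by (rule smooth_on_hmap[OF O3 bounded_linear_pt_real f3]) (use d(2) in \<open>auto simp: f1_def\<close>)
  qed (use d(1) in auto)
qed

lemma chart_map_inverse:
  assumes c: "c \<in> charts_at A p" and f: "open S" "snd c p \<in> S" "hmap f S" "f (snd c p) = snd c p"
    and gf: "\<forall>\<^sub>F z in nhds (snd c p). g (f z) = z"
  shows "\<forall>\<^sub>F x in nhds p. chart_inv c (g (snd c (chart_inv c (f (snd c x))))) = x"
  unfolding eventually_chart[OF c]
  using eventually_in_chart[OF c] gf
    eventually_hmap[OF f(1-3), of "\<lambda>w. w \<in> snd c ` fst c", unfolded f(4), OF eventually_in_chart[OF c]]
  by eventually_elim (simp add: chart_facts(6)[OF charts_atD(1)[OF c]])

end

theorem (in log_chart) log_symplectic_isotopy: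
  assumes n: "CARD('n) = 2 * n" and gen: "generated_by_log_differentials A D h p fs"
    and \<omega>: "log_symplectic A D h p n \<omega>0" "log_symplectic A D h p n \<omega>1"
    and eq: "log_de_rham_class A D h p 2 \<omega>0 = log_de_rham_class A D h p 2 \<omega>1"
  shows "isotopic A D p \<omega>0 \<omega>1"
proof -
  let ?z0 = "snd c p"
  have cl: "\<omega>0 \<in> closed_log_forms A D h p 2" "\<omega>1 \<in> closed_log_forms A D h p 2"
    using \<omega> by (auto simp: log_symplectic_def)
  obtain q0 where q0: "q0 \<in> Ogerm ?z0" "q0 ?z0 \<noteq> 0"
    "\<forall>\<^sub>F z in nhds ?z0. hc z \<noteq> 0 \<longrightarrow> (hc z)\<^sup>2 * det (form_matrix c \<omega>0 z) = q0 z"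
    by (rule log_symplectic_det[OF n \<omega>(1)]) (rule that)
  obtain q1 where q1: "q1 \<in> Ogerm ?z0" "q1 ?z0 \<noteq> 0"
    "\<forall>\<^sub>F z in nhds ?z0. hc z \<noteq> 0 \<longrightarrow> (hc z)\<^sup>2 * det (form_matrix c \<omega>1 z) = q1 z"
    by (rule log_symplectic_det[OF n \<omega>(2)]) (rule that)
  obtain g \<theta> where g: "\<And>k. k < length fs \<Longrightarrow> g k \<in> Ogerm ?z0" and \<theta>: "\<And>j :: 'n. \<theta> j \<in> Ogerm ?z0" and
    d\<eta>: "\<forall>\<^sub>F z in nhds ?z0. hc z \<noteq> 0 \<longrightarrow> (\<forall>i j. form_matrix c \<omega>1 z $ i $ j - form_matrix c \<omega>0 z $ i $ j =
      FD (\<lambda>z. (\<Sum>k<length fs. g k z * (inverse ((fs ! k) (chart_inv c z)) *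
          FD (\<lambda>z. (fs ! k) (chart_inv c z)) z (axis j 1))) + \<theta> j z) z (axis i 1) -
      FD (\<lambda>z. (\<Sum>k<length fs. g k z * (inverse ((fs ! k) (chart_inv c z)) *
          FD (\<lambda>z. (fs ! k) (chart_inv c z)) z (axis i 1))) + \<theta> i z) z (axis j 1))"
    by (rule log_exact_chart[OF gen cl(2) eq]) (rule that)
  obtain \<Omega> \<phi> \<rho> where \<Omega>: "open \<Omega>" "\<rho> > 0" "hmap \<phi> \<Omega>"
    "\<And>t z. t \<in> {0..1} \<Longrightarrow> z \<in> ball ?z0 \<rho> \<Longrightarrow> pt (complex_of_real t) z \<in> \<Omega>"
    and \<phi>0: "\<And>t. t \<in> {0..1} \<Longrightarrow> \<phi> (pt (complex_of_real t) ?z0) = ?z0"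
    and id: "\<And>z. z \<in> ball ?z0 \<rho> \<Longrightarrow> \<phi> (pt 0 z) = z"
    and inv: "\<And>t. t \<in> {0..1} \<Longrightarrow> \<exists>G r. r > 0 \<and> hmap G (ball ?z0 r) \<and> G ?z0 = ?z0 \<and>
       (\<forall>z\<in>ball ?z0 r. G (\<phi> (pt (complex_of_real t) z)) = z \<and> \<phi> (pt (complex_of_real t) (G z)) = z)"
    and pres: "\<And>t z. t \<in> {0..1} \<Longrightarrow> z \<in> ball ?z0 \<rho> \<Longrightarrow> hc (\<phi> (pt (complex_of_real t) z)) = 0 \<longleftrightarrow> hc z = 0"
    and pull: "\<And>z u v. z \<in> ball ?z0 \<rho> \<Longrightarrow> hc z \<noteq> 0 \<Longrightarrow>
       bil (form_matrix c \<omega>1 (\<phi> (pt 1 z))) (FD \<phi> (pt 1 z) (pt 0 u)) (FD \<phi> (pt 1 z) (pt 0 v)) = bil (form_matrix c \<omega>0 z) u v"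
    by (rule moser_isotopy[OF closed_log_form_chart(1)[OF cl(1)] closed_log_form_chart(1)[OF cl(2)] q0 q1, of g \<theta>])
      (use g \<theta> d\<eta> in \<open>simp_all\<close>)
  note cA = charts_atD(1)[OF c]
  define \<Phi> where "\<Phi> t x = chart_inv c (\<phi> (pt (complex_of_real t) (snd c x)))" for t x
  have \<Omega>0: "pt (complex_of_real t) ?z0 \<in> \<Omega>" if "t \<in> {0..1}" for t using \<Omega>(4)[OF that] \<Omega>(2) by simp
  have \<kappa>0: "chart_inv c ?z0 = p" by (rule chart_facts(5)[OF charts_atD[OF c]])
  define S where "S t = (\<lambda>z. pt (complex_of_real t) z) -` \<Omega>" for t
  have S: "open (S t)" "hmap (\<lambda>z. \<phi> (pt (complex_of_real t) z)) (S t)" for t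
    unfolding S_def
    using continuous_open_preimage[OF hmap_continuous[OF hmap_pt_space[of "complex_of_real t" UNIV]] open_UNIV \<Omega>(1)]
    by (auto intro: hmap_compose(1)[OF \<Omega>(3) hmap_pt_space])
  have S0: "?z0 \<in> S t" if "t \<in> {0..1}" for t using \<Omega>0[OF that] by (simp add: S_def)
  \<comment> \<open>The maps of the flow fix the base point, so properties that hold near it can be
    pulled back along them.\<close>
  have near: "\<forall>\<^sub>F z in nhds ?z0. P (\<phi> (pt (complex_of_real t) z))" if "t \<in> {0..1}" "\<forall>\<^sub>F z in nhds ?z0. P z" for t P
    by (rule eventually_hmap[OF S(1) S0[OF that(1)] S(2)]) (simp only: \<phi>0[OF that(1)] that(2))
  have ball: "\<forall>\<^sub>F z in nhds ?z0. z \<in> ball ?z0 \<rho>" using \<Omega>(2) by (intro eventually_nhds_in_open) auto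
  show ?thesis
    unfolding isotopic_def
  proof (intro exI[of _ \<Phi>] conjI ballI)
    show "smooth_family A p \<Phi>"
      unfolding \<Phi>_def[abs_def] by (rule smooth_family_flow[OF c \<Omega>(1,3) \<Omega>0 \<phi>0])
  next
    fix t :: real assume t: "t \<in> {0..1}"
    obtain G r where G: "r > 0" "hmap G (ball ?z0 r)" "G ?z0 = ?z0"
      "\<And>z. z \<in> ball ?z0 r \<Longrightarrow> G (\<phi> (pt (complex_of_real t) z)) = z"
      "\<And>z. z \<in> ball ?z0 r \<Longrightarrow> \<phi> (pt (complex_of_real t) (G z)) = z"
      using inv[OF t] by blast
    have r: "open (ball ?z0 r)" "?z0 \<in> ball ?z0 r" "\<forall>\<^sub>F z in nhds ?z0. z \<in> ball ?z0 r"
      using G(1) by (simp, simp, intro eventually_nhds_in_open, simp_all)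
    show "biholo_aut_germ A p (\<Phi> t)"
      unfolding biholo_aut_germ_def
    proof (intro conjI exI[of _ "\<lambda>x. chart_inv c (G (snd c x))"])
      show "\<Phi> t p = p" by (simp add: \<Phi>_def \<phi>0[OF t] \<kappa>0)
      show "hol_map_germ A p (\<Phi> t)"
        unfolding \<Phi>_def[abs_def] by (rule local_map[OF c S(1) S0[OF t] S(2) \<phi>0[OF t]])
      show "chart_inv c (G (snd c p)) = p" by (simp add: G(3) \<kappa>0)
      show "hol_map_germ A p (\<lambda>x. chart_inv c (G (snd c x)))" by (rule local_map[OF c r(1,2) G(2,3)])
      show "\<forall>\<^sub>F x in nhds p. chart_inv c (G (snd c (\<Phi> t x))) = x"
        unfolding \<Phi>_def
        by (rule chart_map_inverse[OF c S(1) S0[OF t] S(2) \<phi>0[OF t]]) (use r(3) G(4) in \<open>auto elim: eventually_mono\<close>)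
      show "\<forall>\<^sub>F x in nhds p. \<Phi> t (chart_inv c (G (snd c x))) = x"
        unfolding \<Phi>_def
        by (rule chart_map_inverse[OF c r(1,2) G(2,3)]) (use r(3) G(5) in \<open>auto elim: eventually_mono\<close>)
    qed
    show "\<forall>\<^sub>F x in nhds p. \<Phi> t x \<in> D \<longleftrightarrow> x \<in> D"
      unfolding eventually_chart[OF c] using eventually_in_chart[OF c] Dhc near[OF t Dhc] ball
      by eventually_elim (use t pres in \<open>simp add: \<Phi>_def chart_facts(6)[OF cA]\<close>)
  next
    show "\<forall>\<^sub>F x in nhds p. \<Phi> 0 x = x"
      unfolding eventually_chart[OF c] using eventually_in_chart[OF c] ball
      by eventually_elim (use id in \<open>simp add: \<Phi>_def chart_facts(6)[OF cA]\<close>)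
  next
    have 1: "(1::real) \<in> {0..1}" by simp
    show "form_eq A D p 2 (pullback A (\<Phi> 1) \<omega>1) \<omega>0"
      unfolding form_eq_def eventually_chart[OF c]
      using eventually_in_chart[OF c] Dhc near[OF 1 eventually_in_chart[OF c]] near[OF 1 closed_log_form_chart(2)[OF cl(2)]]
        closed_log_form_chart(2)[OF cl(1)] ball eventually_nhds_in_open[OF S(1) S0[OF 1]]
    proof eventually_elim
      case (elim z)
      let ?x = "chart_inv c z" and ?y = "\<phi> (pt 1 z)"
      show ?case
      proof (intro impI allI; elim conjE)
        fix ts assume "?x \<notin> D" "length ts = 2" and ts: "set ts \<subseteq> tspace A ?x"
        \<comment> \<open>The image point is off \<open>D\<close> as well, so the bilinear
          description of \<open>\<omega>1\<close> is valid there.\<close>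
        then have hz: "hc z \<noteq> 0" and hy: "hc ?y \<noteq> 0" using elim(2) pres[OF 1 elim(6)] by auto
        have cx: "c \<in> charts_at A ?x" by (rule chart_inv_charts_at[OF cA elim(1)])
        have \<psi>x: "snd c ?x = z" by (rule chart_facts(6)[OF cA elim(1)])
        obtain t1 t2 where t12: "ts = [t1, t2]"
          using \<open>length ts = 2\<close> by (auto simp: numeral_2_eq_2 length_Suc_conv)
        obtain v1 where v1: "t1 = tangent A c ?x v1" using tspace_chart[OF cx] ts t12 by auto
        obtain v2 where v2: "t2 = tangent A c ?x v2" using tspace_chart[OF cx] ts t12 by auto
        have FD: "FD (\<lambda>z. \<phi> (pt (complex_of_real 1) z)) z v = FD \<phi> (pt 1 z) (pt 0 v)" for v
          using hmap_compose(2)[OF \<Omega>(3) hmap_pt_space[of "complex_of_real 1" "S 1"], of z v] elim(7)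
          by (auto simp: S_def FD_pt_space)
        have push: "pushforward A (\<Phi> 1) ?x (tangent A c ?x v) = tangent A c (chart_inv c ?y) (FD \<phi> (pt 1 z) (pt 0 v))" for v
          using pushforward_tangent[OF cx S(1)[of 1] _ S(2)[of 1], of v] elim(3,7)
          unfolding \<psi>x FD by (simp add: \<Phi>_def[abs_def])
        have "pullback A (\<Phi> 1) \<omega>1 ?x ts = coord_form A c \<omega>1 ?y [FD \<phi> (pt 1 z) (pt 0 v1), FD \<phi> (pt 1 z) (pt 0 v2)]"
          by (simp add: pullback_def t12 v1 v2 push coord_form_def \<Phi>_def \<psi>x)
        also have "\<dots> = bil (form_matrix c \<omega>0 z) v1 v2"
          using elim(4) hy pull[OF elim(6) hz] by simp
        also have "\<dots> = \<omega>0 ?x ts"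
          using elim(5) hz by (simp add: coord_form_def t12 v1 v2)
        finally show "pullback A (\<Phi> 1) \<omega>1 ?x ts = \<omega>0 ?x ts" .
      qed
    qed
  qed
qed

theorem theorem3p7:
  fixes A :: "('m::{t2_space,second_countable_topology}, 'n::finite) chart set"
    and n :: nat
    and D :: "'m set"
    and p :: 'm
    and h :: "'m \<Rightarrow> complex"
    and fs :: "('m \<Rightarrow> complex) list"
    and \<omega>0 \<omega>1 :: "'m dform"
  assumes "complex_atlas A"
    and "CARD('n) = 2 * n"
    and "hypersurface A D"
    and "p \<in> D"
    and "reduced_equation A D p h"
    and "component_equations A D p fs"
    and "generated_by_log_differentials A D h p fs"
    and "log_symplectic A D h p n \<omega>0"
    and "log_symplectic A D h p n \<omega>1"
    and "log_de_rham_class A D h p 2 \<omega>0 = log_de_rham_class A D h p 2 \<omega>1"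
  shows "isotopic A D p \<omega>0 \<omega>1"
proof -
  interpret atlas A by unfold_locales (rule assms(1))
  obtain c where c: "c \<in> charts_at A p" using ex_chart by blast
  obtain u where u: "reduced_germ (snd c p) (map (\<lambda>f z. f (chart_inv c z)) fs) u (\<lambda>z. h (chart_inv c z))"
    and Dh: "\<forall>\<^sub>F x in nhds p. x \<in> D \<longleftrightarrow> h x = 0"
    by (rule reduced_germ_chart[OF c assms(3-6)])
  interpret reduced_germ "snd c p" "map (\<lambda>f z. f (chart_inv c z)) fs" u "\<lambda>z. h (chart_inv c z)"
    by (rule u)
  interpret log_chart A c p fs u h D by unfold_locales (fact c Dh)+
  show ?thesis by (rule log_symplectic_isotopy[OF assms(2,7-10)])
qed

end
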